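(* Let $\alpha\in(0,1)$, $\beta\in(1,2)$ and $m>1+\beta$. Let $\tilde\theta_0\in H^m(\mathbb{R}^2)$ and, for $\nu>0$, let $\theta_0^\nu\in L^2(\mathbb{R}^2)$. Let $\theta^\nu$ be a global weak solution of the dissipative generalized SQG equation (without dispersive forcing) $$\partial_t\theta+u\cdot\nabla\theta+\nu(-\Delta)^{\alpha}\theta=0,\qquad u=\left(\partial_{x_2}\Lambda^{\beta-2}\theta,\,-\partial_{x_1}\Lambda^{\beta-2}\theta\right),\qquad \theta(\cdot,0)=\theta_0^\nu,\qquad x\in\mathbb{R}^2,\ t>0,$$ and let $\tilde\theta$ be a local smooth solution, on its maximal local existence interval $(0,T^* )$, of the corresponding inviscid problem $$\partial_t\tilde\theta+\tilde u\cdot\nabla\tilde\theta=0,\qquad \tilde u=\left(\partial_{x_2}\Lambda^{\beta-2}\tilde\theta,\,-\partial_{x_1}\Lambda^{\beta-2}\tilde\theta\right),\qquad \tilde\theta(\cdot,0)=\tilde\theta_0,\qquad x\in\mathbb{R}^2,\ t>0.$$ Suppose that $$\|\theta_0^\nu-\tilde\theta_0\|_{L^2(\mathbb{R}^2)}\to0\quad\text{as }\nu\to0.$$ Then $$\|\theta^\nu-\tilde\theta\|_{L^\infty(0,T^*;L^2)}\to0\quad\text{as }\nu\to0.$$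
   Context: Notation: $\Lambda=(-\Delta)^{1/2}$, and for $\sigma\in\mathbb{R}$ the operator $\Lambda^\sigma$ is the Fourier multiplier $\widehat{\Lambda^\sigma f}(\xi)=|\xi|^\sigma\widehat f(\xi)$. $H^\sigma(\mathbb{R}^2)$ and $\dot H^\sigma(\mathbb{R}^2)$ are the inhomogeneous and homogeneous $L^2$-based Sobolev spaces, with norms $\|f\|_{H^\sigma}=\|(I-\Delta)^{\sigma/2}f\|_{L^2}$ and $\|f\|_{\dot H^\sigma}=\|\Lambda^\sigma f\|_{L^2}$. Local smooth solution: for initial data $\tilde\theta_0\in H^m(\mathbb{R}^2)$ with $m>1+\beta$, the inviscid equation has a local smooth solution $\tilde\theta\in C^1(0,T^*;H^m)$, where $T^*$ denotes the maximal local existence time. Weak solution: given $\theta_0\in L^2(\mathbb{R}^2)$, a function $\theta$ is a global weak solution of the dissipative generalized SQG equation with initial datum $\theta_0$ if for all $T>0$, $\theta\in L^\infty(0,T;L^2)\cap L^2(0,T;\dot H^\alpha)$, and $$\int_{\mathbb{R}^2}\theta(t)\varphi(t)\,dx-\int_{\mathbb{R}^2}\theta_0\,\varphi(0)\,dx=\int_0^t\int_{\mathbb{R}^2}\Big[(\partial_s\varphi)\theta+(u\cdot\nabla\varphi)\theta-\nu\,\Lambda^\alpha\varphi\,\Lambda^\alpha\theta\Big]\,dx\,ds$$ for all test functions $\varphi\in C_c^\infty([0,\infty)\times\mathbb{R}^2)$ and almost every $t>0$, where $u=(\partial_{x_2}\Lambda^{\beta-2}\theta,-\partial_{x_1}\Lambda^{\beta-2}\theta)$.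 Weak solutions are moreover taken to satisfy the energy inequality $$\|\theta(t)\|_{L^2}^2+2\nu\int_0^t\|\Lambda^\alpha\theta(s)\|_{L^2}^2\,ds\le\|\theta_0\|_{L^2}^2\qquad\text{for all }t>0.$$
   Formalization: (0,T* ) is any finite interval on which the H^m norm of the inviscid solution is bounded, not the maximal one: for nonzero radial data T* is infinite and the claim fails. The term (u·∇φ)θ is read as a limit over frequency truncations. *)

theory Defs
  imports "HOL-Probability.Essential_Supremum"
begin

type_synonym plane = "real ^ 2"

section \<open>Square-integrable functions and the Fourier transform on \<open>L\<^sup>2(\<real>\<^sup>2)\<close>\<close>

text \<open>
  Elements of \<open>L\<^sup>2\<close> are represented by functions; all notions below depend only on the
  almost-everywhere class of their arguments.
\<close>

definition square_integrable :: "(plane \<Rightarrow> 'b::{banach, second_countable_topology}) \<Rightarrow> bool" where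
  "square_integrable f \<longleftrightarrow>
     f \<in> borel_measurable lborel \<and> integrable lborel (\<lambda>x. (norm (f x))\<^sup>2)"

definition L2_norm :: "(plane \<Rightarrow> 'b::{banach, second_countable_topology}) \<Rightarrow> real" where
  "L2_norm f = sqrt (LINT x|lborel. (norm (f x))\<^sup>2)"

definition L1_fourier :: "(plane \<Rightarrow> real) \<Rightarrow> plane \<Rightarrow> complex" where
  "L1_fourier f \<xi> = (LINT x|lborel. cis (- (x \<bullet> \<xi>)) * complex_of_real (f x))"

text \<open>
  The Plancherel extension to \<open>L\<^sup>2\<close>: the \<open>L\<^sup>2\<close>-limit of the transforms of the
  truncations of \<open>f\<close> to balls. It is determined up to a null set.
\<close>

definition L2_fourier :: "(plane \<Rightarrow> real) \<Rightarrow> plane \<Rightarrow> complex" where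
  "L2_fourier f =
     (SOME F. square_integrable F \<and>
        ((\<lambda>R::real. L2_norm (\<lambda>\<xi>. F \<xi> - L1_fourier (\<lambda>x. indicator (ball 0 R) x * f x) \<xi>))
           \<longlongrightarrow> 0) at_top)"

section \<open>Fourier multipliers and Sobolev spaces\<close>

text \<open>
  All symbols \<open>p\<close> used below satisfy \<open>p (-\<xi>) = cnj (p \<xi>)\<close>, so that the multiplier maps
  real-valued functions to real-valued functions. The value of \<open>multiplier p f\<close> is
  meaningful only if \<open>f\<close> lies in the \<open>L\<^sup>2\<close>-domain of the operator.
\<close>

definition is_multiplier_image :: "(plane \<Rightarrow> complex) \<Rightarrow> (plane \<Rightarrow> real) \<Rightarrow> (plane \<Rightarrow> real) \<Rightarrow> bool" where
  "is_multiplier_image p f g \<longleftrightarrow>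
     square_integrable f \<and> square_integrable g \<and>
     (AE \<xi> in lborel. L2_fourier g \<xi> = p \<xi> * L2_fourier f \<xi>)"

definition in_domain :: "(plane \<Rightarrow> complex) \<Rightarrow> (plane \<Rightarrow> real) \<Rightarrow> bool" where
  "in_domain p f \<longleftrightarrow> (\<exists>g. is_multiplier_image p f g)"

definition multiplier :: "(plane \<Rightarrow> complex) \<Rightarrow> (plane \<Rightarrow> real) \<Rightarrow> plane \<Rightarrow> real" where
  "multiplier p f = (SOME g. is_multiplier_image p f g)"

definition Lambda_symbol :: "real \<Rightarrow> plane \<Rightarrow> complex" where
  "Lambda_symbol \<sigma> \<xi> = complex_of_real (norm \<xi> powr \<sigma>)"

definition Bessel_symbol :: "real \<Rightarrow> plane \<Rightarrow> complex" where
  "Bessel_symbol \<sigma> \<xi> = complex_of_real ((1 + (norm \<xi>)\<^sup>2) powr (\<sigma> / 2))"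

definition partial_symbol :: "2 \<Rightarrow> plane \<Rightarrow> complex" where
  "partial_symbol j \<xi> = \<i> * complex_of_real (\<xi> $ j)"

abbreviation Lambda :: "real \<Rightarrow> (plane \<Rightarrow> real) \<Rightarrow> plane \<Rightarrow> real" where
  "Lambda \<sigma> \<equiv> multiplier (Lambda_symbol \<sigma>)"

definition H_space :: "real \<Rightarrow> (plane \<Rightarrow> real) set" where
  "H_space \<sigma> = {f. in_domain (Bessel_symbol \<sigma>) f}"

definition H_norm :: "real \<Rightarrow> (plane \<Rightarrow> real) \<Rightarrow> real" where
  "H_norm \<sigma> f = L2_norm (multiplier (Bessel_symbol \<sigma>) f)"

section \<open>The velocity field\<close>

text \<open>
  \<open>\<partial>\<^sub>j \<Lambda>\<^bsup>\<beta>-2\<^esup>\<close> is taken as a single multiplier, of order \<open>\<beta> - 1\<close>: for \<open>\<beta> < 2\<close> the function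
  \<open>\<Lambda>\<^bsup>\<beta>-2\<^esup> \<theta>\<close> by itself need not be in \<open>L\<^sup>2\<close> because of low frequencies.
\<close>

definition velocity :: "real \<Rightarrow> (plane \<Rightarrow> real) \<Rightarrow> plane \<Rightarrow> plane" where
  "velocity \<beta> f x = vector
     [   multiplier (\<lambda>\<xi>. partial_symbol 2 \<xi> * Lambda_symbol (\<beta> - 2) \<xi>) f x,
       - multiplier (\<lambda>\<xi>. partial_symbol 1 \<xi> * Lambda_symbol (\<beta> - 2) \<xi>) f x ]"

definition L2_gradient :: "(plane \<Rightarrow> real) \<Rightarrow> plane \<Rightarrow> plane" where
  "L2_gradient f x = (\<chi> j. multiplier (partial_symbol j) f x)"

section \<open>Functions of time with values in \<open>L\<^sup>2\<close>\<close>

text \<open>Bochner measurability: almost everywhere limit of simple functions.\<close>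

definition L2_strongly_measurable :: "real set \<Rightarrow> (real \<Rightarrow> plane \<Rightarrow> real) \<Rightarrow> bool" where
  "L2_strongly_measurable I f \<longleftrightarrow>
     (\<exists>s :: nat \<Rightarrow> real \<Rightarrow> plane \<Rightarrow> real.
        (\<forall>n. simple_function (lebesgue_on I) (s n) \<and> (\<forall>t\<in>I. square_integrable (s n t))) \<and>
        (AE t in lebesgue_on I. square_integrable (f t) \<and>
           (\<lambda>n. L2_norm (\<lambda>x. f t x - s n t x)) \<longlonglongrightarrow> 0))"

definition Linf_L2 :: "real \<Rightarrow> (real \<Rightarrow> plane \<Rightarrow> real) set" where
  "Linf_L2 T = {f. L2_strongly_measurable {0<..<T} f \<and>
     (\<exists>C. AE t in lebesgue_on {0<..<T}. L2_norm (f t) \<le> C)}"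

definition Linf_L2_norm :: "real \<Rightarrow> (real \<Rightarrow> plane \<Rightarrow> real) \<Rightarrow> ereal" where
  "Linf_L2_norm T f = esssup (lebesgue_on {0<..<T}) (\<lambda>t. ereal (L2_norm (f t)))"

text \<open>
  \<open>L\<^sup>2(0,T; \<dot>H\<^sup>\<alpha>)\<close>, for functions that take values in \<open>L\<^sup>2\<close>.
\<close>

definition L2_Hdot :: "real \<Rightarrow> real \<Rightarrow> (real \<Rightarrow> plane \<Rightarrow> real) set" where
  "L2_Hdot \<alpha> T = {f.
     (AE t in lebesgue_on {0<..<T}. in_domain (Lambda_symbol \<alpha>) (f t)) \<and>
     L2_strongly_measurable {0<..<T} (\<lambda>t. Lambda \<alpha> (f t)) \<and>
     integrable (lebesgue_on {0<..<T}) (\<lambda>t. (L2_norm (Lambda \<alpha> (f t)))\<^sup>2)}"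

definition has_H_derivative_on ::
    "real \<Rightarrow> real \<Rightarrow> (real \<Rightarrow> plane \<Rightarrow> real) \<Rightarrow> (real \<Rightarrow> plane \<Rightarrow> real) \<Rightarrow> bool" where
  "has_H_derivative_on \<sigma> T f f' \<longleftrightarrow>
     (\<forall>t\<in>{0<..<T}. f t \<in> H_space \<sigma> \<and> f' t \<in> H_space \<sigma> \<and>
        ((\<lambda>h. H_norm \<sigma> (\<lambda>x. (f (t + h) x - f t x) / h - f' t x)) \<longlongrightarrow> 0) (at 0))"

definition H_continuous_on :: "real \<Rightarrow> real \<Rightarrow> (real \<Rightarrow> plane \<Rightarrow> real) \<Rightarrow> bool" where
  "H_continuous_on \<sigma> T f \<longleftrightarrow>
     (\<forall>t\<in>{0<..<T}. f t \<in> H_space \<sigma> \<and>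
        ((\<lambda>s. H_norm \<sigma> (\<lambda>x. f s x - f t x)) \<longlongrightarrow> 0) (at t))"

section \<open>Smooth solutions of the inviscid equation\<close>

text \<open>
  \<open>C\<^sup>1(0,T; H\<^sup>m)\<close> is read as a normed space of functions on a finite interval, so that
  \<open>\<theta>\<close> has a finite supremum norm \<open>sup\<^bsub>0<t<T\<^esub> \<parallel>\<theta>(t)\<parallel>\<^bsub>H\<^sup>m\<^esub>\<close>; no bound on the time derivative
  is imposed near the end points. Every \<open>T\<close> smaller than the blow-up time is admissible.
\<close>

definition smooth_inviscid_solution ::
    "real \<Rightarrow> real \<Rightarrow> real \<Rightarrow> (plane \<Rightarrow> real) \<Rightarrow> (real \<Rightarrow> plane \<Rightarrow> real) \<Rightarrow> bool" where
  "smooth_inviscid_solution \<beta> m T \<theta>\<^sub>0 \<theta> \<longleftrightarrow>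
     (\<exists>\<theta>'. has_H_derivative_on m T \<theta> \<theta>' \<and> H_continuous_on m T \<theta>' \<and>
        (\<forall>t\<in>{0<..<T}. AE x in lborel.
           \<theta>' t x + velocity \<beta> (\<theta> t) x \<bullet> L2_gradient (\<theta> t) x = 0)) \<and>
     (\<exists>C. \<forall>t\<in>{0<..<T}. H_norm m (\<theta> t) \<le> C) \<and>
     ((\<lambda>t. L2_norm (\<lambda>x. \<theta> t x - \<theta>\<^sub>0 x)) \<longlongrightarrow> 0) (at_right 0)"

section \<open>Weak solutions of the dissipative equation\<close>

primrec C_class :: "nat \<Rightarrow> ('a::real_normed_vector \<Rightarrow> real) \<Rightarrow> bool" where
  "C_class 0 f \<longleftrightarrow> continuous_on UNIV f"
| "C_class (Suc k) f \<longleftrightarrow>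
     (\<forall>z. f differentiable (at z)) \<and> (\<forall>v. C_class k (\<lambda>z. frechet_derivative f (at z) v))"

text \<open>
  Elements of \<open>C\<^sub>c\<^sup>\<infinity>([0,\<infinity>) \<times> \<real>\<^sup>2)\<close> are the restrictions to \<open>t \<ge> 0\<close> of test functions
  on \<open>\<real> \<times> \<real>\<^sup>2\<close>.
\<close>

definition test_function :: "(real \<times> plane \<Rightarrow> real) \<Rightarrow> bool" where
  "test_function \<phi> \<longleftrightarrow>
     (\<forall>k. C_class k \<phi>) \<and> (\<exists>K. compact K \<and> (\<forall>z. z \<notin> K \<longrightarrow> \<phi> z = 0))"

definition time_derivative :: "(real \<times> plane \<Rightarrow> real) \<Rightarrow> real \<Rightarrow> plane \<Rightarrow> real" where
  "time_derivative \<phi> s x = frechet_derivative \<phi> (at (s, x)) (1, 0)"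

definition space_gradient :: "(real \<times> plane \<Rightarrow> real) \<Rightarrow> real \<Rightarrow> plane \<Rightarrow> plane" where
  "space_gradient \<phi> s x = (\<chi> j. frechet_derivative \<phi> (at (s, x)) (0, axis j 1))"

definition low_pass :: "real \<Rightarrow> (plane \<Rightarrow> real) \<Rightarrow> plane \<Rightarrow> real" where
  "low_pass R = multiplier (indicator (ball 0 R))"

text \<open>
  The nonlinear term \<open>\<integral> (u \<cdot> \<nabla>\<phi>) \<theta> dx\<close> for \<open>\<theta> \<in> L\<^sup>2\<close>. Since \<open>\<beta> > 1\<close>, the velocity
  \<open>u\<close> is in general only a distribution of negative order, so the integral is defined as the
  limit of the same integral for the frequency truncations of \<open>\<theta>\<close> (for which \<open>u\<close> is in
  \<open>L\<^sup>2\<close>). By antisymmetry of the kernel, that is, the commutator structure of the term, the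
  limit exists for every \<open>\<theta> \<in> L\<^sup>2\<close> and smooth compactly supported \<open>\<phi>\<close>; it is the plain
  integral whenever \<open>u \<in> L\<^sup>2\<close>. The argument \<open>G\<close> is the gradient of \<open>\<phi>\<close>.
\<close>

definition transport_integral :: "real \<Rightarrow> (plane \<Rightarrow> real) \<Rightarrow> (plane \<Rightarrow> plane) \<Rightarrow> real" where
  "transport_integral \<beta> \<theta> G =
     Lim at_top (\<lambda>R::real.
       LINT x|lborel. (velocity \<beta> (low_pass R \<theta>) x \<bullet> G x) * low_pass R \<theta> x)"

definition weak_formulation ::
    "real \<Rightarrow> real \<Rightarrow> real \<Rightarrow> (plane \<Rightarrow> real) \<Rightarrow> (real \<Rightarrow> plane \<Rightarrow> real) \<Rightarrow>
     (real \<times> plane \<Rightarrow> real) \<Rightarrow> real \<Rightarrow> bool" where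
  "weak_formulation \<alpha> \<beta> \<nu> \<theta>\<^sub>0 \<theta> \<phi> t \<longleftrightarrow>
     (LINT x|lborel. \<theta> t x * \<phi> (t, x)) - (LINT x|lborel. \<theta>\<^sub>0 x * \<phi> (0, x)) =
     (LINT s|lebesgue_on {0<..<t}.
        (LINT x|lborel. time_derivative \<phi> s x * \<theta> s x)
        + transport_integral \<beta> (\<theta> s) (space_gradient \<phi> s)
        - \<nu> * (LINT x|lborel. Lambda \<alpha> (\<lambda>y. \<phi> (s, y)) x * Lambda \<alpha> (\<theta> s) x))"

definition energy_inequality ::
    "real \<Rightarrow> real \<Rightarrow> (plane \<Rightarrow> real) \<Rightarrow> (real \<Rightarrow> plane \<Rightarrow> real) \<Rightarrow> real \<Rightarrow> bool" where
  "energy_inequality \<alpha> \<nu> \<theta>\<^sub>0 \<theta> t \<longleftrightarrow>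
     square_integrable (\<theta> t) \<and>
     (L2_norm (\<theta> t))\<^sup>2
       + 2 * \<nu> * (LINT s|lebesgue_on {0<..<t}. (L2_norm (Lambda \<alpha> (\<theta> s)))\<^sup>2)
     \<le> (L2_norm \<theta>\<^sub>0)\<^sup>2"

definition global_weak_solution ::
    "real \<Rightarrow> real \<Rightarrow> real \<Rightarrow> (plane \<Rightarrow> real) \<Rightarrow> (real \<Rightarrow> plane \<Rightarrow> real) \<Rightarrow> bool" where
  "global_weak_solution \<alpha> \<beta> \<nu> \<theta>\<^sub>0 \<theta> \<longleftrightarrow>
     (\<forall>T>0. \<theta> \<in> Linf_L2 T \<and> \<theta> \<in> L2_Hdot \<alpha> T) \<and>
     (\<forall>\<phi>. test_function \<phi> \<longrightarrow>
        (AE t in lebesgue. 0 < t \<longrightarrow> weak_formulation \<alpha> \<beta> \<nu> \<theta>\<^sub>0 \<theta> \<phi> t)) \<and>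
     (\<forall>t>0. energy_inequality \<alpha> \<nu> \<theta>\<^sub>0 \<theta> t)"

end

theory Submission
  imports Defs "HOL-Probability.Levy"
begin

text \<open>
  The proof is a weak-strong stability estimate carried out on the Fourier side. Let \<open>w = \<theta> - g\<close>
  be the difference of a weak solution \<open>\<theta>\<close> and the smooth solution \<open>g\<close>. Formally \<open>\<parallel>w\<parallel>\<^sup>2\<close> grows at the
  rate \<open>- 2 \<integral> (u\<^sub>w \<bullet> \<nabla> g) w\<close> plus \<open>O(\<nu>)\<close>. As \<open>\<beta> > 1\<close>, the velocity \<open>u\<^sub>w\<close> is not controlled by
  \<open>\<parallel>w\<parallel>\<close>, but after symmetrising the two factors \<open>w\<close> the trilinear form has the kernel
  \<open>- (\<xi> \<times> \<eta>) (|\<xi>|\<^bsup>\<beta>-2\<^esup> - |\<xi>+\<eta>|\<^bsup>\<beta>-2\<^esup>) / 2\<close>, which is bounded by \<open>|\<eta>|\<^bsup>\<beta>\<^esup> / 2\<close> with \<open>\<eta>\<close> the frequency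
  of \<open>g\<close>. So it is at most \<open>C \<parallel>g\<parallel>\<^bsub>H\<^sup>m\<^esub> \<parallel>w\<parallel>\<^sup>2\<close>, because \<open>m > 1 + \<beta>\<close>.

  To justify the formal computation, the weak formulation is extended by density from smooth test
  functions to \<open>H\<^sup>m\<close>. It then gives functionals \<open>L(t)\<close> on \<open>H\<^sup>m\<close>, Lipschitz in \<open>t\<close>, with
  \<open>\<langle>\<theta>(t), \<psi>\<rangle> = L(t) \<psi>\<close> for almost every \<open>t\<close>. By the energy inequality,
  \<open>y(t) = \<parallel>\<theta>\<^sub>0\<parallel>\<^sup>2 + \<parallel>g(t)\<parallel>\<^sup>2 - 2 L(t) g(t)\<close> bounds \<open>\<parallel>w(t)\<parallel>\<^sup>2\<close> for almost every \<open>t\<close>; it is continuous, tends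
  to \<open>\<parallel>w(0)\<parallel>\<^sup>2\<close> at \<open>0\<close>, and its upper Dini derivative is at most \<open>K y + C \<nu>\<close>, with \<open>K\<close> independent of
  \<open>\<nu>\<close>. Gronwall's inequality concludes.
\<close>

section \<open>Square-integrable functions\<close>

text \<open>The obstacle is that each identity for \<theta> holds only for almost every time, with a
  null set that depends on the test function, while the natural test function g(t) moves with time.
  So g is frozen at a time t while \<theta> runs through nearby times s, and the Lipschitz
  dependence of L(s) on s carries the estimate back to s = t; null sets are united only over
  countable families. In \<open>y\<close> the norm of \<theta>(t) is replaced by its initial bound,
  because it is not known to depend continuously on t; the energy defect only enlarges
  \<open>y\<close>. The dissipation integral of the energy inequality is dropped. In the weak
  formulation both factors of order \<alpha> are put on g, which is possible since 2\<alpha> < 2 <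
  m, so the viscous error is O(\<nu>) without any bound on derivatives of \<theta>. That only a term
  quadratic in w survives rests on a cyclic identity: the kernel sums to zero over the arrangements
  of three frequencies with sum zero. It gives both the conservation of the norm of g and the
  cancellation of the terms linear in w.\<close>

lemma sqi_measurable [measurable_dest]: "square_integrable f \<Longrightarrow> f \<in> borel_measurable lborel"
  by (simp add: square_integrable_def)

lemma sqi_measurable' [measurable_dest]: "square_integrable f \<Longrightarrow> f \<in> borel_measurable borel"
  by (simp add: square_integrable_def)

lemma sqi_integrable: "square_integrable f \<Longrightarrow> integrable lborel (\<lambda>x. (norm (f x))\<^sup>2)"
  by (simp add: square_integrable_def)

text \<open>The source of most closure properties that follow, with a suitable \<open>K\<close>. The
  two codomains may differ, so it also passes between real and complex functions.\<close>

lemma sqi_bound: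
  fixes f :: "plane \<Rightarrow> 'b::{banach, second_countable_topology}"
    and g :: "plane \<Rightarrow> 'c::{banach, second_countable_topology}"
  assumes "square_integrable f" and [measurable]: "g \<in> borel_measurable borel"
    and "AE x in lborel. norm (g x) \<le> K * norm (f x)"
  shows "square_integrable g"
  unfolding square_integrable_def
proof
  show "integrable lborel (\<lambda>x. (norm (g x))\<^sup>2)"
  proof (rule Bochner_Integration.integrable_bound)
    show "integrable lborel (\<lambda>x. K\<^sup>2 * (norm (f x))\<^sup>2)"
      using sqi_integrable[OF assms(1)] by simp
    show "AE x in lborel. norm ((norm (g x))\<^sup>2) \<le> norm (K\<^sup>2 * (norm (f x))\<^sup>2)"
      using assms(3)
    proof eventually_elim
      case (elim x)
      hence "(norm (g x))\<^sup>2 \<le> (K * norm (f x))\<^sup>2" by (intro power_mono) auto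
      thus ?case by (simp add: power_mult_distrib)
    qed
  qed simp
qed simp

lemma sqi_0 [simp, intro]: "square_integrable (\<lambda>_. 0)"
  by (simp add: square_integrable_def)

lemma sqi_add:
  fixes f g :: "plane \<Rightarrow> 'b::{banach, second_countable_topology}"
  assumes f: "square_integrable f" and g: "square_integrable g"
  shows "square_integrable (\<lambda>x. f x + g x)"
  unfolding square_integrable_def
proof
  note [measurable] = f[THEN sqi_measurable] g[THEN sqi_measurable]
  show "(\<lambda>x. f x + g x) \<in> borel_measurable lborel" by measurable
  show "integrable lborel (\<lambda>x. (norm (f x + g x))\<^sup>2)"
  proof (rule Bochner_Integration.integrable_bound)
    show "integrable lborel (\<lambda>x. 2 * (norm (f x))\<^sup>2 + 2 * (norm (g x))\<^sup>2)"
      using sqi_integrable[OF f] sqi_integrable[OF g] by simp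
    show "AE x in lborel. norm ((norm (f x + g x))\<^sup>2) \<le> norm (2 * (norm (f x))\<^sup>2 + 2 * (norm (g x))\<^sup>2)"
    proof (rule AE_I2)
      fix x
      have "(norm (f x + g x))\<^sup>2 \<le> (norm (f x) + norm (g x))\<^sup>2"
        by (simp add: power_mono norm_triangle_ineq)
      also have "\<dots> \<le> 2 * (norm (f x))\<^sup>2 + 2 * (norm (g x))\<^sup>2"
        using sum_squares_bound[of "norm (f x)" "norm (g x)"] by (simp add: power2_sum)
      finally show "norm ((norm (f x + g x))\<^sup>2) \<le> norm (2 * (norm (f x))\<^sup>2 + 2 * (norm (g x))\<^sup>2)"
        by simp
    qed
  qed simp
qed

lemma sqi_scaleR:
  "square_integrable f \<Longrightarrow> square_integrable (\<lambda>x. c *\<^sub>R f x)"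
  by (rule sqi_bound[where K = "\<bar>c\<bar>"]) auto

lemma sqi_minus: "square_integrable f \<Longrightarrow> square_integrable (\<lambda>x. - f x)"
  by (rule sqi_bound[where K = 1]) auto

lemma sqi_diff:
  assumes "square_integrable f" and "square_integrable g"
  shows "square_integrable (\<lambda>x. f x - g x)"
  using sqi_add[OF assms(1) sqi_minus[OF assms(2)]] by simp

lemma sqi_cmult:
  fixes f :: "plane \<Rightarrow> 'b::{real_normed_field, banach, second_countable_topology}"
  shows "square_integrable f \<Longrightarrow> square_integrable (\<lambda>x. c * f x)"
  by (rule sqi_bound[where K = "norm c"]) (auto simp: norm_mult)

lemma sqi_of_real [simp]:
  "square_integrable (\<lambda>x. complex_of_real (f x)) \<longleftrightarrow> square_integrable f" (is "?L \<longleftrightarrow> ?R")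
proof
  assume L: ?L
  have "(\<lambda>x. Re (complex_of_real (f x))) \<in> borel_measurable borel"
    using sqi_measurable'[OF L] by measurable
  hence "f \<in> borel_measurable borel" by simp
  thus ?R by (rule sqi_bound[OF L, where K = 1]) simp
next
  assume R: ?R
  note [measurable] = sqi_measurable'[OF R]
  show ?L by (rule sqi_bound[OF R, where K = 1]) auto
qed

lemma cnj_measurable [measurable]: "cnj \<in> borel_measurable borel"
  by (intro borel_measurable_continuous_onI continuous_on_cnj continuous_on_id)

lemma sqi_cnj: "square_integrable f \<Longrightarrow> square_integrable (\<lambda>x. cnj (f x))"
  by (rule sqi_bound[where K = 1]) auto

lemma sqi_norm: "square_integrable f \<Longrightarrow> square_integrable (\<lambda>x. norm (f x))"
  by (rule sqi_bound[where K = 1]) auto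

lemma sqi_sum:
  fixes f :: "'i \<Rightarrow> plane \<Rightarrow> 'b::{banach, second_countable_topology}"
  shows "(\<And>i. i \<in> I \<Longrightarrow> square_integrable (f i)) \<Longrightarrow> square_integrable (\<lambda>x. \<Sum>i\<in>I. f i x)"
  by (induction I rule: infinite_finite_induct) (auto intro: sqi_add)

lemma sqi_indicator:
  fixes c :: "'b::{banach, second_countable_topology}"
  assumes "A \<in> sets borel" "emeasure lborel A < \<infinity>"
  shows "square_integrable (\<lambda>x. indicator A x *\<^sub>R c)"
  unfolding square_integrable_def
proof
  show "(\<lambda>x. indicator A x *\<^sub>R c) \<in> borel_measurable lborel" using assms by simp
  have "(\<lambda>x. (norm (indicator A x *\<^sub>R c))\<^sup>2) = (\<lambda>x::plane. indicator A x *\<^sub>R ((norm c)\<^sup>2))"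
    by (auto simp: indicator_def)
  moreover have "integrable lborel (\<lambda>x::plane. indicator A x *\<^sub>R ((norm c)\<^sup>2))"
    using assms by (intro integrable_scaleR_left integrable_real_indicator) auto
  ultimately show "integrable lborel (\<lambda>x. (norm (indicator A x *\<^sub>R c))\<^sup>2)" by simp
qed

lemma sqi_cut:
  fixes f :: "plane \<Rightarrow> 'b::{banach, second_countable_topology}"
  assumes "square_integrable f" "A \<in> sets borel"
  shows "square_integrable (\<lambda>x. indicator A x *\<^sub>R f x)"
proof (rule sqi_bound[OF assms(1), where K = 1])
  note [measurable] = sqi_measurable'[OF assms(1)] assms(2)
  show "(\<lambda>x. indicator A x *\<^sub>R f x) \<in> borel_measurable borel" by measurable
qed (auto simp: indicator_def)

section \<open>The \<open>L2_norm\<close>: Cauchy-Schwarz, triangle inequality, limits and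
  completeness\<close>

lemma L2_norm_nonneg [simp]: "0 \<le> L2_norm f"
  by (simp add: L2_norm_def)

lemma L2_norm_sq: "(L2_norm f)\<^sup>2 = (LINT x|lborel. (norm (f x))\<^sup>2)"
  by (simp add: L2_norm_def)

lemma L2_norm_cong_AE:
  assumes [measurable]: "f \<in> borel_measurable borel" "g \<in> borel_measurable borel"
    and "AE x in lborel. norm (f x) = norm (g x)"
  shows "L2_norm f = L2_norm g"
proof -
  have "(LINT x|lborel. (norm (f x))\<^sup>2) = (LINT x|lborel. (norm (g x))\<^sup>2)"
    using assms(3) by (intro integral_cong_AE) auto
  thus ?thesis by (simp add: L2_norm_def)
qed

lemma sqi_cong_AE:
  assumes "square_integrable f" and [measurable]: "g \<in> borel_measurable borel"
    and "AE x in lborel. g x = f x"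
  shows "square_integrable g"
  using assms by (intro sqi_bound[of f g 1]) auto

lemma L2_norm_of_real [simp]: "L2_norm (\<lambda>x. complex_of_real (f x)) = L2_norm f"
  by (simp add: L2_norm_def)

lemma L2_norm_minus_commute: "L2_norm (\<lambda>x. f x - g x) = L2_norm (\<lambda>x. g x - f x)"
  by (simp add: L2_norm_def norm_minus_commute)

lemma L2_norm_0 [simp]: "L2_norm (\<lambda>x. 0) = 0"
  by (simp add: L2_norm_def)

lemma L2_norm_scaleR: "L2_norm (\<lambda>x. c *\<^sub>R f x) = \<bar>c\<bar> * L2_norm f"
  by (simp add: L2_norm_def power_mult_distrib real_sqrt_mult)

lemma L2_norm_cmult:
  fixes f :: "plane \<Rightarrow> 'b::{real_normed_field, banach, second_countable_topology}"
  shows "L2_norm (\<lambda>x. c * f x) = norm c * L2_norm f"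
  by (simp add: L2_norm_def power_mult_distrib real_sqrt_mult norm_mult)

lemma L2_norm_mono:
  fixes f :: "plane \<Rightarrow> 'b::{banach, second_countable_topology}"
    and g :: "plane \<Rightarrow> 'c::{banach, second_countable_topology}"
  assumes "square_integrable f" "square_integrable g" "AE x in lborel. norm (f x) \<le> norm (g x)"
  shows "L2_norm f \<le> L2_norm g"
  unfolding L2_norm_def
  using assms(3)
  by (intro real_sqrt_le_mono integral_mono_AE sqi_integrable assms(1,2)) (auto elim!: eventually_mono intro: power_mono)

lemma L2_norm_eq_0_AE:
  assumes "square_integrable f" "L2_norm f = 0"
  shows "AE x in lborel. f x = 0"
proof -
  have "AE x in lborel. (norm (f x))\<^sup>2 = 0"
    using assms sqi_integrable[OF assms(1)]
    by (subst integral_nonneg_eq_0_iff_AE[symmetric]) (auto simp: L2_norm_def)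
  thus ?thesis by simp
qed

lemma sqi_mult_integrable:
  fixes f g :: "plane \<Rightarrow> 'b::{real_normed_field, banach, second_countable_topology}"
  assumes f: "square_integrable f" and g: "square_integrable g"
  shows "integrable lborel (\<lambda>x. f x * g x)"
proof (rule Bochner_Integration.integrable_bound)
  show "integrable lborel (\<lambda>x. (norm (f x))\<^sup>2 + (norm (g x))\<^sup>2)"
    using sqi_integrable[OF f] sqi_integrable[OF g] by simp
  show "(\<lambda>x. f x * g x) \<in> borel_measurable lborel"
    using f g by measurable
  show "AE x in lborel. norm (f x * g x) \<le> norm ((norm (f x))\<^sup>2 + (norm (g x))\<^sup>2)"
  proof (rule AE_I2)
    fix x
    have "2 * norm (f x) * norm (g x) \<le> (norm (f x))\<^sup>2 + (norm (g x))\<^sup>2"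
      by (rule sum_squares_bound)
    moreover have "0 \<le> norm (f x) * norm (g x)" by simp
    ultimately have "norm (f x) * norm (g x) \<le> (norm (f x))\<^sup>2 + (norm (g x))\<^sup>2"
      by linarith
    thus "norm (f x * g x) \<le> norm ((norm (f x))\<^sup>2 + (norm (g x))\<^sup>2)"
      by (simp add: norm_mult)
  qed
qed

text \<open>Discriminant argument: the quadratic form \<open>quad\<close> in (s, r) is the integral
  of a square, hence nonnegative. The integrand carries norms, so the codomains may differ.\<close>

lemma L2_Cauchy_Schwarz:
  fixes f :: "plane \<Rightarrow> 'b::{banach, second_countable_topology}"
    and g :: "plane \<Rightarrow> 'c::{banach, second_countable_topology}"
  assumes f: "square_integrable f" and g: "square_integrable g"
  shows "(LINT x|lborel. norm (f x) * norm (g x)) \<le> L2_norm f * L2_norm g"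
proof -
  define A B C where "A = (LINT x|lborel. (norm (f x))\<^sup>2)" and "B = (LINT x|lborel. (norm (g x))\<^sup>2)"
    and "C = (LINT x|lborel. norm (f x) * norm (g x))"
  have int: "integrable lborel (\<lambda>x. norm (f x) * norm (g x))"
    by (rule sqi_mult_integrable[OF sqi_norm[OF f] sqi_norm[OF g]])
  have quad: "0 \<le> A * s\<^sup>2 - 2 * s * r * C + r\<^sup>2 * B" for s r
  proof -
    have "0 \<le> (LINT x|lborel. (s * norm (f x) - r * norm (g x))\<^sup>2)" by simp
    also have "\<dots> = (LINT x|lborel. (s\<^sup>2 * (norm (f x))\<^sup>2 - 2 * s * r * (norm (f x) * norm (g x))) + r\<^sup>2 * (norm (g x))\<^sup>2)"
      by (intro Bochner_Integration.integral_cong) (auto simp: power2_eq_square algebra_simps)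
    also have "\<dots> = s\<^sup>2 * A - 2 * s * r * C + r\<^sup>2 * B"
      using int sqi_integrable[OF f] sqi_integrable[OF g] by (simp add: A_def B_def C_def)
    finally show ?thesis by (simp add: mult.commute)
  qed
  have "A \<ge> 0" "B \<ge> 0" "C \<ge> 0" by (auto simp: A_def B_def C_def)
  have "C\<^sup>2 \<le> A * B"
  proof (cases "B = 0")
    case True
    have "C = 0"
    proof (rule ccontr)
      assume "C \<noteq> 0"
      hence "C > 0" using \<open>C \<ge> 0\<close> by simp
      \<comment> \<open>With \<open>B = 0\<close> the form is linear in r; this r makes its value
        -1.\<close>
      have "0 \<le> A * 1\<^sup>2 - 2 * 1 * ((A + 1) / (2 * C)) * C + ((A + 1) / (2 * C))\<^sup>2 * B" by (rule quad)
      thus False using True \<open>C > 0\<close> by simp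
    qed
    thus ?thesis using True by simp
  next
    case False
    hence "B > 0" using \<open>B \<ge> 0\<close> by simp
    \<comment> \<open>The choice s = \<open>B\<close>, r = \<open>C\<close> is proportional to the
      minimiser of the form and turns it into \<open>B * (A * B - C\<^sup>2)\<close>.\<close>
    have "0 \<le> A * B\<^sup>2 - 2 * B * C * C + C\<^sup>2 * B" by (rule quad)
    hence "0 \<le> B * (A * B - C\<^sup>2)" by (simp add: algebra_simps power2_eq_square)
    thus ?thesis using \<open>B > 0\<close> by (simp add: zero_le_mult_iff)
  qed
  hence "sqrt (C\<^sup>2) \<le> sqrt (A * B)" by (rule real_sqrt_le_mono)
  thus ?thesis using \<open>C \<ge> 0\<close> by (simp add: L2_norm_def A_def B_def C_def real_sqrt_mult)
qed

lemma L2_Cauchy_Schwarz_norm: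
  fixes f g :: "plane \<Rightarrow> 'b::{real_normed_field, banach, second_countable_topology}"
  assumes f: "square_integrable f" and g: "square_integrable g"
  shows "norm (LINT x|lborel. f x * g x) \<le> L2_norm f * L2_norm g"
proof -
  have "norm (LINT x|lborel. f x * g x) \<le> (LINT x|lborel. norm (f x * g x))"
    by (rule integral_norm_bound)
  also have "\<dots> \<le> L2_norm f * L2_norm g"
    using L2_Cauchy_Schwarz[OF f g] by (simp add: norm_mult)
  finally show ?thesis .
qed

lemma L2_norm_triangle:
  fixes f g :: "plane \<Rightarrow> 'b::{banach, second_countable_topology}"
  assumes f: "square_integrable f" and g: "square_integrable g"
  shows "L2_norm (\<lambda>x. f x + g x) \<le> L2_norm f + L2_norm g"
proof -
  have int: "integrable lborel (\<lambda>x. norm (f x) * norm (g x))"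
    by (rule sqi_mult_integrable[OF sqi_norm[OF f] sqi_norm[OF g]])
  have "(L2_norm (\<lambda>x. f x + g x))\<^sup>2
      \<le> (LINT x|lborel. (norm (f x))\<^sup>2 + 2 * (norm (f x) * norm (g x)) + (norm (g x))\<^sup>2)"
    unfolding L2_norm_sq
  proof (rule integral_mono)
    fix x
    have "(norm (f x + g x))\<^sup>2 \<le> (norm (f x) + norm (g x))\<^sup>2"
      by (simp add: power_mono norm_triangle_ineq)
    thus "(norm (f x + g x))\<^sup>2 \<le> (norm (f x))\<^sup>2 + 2 * (norm (f x) * norm (g x)) + (norm (g x))\<^sup>2"
      by (simp add: power2_sum)
  qed (use int sqi_integrable[OF f] sqi_integrable[OF g] sqi_integrable[OF sqi_add[OF f g]] in auto)
  also have "\<dots> = (L2_norm f)\<^sup>2 + 2 * (LINT x|lborel. norm (f x) * norm (g x)) + (L2_norm g)\<^sup>2"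
    using int sqi_integrable[OF f] sqi_integrable[OF g] by (simp add: L2_norm_sq)
  also have "\<dots> \<le> (L2_norm f + L2_norm g)\<^sup>2"
    using L2_Cauchy_Schwarz[OF f g] by (simp add: power2_sum)
  finally show ?thesis by (rule power2_le_imp_le) simp
qed

lemma L2_norm_triangle_diff:
  fixes f g h :: "plane \<Rightarrow> 'b::{banach, second_countable_topology}"
  assumes "square_integrable f" "square_integrable g" "square_integrable h"
  shows "L2_norm (\<lambda>x. f x - h x) \<le> L2_norm (\<lambda>x. f x - g x) + L2_norm (\<lambda>x. g x - h x)"
  using L2_norm_triangle[OF sqi_diff[OF assms(1,2)] sqi_diff[OF assms(2,3)]] by simp

lemma L2_norm_diff_abs:
  fixes f g :: "plane \<Rightarrow> 'b::{banach, second_countable_topology}"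
  assumes f: "square_integrable f" and g: "square_integrable g"
  shows "\<bar>L2_norm f - L2_norm g\<bar> \<le> L2_norm (\<lambda>x. f x - g x)"
  using L2_norm_triangle[OF sqi_diff[OF f g] g] L2_norm_triangle[OF sqi_diff[OF g f] f]
    L2_norm_minus_commute[of f g] by simp

lemma L2_limit_norm:
  fixes f :: "plane \<Rightarrow> 'b::{banach, second_countable_topology}"
  assumes "\<forall>\<^sub>F n in F. square_integrable (fs n)" "square_integrable f"
    and "((\<lambda>n. L2_norm (\<lambda>x. fs n x - f x)) \<longlongrightarrow> 0) F"
  shows "((\<lambda>n. L2_norm (fs n)) \<longlongrightarrow> L2_norm f) F"
proof -
  have "((\<lambda>n. L2_norm (fs n) - L2_norm f) \<longlongrightarrow> 0) F"
    using assms(1) L2_norm_diff_abs[OF _ assms(2)]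
    by (intro Lim_null_comparison[OF _ assms(3)]) (auto elim!: eventually_mono)
  thus ?thesis by (simp add: LIM_zero_iff)
qed

lemma L2_limit_mult:
  fixes f g :: "plane \<Rightarrow> 'b::{real_normed_field, banach, second_countable_topology}"
  assumes sq: "\<forall>\<^sub>F n in F. square_integrable (fs n)" "\<forall>\<^sub>F n in F. square_integrable (gs n)" "square_integrable f" "square_integrable g"
    and lf: "((\<lambda>n. L2_norm (\<lambda>x. fs n x - f x)) \<longlongrightarrow> 0) F"
    and lg: "((\<lambda>n. L2_norm (\<lambda>x. gs n x - g x)) \<longlongrightarrow> 0) F"
  shows "((\<lambda>n. LINT x|lborel. fs n x * gs n x) \<longlongrightarrow> (LINT x|lborel. f x * g x)) F"
proof -
  have "((\<lambda>n. (LINT x|lborel. fs n x * gs n x) - (LINT x|lborel. f x * g x)) \<longlongrightarrow> 0) F"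
  proof (rule Lim_null_comparison)
    show "\<forall>\<^sub>F n in F. norm ((LINT x|lborel. fs n x * gs n x) - (LINT x|lborel. f x * g x))
       \<le> L2_norm (\<lambda>x. fs n x - f x) * L2_norm (gs n) + L2_norm f * L2_norm (\<lambda>x. gs n x - g x)"
      using sq(1,2)
    proof eventually_elim
      case (elim n)
      have "(LINT x|lborel. fs n x * gs n x) - (LINT x|lborel. f x * g x)
          = (LINT x|lborel. fs n x * gs n x - f x * g x)"
        using elim sq by (simp add: sqi_mult_integrable)
      also have "\<dots> = (LINT x|lborel. (fs n x - f x) * gs n x + f x * (gs n x - g x))"
        by (simp add: algebra_simps)
      also have "\<dots> = (LINT x|lborel. (fs n x - f x) * gs n x) + (LINT x|lborel. f x * (gs n x - g x))"
        using elim sq by (intro Bochner_Integration.integral_add sqi_mult_integrable sqi_diff)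
      also have "norm \<dots> \<le> L2_norm (\<lambda>x. fs n x - f x) * L2_norm (gs n) + L2_norm f * L2_norm (\<lambda>x. gs n x - g x)"
        using elim sq by (intro norm_triangle_mono L2_Cauchy_Schwarz_norm sqi_diff)
      finally show ?case .
    qed
    have "((\<lambda>n. L2_norm (\<lambda>x. fs n x - f x) * L2_norm (gs n) + L2_norm f * L2_norm (\<lambda>x. gs n x - g x))
        \<longlongrightarrow> 0 * L2_norm g + L2_norm f * 0) F"
      by (intro tendsto_intros lf lg L2_limit_norm sq)
    thus "((\<lambda>n. L2_norm (\<lambda>x. fs n x - f x) * L2_norm (gs n) + L2_norm f * L2_norm (\<lambda>x. gs n x - g x)) \<longlongrightarrow> 0) F"
      by simp
  qed
  thus ?thesis by (simp add: LIM_zero_iff)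
qed

lemma L2_dominated:
  fixes f :: "plane \<Rightarrow> 'b::{banach, second_countable_topology}"
    and w :: "plane \<Rightarrow> real"
  assumes [measurable]: "\<And>n. fs n \<in> borel_measurable borel" "f \<in> borel_measurable borel" and w: "square_integrable w"
    and lim: "AE x in lborel. (\<lambda>n. fs n x) \<longlonglongrightarrow> f x"
    and le: "\<And>n. AE x in lborel. norm (fs n x - f x) \<le> w x"
  shows "(\<lambda>n. L2_norm (\<lambda>x. fs n x - f x)) \<longlonglongrightarrow> 0"
proof -
  have "(\<lambda>n. LINT x|lborel. (norm (fs n x - f x))\<^sup>2) \<longlonglongrightarrow> (LINT x::plane|lborel. 0)"
  proof (rule integral_dominated_convergence[where w = "\<lambda>x. (w x)\<^sup>2"])
    show "AE x in lborel. (\<lambda>n. (norm (fs n x - f x))\<^sup>2) \<longlonglongrightarrow> 0"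
      using lim
    proof eventually_elim
      case (elim x)
      hence "(\<lambda>n. (norm (fs n x - f x))\<^sup>2) \<longlonglongrightarrow> (norm (f x - f x))\<^sup>2"
        by (intro tendsto_intros)
      thus ?case by simp
    qed
    show "AE x in lborel. norm ((norm (fs n x - f x))\<^sup>2) \<le> (w x)\<^sup>2" for n
      using le[of n] by eventually_elim (simp add: power_mono)
  qed (use sqi_integrable[OF w] in auto)
  hence "(\<lambda>n. sqrt (LINT x|lborel. (norm (fs n x - f x))\<^sup>2)) \<longlonglongrightarrow> sqrt (LINT x::plane|lborel. 0)"
    by (rule tendsto_real_sqrt)
  thus ?thesis by (simp add: L2_norm_def)
qed

text \<open>Riesz-Fischer for a rapidly Cauchy sequence: the partial sums of the pointwise
  increments have norm at most 2, so by monotone convergence their limit is finite almost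
  everywhere, which forces pointwise convergence.\<close>

lemma L2_fast_Cauchy:
  fixes u :: "nat \<Rightarrow> plane \<Rightarrow> 'b::{banach, second_countable_topology}"
  assumes u: "\<And>n. square_integrable (u n)"
    and fast: "\<And>n. L2_norm (\<lambda>x. u (Suc n) x - u n x) \<le> (1/2) ^ n"
  obtains f where "square_integrable f" "(\<lambda>n. L2_norm (\<lambda>x. u n x - f x)) \<longlonglongrightarrow> 0"
proof -
  note [measurable] = u[THEN sqi_measurable']
  define d where "d k x = norm (u (Suc k) x - u k x)" for k x
  define S where "S n x = (\<Sum>k<n. d k x)" for n x
  have d_sqi: "square_integrable (d k)" for k
    unfolding d_def by (intro sqi_norm sqi_diff u)
  have S_sqi: "square_integrable (S n)" for n
    unfolding S_def by (intro sqi_sum d_sqi)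
  note [measurable] = d_sqi[THEN sqi_measurable'] S_sqi[THEN sqi_measurable']
  have d0: "d k x \<ge> 0" for k x by (simp add: d_def)
  have S0: "S n x \<ge> 0" for n x by (simp add: S_def sum_nonneg d0)
  have S_norm: "L2_norm (S n) \<le> 2" for n
  proof -
    have "L2_norm (S n) \<le> (\<Sum>k<n. (1/2) ^ k)"
    proof (induction n)
      case 0 show ?case by (simp add: S_def)
    next
      case (Suc n)
      have "S (Suc n) = (\<lambda>x. S n x + d n x)" by (auto simp: S_def)
      hence "L2_norm (S (Suc n)) \<le> L2_norm (S n) + L2_norm (d n)"
        using L2_norm_triangle[OF S_sqi d_sqi] by simp
      moreover have "L2_norm (d n) \<le> (1/2) ^ n"
        using fast[of n] by (simp add: d_def[abs_def] L2_norm_def)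
      ultimately show ?case using Suc by simp
    qed
    also have "\<dots> \<le> 2" by (subst sum_gp_strict) simp
    finally show ?thesis .
  qed
  have inc: "S n x \<le> S m x" if "n \<le> m" for n m x
    unfolding S_def using that d0 by (intro sum_mono2) auto
  have "(\<integral>\<^sup>+x. (SUP n. ennreal ((S n x)\<^sup>2)) \<partial>lborel) = (SUP n. \<integral>\<^sup>+x. ennreal ((S n x)\<^sup>2) \<partial>lborel)"
    by (rule nn_integral_monotone_convergence_SUP)
      (auto simp: incseq_def le_fun_def intro!: ennreal_leI power_mono inc S0)
  also have "\<dots> \<le> ennreal 4"
  proof (rule SUP_least)
    fix n
    have "(\<integral>\<^sup>+x. ennreal ((S n x)\<^sup>2) \<partial>lborel) = ennreal (LINT x|lborel. (S n x)\<^sup>2)"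
      using sqi_integrable[OF S_sqi[of n]] by (intro nn_integral_eq_integral) auto
    also have "(LINT x|lborel. (S n x)\<^sup>2) = (L2_norm (S n))\<^sup>2" by (simp add: L2_norm_sq)
    also have "ennreal \<dots> \<le> ennreal (2\<^sup>2)" by (intro ennreal_leI power_mono S_norm) simp
    finally show "(\<integral>\<^sup>+x. ennreal ((S n x)\<^sup>2) \<partial>lborel) \<le> ennreal 4" by simp
  qed
  finally have H: "(\<integral>\<^sup>+x. (SUP n. ennreal ((S n x)\<^sup>2)) \<partial>lborel) \<le> ennreal 4" .
  have "AE x in lborel. (SUP n. ennreal ((S n x)\<^sup>2)) \<noteq> \<infinity>"
    using H by (intro nn_integral_PInf_AE) (auto simp: top_unique)
  hence AE_sum: "AE x in lborel. summable (\<lambda>k. d k x)"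
  proof eventually_elim
    case (elim x)
    then obtain B where B: "(SUP n. ennreal ((S n x)\<^sup>2)) = ennreal B" "B \<ge> 0"
      by (cases "SUP n. ennreal ((S n x)\<^sup>2)" rule: ennreal_cases) auto
    have "(S n x)\<^sup>2 \<le> B" for n
    proof -
      have "ennreal ((S n x)\<^sup>2) \<le> ennreal B" unfolding B(1)[symmetric] by (rule SUP_upper) simp
      thus ?thesis using B(2) by simp
    qed
    hence "S n x \<le> sqrt B" for n by (intro real_le_rsqrt)
    thus ?case
      by (intro bounded_imp_summable[where B = "sqrt B"] d0)
        (metis S_def lessThan_Suc_atMost)
  qed
  \<comment> \<open>By telescoping, \<open>w\<close> dominates every
    \<open>norm (u n x - f x)\<close>; it is the majorant for the dominated convergence at the
    end.\<close>
  define w where "w x = (\<Sum>k. d k x)" for x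
  have [measurable]: "w \<in> borel_measurable borel" unfolding w_def by measurable
  have w_sq: "square_integrable w"
    unfolding square_integrable_def
  proof (intro conjI integrableI_bounded)
    have "(\<integral>\<^sup>+x. ennreal (norm ((norm (w x))\<^sup>2)) \<partial>lborel) \<le> (\<integral>\<^sup>+x. (SUP n. ennreal ((S n x)\<^sup>2)) \<partial>lborel)"
    proof (rule nn_integral_mono_AE)
      show "AE x in lborel. ennreal (norm ((norm (w x))\<^sup>2)) \<le> (SUP n. ennreal ((S n x)\<^sup>2))"
        using AE_sum
      proof eventually_elim
        case (elim x)
        hence "(\<lambda>n. S n x) \<longlonglongrightarrow> w x"
          unfolding S_def w_def by (rule summable_LIMSEQ)
        hence "(\<lambda>n. ennreal ((S n x)\<^sup>2)) \<longlonglongrightarrow> ennreal ((w x)\<^sup>2)"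
          by (intro tendsto_intros)
        hence "ennreal ((w x)\<^sup>2) \<le> (SUP n. ennreal ((S n x)\<^sup>2))"
          by (rule LIMSEQ_le_const2) (intro exI[of _ 0] allI impI SUP_upper, simp)
        thus ?case by simp
      qed
    qed
    also have "\<dots> < \<infinity>" using H by (simp add: order_le_less_trans)
    finally show "(\<integral>\<^sup>+x. ennreal (norm ((norm (w x))\<^sup>2)) \<partial>lborel) < \<infinity>" .
  qed auto
  define f where "f x = lim (\<lambda>n. u n x)" for x
  have [measurable]: "f \<in> borel_measurable borel" unfolding f_def by measurable
  have lim: "AE x in lborel. (\<lambda>n. u n x) \<longlonglongrightarrow> f x \<and> (\<forall>n. norm (u n x - f x) \<le> w x)"
    using AE_sum
  proof eventually_elim
    case (elim x)
    hence sm: "summable (\<lambda>k. u (Suc k) x - u k x)"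
      unfolding d_def by (rule summable_norm_cancel)
    have tele: "(\<Sum>k<n. u (Suc k) x - u k x) = u n x - u 0 x" for n
      by (rule sum_lessThan_telescope)
    have "convergent (\<lambda>n. u n x - u 0 x)"
      using sm unfolding summable_iff_convergent tele .
    hence "convergent (\<lambda>n. u n x)"
      using convergent_add[of "\<lambda>n. u n x - u 0 x" "\<lambda>_. u 0 x"] by (simp add: convergent_const)
    hence l: "(\<lambda>n. u n x) \<longlonglongrightarrow> f x" by (simp add: f_def convergent_LIMSEQ_iff)
    have "norm (u n x - f x) \<le> w x" for n
    proof -
      have "norm (u n x - u m x) \<le> w x" if "n \<le> m" for m
      proof -
        have "u m x - u n x = (\<Sum>k=n..<m. u (Suc k) x - u k x)"
          using sum_Suc_diff'[OF that, of "\<lambda>k. u k x"] by simp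
        hence "norm (u n x - u m x) \<le> (\<Sum>k=n..<m. d k x)"
          unfolding d_def norm_minus_commute[of "u n x"] by (simp only: norm_sum)
        also have "\<dots> \<le> w x"
          unfolding w_def by (rule sum_le_suminf[OF elim]) (auto simp: d0)
        finally show ?thesis .
      qed
      moreover have "(\<lambda>m. norm (u n x - u m x)) \<longlonglongrightarrow> norm (u n x - f x)"
        by (intro tendsto_intros l)
      ultimately show ?thesis
        by (intro LIMSEQ_le_const2) auto
    qed
    with l show ?case by blast
  qed
  have le: "AE x in lborel. norm (u n x - f x) \<le> w x" for n
    using lim by eventually_elim blast
  have "square_integrable (\<lambda>x. u 0 x - f x)"
    using le[of 0] by (intro sqi_bound[OF w_sq, where K = 1]) (auto elim!: eventually_mono)
  from sqi_diff[OF u[of 0] this] have "square_integrable f" by simp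
  moreover have "(\<lambda>n. L2_norm (\<lambda>x. u n x - f x)) \<longlonglongrightarrow> 0"
    using lim by (intro L2_dominated[OF _ _ w_sq _ le]) (auto elim!: eventually_mono)
  ultimately show ?thesis by (rule that)
qed

lemma L2_complete:
  fixes u :: "nat \<Rightarrow> plane \<Rightarrow> 'b::{banach, second_countable_topology}"
  assumes u: "\<And>n. square_integrable (u n)"
    and Cau: "\<And>e. e > 0 \<Longrightarrow> \<exists>N. \<forall>m\<ge>N. \<forall>n\<ge>N. L2_norm (\<lambda>x. u m x - u n x) < e"
  obtains f where "square_integrable f" "(\<lambda>n. L2_norm (\<lambda>x. u n x - f x)) \<longlonglongrightarrow> 0"
proof -
  have "\<forall>k. \<exists>N. \<forall>m\<ge>N. \<forall>n\<ge>N. L2_norm (\<lambda>x. u m x - u n x) < (1/2) ^ k"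
    by (intro allI Cau) simp
  then obtain N where N: "\<And>k m n. m \<ge> N k \<Longrightarrow> n \<ge> N k \<Longrightarrow> L2_norm (\<lambda>x. u m x - u n x) < (1/2) ^ k"
    by metis
  \<comment> \<open>Partial sums of \<open>N\<close> give an increasing choice of indices with
    \<open>r k\<close> and \<open>r (Suc k)\<close> both at least \<open>N k\<close>, so consecutive
    terms are within \<open>(1/2) ^ k\<close>.\<close>
  define r where "r k = (\<Sum>j\<le>k. N j)" for k
  have r: "r k \<ge> N k" "r (Suc k) \<ge> r k" for k
    by (auto simp: r_def intro: member_le_sum[of k "{..k}" N, simplified])
  have rr: "r (Suc k) \<ge> N k" for k using r[of k] by linarith
  obtain f where f: "square_integrable f" "(\<lambda>n. L2_norm (\<lambda>x. u (r n) x - f x)) \<longlonglongrightarrow> 0"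
  proof (rule L2_fast_Cauchy[of "\<lambda>k. u (r k)"])
    show "L2_norm (\<lambda>x. u (r (Suc n)) x - u (r n) x) \<le> (1/2) ^ n" for n
      using N[OF rr r(1)] by (rule less_imp_le)
  qed (use u in auto)
  have "(\<lambda>n. L2_norm (\<lambda>x. u n x - f x)) \<longlonglongrightarrow> 0"
  proof (rule LIMSEQ_I)
    fix e :: real assume e: "e > 0"
    obtain k0 where k0: "\<And>k. k \<ge> k0 \<Longrightarrow> L2_norm (\<lambda>x. u (r k) x - f x) < e / 2"
      using LIMSEQ_D[OF f(2), of "e/2"] e by auto
    obtain k1 where k1: "(1/2 :: real) ^ k1 < e / 2"
      using real_arch_pow_inv[of "e/2" "1/2"] e by auto
    define k where "k = max k0 k1"
    have "(1/2 :: real) ^ k \<le> (1/2) ^ k1" by (rule power_decreasing) (auto simp: k_def)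
    have "norm (L2_norm (\<lambda>x. u n x - f x) - 0) < e" if "n \<ge> N k" for n
    proof -
      have "L2_norm (\<lambda>x. u n x - f x) \<le> L2_norm (\<lambda>x. u n x - u (r k) x) + L2_norm (\<lambda>x. u (r k) x - f x)"
        by (intro L2_norm_triangle_diff u f)
      also have "\<dots> < e / 2 + e / 2"
      proof (rule add_strict_mono)
        show "L2_norm (\<lambda>x. u n x - u (r k) x) < e / 2"
          using N[OF that r(1)] \<open>(1/2 :: real) ^ k \<le> (1/2) ^ k1\<close> k1 by linarith
        show "L2_norm (\<lambda>x. u (r k) x - f x) < e / 2" by (rule k0) (simp add: k_def)
      qed
      finally show ?thesis by simp
    qed
    thus "\<exists>no. \<forall>n\<ge>no. norm (L2_norm (\<lambda>x. u n x - f x) - 0) < e" by blast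
  qed
  with f(1) show ?thesis by (rule that)
qed

text \<open>Boxes serve as building blocks for two reasons: the transform of a box factors into
  one-dimensional integrals, and open boxes form an intersection-stable generator of the Borel
  sets.\<close>

inductive box_step :: "(plane \<Rightarrow> 'b::real_normed_vector) \<Rightarrow> bool" where
  zero: "box_step (\<lambda>_. 0)"
| add: "box_step f \<Longrightarrow> box_step (\<lambda>x. f x + indicator (box a b) x *\<^sub>R c)"

lemma sqi_box [intro, simp]:
  fixes c :: "'b::{banach, second_countable_topology}"
  shows "square_integrable (\<lambda>x. indicator (box a b) x *\<^sub>R c)"
  using emeasure_lborel_box_finite[of a b] by (intro sqi_indicator) auto

lemma sqi_box_step:
  fixes f :: "plane \<Rightarrow> 'b::{banach, second_countable_topology}"
  shows "box_step f \<Longrightarrow> square_integrable f"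
  by (induction rule: box_step.induct) (auto intro: sqi_add)

lemma box_step_add: "box_step f \<Longrightarrow> box_step g \<Longrightarrow> box_step (\<lambda>x. g x + f x)"
proof (induction rule: box_step.induct)
  case (add f a b c)
  have "box_step (\<lambda>x. (g x + f x) + indicator (box a b) x *\<^sub>R c)"
    by (rule box_step.add) (rule add.IH[OF add.prems])
  thus ?case by (simp add: add.assoc)
qed simp

lemma box_step_box: "box_step (\<lambda>x. indicator (box a b) x *\<^sub>R c)"
  using box_step.add[OF box_step.zero] by simp

lemma box_step_linear:
  assumes "linear T" "box_step f"
  shows "box_step (\<lambda>x. T (f x))"
  using assms(2)
proof (induction rule: box_step.induct)
  case zero thus ?case using box_step.zero by (simp add: linear_0[OF assms(1)])
next
  case (add f a b c)
  have "box_step (\<lambda>x. T (f x) + indicator (box a b) x *\<^sub>R T c)"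
    by (rule box_step.add[OF add.IH])
  thus ?case by (simp add: linear_add[OF assms(1)] linear_scale[OF assms(1)])
qed

definition L2_approx :: "(plane \<Rightarrow> 'b::{banach, second_countable_topology}) \<Rightarrow> bool" where
  "L2_approx f \<longleftrightarrow> square_integrable f \<and> (\<forall>e>0. \<exists>g. box_step g \<and> L2_norm (\<lambda>x. f x - g x) < e)"

lemma L2_approxD: "L2_approx f \<Longrightarrow> square_integrable f"
  by (simp add: L2_approx_def)

lemma L2_approx_box_step: "box_step f \<Longrightarrow> L2_approx f"
  unfolding L2_approx_def by (auto intro!: sqi_box_step exI[of _ f])

lemma L2_approx_add:
  assumes "L2_approx f" "L2_approx g"
  shows "L2_approx (\<lambda>x. f x + g x)"
  unfolding L2_approx_def
proof (intro conjI allI impI)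
  show "square_integrable (\<lambda>x. f x + g x)" using assms by (intro sqi_add L2_approxD)
  fix e :: real assume e: "e > 0"
  hence "e / 2 > 0" by simp
  then obtain f' g' where f': "box_step f'" "L2_norm (\<lambda>x. f x - f' x) < e / 2"
    and g': "box_step g'" "L2_norm (\<lambda>x. g x - g' x) < e / 2"
    using assms unfolding L2_approx_def by metis
  have "L2_norm (\<lambda>x. (f x - f' x) + (g x - g' x)) \<le> L2_norm (\<lambda>x. f x - f' x) + L2_norm (\<lambda>x. g x - g' x)"
    using assms f' g' by (intro L2_norm_triangle sqi_diff L2_approxD sqi_box_step)
  hence "L2_norm (\<lambda>x. (f x + g x) - (f' x + g' x)) < e"
    using f' g' by (simp add: algebra_simps)
  thus "\<exists>h. box_step h \<and> L2_norm (\<lambda>x. (f x + g x) - h x) < e"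
    using box_step_add[OF g'(1) f'(1)] by blast
qed

lemma L2_approx_minus:
  assumes "L2_approx f"
  shows "L2_approx (\<lambda>x. - f x)"
  unfolding L2_approx_def
proof (intro conjI allI impI)
  show "square_integrable (\<lambda>x. - f x)" using assms by (intro sqi_minus L2_approxD)
  fix e :: real assume "e > 0"
  then obtain g where g: "box_step g" "L2_norm (\<lambda>x. f x - g x) < e"
    using assms unfolding L2_approx_def by metis
  have "box_step (\<lambda>x. - g x)"
    by (rule box_step_linear[OF _ g(1)]) (auto intro: linear_compose_neg linear_ident simp: module_hom_uminus)
  moreover have "L2_norm (\<lambda>x. - f x - - g x) < e"
    using g(2) L2_norm_minus_commute[of f g] by simp
  ultimately show "\<exists>h. box_step h \<and> L2_norm (\<lambda>x. - f x - h x) < e" by blast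
qed

lemma L2_approx_limit:
  assumes fs: "\<And>n. L2_approx (fs n)" and f: "square_integrable f"
    and lim: "(\<lambda>n::nat. L2_norm (\<lambda>x. fs n x - f x)) \<longlonglongrightarrow> 0"
  shows "L2_approx f"
  unfolding L2_approx_def
proof (intro conjI allI impI f)
  fix e :: real assume "e > 0"
  hence e: "e / 2 > 0" by simp
  from LIMSEQ_D[OF lim e] obtain n where n: "L2_norm (\<lambda>x. fs n x - f x) < e / 2" by auto
  from fs[of n] e obtain g where g: "box_step g" "L2_norm (\<lambda>x. fs n x - g x) < e / 2"
    unfolding L2_approx_def by metis
  have "L2_norm (\<lambda>x. f x - g x) \<le> L2_norm (\<lambda>x. f x - fs n x) + L2_norm (\<lambda>x. fs n x - g x)"
    by (intro L2_norm_triangle_diff f L2_approxD[OF fs] sqi_box_step[OF g(1)])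
  also have "\<dots> < e" using n g(2) L2_norm_minus_commute[of f "fs n"] by simp
  finally show "\<exists>g. box_step g \<and> L2_norm (\<lambda>x. f x - g x) < e" using g(1) by blast
qed

lemma L2_approx_cong:
  assumes "L2_approx f" "\<And>x. f x = g x"
  shows "L2_approx g"
proof -
  have "f = g" using assms(2) by auto
  with assms(1) show ?thesis by simp
qed

text \<open>Dynkin's argument, run inside one fixed box: complements are taken relative to
  \<open>box a b\<close>, so every set met has finite measure and the indicator of the box dominates
  the limit over disjoint unions.\<close>

lemma L2_approx_indicator_bounded:
  fixes c :: "'b::{banach, second_countable_topology}"
  assumes "A \<in> sets borel"
  shows "L2_approx (\<lambda>x::plane. indicator (A \<inter> box a b) x *\<^sub>R c)"
proof -
  let ?G = "range (\<lambda>(a, b). box a b :: plane set)"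
  let ?P = "\<lambda>A. L2_approx (\<lambda>x::plane. indicator (A \<inter> box a b) x *\<^sub>R c)"
  have fin: "square_integrable (\<lambda>x. indicator (B \<inter> box a b) x *\<^sub>R c)" if "B \<in> sets borel" for B
  proof (rule sqi_indicator)
    have "emeasure lborel (B \<inter> box a b) \<le> emeasure lborel (box a b)"
      using that by (intro emeasure_mono) auto
    thus "emeasure lborel (B \<inter> box a b) < \<infinity>"
      using emeasure_lborel_box_finite order_le_less_trans by blast
  qed (use that in auto)
  have sig: "sets (borel :: plane measure) = sigma_sets UNIV ?G"
    unfolding borel_eq_box by (rule sets_measure_of) auto
  have "Int_stable ?G" by (auto simp: Int_stable_def box_Int_box)
  moreover have "?G \<subseteq> Pow UNIV" by simp
  moreover have "A \<in> sigma_sets UNIV ?G" using assms sig by simp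
  ultimately show ?thesis
  proof (induction rule: sigma_sets_induct_disjoint)
    case (basic A)
    then obtain p q where "A = box p q" by auto
    then obtain p' q' where "A \<inter> box a b = box p' q'" by (simp add: box_Int_box)
    thus ?case by (simp add: L2_approx_box_step box_step_box)
  next
    case empty
    show ?case by (auto intro!: L2_approx_box_step box_step.zero)
  next
    case (compl A)
    have "L2_approx (\<lambda>x. indicator (box a b) x *\<^sub>R c + - (indicator (A \<inter> box a b) x *\<^sub>R c))"
      by (rule L2_approx_add[OF L2_approx_box_step[OF box_step_box] L2_approx_minus[OF compl(2)]])
    thus ?case by (rule L2_approx_cong) (auto simp: indicator_def)
  next
    case (union A)
    have meas [measurable]: "A i \<in> sets borel" for i using union(2) sig by auto
    define fs where "fs n x = (\<Sum>i<n. indicator (A i \<inter> box a b) x *\<^sub>R c)" for n x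
    have fs: "L2_approx (fs n)" for n
    proof (induction n)
      case 0 show ?case unfolding fs_def by (auto intro!: L2_approx_box_step box_step.zero)
    next
      case (Suc n)
      show ?case using L2_approx_add[OF Suc union(3)[of n]]
        by (rule L2_approx_cong) (simp add: fs_def)
    qed
    have fs_eq: "fs n x = indicator ((\<Union>i<n. A i) \<inter> box a b) x *\<^sub>R c" for n x
    proof (induction n)
      case 0 show ?case by (simp add: fs_def)
    next
      case (Suc n)
      have "A n \<inter> A i = {}" if "i < n" for i
        using union(1) that by (auto simp: disjoint_family_on_def)
      hence "A n \<inter> (\<Union>i<n. A i) = {}" by blast
      hence "indicator ((\<Union>i<n. A i) \<inter> box a b) x *\<^sub>R c + indicator (A n \<inter> box a b) x *\<^sub>R c
          = (indicator ((\<Union>i<Suc n. A i) \<inter> box a b) x :: real) *\<^sub>R c"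
        by (auto simp: indicator_def less_Suc_eq)
      thus ?case using Suc by (simp add: fs_def)
    qed
    show ?case
    proof (rule L2_approx_limit[OF fs])
      show "square_integrable (\<lambda>x. indicator (\<Union> (range A) \<inter> box a b) x *\<^sub>R c)"
        by (rule fin) auto
      show "(\<lambda>n. L2_norm (\<lambda>x. fs n x - indicator (\<Union> (range A) \<inter> box a b) x *\<^sub>R c)) \<longlonglongrightarrow> 0"
      proof (rule L2_dominated[where w = "\<lambda>x. indicator (box a b) x *\<^sub>R norm c"])
        show "AE x in lborel. (\<lambda>n. fs n x) \<longlonglongrightarrow> indicator (\<Union> (range A) \<inter> box a b) x *\<^sub>R c"
        proof (rule AE_I2)
          fix x
          show "(\<lambda>n. fs n x) \<longlonglongrightarrow> indicator (\<Union> (range A) \<inter> box a b) x *\<^sub>R c"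
          proof (cases "x \<in> \<Union> (range A)")
            case True
            then obtain k where "x \<in> A k" by auto
            hence "\<forall>\<^sub>F n in sequentially. fs n x = indicator (\<Union> (range A) \<inter> box a b) x *\<^sub>R c"
              unfolding fs_eq eventually_sequentially by (intro exI[of _ "Suc k"]) (force simp: indicator_def)
            thus ?thesis by (rule tendsto_eventually)
          next
            case False
            hence "fs n x = indicator (\<Union> (range A) \<inter> box a b) x *\<^sub>R c" for n
              unfolding fs_eq by (auto simp: indicator_def)
            thus ?thesis by simp
          qed
        qed
        show "AE x in lborel. norm (fs n x - indicator (\<Union> (range A) \<inter> box a b) x *\<^sub>R c)
            \<le> indicator (box a b) x *\<^sub>R norm c" for n
          unfolding fs_eq by (rule AE_I2) (auto simp: indicator_def)
        show "square_integrable (\<lambda>x. indicator (box a b) x *\<^sub>R norm c)" by (rule sqi_box)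
      qed (auto simp: fs_eq)
    qed
  qed
qed

lemma box_exhaust: "\<exists>N::nat. \<forall>n\<ge>N. (x::plane) \<in> box (- (\<Sum>b\<in>Basis. real n *\<^sub>R b)) (\<Sum>b\<in>Basis. real n *\<^sub>R b)"
proof -
  obtain N :: nat where N: "real N > norm x" using reals_Archimedean2 by blast
  show ?thesis
  proof (intro exI[of _ N] allI impI)
    fix n assume "n \<ge> N"
    hence "real n > norm x" using N by linarith
    hence "\<bar>x \<bullet> b\<bar> < real n" if "b \<in> Basis" for b
      using Basis_le_norm[OF that, of x] by linarith
    thus "x \<in> box (- (\<Sum>b\<in>Basis. real n *\<^sub>R b)) (\<Sum>b\<in>Basis. real n *\<^sub>R b)"
      by (auto simp: mem_box inner_sum_left inner_Basis abs_less_iff if_distrib cong: if_cong)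
        (smt (verit))
  qed
qed

lemma L2_approx_indicator:
  fixes c :: "'b::{banach, second_countable_topology}"
  assumes A [measurable]: "A \<in> sets borel" and fin: "emeasure lborel A < \<infinity>"
  shows "L2_approx (\<lambda>x::plane. indicator A x *\<^sub>R c)"
proof -
  define B :: "nat \<Rightarrow> plane set"
    where "B n = box (- (\<Sum>b\<in>Basis. real n *\<^sub>R b)) (\<Sum>b\<in>Basis. real n *\<^sub>R b)" for n
  have [measurable]: "B n \<in> sets borel" for n by (simp add: B_def)
  show ?thesis
  proof (rule L2_approx_limit)
    show "L2_approx (\<lambda>x. indicator (A \<inter> B n) x *\<^sub>R c)" for n
      unfolding B_def by (rule L2_approx_indicator_bounded[OF A])
    show "(\<lambda>n. L2_norm (\<lambda>x. indicator (A \<inter> B n) x *\<^sub>R c - indicator A x *\<^sub>R c)) \<longlonglongrightarrow> 0"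
    proof (rule L2_dominated[where w = "\<lambda>x. indicator A x *\<^sub>R norm c"])
      show "AE x in lborel. (\<lambda>n. indicator (A \<inter> B n) x *\<^sub>R c) \<longlonglongrightarrow> indicator A x *\<^sub>R c"
      proof (rule AE_I2)
        fix x
        obtain N where "\<forall>n\<ge>N. x \<in> B n" using box_exhaust[of x] unfolding B_def by blast
        hence "\<forall>\<^sub>F n in sequentially. indicator (A \<inter> B n) x *\<^sub>R c = (indicator A x :: real) *\<^sub>R c"
          unfolding eventually_sequentially by (intro exI[of _ N]) (auto simp: indicator_def)
        thus "(\<lambda>n. indicator (A \<inter> B n) x *\<^sub>R c) \<longlonglongrightarrow> indicator A x *\<^sub>R c"
          by (rule tendsto_eventually)
      qed
      show "AE x in lborel. norm (indicator (A \<inter> B n) x *\<^sub>R c - indicator A x *\<^sub>R c) \<le> indicator A x *\<^sub>R norm c" for n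
        by (rule AE_I2) (auto simp: indicator_def)
      show "square_integrable (\<lambda>x. indicator A x *\<^sub>R norm c)" by (rule sqi_indicator[OF A fin])
    qed auto
  qed (rule sqi_indicator[OF A fin])
qed

theorem box_step_dense:
  fixes f :: "plane \<Rightarrow> 'b::{banach, second_countable_topology}"
  assumes f: "square_integrable f"
  shows "L2_approx f"
proof -
  note [measurable] = sqi_measurable'[OF f]
  have "f \<in> borel_measurable lborel" by simp
  from borel_measurable_implies_sequence_metric[OF this, of 0]
  obtain s where s: "\<And>i. simple_function lborel (s i)" "\<And>x. (\<lambda>i. s i x) \<longlonglongrightarrow> f x"
    "\<And>i x. norm (s i x) \<le> 2 * norm (f x)"
    by auto
  have [measurable]: "s i \<in> borel_measurable borel" for i
    using borel_measurable_simple_function[OF s(1)[of i]] by simp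
  have s_sqi: "square_integrable (s i)" for i
    using s(3) by (intro sqi_bound[OF f, where K = 2]) auto
  have s_approx: "L2_approx (s i)" for i
  proof -
    have fin: "finite (s i ` UNIV)" using s(1)[of i] by (simp add: simple_function_def)
    have part: "L2_approx (\<lambda>x. indicator (s i -` {y}) x *\<^sub>R y)" for y
    proof (cases "y = 0")
      case True thus ?thesis by (simp add: L2_approx_box_step box_step.zero)
    next
      case False
      have A [measurable]: "s i -` {y} \<in> sets borel"
        using measurable_sets_borel[of "s i" borel "{y}"] by simp
      \<comment> \<open>Chebyshev: on the level set of a nonzero value \<open>y\<close> the quotient
        below equals 1, so the level set has finite measure.\<close>
      have "integrable lborel (indicator (s i -` {y}) :: plane \<Rightarrow> real)"
      proof (rule Bochner_Integration.integrable_bound)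
        show "integrable lborel (\<lambda>x. (norm (s i x))\<^sup>2 / (norm y)\<^sup>2)"
          using sqi_integrable[OF s_sqi[of i]] by simp
      qed (use False in \<open>auto simp: indicator_def\<close>)
      thus ?thesis by (intro L2_approx_indicator A) (simp add: integrable_indicator_iff)
    qed
    have "L2_approx (\<lambda>x. \<Sum>y\<in>Y. indicator (s i -` {y}) x *\<^sub>R y)" if "finite Y" for Y
      using that
    proof (induction Y rule: finite_induct)
      case empty thus ?case by (simp add: L2_approx_box_step box_step.zero)
    next
      case (insert y Y) show ?case using L2_approx_add[OF part[of y] insert.IH] by (simp only: sum.insert[OF insert.hyps])
    qed
    from this[OF fin] show ?thesis
    proof (rule L2_approx_cong)
      fix x
      show "(\<Sum>y\<in>range (s i). indicator (s i -` {y}) x *\<^sub>R y) = s i x"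
        using simple_function_indicator_representation_banach[OF s(1)[of i], of x]
        by (simp only: space_lborel space_borel Int_UNIV_right UNIV_I simp_thms)
    qed
  qed
  show ?thesis
  proof (rule L2_approx_limit[OF s_approx f])
    show "(\<lambda>n. L2_norm (\<lambda>x. s n x - f x)) \<longlonglongrightarrow> 0"
    proof (rule L2_dominated[where w = "\<lambda>x. 3 *\<^sub>R norm (f x)"])
      show "AE x in lborel. norm (s n x - f x) \<le> 3 *\<^sub>R norm (f x)" for n
      proof (rule AE_I2)
        fix x
        have "norm (s n x - f x) \<le> norm (s n x) + norm (f x)" by (rule norm_triangle_ineq4)
        thus "norm (s n x - f x) \<le> 3 *\<^sub>R norm (f x)" using s(3)[of n x] by simp
      qed
      show "square_integrable (\<lambda>x. 3 *\<^sub>R norm (f x))" by (intro sqi_scaleR sqi_norm f)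
    qed (use s(2) in auto)
  qed
qed

lemma box_step_sequence:
  fixes f :: "plane \<Rightarrow> 'b::{banach, second_countable_topology}"
  assumes f: "square_integrable f"
  obtains g where "\<And>n. box_step (g n)" "(\<lambda>n::nat. L2_norm (\<lambda>x. g n x - f x)) \<longlonglongrightarrow> 0"
proof -
  have "\<exists>g. box_step g \<and> L2_norm (\<lambda>x. f x - g x) < 1 / Suc n" for n :: nat
    using box_step_dense[OF f] unfolding L2_approx_def by simp
  then obtain g where g: "\<And>n. box_step (g n)" "\<And>n. L2_norm (\<lambda>x. f x - g n x) < 1 / Suc n"
    by metis
  have "(\<lambda>n::nat. L2_norm (\<lambda>x. g n x - f x)) \<longlonglongrightarrow> 0"
  proof (rule Lim_null_comparison)
    show "\<forall>\<^sub>F n in sequentially. norm (L2_norm (\<lambda>x. g n x - f x)) \<le> 1 / Suc n"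
      using g(2) by (auto simp: L2_norm_minus_commute[of _ f] intro!: always_eventually less_imp_le)
  qed (rule LIMSEQ_Suc[OF lim_1_over_n])
  with g(1) show ?thesis by (rule that)
qed

text \<open>Box steps approximate the conjugate of \<open>F\<close>; integrating \<open>F\<close>
  against them gives 0, and in the limit the squared norm of \<open>F\<close>.\<close>

lemma AE_zero_of_box_integrals:
  fixes F :: "plane \<Rightarrow> complex"
  assumes F: "square_integrable F"
    and zero: "\<And>a b. (LINT x|lborel. F x * indicator (box a b) x) = 0"
  shows "AE x in lborel. F x = 0"
proof -
  have step0: "(LINT x|lborel. F x * g x) = 0" if "box_step g" for g
    using that
  proof (induction rule: box_step.induct)
    case (add g a b c)
    have "(LINT x|lborel. F x * (g x + indicator (box a b) x *\<^sub>R c))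
        = (LINT x|lborel. F x * g x + F x * (indicator (box a b) x *\<^sub>R c))"
      by (simp add: algebra_simps)
    also have "\<dots> = (LINT x|lborel. F x * g x) + (LINT x|lborel. F x * (indicator (box a b) x *\<^sub>R c))"
      by (intro Bochner_Integration.integral_add sqi_mult_integrable F sqi_box_step add sqi_box)
    also have "(LINT x|lborel. F x * (indicator (box a b) x *\<^sub>R c)) = (LINT x|lborel. c * (F x * indicator (box a b) x))"
      by (intro Bochner_Integration.integral_cong) (auto simp: indicator_def)
    also have "\<dots> = 0" using zero by simp
    finally show ?case using add by simp
  qed simp
  obtain g where g: "\<And>n. box_step (g n)" "(\<lambda>n::nat. L2_norm (\<lambda>x. g n x - cnj (F x))) \<longlonglongrightarrow> 0"
    by (rule box_step_sequence[OF sqi_cnj[OF F]]) blast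
  have "(\<lambda>n::nat. LINT x|lborel. F x * g n x) \<longlonglongrightarrow> (LINT x|lborel. F x * cnj (F x))"
    using g by (intro L2_limit_mult) (auto simp: F sqi_cnj sqi_box_step)
  hence "(LINT x|lborel. F x * cnj (F x)) = 0"
    by (simp add: step0[OF g(1)] LIMSEQ_const_iff)
  moreover have "(LINT x|lborel. F x * cnj (F x)) = complex_of_real ((L2_norm F)\<^sup>2)"
    by (simp add: L2_norm_sq complex_norm_square[symmetric] flip: of_real_power integral_complex_of_real)
  ultimately have "L2_norm F = 0" by simp
  thus ?thesis by (rule L2_norm_eq_0_AE[OF F])
qed

section \<open>The Fourier transform of boxes\<close>

lemma cis_measurable [measurable]: "cis \<in> borel_measurable borel"
  by (intro borel_measurable_continuous_onI) (simp add: cis_conv_exp continuous_intros)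

lemma integrable_indicator_complex:
  "A \<in> sets M \<Longrightarrow> emeasure M A < \<infinity> \<Longrightarrow> integrable M (indicator A :: 'a \<Rightarrow> complex)"
  using integrable_of_real[OF integrable_real_indicator[of A M], where 'a = complex]
  by (simp add: of_real_indicator)

lemma integral_indicator_complex:
  "(LINT x|M. indicator A x :: complex) = measure M (A \<inter> space M)"
proof -
  have "(LINT x|M. indicator A x :: complex) = (LINT x|M. complex_of_real (indicator A x))"
    by (simp add: of_real_indicator)
  thus ?thesis by simp
qed

lemma emeasure_lborel_Ioo_finite: "emeasure lborel {a<..<b::real} < \<infinity>"
  using emeasure_lborel_box_finite[of a b] by (simp only: box_real)

definition e1 :: "real \<Rightarrow> real \<Rightarrow> real \<Rightarrow> complex" where
  "e1 a b t = (LINT x|lborel. cis (- (x * t)) * indicator {a<..<b} x)"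

lemma integrable_cis_interval: "integrable lborel (\<lambda>x. cis (- (x * t)) * indicator {a<..<b::real} x)"
proof (rule Bochner_Integration.integrable_bound)
  show "integrable lborel (indicator {a<..<b} :: real \<Rightarrow> real)"
    using emeasure_lborel_Ioo_finite by (intro integrable_real_indicator) auto
qed (auto simp: indicator_def)

lemma e1_empty: "b \<le> a \<Longrightarrow> e1 a b t = 0"
  by (simp add: e1_def)

lemma e1_measurable [measurable]: "e1 a b \<in> borel_measurable borel"
proof -
  have "(\<lambda>t. LINT x|lborel. cis (- (x * t)) * indicator {a<..<b} x) \<in> borel_measurable borel"
    by (intro lborel.borel_measurable_lebesgue_integral) measurable
  thus ?thesis by (simp add: e1_def[abs_def])
qed

lemma e1_formula:
  assumes "a \<le> b" "t \<noteq> 0"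
  shows "e1 a b t = (iexp (- (t * a)) - iexp (- (t * b))) / (\<i> * t)"
proof -
  define F where "F x = \<i> / of_real t * iexp (- (t * x))" for x
  have "has_bochner_integral lborel (\<lambda>x. indicator {a..b} x *\<^sub>R iexp (- (t * x))) (F b - F a)"
  proof (rule has_bochner_integral_FTC_Icc[OF assms(1)])
    fix x
    have der: "((\<lambda>z. k * exp (l * z)) has_field_derivative k * (exp (l * z) * l)) (at z)" for k l z :: complex
      by (auto intro!: derivative_eq_intros)
    have "\<i> / of_real t * - (\<i> * of_real t) = 1" using assms(2) by simp
    hence "k * (\<i> / of_real t * - (\<i> * of_real t)) = k" for k by simp
    hence kl: "\<i> / of_real t * (k * - (\<i> * of_real t)) = k" for k
      by (simp only: mult.left_commute)
    have "iexp (- (t * x)) = exp (- (\<i> * of_real t) * of_real x)" for x by (simp add: mult.assoc)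
    hence F: "F = (\<lambda>x. \<i> / of_real t * exp (- (\<i> * of_real t) * of_real x))"
        "iexp (- (t * x)) = exp (- (\<i> * of_real t) * of_real x)"
      by (simp_all only: F_def fun_eq_iff simp_thms)
    show "(F has_vector_derivative iexp (- (t * x))) (at x within {a..b})"
      unfolding F using has_vector_derivative_real_field[OF der, of "\<i> / of_real t" "- (\<i> * of_real t)" x "{a..b}"]
      by (simp only: kl)
  qed (auto intro!: continuous_intros)
  hence "(LINT x|lborel. indicator {a..b} x *\<^sub>R iexp (- (t * x))) = F b - F a"
    by (rule has_bochner_integral_integral_eq)
  moreover have "e1 a b t = (LINT x|lborel. indicator {a..b} x *\<^sub>R iexp (- (t * x)))"
    unfolding e1_def
  proof (rule integral_cong_AE)
    show "AE x in lborel. cis (- (x * t)) * indicator {a<..<b} x = indicator {a..b} x *\<^sub>R iexp (- (t * x))"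
      using AE_lborel_singleton[of a] AE_lborel_singleton[of b]
      by eventually_elim (auto simp: indicator_def cis_conv_exp mult.commute)
  qed measurable
  ultimately have "e1 a b t = F b - F a" by simp
  also have "\<dots> = (iexp (- (t * a)) - iexp (- (t * b))) / (\<i> * t)"
    using assms(2) by (simp add: F_def field_simps)
  finally show ?thesis .
qed

text \<open>Two bounds are combined: the length of the interval for small t, and
  \<open>2 / \<bar>t\<bar>\<close> from the explicit formula for large t. A single transform is not
  absolutely integrable, but this decay makes products of two integrable.\<close>

lemma e1_bound: obtains K where "K \<ge> 0" "\<And>t. norm (e1 a b t) \<le> K / (1 + \<bar>t\<bar>)"
proof (cases "a \<le> b")
  case False
  thus ?thesis by (intro that[of 0]) (auto simp: e1_empty)
next
  case True
  have 1: "norm (e1 a b t) \<le> b - a" for t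
  proof -
    have "norm (e1 a b t) \<le> (LINT x|lborel. norm (cis (- (x * t)) * indicator {a<..<b} x))"
      unfolding e1_def by (rule integral_norm_bound)
    also have "\<dots> = (LINT x|lborel. indicator {a<..<b} x)"
      by (intro Bochner_Integration.integral_cong) (auto simp: norm_mult indicator_def)
    also have "\<dots> = b - a" using True by simp
    finally show ?thesis .
  qed
  have 2: "norm (e1 a b t) * \<bar>t\<bar> \<le> 2" for t
  proof (cases "t = 0")
    case False
    have "norm (e1 a b t) * \<bar>t\<bar> = norm (iexp (- (t * a)) - iexp (- (t * b)))"
      using False by (simp add: e1_formula[OF True False] norm_divide norm_mult)
    also have "\<dots> \<le> norm (iexp (- (t * a))) + norm (iexp (- (t * b)))" by (rule norm_triangle_ineq4)
    also have "\<dots> = 2" by (simp add: norm_exp_i_times del: of_real_minus of_real_mult)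
    finally show ?thesis .
  qed simp
  show ?thesis
  proof (rule that[of "b - a + 2"])
    fix t
    have "norm (e1 a b t) * (1 + \<bar>t\<bar>) \<le> b - a + 2"
      using 1[of t] 2[of t] by (simp add: distrib_left)
    thus "norm (e1 a b t) \<le> (b - a + 2) / (1 + \<bar>t\<bar>)"
      by (simp add: pos_le_divide_eq add_pos_nonneg)
  qed (use True in simp)
qed

lemma integrable_inverse_1_plus_sq: "integrable lborel (\<lambda>x::real. 1 / (1 + x\<^sup>2))"
  using integrable_inverse_1_plus_square
  by (simp add: set_integrable_def inverse_eq_divide)

lemma e1_mult_integrable: "integrable lborel (\<lambda>t. e1 a b t * cnj (e1 c d t))"
proof -
  obtain K where K: "K \<ge> 0" "\<And>t. norm (e1 a b t) \<le> K / (1 + \<bar>t\<bar>)" by (rule e1_bound[of a b]) blast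
  obtain L where L: "L \<ge> 0" "\<And>t. norm (e1 c d t) \<le> L / (1 + \<bar>t\<bar>)" by (rule e1_bound[of c d]) blast
  show ?thesis
  proof (rule Bochner_Integration.integrable_bound)
    show "integrable lborel (\<lambda>t::real. (K * L) * (1 / (1 + t\<^sup>2)))"
      by (intro integrable_mult_right integrable_inverse_1_plus_sq)
    show "AE t in lborel. norm (e1 a b t * cnj (e1 c d t)) \<le> norm ((K * L) * (1 / (1 + t\<^sup>2)))"
    proof (rule AE_I2)
      fix t :: real
      have "norm (e1 a b t * cnj (e1 c d t)) \<le> (K / (1 + \<bar>t\<bar>)) * (L / (1 + \<bar>t\<bar>))"
        using K L by (simp only: norm_mult complex_mod_cnj) (intro mult_mono, auto)
      also have "\<dots> = (K * L) / (1 + \<bar>t\<bar>)\<^sup>2" by (simp add: power2_eq_square)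
      also have "\<dots> \<le> (K * L) / (1 + t\<^sup>2)"
      proof (rule divide_left_mono)
        have "(1 + \<bar>t\<bar>)\<^sup>2 = 1 + 2 * \<bar>t\<bar> + t\<^sup>2" by (simp add: power2_sum)
        thus "1 + t\<^sup>2 \<le> (1 + \<bar>t\<bar>)\<^sup>2" by simp
        show "0 < (1 + \<bar>t\<bar>)\<^sup>2 * (1 + t\<^sup>2)"
          by (intro mult_pos_pos zero_less_power add_pos_nonneg) auto
      qed (use K L in auto)
      also have "\<dots> = norm ((K * L) * (1 / (1 + t\<^sup>2)))"
        using K L by (simp add: abs_mult add_nonneg_nonneg)
      finally show "norm (e1 a b t * cnj (e1 c d t)) \<le> norm ((K * L) * (1 / (1 + t\<^sup>2)))" .
    qed
  qed measurable
qed

text \<open>This is Levy's inversion theorem for the uniform distribution \<open>M\<close> on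
  \<open>{c<..<d}\<close>: its characteristic function is the conjugate of \<open>e1 c d\<close> up
  to normalisation, and the inversion kernel of the interval from a to b is \<open>e1 a b\<close>.
  As the product is integrable, the truncated integrals of the inversion formula converge to the
  full one.\<close>

lemma e1_Parseval:
  "(LINT t|lborel. e1 a b t * cnj (e1 c d t)) = 2 * pi * measure lborel ({a<..<b} \<inter> {c<..<d})"
proof (cases "a < b \<and> c < d")
  case False
  thus ?thesis by (auto simp: e1_empty not_less)
next
  case True
  hence ab: "a \<le> b" and cd: "c < d" by auto
  define M where "M = density lborel (\<lambda>x. ennreal (indicator {c<..<d} x / (d - c)))"
  have dens: "integral\<^sup>L M f = (LINT x|lborel. (indicator {c<..<d} x / (d - c)) *\<^sub>R f x)"
    if [measurable]: "f \<in> borel_measurable borel" for f :: "real \<Rightarrow> 'b::{banach, second_countable_topology}"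
    unfolding M_def using cd by (intro integral_density) (auto intro!: AE_I2)
  interpret M: prob_space M
  proof (rule prob_spaceI)
    have "emeasure M (space M) = (\<integral>\<^sup>+x. ennreal (indicator {c<..<d} x / (d - c)) \<partial>lborel)"
      by (simp add: M_def emeasure_density)
    also have "\<dots> = ennreal (LINT x|lborel. indicator {c<..<d} x / (d - c))"
      using cd by (intro nn_integral_eq_integral) (auto intro!: integrable_real_indicator emeasure_lborel_Ioo_finite)
    also have "(LINT x|lborel. indicator {c<..<d} x / (d - c)) = 1"
      using cd by simp
    finally show "emeasure M (space M) = 1" by simp
  qed
  interpret M: real_distribution M
    by unfold_locales (simp add: M_def)
  have mM: "measure M A = measure lborel (A \<inter> {c<..<d}) / (d - c)" if [measurable]: "A \<in> sets borel" for A
  proof -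
    have "measure M A = (LINT x|M. indicator A x)" by (simp add: M_def)
    also have "\<dots> = (LINT x|lborel. indicator (A \<inter> {c<..<d}) x / (d - c))"
      by (subst dens) (auto intro!: Bochner_Integration.integral_cong simp: indicator_def)
    finally show ?thesis by simp
  qed
  have chr: "char M t = cnj (e1 c d t) / (d - c)" for t
  proof -
    have "char M t = (LINT x|lborel. (indicator {c<..<d} x / (d - c)) *\<^sub>R iexp (t * x))"
      unfolding char_def by (rule dens) measurable
    also have "\<dots> = (LINT x|lborel. cnj (cis (- (x * t)) * indicator {c<..<d} x) / (d - c))"
      by (intro Bochner_Integration.integral_cong)
        (auto simp: indicator_def exp_cnj cis_conv_exp mult.commute scaleR_conv_of_real)
    also have "\<dots> = (LINT x|lborel. cnj (cis (- (x * t)) * indicator {c<..<d} x)) / (d - c)"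
      by (rule integral_divide_zero)
    also have "\<dots> = cnj (e1 c d t) / (d - c)"
      by (simp only: e1_def Bochner_Integration.integral_cnj)
    finally show ?thesis .
  qed
  define g where "g t = e1 a b t * cnj (e1 c d t)" for t
  have [measurable]: "g \<in> borel_measurable borel" unfolding g_def by measurable
  have g_int: "integrable lborel g" unfolding g_def by (rule e1_mult_integrable)
  have "(\<lambda>T::nat. 1 / (2 * pi) * (CLBINT t=-T..T. (iexp (-(t * a)) - iexp (-(t * b))) / (\<i> * t) * char M t))
      \<longlonglongrightarrow> of_real (measure M {a<..b})"
    using ab by (intro M.Levy_Inversion) (auto simp: mM Int_insert_left)
  moreover have "(CLBINT t=-T..T. (iexp (-(t * a)) - iexp (-(t * b))) / (\<i> * t) * char M t)
      = (LINT t|lborel. indicator {-real T<..<real T} t *\<^sub>R g t) / (d - c)" for T :: nat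
  proof -
    have "(CLBINT t=-T..T. (iexp (-(t * a)) - iexp (-(t * b))) / (\<i> * t) * char M t)
      = (LINT t|lborel. indicator {-real T<..<real T} t *\<^sub>R ((iexp (-(t * a)) - iexp (-(t * b))) / (\<i> * t) * char M t))"
      by (simp add: interval_lebesgue_integral_def set_lebesgue_integral_def)
    also have "\<dots> = (LINT t|lborel. indicator {-real T<..<real T} t *\<^sub>R g t / (d - c))"
    proof (rule integral_cong_AE)
      show "AE t in lborel. indicator {-real T<..<real T} t *\<^sub>R ((iexp (-(t * a)) - iexp (-(t * b))) / (\<i> * t) * char M t)
          = indicator {-real T<..<real T} t *\<^sub>R g t / (d - c)"
        using AE_lborel_singleton[of 0]
        by eventually_elim (simp add: e1_formula[OF ab] chr g_def indicator_def)
    qed (unfold chr, measurable)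
    finally show ?thesis by simp
  qed
  ultimately have "(\<lambda>T::nat. 1 / (2 * pi) * ((LINT t|lborel. indicator {-real T<..<real T} t *\<^sub>R g t) / (d - c)))
      \<longlonglongrightarrow> of_real (measure M {a<..b})" by (simp only:)
  moreover have "(\<lambda>T::nat. LINT t|lborel. indicator {-real T<..<real T} t *\<^sub>R g t) \<longlonglongrightarrow> (LINT t|lborel. g t)"
  proof (rule integral_dominated_convergence[where w = "\<lambda>t. norm (g t)"])
    show "AE t in lborel. (\<lambda>T::nat. indicator {-real T<..<real T} t *\<^sub>R g t) \<longlonglongrightarrow> g t"
    proof (rule AE_I2)
      fix t :: real
      obtain N :: nat where "real N > \<bar>t\<bar>" using reals_Archimedean2 by blast
      hence "\<forall>\<^sub>F T in sequentially. indicator {-real T<..<real T} t *\<^sub>R g t = g t"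
        unfolding eventually_sequentially by (intro exI[of _ N]) (auto simp: indicator_def)
      thus "(\<lambda>T::nat. indicator {-real T<..<real T} t *\<^sub>R g t) \<longlonglongrightarrow> g t"
        by (rule tendsto_eventually)
    qed
  qed (use g_int in \<open>auto simp: indicator_def\<close>)
  hence "(\<lambda>T::nat. 1 / (2 * pi) * ((LINT t|lborel. indicator {-real T<..<real T} t *\<^sub>R g t) / (d - c)))
      \<longlonglongrightarrow> 1 / (2 * pi) * ((LINT t|lborel. g t) / (d - c))"
    using cd by (intro tendsto_intros) auto
  ultimately have "of_real (measure M {a<..b}) = 1 / (2 * pi) * ((LINT t|lborel. g t) / (d - c))"
    using LIMSEQ_unique by blast
  hence "(LINT t|lborel. g t) = 2 * pi * measure lborel ({a<..b} \<inter> {c<..<d})"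
    using cd by (simp add: mM field_simps flip: of_real_diff)
  \<comment> \<open>Levy inversion speaks of a half-open interval; the end point b has measure
    zero.\<close>
  also have "measure lborel ({a<..b} \<inter> {c<..<d}) = measure lborel ({a<..<b} \<inter> {c<..<d})"
  proof (rule measure_eq_AE)
    show "AE x in lborel. (x \<in> {a<..b} \<inter> {c<..<d}) = (x \<in> {a<..<b} \<inter> {c<..<d})"
      using AE_lborel_singleton[of b] by eventually_elim auto
  qed auto
  finally show ?thesis by (simp add: g_def)
qed

section \<open>The plane as a product of two lines, for the use of Fubini\<close>

definition pl :: "real \<times> real \<Rightarrow> plane" where
  "pl z = vector [fst z, snd z]"

lemma pl_nth [simp]: "pl z $ 1 = fst z" "pl z $ 2 = snd z"
  by (simp_all add: pl_def)

lemma continuous_pl: "continuous_on UNIV pl"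
proof -
  have "pl = (\<lambda>z. fst z *\<^sub>R axis 1 1 + snd z *\<^sub>R axis 2 1)"
    by (auto simp: fun_eq_iff vec_eq_iff forall_2 axis_def)
  moreover have "continuous_on UNIV (\<lambda>z::real \<times> real. fst z *\<^sub>R axis 1 1 + snd z *\<^sub>R axis 2 1 :: plane)"
    by (intro continuous_intros)
  ultimately show ?thesis by (simp only:)
qed

lemma pl_measurable [measurable]: "pl \<in> lborel \<Otimes>\<^sub>M lborel \<rightarrow>\<^sub>M borel"
  using borel_measurable_continuous_onI[OF continuous_pl]
  by (simp add: borel_prod[symmetric] cong: measurable_cong_sets)

lemma nth_measurable [measurable]: "(\<lambda>x::plane. x $ i) \<in> borel_measurable borel"
  by (intro borel_measurable_continuous_onI continuous_intros)

lemma mem_box_plane: "(x::plane) \<in> box a b \<longleftrightarrow> x $ 1 \<in> {a $ 1<..<b $ 1} \<and> x $ 2 \<in> {a $ 2<..<b $ (2::2)}"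
  by (auto simp: mem_box_cart forall_2)

lemma indicator_box_plane:
  "(indicator (box a b) (x::plane) :: 'a::{comm_semiring_1}) = indicator {a $ 1<..<b $ 1} (x $ 1) * indicator {a $ 2<..<b $ 2} (x $ (2::2))"
  by (auto simp: indicator_def mem_box_plane)

lemma Basis_plane: "(Basis :: plane set) = {axis 1 1, axis 2 1}"
  by (auto simp: Basis_vec_def UNIV_2)

lemma axis_12: "axis 1 (1::real) \<noteq> (axis 2 1 :: plane)"
  by (simp add: axis_eq_axis)

text \<open>Lebesgue measure is determined by its values on boxes, and the preimage of a box under
  \<open>pl\<close> is a product of intervals.\<close>

lemma lborel_plane: "lborel = distr (lborel \<Otimes>\<^sub>M lborel) borel pl"
proof (rule lborel_eqI)
  fix l u :: plane assume "\<And>b. b \<in> Basis \<Longrightarrow> l \<bullet> b \<le> u \<bullet> b"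
  from this[of "axis 1 1"] this[of "axis 2 1"] have le: "l $ 1 \<le> u $ 1" "l $ 2 \<le> u $ 2"
    by (auto simp: Basis_plane inner_axis)
  have "emeasure (distr (lborel \<Otimes>\<^sub>M lborel) borel pl) (box l u)
      = emeasure (lborel \<Otimes>\<^sub>M lborel) ({l $ 1<..<u $ 1} \<times> {l $ 2<..<u $ 2})"
    by (subst emeasure_distr) (auto simp: mem_box_plane space_pair_measure intro!: arg_cong2[where f = emeasure])
  also have "\<dots> = ennreal (u $ 1 - l $ 1) * ennreal (u $ 2 - l $ 2)"
    using le by (subst lborel.emeasure_pair_measure_Times) auto
  also have "\<dots> = (\<Prod>b\<in>Basis. (u - l) \<bullet> b)"
    using le axis_12 by (simp add: Basis_plane inner_axis ennreal_mult inner_diff_left)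
  finally show "emeasure (distr (lborel \<Otimes>\<^sub>M lborel) borel pl) (box l u) = (\<Prod>b\<in>Basis. (u - l) \<bullet> b)" .
qed simp

lemma integral_plane:
  fixes f :: "plane \<Rightarrow> 'b::{banach, second_countable_topology}"
  assumes [measurable]: "f \<in> borel_measurable borel"
  shows "(LINT x|lborel. f x) = (LINT z|(lborel \<Otimes>\<^sub>M lborel). f (pl z))"
  by (subst lborel_plane) (rule integral_distr, auto)

lemma integrable_plane:
  fixes f :: "plane \<Rightarrow> 'b::{banach, second_countable_topology}"
  assumes [measurable]: "f \<in> borel_measurable borel"
  shows "integrable lborel f \<longleftrightarrow> integrable (lborel \<Otimes>\<^sub>M lborel) (\<lambda>z. f (pl z))"
  by (subst lborel_plane) (rule integrable_distr_eq, auto)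

text \<open>The factor \<open>k\<close> of modulus at most 1 admits the oscillating phase of a
  Fourier integral. The spaces are general because the lemma serves both line times line and plane
  times plane.\<close>

lemma integrable_tensor:
  fixes u :: "'a::euclidean_space \<Rightarrow> complex" and v :: "'b::euclidean_space \<Rightarrow> complex"
    and k :: "'a \<times> 'b \<Rightarrow> complex"
  assumes u: "integrable lborel u" and v: "integrable lborel v"
    and [measurable]: "k \<in> borel_measurable (borel \<Otimes>\<^sub>M borel)" and k: "\<And>z. norm (k z) \<le> 1"
  shows "integrable (lborel \<Otimes>\<^sub>M lborel) (\<lambda>z. k z * u (fst z) * v (snd z))"
proof -
  note [measurable] = borel_measurable_integrable[OF u] borel_measurable_integrable[OF v]
  have "integrable (lborel \<Otimes>\<^sub>M lborel) (\<lambda>z. u (fst z) * v (snd z))"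
    by (rule lborel_pair.Fubini_integrable)
      (use u v in \<open>auto simp: norm_mult intro!: integrable_mult_left integrable_mult_right\<close>)
  thus ?thesis
  proof (rule Bochner_Integration.integrable_bound)
    show "AE z in lborel \<Otimes>\<^sub>M lborel. norm (k z * u (fst z) * v (snd z)) \<le> norm (u (fst z) * v (snd z))"
    proof (rule AE_I2)
      fix z
      have "norm (k z) * (norm (u (fst z)) * norm (v (snd z))) \<le> 1 * (norm (u (fst z)) * norm (v (snd z)))"
        by (intro mult_right_mono k) auto
      thus "norm (k z * u (fst z) * v (snd z)) \<le> norm (u (fst z) * v (snd z))"
        by (simp add: norm_mult mult.assoc)
    qed
  qed measurable
qed

lemma integral_tensor:
  fixes u :: "'a::euclidean_space \<Rightarrow> complex" and v :: "'b::euclidean_space \<Rightarrow> complex"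
  assumes u: "integrable lborel u" and v: "integrable lborel v"
  shows "(LINT z|(lborel \<Otimes>\<^sub>M lborel). u (fst z) * v (snd z)) = (LINT x|lborel. u x) * (LINT y|lborel. v y)"
proof -
  have "integrable (lborel \<Otimes>\<^sub>M lborel) (\<lambda>z. 1 * u (fst z) * v (snd z))"
    by (rule integrable_tensor[OF u v]) auto
  hence "(LINT z|(lborel \<Otimes>\<^sub>M lborel). u (fst z) * v (snd z)) = (LINT x|lborel. LINT y|lborel. u x * v y)"
    by (subst lborel_pair.integral_fst'[symmetric]) auto
  thus ?thesis by simp
qed

lemma integrable_plane_product:
  fixes u v :: "real \<Rightarrow> complex"
  assumes u: "integrable lborel u" and v: "integrable lborel v"
  shows "integrable lborel (\<lambda>x::plane. u (x $ 1) * v (x $ 2))"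
proof -
  note [measurable] = borel_measurable_integrable[OF u] borel_measurable_integrable[OF v]
  have "integrable (lborel \<Otimes>\<^sub>M lborel) (\<lambda>z. 1 * u (fst z) * v (snd z))"
    by (rule integrable_tensor[OF u v]) auto
  thus ?thesis by (subst integrable_plane) auto
qed

lemma integral_plane_product:
  fixes u v :: "real \<Rightarrow> complex"
  assumes u: "integrable lborel u" and v: "integrable lborel v"
  shows "(LINT x|lborel. u ((x::plane) $ 1) * v (x $ 2)) = (LINT s|lborel. u s) * (LINT s|lborel. v s)"
proof -
  note [measurable] = borel_measurable_integrable[OF u] borel_measurable_integrable[OF v]
  show ?thesis by (subst integral_plane) (auto simp: integral_tensor[OF u v])
qed

section \<open>The Fourier transform on \<open>L\<^sup>2\<close>\<close>

definition L1C :: "(plane \<Rightarrow> complex) \<Rightarrow> plane \<Rightarrow> complex" where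
  "L1C f \<xi> = (LINT x|lborel. cis (- (x \<bullet> \<xi>)) * f x)"

lemma L1_fourier_eq_L1C: "L1_fourier f = L1C (\<lambda>x. complex_of_real (f x))"
  by (simp add: L1_fourier_def L1C_def fun_eq_iff)

lemma inner_plane: "(x::plane) \<bullet> y = x $ 1 * y $ 1 + x $ 2 * y $ 2"
  by (simp add: inner_vec_def sum_2)

lemma L1C_measurable [measurable]:
  assumes [measurable]: "f \<in> borel_measurable borel"
  shows "L1C f \<in> borel_measurable borel"
proof -
  have "(\<lambda>\<xi>. LINT x|lborel. cis (- (x \<bullet> \<xi>)) * f x) \<in> borel_measurable borel"
    by (intro lborel.borel_measurable_lebesgue_integral) measurable
  thus ?thesis by (simp add: L1C_def[abs_def])
qed

lemma integrable_cis_mult: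
  assumes "integrable lborel f" and [measurable]: "h \<in> borel_measurable borel"
  shows "integrable lborel (\<lambda>x::'a::euclidean_space. cis (h x) * f x)"
proof (rule Bochner_Integration.integrable_bound[OF assms(1)])
  note [measurable] = borel_measurable_integrable[OF assms(1)]
  show "(\<lambda>x. cis (h x) * f x) \<in> borel_measurable lborel" by measurable
qed (simp add: norm_mult)

lemma L1C_add:
  assumes "integrable lborel f" "integrable lborel g"
  shows "L1C (\<lambda>x. f x + g x) \<xi> = L1C f \<xi> + L1C g \<xi>"
  using integrable_cis_mult[OF assms(1), of "\<lambda>x. - (x \<bullet> \<xi>)"] integrable_cis_mult[OF assms(2), of "\<lambda>x. - (x \<bullet> \<xi>)"]
  by (simp add: L1C_def distrib_left)

lemma L1C_cmult: "L1C (\<lambda>x. c * f x) \<xi> = c * L1C f \<xi>"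
proof -
  have "(LINT x|lborel. cis (- (x \<bullet> \<xi>)) * (c * f x)) = (LINT x|lborel. c * (cis (- (x \<bullet> \<xi>)) * f x))"
    by (simp add: mult.left_commute)
  thus ?thesis by (simp add: L1C_def)
qed

lemma L1C_bound:
  assumes "integrable lborel f"
  shows "norm (L1C f \<xi>) \<le> (LINT x|lborel. norm (f x))"
proof -
  have "norm (L1C f \<xi>) \<le> (LINT x|lborel. norm (cis (- (x \<bullet> \<xi>)) * f x))"
    unfolding L1C_def by (rule integral_norm_bound)
  thus ?thesis by (simp add: norm_mult)
qed

abbreviation ibox :: "plane \<Rightarrow> plane \<Rightarrow> plane \<Rightarrow> complex" where
  "ibox a b \<equiv> indicator (box a b)"

abbreviation bxh :: "plane \<Rightarrow> plane \<Rightarrow> plane \<Rightarrow> complex" where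
  "bxh a b \<equiv> L1C (ibox a b)"

lemma integrable_ibox [simp, intro]: "integrable lborel (ibox a b)"
  using emeasure_lborel_box_finite[of a b] by (intro integrable_indicator_complex) auto

lemma sqi_ibox [simp, intro]: "square_integrable (ibox a b)"
  using sqi_box[of a b "1::complex"] by (simp add: scaleR_conv_of_real of_real_indicator)

lemma bxh_eq: "bxh a b \<xi> = e1 (a $ 1) (b $ 1) (\<xi> $ 1) * e1 (a $ 2) (b $ 2) (\<xi> $ 2)"
proof -
  have ci: "cis (- (x \<bullet> \<xi>)) = cis (- (x $ 1 * \<xi> $ 1)) * cis (- (x $ 2 * \<xi> $ 2))" for x
    by (simp add: inner_plane cis_mult)
  have "bxh a b \<xi> = (LINT x|lborel. (cis (- (x $ 1 * \<xi> $ 1)) * indicator {a $ 1<..<b $ 1} ((x::plane) $ 1))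
      * (cis (- (x $ 2 * \<xi> $ 2)) * indicator {a $ 2<..<b $ 2} (x $ 2)))"
    unfolding L1C_def
    by (intro Bochner_Integration.integral_cong refl)
      (simp add: ci indicator_box_plane mult_ac)
  also have "\<dots> = e1 (a $ 1) (b $ 1) (\<xi> $ 1) * e1 (a $ 2) (b $ 2) (\<xi> $ 2)"
    unfolding e1_def by (rule integral_plane_product[OF integrable_cis_interval integrable_cis_interval])
  finally show ?thesis .
qed

lemma bxh_mult_integrable: "integrable lborel (\<lambda>\<xi>. bxh a b \<xi> * cnj (bxh c d \<xi>))"
proof -
  have "(\<lambda>\<xi>. bxh a b \<xi> * cnj (bxh c d \<xi>)) = (\<lambda>\<xi>. (e1 (a $ 1) (b $ 1) (\<xi> $ 1) * cnj (e1 (c $ 1) (d $ 1) (\<xi> $ 1)))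
     * (e1 (a $ 2) (b $ 2) (\<xi> $ 2) * cnj (e1 (c $ 2) (d $ 2) (\<xi> $ 2))))"
    by (simp add: bxh_eq mult_ac)
  thus ?thesis
    using integrable_plane_product[OF e1_mult_integrable e1_mult_integrable] by simp
qed

lemma sqi_bxh [simp, intro]: "square_integrable (bxh a b)"
  unfolding square_integrable_def
proof
  have "integrable lborel (\<lambda>\<xi>. norm (bxh a b \<xi> * cnj (bxh a b \<xi>)))"
    by (intro integrable_norm bxh_mult_integrable)
  thus "integrable lborel (\<lambda>\<xi>. (norm (bxh a b \<xi>))\<^sup>2)"
    by (simp add: norm_mult power2_eq_square)
qed simp

lemma bxh_Parseval:
  "(LINT \<xi>|lborel. bxh a b \<xi> * cnj (bxh c d \<xi>)) = (2 * pi)\<^sup>2 * (LINT x|lborel. ibox a b x * ibox c d x)"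
proof -
  have ind: "integrable lborel (indicator ({p<..<q} \<inter> {r<..<s}) :: real \<Rightarrow> complex)" for p q r s :: real
  proof -
    have "emeasure lborel ({p<..<q} \<inter> {r<..<s}) \<le> emeasure lborel {p<..<q}" by (intro emeasure_mono) auto
    also have "\<dots> < \<infinity>" by (rule emeasure_lborel_Ioo_finite)
    finally show ?thesis by (intro integrable_indicator_complex) auto
  qed
  have "(LINT x|lborel. ibox a b x * ibox c d x) = (LINT x|lborel. indicator ({a $ 1<..<b $ 1} \<inter> {c $ 1<..<d $ 1}) ((x::plane) $ 1)
      * indicator ({a $ 2<..<b $ 2} \<inter> {c $ 2<..<d $ 2}) (x $ 2))"
    by (intro Bochner_Integration.integral_cong refl) (simp add: indicator_box_plane indicator_inter_arith mult_ac del: Int_greaterThanLessThan)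
  also have "\<dots> = (LINT s|lborel. indicator ({a $ 1<..<b $ 1} \<inter> {c $ 1<..<d $ 1}) s)
      * (LINT s|lborel. indicator ({a $ 2<..<b $ 2} \<inter> {c $ 2<..<d $ 2}) s)"
    by (rule integral_plane_product[OF ind ind])
  finally have 1: "(LINT x|lborel. ibox a b x * ibox c d x)
     = measure lborel ({a $ 1<..<b $ 1} \<inter> {c $ 1<..<d $ 1}) * measure lborel ({a $ 2<..<b $ 2} \<inter> {c $ 2<..<d $ 2})"
    by (simp add: integral_indicator_complex del: Int_greaterThanLessThan)
  have "(LINT \<xi>|lborel. bxh a b \<xi> * cnj (bxh c d \<xi>))
     = (LINT \<xi>|lborel. (e1 (a $ 1) (b $ 1) ((\<xi>::plane) $ 1) * cnj (e1 (c $ 1) (d $ 1) (\<xi> $ 1)))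
     * (e1 (a $ 2) (b $ 2) (\<xi> $ 2) * cnj (e1 (c $ 2) (d $ 2) (\<xi> $ 2))))"
    by (simp add: bxh_eq mult_ac)
  also have "\<dots> = complex_of_real (2 * pi * measure lborel ({a $ 1<..<b $ 1} \<inter> {c $ 1<..<d $ 1}))
      * complex_of_real (2 * pi * measure lborel ({a $ 2<..<b $ 2} \<inter> {c $ 2<..<d $ 2}))"
    unfolding integral_plane_product[OF e1_mult_integrable e1_mult_integrable] e1_Parseval ..
  finally show ?thesis by (simp add: 1 power2_eq_square)
qed

lemma sqi_mult_indicator_integrable:
  fixes f :: "plane \<Rightarrow> complex"
  assumes "square_integrable f" shows "integrable lborel (\<lambda>x. f x * ibox a b x)"
  by (rule sqi_mult_integrable[OF assms sqi_ibox])

text \<open>Fubini and the symmetry of the phase in x and \<xi>. This is the identity by which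
  \<open>has_FT\<close> characterises the transform.\<close>

lemma L1C_multiplication:
  assumes f: "integrable lborel f" and g: "integrable lborel g"
  shows "(LINT \<xi>|lborel. L1C f \<xi> * g \<xi>) = (LINT x|lborel. f x * L1C g x)"
proof -
  have "integrable (lborel \<Otimes>\<^sub>M lborel) (\<lambda>z::plane\<times>plane. cis (- (fst z \<bullet> snd z)) * f (fst z) * g (snd z))"
    by (rule integrable_tensor[OF f g]) auto
  hence int': "integrable (lborel \<Otimes>\<^sub>M lborel) (case_prod (\<lambda>x \<xi>::plane. cis (- (x \<bullet> \<xi>)) * f x * g \<xi>))"
    unfolding case_prod_unfold .
  have "(LINT \<xi>|lborel. L1C f \<xi> * g \<xi>) = (LINT \<xi>|lborel. LINT x|lborel. cis (- (x \<bullet> \<xi>)) * f x * g \<xi>)"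
    by (simp add: L1C_def)
  also have "\<dots> = (LINT x|lborel. LINT \<xi>|lborel. cis (- (x \<bullet> \<xi>)) * f x * g \<xi>)"
    by (rule lborel_pair.Fubini_integral[OF int'])
  also have "\<dots> = (LINT x|lborel. LINT \<xi>|lborel. f x * (cis (- (\<xi> \<bullet> x)) * g \<xi>))"
    by (simp add: inner_commute mult_ac)
  also have "\<dots> = (LINT x|lborel. f x * L1C g x)"
    by (simp add: L1C_def)
  finally show ?thesis .
qed

text \<open>
  \<open>F\<close> is the \<open>L\<^sup>2\<close> Fourier transform of \<open>f\<close>, expressed by the multiplication formula against
  indicators of boxes. Their transforms are explicit, they span a dense subspace and the condition
  is stable under \<open>L\<^sup>2\<close> limits, so no Schwartz functions are needed.
\<close>

definition has_FT :: "(plane \<Rightarrow> complex) \<Rightarrow> (plane \<Rightarrow> complex) \<Rightarrow> bool" where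
  "has_FT f F \<longleftrightarrow> square_integrable f \<and> square_integrable F \<and>
     (\<forall>a b. (LINT \<xi>|lborel. F \<xi> * ibox a b \<xi>) = (LINT x|lborel. f x * bxh a b x))"

lemma has_FT_sqi: "has_FT f F \<Longrightarrow> square_integrable f" "has_FT f F \<Longrightarrow> square_integrable F"
  by (simp_all add: has_FT_def)

lemma has_FT_box: "has_FT f F \<Longrightarrow> (LINT \<xi>|lborel. F \<xi> * ibox a b \<xi>) = (LINT x|lborel. f x * bxh a b x)"
  by (simp add: has_FT_def)

lemma has_FT_add:
  assumes "has_FT f F" "has_FT g G"
  shows "has_FT (\<lambda>x. f x + g x) (\<lambda>\<xi>. F \<xi> + G \<xi>)"
proof -
  note sq = has_FT_sqi[OF assms(1)] has_FT_sqi[OF assms(2)]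
  show ?thesis
    unfolding has_FT_def
    using sq sqi_mult_integrable[OF _ sqi_ibox] sqi_mult_integrable[OF _ sqi_bxh]
    by (auto intro!: sqi_add simp: distrib_right has_FT_box[OF assms(1)] has_FT_box[OF assms(2)])
qed

lemma has_FT_cmult:
  assumes "has_FT f F"
  shows "has_FT (\<lambda>x. c * f x) (\<lambda>\<xi>. c * F \<xi>)"
  using has_FT_sqi[OF assms] unfolding has_FT_def
  by (auto intro!: sqi_cmult simp: mult.assoc has_FT_box[OF assms])

lemma has_FT_diff:
  assumes "has_FT f F" "has_FT g G"
  shows "has_FT (\<lambda>x. f x - g x) (\<lambda>\<xi>. F \<xi> - G \<xi>)"
  using has_FT_add[OF assms(1) has_FT_cmult[OF assms(2), of "-1"]] by simp

lemma has_FT_cong: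
  assumes "has_FT f F" and [measurable]: "g \<in> borel_measurable borel" "G \<in> borel_measurable borel"
    and "AE x in lborel. g x = f x" "AE x in lborel. G x = F x"
  shows "has_FT g G"
proof -
  have sg: "square_integrable g" and sG: "square_integrable G"
    using sqi_cong_AE[OF has_FT_sqi(1)[OF assms(1)] _ assms(4)] sqi_cong_AE[OF has_FT_sqi(2)[OF assms(1)] _ assms(5)]
    by auto
  have [measurable]: "f \<in> borel_measurable borel" "F \<in> borel_measurable borel"
    using has_FT_sqi[OF assms(1)] by (auto simp: square_integrable_def)
  have "(LINT \<xi>|lborel. G \<xi> * ibox a b \<xi>) = (LINT x|lborel. g x * bxh a b x)" for a b
  proof -
    have "(LINT \<xi>|lborel. G \<xi> * ibox a b \<xi>) = (LINT \<xi>|lborel. F \<xi> * ibox a b \<xi>)"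
      using assms(5) by (intro integral_cong_AE) auto
    also have "\<dots> = (LINT x|lborel. f x * bxh a b x)" by (rule has_FT_box[OF assms(1)])
    also have "\<dots> = (LINT x|lborel. g x * bxh a b x)"
      using assms(4) by (intro integral_cong_AE) auto
    finally show ?thesis .
  qed
  with sg sG show ?thesis by (simp add: has_FT_def)
qed

lemma has_FT_unique:
  assumes "has_FT f F" "has_FT f G"
  shows "AE \<xi> in lborel. F \<xi> = G \<xi>"
proof -
  have "AE \<xi> in lborel. F \<xi> - G \<xi> = 0"
  proof (rule AE_zero_of_box_integrals)
    show "square_integrable (\<lambda>\<xi>. F \<xi> - G \<xi>)"
      using assms by (intro sqi_diff has_FT_sqi(2))
    show "(LINT x|lborel. (F x - G x) * ibox a b x) = 0" for a b
      using sqi_mult_integrable[OF has_FT_sqi(2)[OF assms(1)] sqi_ibox]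
        sqi_mult_integrable[OF has_FT_sqi(2)[OF assms(2)] sqi_ibox]
      by (simp add: left_diff_distrib has_FT_box[OF assms(1)] has_FT_box[OF assms(2)])
  qed
  thus ?thesis by simp
qed

lemma has_FT_limit:
  assumes FT: "\<And>n::nat. has_FT (fs n) (Fs n)" and f: "square_integrable f" and F: "square_integrable F"
    and "(\<lambda>n. L2_norm (\<lambda>x. fs n x - f x)) \<longlonglongrightarrow> 0" "(\<lambda>n. L2_norm (\<lambda>x. Fs n x - F x)) \<longlonglongrightarrow> 0"
  shows "has_FT f F"
  unfolding has_FT_def
proof (intro conjI allI f F)
  fix a b
  have "(\<lambda>n. LINT \<xi>|lborel. Fs n \<xi> * ibox a b \<xi>) \<longlonglongrightarrow> (LINT \<xi>|lborel. F \<xi> * ibox a b \<xi>)"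
    using assms by (intro L2_limit_mult) (auto intro!: always_eventually has_FT_sqi(1)[OF FT] has_FT_sqi(2)[OF FT])
  moreover have "(\<lambda>n. LINT \<xi>|lborel. fs n \<xi> * bxh a b \<xi>) \<longlonglongrightarrow> (LINT \<xi>|lborel. f \<xi> * bxh a b \<xi>)"
    using assms by (intro L2_limit_mult) (auto intro!: always_eventually has_FT_sqi(1)[OF FT] has_FT_sqi(2)[OF FT])
  ultimately show "(LINT \<xi>|lborel. F \<xi> * ibox a b \<xi>) = (LINT x|lborel. f x * bxh a b x)"
    using LIMSEQ_unique by (simp add: has_FT_box[OF FT])
qed

lemma box_step_integrable:
  fixes f :: "plane \<Rightarrow> complex"
  assumes "box_step f" shows "integrable lborel f"
  using assms
proof (induction rule: box_step.induct)
  case (add f a b c)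
  have "integrable lborel (\<lambda>x. f x + c * ibox a b x)"
    by (intro Bochner_Integration.integrable_add add integrable_mult_right) auto
  thus ?case by (simp add: scaleR_conv_of_real of_real_indicator mult.commute)
qed simp

lemma L1C_step:
  assumes "box_step f"
  shows "L1C (\<lambda>x. f x + indicator (box a b) x *\<^sub>R c) \<xi> = L1C f \<xi> + c * bxh a b \<xi>"
proof -
  have "(\<lambda>x. f x + indicator (box a b) x *\<^sub>R c) = (\<lambda>x. f x + c * ibox a b x)"
    by (simp add: fun_eq_iff scaleR_conv_of_real of_real_indicator mult.commute)
  moreover have "L1C (\<lambda>x. f x + c * ibox a b x) \<xi> = L1C f \<xi> + L1C (\<lambda>x. c * ibox a b x) \<xi>"
    by (rule L1C_add[OF box_step_integrable[OF assms] integrable_mult_right]) auto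
  ultimately show ?thesis by (simp add: L1C_cmult)
qed

lemma L1C_0 [simp]: "L1C (\<lambda>_. 0) \<xi> = 0"
  by (simp add: L1C_def)

lemma sqi_L1C_step: "box_step f \<Longrightarrow> square_integrable (L1C f)"
proof (induction rule: box_step.induct)
  case zero thus ?case by (simp add: L1C_def[abs_def])
next
  case (add f a b c)
  have "square_integrable (\<lambda>\<xi>. L1C f \<xi> + c * bxh a b \<xi>)"
    by (intro sqi_add add sqi_cmult sqi_bxh)
  moreover have "L1C (\<lambda>x. f x + indicator (box a b) x *\<^sub>R c) = (\<lambda>\<xi>. L1C f \<xi> + c * bxh a b \<xi>)"
    using L1C_step[OF add.hyps(1)] by (rule ext)
  ultimately show ?case by (simp only:)
qed

lemma has_FT_step: "box_step f \<Longrightarrow> has_FT f (L1C f)"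
  unfolding has_FT_def
  by (auto intro: sqi_box_step sqi_L1C_step L1C_multiplication box_step_integrable)

lemma Parseval_step_box:
  assumes "box_step f"
  shows "(LINT \<xi>|lborel. L1C f \<xi> * cnj (bxh c d \<xi>)) = (2 * pi)\<^sup>2 * (LINT x|lborel. f x * ibox c d x)"
  using assms
proof (induction rule: box_step.induct)
  case zero thus ?case by (simp add: L1C_def)
next
  case (add f a b e)
  have "(LINT \<xi>|lborel. L1C (\<lambda>x. f x + indicator (box a b) x *\<^sub>R e) \<xi> * cnj (bxh c d \<xi>))
      = (LINT \<xi>|lborel. L1C f \<xi> * cnj (bxh c d \<xi>) + e * (bxh a b \<xi> * cnj (bxh c d \<xi>)))"
    by (simp add: L1C_step[OF add.hyps(1)] algebra_simps)
  also have "\<dots> = (LINT \<xi>|lborel. L1C f \<xi> * cnj (bxh c d \<xi>)) + e * (LINT \<xi>|lborel. bxh a b \<xi> * cnj (bxh c d \<xi>))"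
    using sqi_mult_integrable[OF sqi_L1C_step[OF add.hyps(1)] sqi_cnj[OF sqi_bxh, of c d]]
      bxh_mult_integrable[of a b c d] by simp
  also have "\<dots> = (2 * pi)\<^sup>2 * ((LINT x|lborel. f x * ibox c d x) + e * (LINT x|lborel. ibox a b x * ibox c d x))"
    by (simp add: add.IH bxh_Parseval algebra_simps)
  also have "(LINT x|lborel. f x * ibox c d x) + e * (LINT x|lborel. ibox a b x * ibox c d x)
      = (LINT x|lborel. f x * ibox c d x + e * (ibox a b x * ibox c d x))"
    using sqi_mult_integrable[OF sqi_box_step[OF add.hyps(1)] sqi_ibox, of c d]
      sqi_mult_integrable[OF sqi_ibox sqi_ibox, of a b c d] by simp
  also have "\<dots> = (LINT x|lborel. (f x + indicator (box a b) x *\<^sub>R e) * ibox c d x)"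
    by (simp add: algebra_simps scaleR_conv_of_real of_real_indicator)
  finally show ?case .
qed

text \<open>Conjugate linearity in the second factor. \<open>F\<close> and \<open>f\<close> are left
  arbitrary because it is used twice: for box steps in \<open>Plancherel_step\<close>, and for
  general pairs in \<open>Parseval\<close>.\<close>

lemma Parseval_extend_step:
  assumes F: "square_integrable F" and f: "square_integrable f"
    and box: "\<And>c d. (LINT \<xi>|lborel. F \<xi> * cnj (bxh c d \<xi>)) = (2 * pi)\<^sup>2 * (LINT x|lborel. f x * ibox c d x)"
    and "box_step g"
  shows "(LINT \<xi>|lborel. F \<xi> * cnj (L1C g \<xi>)) = (2 * pi)\<^sup>2 * (LINT x|lborel. f x * cnj (g x))"
  using assms(4)
proof (induction rule: box_step.induct)
  case zero thus ?case by (simp add: L1C_def)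
next
  case (add g a b e)
  have "(LINT \<xi>|lborel. F \<xi> * cnj (L1C (\<lambda>x. g x + indicator (box a b) x *\<^sub>R e) \<xi>))
      = (LINT \<xi>|lborel. F \<xi> * cnj (L1C g \<xi>) + cnj e * (F \<xi> * cnj (bxh a b \<xi>)))"
    by (simp add: L1C_step[OF add.hyps(1)] algebra_simps)
  also have "\<dots> = (LINT \<xi>|lborel. F \<xi> * cnj (L1C g \<xi>)) + cnj e * (LINT \<xi>|lborel. F \<xi> * cnj (bxh a b \<xi>))"
    using sqi_mult_integrable[OF F sqi_cnj[OF sqi_L1C_step[OF add.hyps(1)]]]
      sqi_mult_integrable[OF F sqi_cnj[OF sqi_bxh, of a b]] by simp
  also have "\<dots> = (2 * pi)\<^sup>2 * ((LINT x|lborel. f x * cnj (g x)) + cnj e * (LINT x|lborel. f x * ibox a b x))"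
    by (simp add: add.IH box algebra_simps)
  also have "(LINT x|lborel. f x * cnj (g x)) + cnj e * (LINT x|lborel. f x * ibox a b x)
      = (LINT x|lborel. f x * cnj (g x) + cnj e * (f x * ibox a b x))"
    using sqi_mult_integrable[OF f sqi_cnj[OF sqi_box_step[OF add.hyps(1)]]]
      sqi_mult_integrable[OF f sqi_ibox, of a b] by simp
  also have "\<dots> = (LINT x|lborel. f x * cnj (g x + indicator (box a b) x *\<^sub>R e))"
    by (intro Bochner_Integration.integral_cong) (auto simp: indicator_def algebra_simps)
  finally show ?case .
qed

lemma L2_norm_cnj_sq: "complex_of_real ((L2_norm f)\<^sup>2) = (LINT x|lborel. f x * cnj (f x))"
proof -
  have "(LINT x|lborel. f x * cnj (f x)) = (LINT x|lborel. complex_of_real ((norm (f x))\<^sup>2))"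
    by (intro Bochner_Integration.integral_cong) (simp_all add: complex_norm_square del: of_real_power)
  thus ?thesis by (simp only: L2_norm_sq integral_complex_of_real)
qed

lemma norm_of_sq_eq:
  fixes x y :: real
  assumes "complex_of_real (x\<^sup>2) = (2 * pi)\<^sup>2 * complex_of_real (y\<^sup>2)" "x \<ge> 0" "y \<ge> 0"
  shows "x = 2 * pi * y"
proof -
  have "x\<^sup>2 = (2 * pi * y)\<^sup>2"
  proof -
    have "complex_of_real (x\<^sup>2) = complex_of_real ((2 * pi * y)\<^sup>2)"
      unfolding assms(1) by (simp add: power_mult_distrib)
    thus ?thesis by (simp only: of_real_eq_iff)
  qed
  thus ?thesis using assms by (simp add: power2_eq_iff_nonneg)
qed

lemma Plancherel_step:
  assumes "box_step f"
  shows "L2_norm (L1C f) = 2 * pi * L2_norm f"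
proof (rule norm_of_sq_eq)
  show "complex_of_real ((L2_norm (L1C f))\<^sup>2) = (2 * pi)\<^sup>2 * complex_of_real ((L2_norm f)\<^sup>2)"
    unfolding L2_norm_cnj_sq
    by (rule Parseval_extend_step[OF sqi_L1C_step[OF assms] sqi_box_step[OF assms] Parseval_step_box[OF assms] assms])
qed auto

text \<open>By Plancherel on box steps, the transforms of an approximating sequence are again
  Cauchy. The norm identity and Parseval against boxes are recorded for this limit; uniqueness of
  the transform then hands them to every \<open>F\<close> with \<open>has_FT f F\<close>.\<close>

lemma FT_limit_exists:
  assumes f: "square_integrable f"
  obtains F where "has_FT f F" "L2_norm F = 2 * pi * L2_norm f"
    "\<And>c d. (LINT \<xi>|lborel. F \<xi> * cnj (bxh c d \<xi>)) = (2 * pi)\<^sup>2 * (LINT x|lborel. f x * ibox c d x)"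
proof -
  obtain g where g: "\<And>n. box_step (g n)" "(\<lambda>n::nat. L2_norm (\<lambda>x. g n x - f x)) \<longlonglongrightarrow> 0"
    by (rule box_step_sequence[OF f]) blast
  have diff: "L2_norm (\<lambda>\<xi>. L1C (g m) \<xi> - L1C (g n) \<xi>) = 2 * pi * L2_norm (\<lambda>x. g m x - g n x)" for m n
  proof -
    have st: "box_step (\<lambda>x. - g n x)"
      by (rule box_step_linear[OF _ g(1)]) (auto intro: linear_compose_neg linear_ident simp: module_hom_uminus)
    have "L1C (\<lambda>x. g m x + - g n x) = (\<lambda>\<xi>. L1C (g m) \<xi> - L1C (g n) \<xi>)"
      using L1C_add[OF box_step_integrable[OF g(1)[of m]] box_step_integrable[OF st]] L1C_cmult[of "-1" "g n"]
      by (intro ext) simp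
    with Plancherel_step[OF box_step_add[OF st g(1)[of m]]]
    have "L2_norm (\<lambda>\<xi>. L1C (g m) \<xi> - L1C (g n) \<xi>) = 2 * pi * L2_norm (\<lambda>x. g m x + - g n x)"
      by (simp only:)
    thus ?thesis by simp
  qed
  have "\<exists>N. \<forall>m\<ge>N. \<forall>n\<ge>N. L2_norm (\<lambda>\<xi>. L1C (g m) \<xi> - L1C (g n) \<xi>) < e" if "e > 0" for e :: real
  proof -
    \<comment> \<open>Plancherel costs a factor \<open>2 * pi\<close>, and the triangle inequality
      has two terms.\<close>
    have e: "e / (4 * pi) > 0" using that by simp
    obtain N where N: "\<And>n. n \<ge> N \<Longrightarrow> L2_norm (\<lambda>x. g n x - f x) < e / (4 * pi)"
      using LIMSEQ_D[OF g(2) e] by auto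
    have "L2_norm (\<lambda>\<xi>. L1C (g m) \<xi> - L1C (g n) \<xi>) < e" if "m \<ge> N" "n \<ge> N" for m n
    proof -
      have "L2_norm (\<lambda>x. g m x - g n x) \<le> L2_norm (\<lambda>x. g m x - f x) + L2_norm (\<lambda>x. f x - g n x)"
        by (intro L2_norm_triangle_diff f sqi_box_step g)
      also have "\<dots> < e / (4 * pi) + e / (4 * pi)"
        using N[OF that(1)] N[OF that(2)] L2_norm_minus_commute[of f "g n"] by simp
      also have "\<dots> = e / (2 * pi)" by simp
      finally show ?thesis by (simp add: diff field_simps)
    qed
    thus ?thesis by blast
  qed
  then obtain F where F: "square_integrable F" "(\<lambda>n. L2_norm (\<lambda>\<xi>. L1C (g n) \<xi> - F \<xi>)) \<longlonglongrightarrow> 0"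
    by (rule L2_complete[OF sqi_L1C_step[OF g(1)]]) blast
  show ?thesis
  proof (rule that)
    show "has_FT f F"
      by (rule has_FT_limit[OF has_FT_step[OF g(1)] f F(1) g(2) F(2)])
    have "(\<lambda>n. L2_norm (L1C (g n))) \<longlonglongrightarrow> L2_norm F"
      by (intro L2_limit_norm F always_eventually allI sqi_L1C_step g)
    moreover have "(\<lambda>n. 2 * pi * L2_norm (g n)) \<longlonglongrightarrow> 2 * pi * L2_norm f"
      by (intro tendsto_mult tendsto_const L2_limit_norm f g always_eventually allI sqi_box_step)
    hence "(\<lambda>n. L2_norm (L1C (g n))) \<longlonglongrightarrow> 2 * pi * L2_norm f"
      by (simp only: Plancherel_step[OF g(1)])
    ultimately show "L2_norm F = 2 * pi * L2_norm f" by (rule LIMSEQ_unique)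
    fix c d
    have "(\<lambda>n. LINT \<xi>|lborel. L1C (g n) \<xi> * cnj (bxh c d \<xi>)) \<longlonglongrightarrow> (LINT \<xi>|lborel. F \<xi> * cnj (bxh c d \<xi>))"
      by (intro L2_limit_mult F always_eventually allI sqi_L1C_step g sqi_cnj sqi_bxh) auto
    moreover have "(\<lambda>n. (2 * pi)\<^sup>2 * (LINT x|lborel. g n x * ibox c d x)) \<longlonglongrightarrow> (2 * pi)\<^sup>2 * (LINT x|lborel. f x * ibox c d x)"
      by (intro tendsto_mult tendsto_const L2_limit_mult f g always_eventually allI sqi_box_step sqi_ibox) auto
    hence "(\<lambda>n. LINT \<xi>|lborel. L1C (g n) \<xi> * cnj (bxh c d \<xi>)) \<longlonglongrightarrow> (2 * pi)\<^sup>2 * (LINT x|lborel. f x * ibox c d x)"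
      by (simp only: Parseval_step_box[OF g(1)])
    ultimately show "(LINT \<xi>|lborel. F \<xi> * cnj (bxh c d \<xi>)) = (2 * pi)\<^sup>2 * (LINT x|lborel. f x * ibox c d x)"
      by (rule LIMSEQ_unique)
  qed
qed

lemma has_FT_exists:
  assumes "square_integrable f" obtains F where "has_FT f F"
  by (rule FT_limit_exists[OF assms]) blast

lemma Plancherel:
  assumes "has_FT f F"
  shows "L2_norm F = 2 * pi * L2_norm f"
proof -
  obtain G where G: "has_FT f G" "L2_norm G = 2 * pi * L2_norm f"
    by (rule FT_limit_exists[OF has_FT_sqi(1)[OF assms]]) blast
  have "L2_norm F = L2_norm G"
    using has_FT_unique[OF assms G(1)] has_FT_sqi(2)[OF assms] has_FT_sqi(2)[OF G(1)]
    by (intro L2_norm_cong_AE) (auto simp: square_integrable_def)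
  with G(2) show ?thesis by simp
qed

lemma Parseval_box:
  assumes "has_FT f F"
  shows "(LINT \<xi>|lborel. F \<xi> * cnj (bxh c d \<xi>)) = (2 * pi)\<^sup>2 * (LINT x|lborel. f x * ibox c d x)"
proof -
  obtain G where G: "has_FT f G"
    "(LINT \<xi>|lborel. G \<xi> * cnj (bxh c d \<xi>)) = (2 * pi)\<^sup>2 * (LINT x|lborel. f x * ibox c d x)"
    by (rule FT_limit_exists[OF has_FT_sqi(1)[OF assms]]) blast
  have "(LINT \<xi>|lborel. F \<xi> * cnj (bxh c d \<xi>)) = (LINT \<xi>|lborel. G \<xi> * cnj (bxh c d \<xi>))"
    using has_FT_unique[OF assms G(1)] has_FT_sqi(2)[OF assms] has_FT_sqi(2)[OF G(1)]
    by (intro integral_cong_AE) (auto simp: square_integrable_def)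
  with G(2) show ?thesis by simp
qed

lemma Parseval:
  assumes F: "has_FT f F" and G: "has_FT g G"
  shows "(LINT \<xi>|lborel. F \<xi> * cnj (G \<xi>)) = (2 * pi)\<^sup>2 * (LINT x|lborel. f x * cnj (g x))"
proof -
  note sq = has_FT_sqi[OF F] has_FT_sqi[OF G]
  obtain h where h: "\<And>n. box_step (h n)" "(\<lambda>n::nat. L2_norm (\<lambda>x. h n x - g x)) \<longlonglongrightarrow> 0"
    by (rule box_step_sequence[OF sq(3)]) blast
  have cnj_norm: "L2_norm (\<lambda>x. cnj (u x) - cnj (v x)) = L2_norm (\<lambda>x. u x - v x)" for u v
    by (simp add: L2_norm_def flip: complex_cnj_diff)
  have "(\<lambda>n. L2_norm (\<lambda>x. L1C (h n) x - G x)) \<longlonglongrightarrow> 2 * pi * 0"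
    unfolding Plancherel[OF has_FT_diff[OF has_FT_step[OF h(1)] G]]
    by (intro tendsto_mult tendsto_const h(2))
  hence "(\<lambda>n. LINT \<xi>|lborel. F \<xi> * cnj (L1C (h n) \<xi>)) \<longlonglongrightarrow> (LINT \<xi>|lborel. F \<xi> * cnj (G \<xi>))"
    by (intro L2_limit_mult always_eventually allI sq sqi_cnj sqi_L1C_step h) (simp_all add: cnj_norm)
  hence "(\<lambda>n. (2 * pi)\<^sup>2 * (LINT x|lborel. f x * cnj (h n x))) \<longlonglongrightarrow> (LINT \<xi>|lborel. F \<xi> * cnj (G \<xi>))"
    by (simp only: Parseval_extend_step[OF sq(2,1) Parseval_box[OF F] h(1)])
  moreover have "(\<lambda>n. (2 * pi)\<^sup>2 * (LINT x|lborel. f x * cnj (h n x))) \<longlonglongrightarrow> (2 * pi)\<^sup>2 * (LINT x|lborel. f x * cnj (g x))"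
    by (intro tendsto_mult tendsto_const L2_limit_mult always_eventually allI sq sqi_cnj sqi_box_step h)
      (simp_all add: cnj_norm h)
  ultimately show ?thesis by (rule LIMSEQ_unique)
qed

text \<open>The conjugate of Parseval against boxes is literally the multiplication formula for the
  conjugate of \<open>F\<close>, so inversion needs no separate limit argument.\<close>

lemma FT_inversion:
  assumes "has_FT f F"
  shows "has_FT (\<lambda>\<xi>. cnj (F \<xi>)) (\<lambda>x. (2 * pi)\<^sup>2 * cnj (f x))"
  unfolding has_FT_def
proof (intro conjI allI)
  show "square_integrable (\<lambda>x. cnj (F x))" "square_integrable (\<lambda>x. (2 * pi)\<^sup>2 * cnj (f x))"
    using has_FT_sqi[OF assms] by (auto intro!: sqi_cmult sqi_cnj)
  fix a b
  have "(LINT x|lborel. cnj (F x) * bxh a b x) = (LINT x|lborel. cnj (F x * cnj (bxh a b x)))" by simp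
  also have "\<dots> = cnj (LINT x|lborel. F x * cnj (bxh a b x))" by (rule Bochner_Integration.integral_cnj)
  also have "\<dots> = (2 * pi)\<^sup>2 * cnj (LINT x|lborel. f x * ibox a b x)"
    by (simp only: Parseval_box[OF assms]) simp
  also have "cnj (LINT x|lborel. f x * ibox a b x) = (LINT x|lborel. cnj (f x * ibox a b x))"
    by (rule Bochner_Integration.integral_cnj[symmetric])
  also have "\<dots> = (LINT x|lborel. cnj (f x) * ibox a b x)"
    by (intro Bochner_Integration.integral_cong) (auto simp: indicator_def)
  finally show "(LINT x|lborel. (2 * pi)\<^sup>2 * cnj (f x) * ibox a b x) = (LINT x|lborel. cnj (F x) * bxh a b x)"
    by (simp add: mult.assoc)
qed

lemma has_FT_exists_inverse:
  assumes "square_integrable F" obtains f where "has_FT f F"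
proof -
  obtain g where "has_FT (\<lambda>\<xi>. cnj (F \<xi>)) g" using sqi_cnj[OF assms] by (rule has_FT_exists)
  from has_FT_cmult[OF FT_inversion[OF this], of "1 / (2 * pi)\<^sup>2"]
  have "has_FT (\<lambda>x. 1 / (2 * pi)\<^sup>2 * cnj (g x)) F" by simp
  thus ?thesis by (rule that)
qed

lemma has_FT_inj:
  assumes "has_FT f F" "has_FT g G" "AE \<xi> in lborel. F \<xi> = G \<xi>"
  shows "AE x in lborel. f x = g x"
proof -
  note d = has_FT_diff[OF assms(1,2)]
  have "L2_norm (\<lambda>\<xi>. F \<xi> - G \<xi>) = L2_norm (\<lambda>_::plane. 0::complex)"
    using assms(3) has_FT_sqi(2)[OF d] by (intro L2_norm_cong_AE) (auto simp: square_integrable_def)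
  hence "L2_norm (\<lambda>x. f x - g x) = 0" using Plancherel[OF d] by simp
  from L2_norm_eq_0_AE[OF has_FT_sqi(1)[OF d] this] show ?thesis by simp
qed

text \<open>The integral transform is known only to be bounded, so its difference from
  \<open>F\<close> is first cut to a large box \<open>B n\<close> to become square integrable.
  Intersecting a test box with \<open>B n\<close> gives a box again, where both transforms obey the
  multiplication formula.\<close>

lemma has_FT_L1C:
  assumes f: "integrable lborel f" and FT: "has_FT f F"
  shows "AE \<xi> in lborel. F \<xi> = L1C f \<xi>"
proof -
  note [measurable] = borel_measurable_integrable[OF f]
  note [measurable] = sqi_measurable'[OF has_FT_sqi(2)[OF FT]]
  define B where "B n = box (- (\<Sum>b\<in>Basis. real n *\<^sub>R b)) (\<Sum>b\<in>Basis. real n *\<^sub>R b :: plane)" for n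
  have "AE \<xi> in lborel. indicator (B n) \<xi> *\<^sub>R (F \<xi> - L1C f \<xi>) = 0" for n
  proof (rule AE_zero_of_box_integrals)
    have "square_integrable (\<lambda>\<xi>. indicator (B n) \<xi> *\<^sub>R L1C f \<xi>)"
    proof (rule sqi_bound)
      show "square_integrable (\<lambda>\<xi>. indicator (B n) \<xi> *\<^sub>R (1::real))"
        unfolding B_def by (rule sqi_box)
      show "AE \<xi> in lborel. norm (indicator (B n) \<xi> *\<^sub>R L1C f \<xi>) \<le> (LINT x|lborel. norm (f x)) * norm (indicator (B n) \<xi> *\<^sub>R (1::real))"
        using L1C_bound[OF f] by (intro AE_I2) (simp add: indicator_def)
      show "(\<lambda>\<xi>. indicator (B n) \<xi> *\<^sub>R L1C f \<xi>) \<in> borel_measurable borel" by (simp add: B_def)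
    qed
    moreover have "square_integrable (\<lambda>\<xi>. indicator (B n) \<xi> *\<^sub>R F \<xi>)"
      by (rule sqi_cut[OF has_FT_sqi(2)[OF FT]]) (simp add: B_def)
    ultimately show "square_integrable (\<lambda>\<xi>. indicator (B n) \<xi> *\<^sub>R (F \<xi> - L1C f \<xi>))"
      using sqi_diff by (fastforce simp: scaleR_diff_right)
    fix a b
    obtain p q where pq: "box a b \<inter> B n = box p q" unfolding B_def box_Int_box by blast
    have "(LINT \<xi>|lborel. indicator (B n) \<xi> *\<^sub>R (F \<xi> - L1C f \<xi>) * ibox a b \<xi>)
        = (LINT \<xi>|lborel. F \<xi> * ibox p q \<xi> - L1C f \<xi> * ibox p q \<xi>)"
      unfolding pq[symmetric] by (intro Bochner_Integration.integral_cong) (auto simp: indicator_def)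
    also have "\<dots> = (LINT \<xi>|lborel. F \<xi> * ibox p q \<xi>) - (LINT \<xi>|lborel. L1C f \<xi> * ibox p q \<xi>)"
    proof (rule Bochner_Integration.integral_diff)
      show "integrable lborel (\<lambda>\<xi>. L1C f \<xi> * ibox p q \<xi>)"
      proof (rule Bochner_Integration.integrable_bound)
        show "integrable lborel (\<lambda>\<xi>. (LINT x|lborel. norm (f x)) *\<^sub>R ibox p q \<xi>)" by simp
        show "AE \<xi> in lborel. norm (L1C f \<xi> * ibox p q \<xi>) \<le> norm ((LINT x|lborel. norm (f x)) *\<^sub>R ibox p q \<xi>)"
          using L1C_bound[OF f] by (intro AE_I2) (auto simp: indicator_def)
      qed simp
    qed (rule sqi_mult_indicator_integrable[OF has_FT_sqi(2)[OF FT]])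
    also have "\<dots> = 0"
      unfolding has_FT_box[OF FT] L1C_multiplication[OF f integrable_ibox] by simp
    finally show "(LINT \<xi>|lborel. indicator (B n) \<xi> *\<^sub>R (F \<xi> - L1C f \<xi>) * ibox a b \<xi>) = 0" .
  qed
  hence "AE \<xi> in lborel. \<forall>n. indicator (B n) \<xi> *\<^sub>R (F \<xi> - L1C f \<xi>) = 0"
    unfolding AE_all_countable by blast
  thus ?thesis
  proof eventually_elim
    case (elim \<xi>)
    obtain N where "\<xi> \<in> B N" using box_exhaust[of \<xi>] unfolding B_def by blast
    with elim show ?case by (auto dest: spec[of _ N])
  qed
qed

section \<open>Reflections, translations, modulations and real-valued functions\<close>

lemma lborel_plane_uminus: "distr lborel borel uminus = (lborel :: 'a::euclidean_space measure)"
  by (subst lborel_affine[of "-1" 0]) (auto simp: density_1 one_ennreal_def[symmetric])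

lemma integral_reflect:
  fixes f :: "'a::euclidean_space \<Rightarrow> 'b::{banach, second_countable_topology}"
  assumes "f \<in> borel_measurable borel"
  shows "(LINT x|lborel. f (- x)) = (LINT x|lborel. f x)"
  using integral_distr[of uminus lborel borel f] assms by (simp add: lborel_plane_uminus)

lemma integrable_reflect:
  fixes f :: "'a::euclidean_space \<Rightarrow> 'b::{banach, second_countable_topology}"
  assumes "integrable lborel f"
  shows "integrable lborel (\<lambda>x. f (- x))"
  using integrable_distr[of uminus lborel borel f] assms by (simp add: lborel_plane_uminus)

lemma integral_translate:
  fixes f :: "'a::euclidean_space \<Rightarrow> 'b::{banach, second_countable_topology}"
  assumes "f \<in> borel_measurable borel"
  shows "(LINT x|lborel. f (c + x)) = (LINT x|lborel. f x)"
  using integral_distr[of "(+) c" lborel borel f] assms by (simp add: lborel_distr_plus)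

lemma integrable_translate:
  fixes f :: "'a::euclidean_space \<Rightarrow> 'b::{banach, second_countable_topology}"
  assumes "integrable lborel f"
  shows "integrable lborel (\<lambda>x. f (c + x))"
  using integrable_distr[of "(+) c" lborel borel f] assms by (simp add: lborel_distr_plus)

lemma sqi_reflect:
  assumes "square_integrable f" shows "square_integrable (\<lambda>x. f (- x))"
  unfolding square_integrable_def
proof
  note [measurable] = sqi_measurable'[OF assms]
  show "(\<lambda>x. f (- x)) \<in> borel_measurable lborel" by measurable
  show "integrable lborel (\<lambda>x. (norm (f (- x)))\<^sup>2)"
    using integrable_reflect[OF sqi_integrable[OF assms]] .
qed

lemma sqi_translate:
  assumes "square_integrable f" shows "square_integrable (\<lambda>x. f (c + x))"
  unfolding square_integrable_def
proof
  note [measurable] = sqi_measurable'[OF assms]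
  show "(\<lambda>x. f (c + x)) \<in> borel_measurable lborel" by measurable
  show "integrable lborel (\<lambda>x. (norm (f (c + x)))\<^sup>2)"
    using integrable_translate[OF sqi_integrable[OF assms]] .
qed

lemma L2_norm_reflect:
  assumes "square_integrable f" shows "L2_norm (\<lambda>x. f (- x)) = L2_norm f"
  unfolding L2_norm_def
  by (subst integral_reflect[of "\<lambda>x. (norm (f x))\<^sup>2"]) (use sqi_measurable'[OF assms] in auto)

lemma L2_norm_translate:
  assumes "square_integrable f" shows "L2_norm (\<lambda>x. f (c + x)) = L2_norm f"
  unfolding L2_norm_def
  by (subst integral_translate[of "\<lambda>x. (norm (f x))\<^sup>2"]) (use sqi_measurable'[OF assms] in auto)

lemma has_FT_cnj:
  assumes "has_FT f F"
  shows "has_FT (\<lambda>x. cnj (f x)) (\<lambda>\<xi>. cnj (F (- \<xi>)))"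
  unfolding has_FT_def
proof (intro conjI allI)
  note [measurable] = sqi_measurable'[OF has_FT_sqi(2)[OF assms]]
  show "square_integrable (\<lambda>x. cnj (f x))" "square_integrable (\<lambda>\<xi>. cnj (F (- \<xi>)))"
    using has_FT_sqi[OF assms] by (auto intro: sqi_cnj sqi_reflect)
  fix a b
  have mb: "- \<xi> \<in> box a b \<longleftrightarrow> \<xi> \<in> box (- b) (- a)" for \<xi> :: plane
    by (auto simp: mem_box)
  have bx: "bxh (- b) (- a) x = cnj (bxh a b x)" for x
  proof -
    have "bxh (- b) (- a) x = (LINT y|lborel. cis (- (- y \<bullet> x)) * ibox (- b) (- a) (- y))"
      unfolding L1C_def by (rule integral_reflect[symmetric]) measurable
    also have "\<dots> = (LINT y|lborel. cnj (cis (- (y \<bullet> x)) * ibox a b y))"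
      by (intro Bochner_Integration.integral_cong refl)
        (auto simp: indicator_def cis_cnj mb[symmetric])
    also have "\<dots> = cnj (bxh a b x)" unfolding L1C_def by (rule Bochner_Integration.integral_cnj)
    finally show ?thesis .
  qed
  have "(LINT \<xi>|lborel. cnj (F (- \<xi>)) * ibox a b \<xi>) = (LINT \<xi>|lborel. cnj (F (- (- \<xi>))) * ibox a b (- \<xi>))"
    by (rule integral_reflect[symmetric]) measurable
  also have "\<dots> = (LINT \<xi>|lborel. cnj (F \<xi> * ibox (- b) (- a) \<xi>))"
    by (intro Bochner_Integration.integral_cong refl) (auto simp: indicator_def mb)
  also have "\<dots> = cnj (LINT \<xi>|lborel. F \<xi> * ibox (- b) (- a) \<xi>)" by (rule Bochner_Integration.integral_cnj)
  also have "\<dots> = cnj (LINT x|lborel. f x * cnj (bxh a b x))"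
    by (simp add: has_FT_box[OF assms] bx)
  also have "\<dots> = (LINT x|lborel. cnj (f x * cnj (bxh a b x)))" by (rule Bochner_Integration.integral_cnj[symmetric])
  finally show "(LINT \<xi>|lborel. cnj (F (- \<xi>)) * ibox a b \<xi>) = (LINT x|lborel. cnj (f x) * bxh a b x)" by simp
qed

lemma has_FT_modulate:
  assumes "has_FT f F"
  shows "has_FT (\<lambda>x. cis (x \<bullet> \<eta>) * f x) (\<lambda>\<xi>. F (\<xi> - \<eta>))"
  unfolding has_FT_def
proof (intro conjI allI)
  note [measurable] = sqi_measurable'[OF has_FT_sqi(2)[OF assms]] sqi_measurable'[OF has_FT_sqi(1)[OF assms]]
  show "square_integrable (\<lambda>x. cis (x \<bullet> \<eta>) * f x)"
    by (rule sqi_bound[OF has_FT_sqi(1)[OF assms], where K = 1]) (auto simp: norm_mult)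
  show "square_integrable (\<lambda>\<xi>. F (\<xi> - \<eta>))"
    using sqi_translate[OF has_FT_sqi(2)[OF assms], of "- \<eta>"] by simp
  fix a b
  have mb: "\<eta> + \<xi> \<in> box a b \<longleftrightarrow> \<xi> \<in> box (a - \<eta>) (b - \<eta>)" for \<xi> :: plane
    by (auto simp: mem_box inner_diff_left inner_add_left algebra_simps)
  have bx: "bxh (a - \<eta>) (b - \<eta>) x = cis (x \<bullet> \<eta>) * bxh a b x" for x
  proof -
    have "bxh a b x = (LINT y|lborel. cis (- ((\<eta> + y) \<bullet> x)) * ibox a b (\<eta> + y))"
      unfolding L1C_def by (rule integral_translate[symmetric]) measurable
    also have "\<dots> = (LINT y|lborel. cis (- (\<eta> \<bullet> x)) * (cis (- (y \<bullet> x)) * ibox (a - \<eta>) (b - \<eta>) y))"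
      by (intro Bochner_Integration.integral_cong refl)
        (auto simp: indicator_def mb cis_mult inner_add_left)
    also have "\<dots> = cis (- (\<eta> \<bullet> x)) * bxh (a - \<eta>) (b - \<eta>) x" by (simp add: L1C_def)
    finally have "cis (x \<bullet> \<eta>) * bxh a b x = (cis (x \<bullet> \<eta>) * cis (- (x \<bullet> \<eta>))) * bxh (a - \<eta>) (b - \<eta>) x"
      by (simp add: inner_commute mult.assoc)
    thus ?thesis by (simp add: cis_mult)
  qed
  have "(LINT \<xi>|lborel. F (\<xi> - \<eta>) * ibox a b \<xi>) = (LINT \<xi>|lborel. F (\<eta> + \<xi> - \<eta>) * ibox a b (\<eta> + \<xi>))"
    by (rule integral_translate[symmetric]) measurable
  also have "\<dots> = (LINT \<xi>|lborel. F \<xi> * ibox (a - \<eta>) (b - \<eta>) \<xi>)"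
    by (intro Bochner_Integration.integral_cong refl) (auto simp: indicator_def mb)
  also have "\<dots> = (LINT x|lborel. f x * (cis (x \<bullet> \<eta>) * bxh a b x))"
    by (simp add: has_FT_box[OF assms] bx)
  finally show "(LINT \<xi>|lborel. F (\<xi> - \<eta>) * ibox a b \<xi>) = (LINT x|lborel. cis (x \<bullet> \<eta>) * f x * bxh a b x)"
    by (simp add: mult_ac)
qed

lemma Parseval_bilinear:
  fixes f g F G :: "plane \<Rightarrow> complex"
  assumes F: "has_FT f F" and G: "has_FT g G"
  shows "(LINT \<xi>|lborel. F \<xi> * G (- \<xi>)) = (2 * pi)\<^sup>2 * (LINT x|lborel. f x * g x)"
  using Parseval[OF F has_FT_cnj[OF G]] by simp

lemma has_FT_real_Hermitian:
  assumes "has_FT (\<lambda>x. complex_of_real (f x)) F"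
  shows "AE \<xi> in lborel. F (- \<xi>) = cnj (F \<xi>)"
proof -
  have "AE \<xi> in lborel. cnj (F (- \<xi>)) = F \<xi>"
    using has_FT_cnj[OF assms] by (intro has_FT_unique[of "\<lambda>x. complex_of_real (f x)"] assms) simp
  thus ?thesis by eventually_elim (metis complex_cnj_cnj)
qed

lemma has_FT_Hermitian_real:
  assumes FT: "has_FT f F" and H: "AE \<xi> in lborel. F (- \<xi>) = cnj (F \<xi>)"
  shows "has_FT (\<lambda>x. complex_of_real (Re (f x))) F"
proof -
  note [measurable] = sqi_measurable'[OF has_FT_sqi(2)[OF FT]] sqi_measurable'[OF has_FT_sqi(1)[OF FT]]
  have "AE x in lborel. cnj (f x) = f x"
    using H by (intro has_FT_inj[OF has_FT_cnj[OF FT] FT]) auto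
  hence "AE x in lborel. complex_of_real (Re (f x)) = f x"
    by eventually_elim (auto simp: complex_eq_iff)
  thus ?thesis by (intro has_FT_cong[OF FT]) auto
qed

section \<open>Fourier multipliers\<close>

text \<open>The bridge from the choice operator in \<open>L2_fourier\<close> to
  \<open>has_FT\<close>. Truncations to balls are integrable, so their integral transform is an
  \<open>L2\<close> transform; Plancherel turns their convergence into convergence of the
  transforms, which shows that a limit exists and identifies the chosen one almost
  everywhere.\<close>

lemma has_FT_L2_fourier:
  assumes f: "square_integrable f"
  shows "has_FT (\<lambda>x. complex_of_real (f x)) (L2_fourier f)"
proof -
  let ?f = "\<lambda>x. complex_of_real (f x)"
  let ?t = "\<lambda>R x. indicator (ball 0 R) x * f x"
  note [measurable] = sqi_measurable'[OF f]
  have sf: "square_integrable ?f" using f by simp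
  have t_sqi: "square_integrable (?t R)" for R
    using sqi_cut[OF f, of "ball 0 R"] by simp
  have t_FT: "has_FT (\<lambda>x. complex_of_real (?t R x)) (L1_fourier (?t R))" for R
  proof -
    have int: "integrable lborel (\<lambda>x. complex_of_real (?t R x))"
    proof -
      have "emeasure lborel (ball 0 R :: plane set) < \<infinity>"
        by (rule emeasure_bounded_finite) simp
      hence "square_integrable (\<lambda>x::plane. indicator (ball 0 R) x *\<^sub>R (1::real))"
        by (intro sqi_indicator) auto
      from sqi_mult_integrable[OF this f] show ?thesis by (intro integrable_of_real) simp
    qed
    have sqt: "square_integrable (\<lambda>x. complex_of_real (?t R x))" using t_sqi[of R] by (simp only: sqi_of_real)
    obtain F where F: "has_FT (\<lambda>x. complex_of_real (?t R x)) F" by (rule has_FT_exists[OF sqt])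
    have [measurable]: "(\<lambda>x. complex_of_real (?t R x)) \<in> borel_measurable borel"
      by (rule sqi_measurable'[OF sqt])
    show ?thesis
      unfolding L1_fourier_eq_L1C
    proof (rule has_FT_cong[OF F])
      show "L1C (\<lambda>x. complex_of_real (?t R x)) \<in> borel_measurable borel" by measurable
      show "AE \<xi> in lborel. L1C (\<lambda>x. complex_of_real (?t R x)) \<xi> = F \<xi>"
        using has_FT_L1C[OF int F] by eventually_elim (rule sym)
      show "(\<lambda>x. complex_of_real (?t R x)) \<in> borel_measurable borel"
        by (rule sqi_measurable'[OF sqt])
    qed simp
  qed
  have lim0: "((\<lambda>R. L2_norm (\<lambda>x. ?f x - complex_of_real (?t R x))) \<longlongrightarrow> 0) at_top"
  proof (rule tendsto_at_topI_sequentially)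
    fix X :: "nat \<Rightarrow> real" assume X: "filterlim X at_top sequentially"
    have "(\<lambda>n. L2_norm (\<lambda>x. ?t (X n) x - f x)) \<longlonglongrightarrow> 0"
    proof (rule L2_dominated[where w = "\<lambda>x. norm (f x)"])
      show "AE x in lborel. (\<lambda>n. ?t (X n) x) \<longlonglongrightarrow> f x"
      proof (rule AE_I2)
        fix x :: plane
        have "\<forall>\<^sub>F n in sequentially. X n > norm x" using X by (simp add: filterlim_at_top_dense)
        hence "\<forall>\<^sub>F n in sequentially. ?t (X n) x = f x"
          by eventually_elim (simp add: indicator_def)
        thus "(\<lambda>n. ?t (X n) x) \<longlonglongrightarrow> f x" by (rule tendsto_eventually)
      qed
      show "square_integrable (\<lambda>x. norm (f x))" by (rule sqi_norm[OF f])
    qed (auto simp: indicator_def intro!: AE_I2)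
    moreover have "L2_norm (\<lambda>x. ?f x - complex_of_real (?t R x)) = L2_norm (\<lambda>x. ?t R x - f x)" for R
      unfolding L2_norm_minus_commute[of _ f] by (subst L2_norm_of_real[symmetric]) simp
    ultimately show "(\<lambda>n. L2_norm (\<lambda>x. ?f x - complex_of_real (?t (X n) x))) \<longlonglongrightarrow> 0"
      by (simp only:)
  qed
  have conv: "((\<lambda>R. L2_norm (\<lambda>\<xi>. F \<xi> - L1_fourier (?t R) \<xi>)) \<longlongrightarrow> 0) at_top"
    if F: "has_FT ?f F" for F
  proof -
    have "((\<lambda>R. 2 * pi * L2_norm (\<lambda>x. ?f x - complex_of_real (?t R x))) \<longlongrightarrow> 2 * pi * 0) at_top"
      by (intro tendsto_mult tendsto_const lim0)
    thus ?thesis by (simp only: Plancherel[OF has_FT_diff[OF F t_FT]] mult_zero_right)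
  qed
  obtain F where F: "has_FT ?f F" by (rule has_FT_exists[OF sf])
  let ?P = "\<lambda>F. square_integrable F \<and> ((\<lambda>R::real. L2_norm (\<lambda>\<xi>. F \<xi> - L1_fourier (?t R) \<xi>)) \<longlongrightarrow> 0) at_top"
  have "?P (L2_fourier f)"
    unfolding L2_fourier_def by (rule someI[of ?P F]) (use has_FT_sqi(2)[OF F] conv[OF F] in simp)
  hence sq: "square_integrable (L2_fourier f)"
    and lim: "((\<lambda>R::real. L2_norm (\<lambda>\<xi>. L2_fourier f \<xi> - L1_fourier (?t R) \<xi>)) \<longlongrightarrow> 0) at_top" by auto
  note [measurable] = sqi_measurable'[OF sq] sqi_measurable'[OF has_FT_sqi(2)[OF F]]
  have "L2_norm (\<lambda>\<xi>. L2_fourier f \<xi> - F \<xi>) \<le> 0"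
  proof (rule tendsto_lowerbound)
    show "((\<lambda>R. L2_norm (\<lambda>\<xi>. L2_fourier f \<xi> - L1_fourier (?t R) \<xi>) + L2_norm (\<lambda>\<xi>. F \<xi> - L1_fourier (?t R) \<xi>)) \<longlongrightarrow> 0) at_top"
      using tendsto_add[OF lim conv[OF F]] by simp
    show "\<forall>\<^sub>F R in at_top. L2_norm (\<lambda>\<xi>. L2_fourier f \<xi> - F \<xi>)
        \<le> L2_norm (\<lambda>\<xi>. L2_fourier f \<xi> - L1_fourier (?t R) \<xi>) + L2_norm (\<lambda>\<xi>. F \<xi> - L1_fourier (?t R) \<xi>)"
    proof (intro always_eventually allI)
      fix R
      show "L2_norm (\<lambda>\<xi>. L2_fourier f \<xi> - F \<xi>)
        \<le> L2_norm (\<lambda>\<xi>. L2_fourier f \<xi> - L1_fourier (?t R) \<xi>) + L2_norm (\<lambda>\<xi>. F \<xi> - L1_fourier (?t R) \<xi>)"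
        unfolding L2_norm_minus_commute[of F]
        by (rule L2_norm_triangle_diff[OF sq has_FT_sqi(2)[OF t_FT] has_FT_sqi(2)[OF F]])
    qed
  qed simp
  hence "L2_norm (\<lambda>\<xi>. L2_fourier f \<xi> - F \<xi>) = 0" using L2_norm_nonneg by (intro antisym)
  from L2_norm_eq_0_AE[OF sqi_diff[OF sq has_FT_sqi(2)[OF F]] this]
  show ?thesis by (intro has_FT_cong[OF F]) auto
qed

lemma sqi_L2_fourier: "square_integrable f \<Longrightarrow> square_integrable (L2_fourier f)"
  using has_FT_L2_fourier has_FT_sqi(2) by blast

lemma L2_fourier_AE:
  assumes "has_FT (\<lambda>x. complex_of_real (f x)) F"
  shows "AE \<xi> in lborel. L2_fourier f \<xi> = F \<xi>"
  using has_FT_unique[OF has_FT_L2_fourier assms] has_FT_sqi(1)[OF assms] by simp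

lemma L2_norm_fourier: "square_integrable f \<Longrightarrow> L2_norm (L2_fourier f) = 2 * pi * L2_norm f"
  using Plancherel[OF has_FT_L2_fourier] by simp

lemma has_FT_multiplier:
  assumes "is_multiplier_image p f g" and [measurable]: "p \<in> borel_measurable borel"
  shows "has_FT (\<lambda>x. complex_of_real (g x)) (\<lambda>\<xi>. p \<xi> * L2_fourier f \<xi>)"
proof -
  have f: "square_integrable f" and g: "square_integrable g"
    and eq: "AE \<xi> in lborel. L2_fourier g \<xi> = p \<xi> * L2_fourier f \<xi>"
    using assms(1) by (auto simp: is_multiplier_image_def)
  note [measurable] = sqi_measurable'[OF sqi_L2_fourier[OF f]] sqi_measurable'[OF g]
  show ?thesis
    using eq by (intro has_FT_cong[OF has_FT_L2_fourier[OF g]]) (auto elim!: eventually_mono)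
qed

lemma multiplier_image: "in_domain p f \<Longrightarrow> is_multiplier_image p f (multiplier p f)"
  unfolding in_domain_def multiplier_def by (rule someI_ex[of "is_multiplier_image p f"])

text \<open>The multiplier must return a real function. The symmetry of \<open>p\<close> makes the
  product Hermitian, so the real part of the inverse transform still has the right
  transform.\<close>

lemma in_domainI:
  assumes f: "square_integrable f" and p: "p \<in> borel_measurable borel" "\<And>\<xi>. p (- \<xi>) = cnj (p \<xi>)"
    and pf: "square_integrable (\<lambda>\<xi>. p \<xi> * L2_fourier f \<xi>)"
  shows "in_domain p f"
proof -
  obtain g where g: "has_FT g (\<lambda>\<xi>. p \<xi> * L2_fourier f \<xi>)" by (rule has_FT_exists_inverse[OF pf])
  have "AE \<xi> in lborel. p (- \<xi>) * L2_fourier f (- \<xi>) = cnj (p \<xi> * L2_fourier f \<xi>)"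
    using has_FT_real_Hermitian[OF has_FT_L2_fourier[OF f]] by eventually_elim (simp add: p(2))
  from has_FT_Hermitian_real[OF g this]
  have G: "has_FT (\<lambda>x. complex_of_real (Re (g x))) (\<lambda>\<xi>. p \<xi> * L2_fourier f \<xi>)" .
  have "is_multiplier_image p f (\<lambda>x. Re (g x))"
    unfolding is_multiplier_image_def
    using f L2_fourier_AE[OF G] has_FT_sqi(1)[OF G] by simp
  thus ?thesis by (auto simp: in_domain_def)
qed

lemma has_FT_multiplier_in_domain:
  assumes "in_domain p f" "p \<in> borel_measurable borel"
  shows "has_FT (\<lambda>x. complex_of_real (multiplier p f x)) (\<lambda>\<xi>. p \<xi> * L2_fourier f \<xi>)"
  by (rule has_FT_multiplier[OF multiplier_image[OF assms(1)] assms(2)])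

lemma in_domain_sqi: "in_domain p f \<Longrightarrow> square_integrable f"
  by (auto simp: in_domain_def is_multiplier_image_def)

lemma sqi_multiplier: "in_domain p f \<Longrightarrow> square_integrable (multiplier p f)"
  using multiplier_image by (auto simp: is_multiplier_image_def)

lemma in_domain_FT_sqi:
  assumes "in_domain p f" "p \<in> borel_measurable borel"
  shows "square_integrable (\<lambda>\<xi>. p \<xi> * L2_fourier f \<xi>)"
  using has_FT_sqi(2)[OF has_FT_multiplier_in_domain[OF assms]] .

lemma L2_norm_multiplier:
  assumes "in_domain p f" "p \<in> borel_measurable borel"
  shows "L2_norm (\<lambda>\<xi>. p \<xi> * L2_fourier f \<xi>) = 2 * pi * L2_norm (multiplier p f)"
  using Plancherel[OF has_FT_multiplier_in_domain[OF assms]] by simp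

section \<open>Convolution integrals on the frequency side\<close>

abbreviation LL :: "(plane \<times> plane) measure" where
  "LL \<equiv> lborel \<Otimes>\<^sub>M lborel"

lemma lborel_reflect_translate:
  "distr lborel borel (\<lambda>x. - x - c) = (lborel :: 'a::euclidean_space measure)"
proof -
  have "(lborel :: 'a measure) = distr lborel borel (\<lambda>x. - c + (- 1) *\<^sub>R x)"
    using lborel_affine[of "-1" "- c"] by (simp add: density_1 one_ennreal_def[symmetric])
  also have "(\<lambda>x. - c + (- 1) *\<^sub>R x) = (\<lambda>x::'a. - x - c)" by auto
  finally show ?thesis ..
qed

lemma nn_integral_reflect_translate:
  fixes f :: "plane \<Rightarrow> ennreal"
  assumes "f \<in> borel_measurable borel"
  shows "(\<integral>\<^sup>+x. f (- x - c) \<partial>lborel) = (\<integral>\<^sup>+x. f x \<partial>lborel)"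
  using nn_integral_distr[of "\<lambda>x. - x - c" lborel borel f] assms
  by (simp add: lborel_reflect_translate)

text \<open>A pair z = (\<eta>, \<xi>) stands for three frequencies \<eta>, \<xi>, \<zeta> =
  -\<xi>-\<eta> with sum zero. \<open>shear1\<close> exchanges \<xi> and \<zeta>, and
  \<open>shear2\<close> exchanges \<eta> and \<zeta>; together they generate all permutations of the
  three factors of a trilinear integral.\<close>

definition shear1 :: "plane \<times> plane \<Rightarrow> plane \<times> plane" where
  "shear1 z = (fst z, - snd z - fst z)"

definition shear2 :: "plane \<times> plane \<Rightarrow> plane \<times> plane" where
  "shear2 z = (- snd z - fst z, snd z)"

lemma shear_simps [simp]:
  "fst (shear1 z) = fst z" "snd (shear1 z) = - snd z - fst z"
  "fst (shear2 z) = - snd z - fst z" "snd (shear2 z) = snd z"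
  by (simp_all add: shear1_def shear2_def)

lemma shear_measurable [measurable]:
  "shear1 \<in> LL \<rightarrow>\<^sub>M LL" "shear2 \<in> LL \<rightarrow>\<^sub>M LL"
  unfolding shear1_def[abs_def] shear2_def[abs_def] by measurable

lemma distr_shear1: "distr LL LL shear1 = LL"
proof (rule measure_eqI)
  fix A assume A0: "A \<in> sets (distr LL LL shear1)"
  hence A [measurable]: "A \<in> sets LL" by (simp only: sets_distr)
  have "emeasure (distr LL LL shear1) A = (\<integral>\<^sup>+z. indicator A z \<partial>distr LL LL shear1)"
    by (rule nn_integral_indicator[OF A0, symmetric])
  also have "\<dots> = (\<integral>\<^sup>+z. indicator A (shear1 z) \<partial>LL)"
    by (rule nn_integral_distr) auto
  also have "\<dots> = (\<integral>\<^sup>+x. \<integral>\<^sup>+y. indicator A (x, - y - x) \<partial>lborel \<partial>lborel)"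
    by (subst lborel.nn_integral_fst[symmetric]) (auto simp: shear1_def)
  also have "\<dots> = (\<integral>\<^sup>+x. \<integral>\<^sup>+y. indicator A (x, y) \<partial>lborel \<partial>lborel)"
    by (intro nn_integral_cong nn_integral_reflect_translate[of "\<lambda>y. indicator A (_, y)"]) measurable
  also have "\<dots> = (\<integral>\<^sup>+z. indicator A z \<partial>LL)"
    by (rule lborel.nn_integral_fst) auto
  also have "\<dots> = emeasure LL A" by (rule nn_integral_indicator[OF A])
  finally show "emeasure (distr LL LL shear1) A = emeasure LL A" .
qed simp

lemma distr_shear2: "distr LL LL shear2 = LL"
proof -
  let ?s = "\<lambda>(x, y). (y, x)"
  have sw: "distr LL LL ?s = LL" using lborel_pair.distr_pair_swap ..
  have m [measurable]: "?s \<in> LL \<rightarrow>\<^sub>M LL" by measurable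
  have "shear2 = ?s \<circ> (shear1 \<circ> ?s)" by (auto simp: shear1_def shear2_def fun_eq_iff)
  hence "distr LL LL shear2 = distr (distr (distr LL LL ?s) LL shear1) LL ?s"
    by (simp add: distr_distr comp_def)
  also have "\<dots> = LL" by (simp only: sw distr_shear1)
  finally show ?thesis .
qed

lemma
  fixes f :: "plane \<times> plane \<Rightarrow> complex"
  assumes f: "integrable LL f"
  shows integrable_shear1: "integrable LL (\<lambda>z. f (shear1 z))"
    and integral_shear1: "(LINT z|LL. f (shear1 z)) = (LINT z|LL. f z)"
    and integrable_shear2: "integrable LL (\<lambda>z. f (shear2 z))"
    and integral_shear2: "(LINT z|LL. f (shear2 z)) = (LINT z|LL. f z)"
  using f integrable_distr[of shear1 LL LL f] integral_distr[of shear1 LL LL f]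
    integrable_distr[of shear2 LL LL f] integral_distr[of shear2 LL LL f]
  by (simp_all add: distr_shear1 distr_shear2)

lemma sqi_reflect_translate:
  assumes "square_integrable f" shows "square_integrable (\<lambda>x. f (- x - c))"
proof -
  have "- x - c = - (c + x)" for x by simp
  thus ?thesis using sqi_translate[OF sqi_reflect[OF assms], of c] by (simp only:)
qed

lemma L2_norm_reflect_translate:
  assumes "square_integrable f" shows "L2_norm (\<lambda>x. f (- x - c)) = L2_norm f"
proof -
  have "- x - c = - (c + x)" for x by simp
  thus ?thesis using L2_norm_translate[OF sqi_reflect[OF assms], of c] L2_norm_reflect[OF assms] by (simp only:)
qed

text \<open>Cauchy-Schwarz in \<xi> for fixed \<eta>, where the reflected translate of
  \<open>B\<close> keeps its norm, followed by integration of \<open>C\<close>. One factor has an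
  integrable transform, the other two need only be square integrable.\<close>

lemma
  fixes A B C :: "plane \<Rightarrow> complex"
  assumes C: "integrable lborel C" and A: "square_integrable A" and B: "square_integrable B"
  shows conv_integrable: "integrable LL (\<lambda>z. C (fst z) * (A (snd z) * B (- snd z - fst z)))"
    and conv_bound: "(LINT z|LL. norm (C (fst z) * (A (snd z) * B (- snd z - fst z))))
      \<le> (LINT \<eta>|lborel. norm (C \<eta>)) * L2_norm A * L2_norm B"
proof -
  note [measurable] = borel_measurable_integrable[OF C] sqi_measurable'[OF A] sqi_measurable'[OF B]
  let ?f = "\<lambda>z. C (fst z) * (A (snd z) * B (- snd z - fst z))"
  have [measurable]: "?f \<in> borel_measurable LL" by measurable
  have inner: "(LINT \<xi>|lborel. norm (?f (\<eta>, \<xi>))) \<le> norm (C \<eta>) * (L2_norm A * L2_norm B)" for \<eta>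
  proof -
    have "(LINT \<xi>|lborel. norm (?f (\<eta>, \<xi>))) = norm (C \<eta>) * (LINT \<xi>|lborel. norm (A \<xi>) * norm (B (- \<xi> - \<eta>)))"
      by (simp add: norm_mult)
    also have "\<dots> \<le> norm (C \<eta>) * (L2_norm A * L2_norm B)"
      using L2_Cauchy_Schwarz[OF A sqi_reflect_translate[OF B, of \<eta>]]
      by (intro mult_left_mono) (simp_all add: L2_norm_reflect_translate[OF B])
    finally show ?thesis .
  qed
  have int1: "integrable lborel (\<lambda>\<eta>. LINT \<xi>|lborel. norm (?f (\<eta>, \<xi>)))"
  proof (rule Bochner_Integration.integrable_bound)
    show "integrable lborel (\<lambda>\<eta>. norm (C \<eta>) * (L2_norm A * L2_norm B))"
      using C by (intro integrable_mult_left integrable_norm)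
    show "(\<lambda>\<eta>. LINT \<xi>|lborel. norm (?f (\<eta>, \<xi>))) \<in> borel_measurable lborel" by measurable
    show "AE \<eta> in lborel. norm (LINT \<xi>|lborel. norm (?f (\<eta>, \<xi>))) \<le> norm (norm (C \<eta>) * (L2_norm A * L2_norm B))"
    proof (rule AE_I2)
      fix \<eta>
      have "0 \<le> (LINT \<xi>|lborel. norm (?f (\<eta>, \<xi>)))" by (rule Bochner_Integration.integral_nonneg) simp
      with inner[of \<eta>] show "norm (LINT \<xi>|lborel. norm (?f (\<eta>, \<xi>))) \<le> norm (norm (C \<eta>) * (L2_norm A * L2_norm B))"
        by (simp only: real_norm_def abs_of_nonneg)
    qed
  qed
  show int: "integrable LL ?f"
  proof (rule lborel_pair.Fubini_integrable[OF _ int1])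
    show "AE \<eta> in lborel. integrable lborel (\<lambda>\<xi>. ?f (\<eta>, \<xi>))"
      using sqi_mult_integrable[OF A sqi_reflect_translate[OF B]]
      by (intro AE_I2) (auto intro!: integrable_mult_right)
  qed simp
  have "(LINT z|LL. norm (?f z)) = (LINT \<eta>|lborel. LINT \<xi>|lborel. norm (?f (\<eta>, \<xi>)))"
    by (rule lborel_pair.integral_fst'[symmetric]) (rule integrable_norm[OF int])
  also have "\<dots> \<le> (LINT \<eta>|lborel. norm (C \<eta>) * (L2_norm A * L2_norm B))"
    using inner C by (intro integral_mono int1 integrable_mult_left integrable_norm) auto
  also have "\<dots> = (LINT \<eta>|lborel. norm (C \<eta>)) * L2_norm A * L2_norm B" by simp
  finally show "(LINT z|LL. norm (?f z)) \<le> (LINT \<eta>|lborel. norm (C \<eta>)) * L2_norm A * L2_norm B" .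
qed

lemma FT_inversion_pointwise:
  fixes c C :: "plane \<Rightarrow> complex"
  assumes "has_FT c C" "integrable lborel C"
  shows "AE x in lborel. (2 * pi)\<^sup>2 * c x = (LINT \<eta>|lborel. cis (x \<bullet> \<eta>) * C \<eta>)"
proof -
  have "AE x in lborel. (2 * pi)\<^sup>2 * cnj (c x) = L1C (\<lambda>\<xi>. cnj (C \<xi>)) x"
    using assms by (intro has_FT_L1C[OF _ FT_inversion]) auto
  thus ?thesis
  proof eventually_elim
    case (elim x)
    have "(2 * pi)\<^sup>2 * c x = cnj ((2 * pi)\<^sup>2 * cnj (c x))" by simp
    also have "\<dots> = cnj (LINT \<eta>|lborel. cis (- (\<eta> \<bullet> x)) * cnj (C \<eta>))" by (simp only: elim L1C_def)
    also have "\<dots> = (LINT \<eta>|lborel. cnj (cis (- (\<eta> \<bullet> x)) * cnj (C \<eta>)))"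
      by (rule Bochner_Integration.integral_cnj[symmetric])
    finally show ?case by (simp add: cis_cnj inner_commute)
  qed
qed

text \<open>One factor \<open>(2 * pi)\<^sup>2\<close> comes from the pointwise inversion of the
  transform of \<open>c\<close>, the other from Parseval for \<open>a\<close> and the modulated
  \<open>b\<close>.\<close>

lemma triple_product_integral:
  fixes a b c A B C :: "plane \<Rightarrow> complex"
  assumes A: "has_FT a A" and B: "has_FT b B" and C: "has_FT c C" and iC: "integrable lborel C"
  shows "(LINT x|lborel. a x * b x * c x) = 1 / (2 * complex_of_real pi)^4 * (LINT z|LL. C (fst z) * (A (snd z) * B (- snd z - fst z)))"
proof -
  note sq = has_FT_sqi[OF A] has_FT_sqi[OF B] has_FT_sqi[OF C]
  note [measurable] = sq[THEN sqi_measurable']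
  have ab: "integrable lborel (\<lambda>x. a x * b x)" by (rule sqi_mult_integrable[OF sq(1,3)])
  have int: "integrable LL (case_prod (\<lambda>x \<eta>. cis (x \<bullet> \<eta>) * (a x * b x) * C \<eta>))"
    unfolding case_prod_unfold by (rule integrable_tensor[OF ab iC]) auto
  have mod: "(2 * pi)\<^sup>2 * (LINT x|lborel. a x * (cis (x \<bullet> \<eta>) * b x)) = (LINT \<xi>|lborel. A \<xi> * B (- \<xi> - \<eta>))" for \<eta>
    using Parseval_bilinear[OF A has_FT_modulate[OF B, of \<eta>]] by simp
  have "(2 * pi)\<^sup>2 * (LINT x|lborel. a x * b x * c x) = (LINT x|lborel. a x * b x * ((2 * pi)\<^sup>2 * c x))"
    by (subst integral_mult_right_zero[symmetric]) (simp add: mult_ac)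
  also have "\<dots> = (LINT x|lborel. LINT \<eta>|lborel. cis (x \<bullet> \<eta>) * (a x * b x) * C \<eta>)"
  proof (rule integral_cong_AE)
    show "AE x in lborel. a x * b x * ((2 * pi)\<^sup>2 * c x) = (LINT \<eta>|lborel. cis (x \<bullet> \<eta>) * (a x * b x) * C \<eta>)"
      using FT_inversion_pointwise[OF C iC]
    proof eventually_elim
      case (elim x)
      have "(LINT \<eta>|lborel. cis (x \<bullet> \<eta>) * (a x * b x) * C \<eta>) = (LINT \<eta>|lborel. (a x * b x) * (cis (x \<bullet> \<eta>) * C \<eta>))"
        by (simp add: mult_ac)
      also have "\<dots> = (a x * b x) * (LINT \<eta>|lborel. cis (x \<bullet> \<eta>) * C \<eta>)" by (rule integral_mult_right_zero)
      finally show ?case by (simp only: elim)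
    qed
  qed measurable
  also have "\<dots> = (LINT \<eta>|lborel. LINT x|lborel. cis (x \<bullet> \<eta>) * (a x * b x) * C \<eta>)"
    by (rule lborel_pair.Fubini_integral[OF int, symmetric])
  also have "\<dots> = (LINT \<eta>|lborel. C \<eta> * (LINT x|lborel. a x * (cis (x \<bullet> \<eta>) * b x)))"
    by (simp add: mult_ac)
  finally have E: "(2 * pi)\<^sup>2 * (LINT x|lborel. a x * b x * c x) = (LINT \<eta>|lborel. C \<eta> * (LINT x|lborel. a x * (cis (x \<bullet> \<eta>) * b x)))" .
  have "(2 * pi)\<^sup>2 * ((2 * pi)\<^sup>2 * (LINT x|lborel. a x * b x * c x))
      = (LINT \<eta>|lborel. (2 * pi)\<^sup>2 * (C \<eta> * (LINT x|lborel. a x * (cis (x \<bullet> \<eta>) * b x))))"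
    unfolding E by (rule integral_mult_right_zero[symmetric])
  also have "\<dots> = (LINT \<eta>|lborel. C \<eta> * ((2 * pi)\<^sup>2 * (LINT x|lborel. a x * (cis (x \<bullet> \<eta>) * b x))))"
    by (simp only: mult.left_commute)
  finally have "(2 * pi)\<^sup>2 * ((2 * pi)\<^sup>2 * (LINT x|lborel. a x * b x * c x))
      = (LINT \<eta>|lborel. C \<eta> * ((2 * pi)\<^sup>2 * (LINT x|lborel. a x * (cis (x \<bullet> \<eta>) * b x))))" .
  also have "\<dots> = (LINT \<eta>|lborel. LINT \<xi>|lborel. C (fst (\<eta>, \<xi>)) * (A (snd (\<eta>, \<xi>)) * B (- snd (\<eta>, \<xi>) - fst (\<eta>, \<xi>))))"
    by (simp only: mod fst_conv snd_conv integral_mult_right_zero)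
  also have "\<dots> = (LINT z|LL. C (fst z) * (A (snd z) * B (- snd z - fst z)))"
    by (rule lborel_pair.integral_fst'[OF conv_integrable[OF iC sq(2,4)]])
  finally show ?thesis by (simp add: field_simps power2_eq_square power4_eq_xxxx)
qed

section \<open>The symmetrised kernel\<close>

text \<open>A velocity at frequency \<xi> dotted with a gradient at frequency \<eta> has the symbol
  \<open>- crs \<xi> \<eta>\<close> times the norm of \<xi> to the power \<beta>-2; the sign is the
  square of the two factors \<open>\<i>\<close>.\<close>

definition crs :: "plane \<Rightarrow> plane \<Rightarrow> real" where
  "crs \<xi> \<eta> = \<xi> $ 2 * \<eta> $ 1 - \<xi> $ 1 * \<eta> $ 2"

lemma crs_measurable [measurable]: "(\<lambda>z. crs (snd z) (fst z)) \<in> borel_measurable (borel \<Otimes>\<^sub>M borel)"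
  unfolding crs_def by measurable

lemma norm_plane_sq: "(norm (x::plane))\<^sup>2 = (x $ 1)\<^sup>2 + (x $ 2)\<^sup>2"
  by (simp only: power2_norm_eq_inner inner_plane) (simp add: power2_eq_square)

lemma crs_bound: "\<bar>crs \<xi> \<eta>\<bar> \<le> norm \<xi> * norm \<eta>"
proof (rule power2_le_imp_le)
  have "(norm \<xi> * norm \<eta>)\<^sup>2 - (crs \<xi> \<eta>)\<^sup>2 = (\<xi> $ 1 * \<eta> $ 1 + \<xi> $ 2 * \<eta> $ 2)\<^sup>2"
    unfolding power_mult_distrib norm_plane_sq crs_def by (simp add: power2_eq_square algebra_simps)
  thus "\<bar>crs \<xi> \<eta>\<bar>\<^sup>2 \<le> (norm \<xi> * norm \<eta>)\<^sup>2"
    by (metis diff_ge_0_iff_ge power2_abs zero_le_power2)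
qed simp

lemma crs_third: "crs (- \<xi> - \<eta>) \<eta> = - crs \<xi> \<eta>" "crs \<xi> (- \<xi> - \<eta>) = - crs \<xi> \<eta>"
  "crs \<eta> (- \<xi> - \<eta>) = crs \<xi> \<eta>"
  by (simp_all add: crs_def algebra_simps)

text \<open>With x = r/s in (0, 1], two elementary inequalities suffice:
  \<open>x \<le> x powr (1 - p)\<close>, and \<open>1 - x \<le> (1 - x) powr p\<close>. It is
  applied with p = \<beta>-1.\<close>

lemma powr_commutator_bound:
  fixes r s p :: real
  assumes "0 < r" "r \<le> s" "0 < p" "p < 1"
  shows "r * (r powr (p - 1) - s powr (p - 1)) \<le> (s - r) powr p"
proof -
  have s: "s > 0" using assms by simp
  have rs: "0 < r / s" "r / s \<le> 1" using assms s by auto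
  have "r / s = (r / s) powr 1" using rs(1) by (simp only: powr_one)
  also have "\<dots> \<le> (r / s) powr (1 - p)" using rs assms by (intro powr_mono') auto
  finally have 1: "r / s \<le> (r / s) powr (1 - p)" .
  have "r * (r powr (p - 1) - s powr (p - 1)) = r powr p * (1 - (r / s) powr (1 - p))"
  proof -
    have "r * r powr (p - 1) = r powr p" using assms by (simp add: powr_diff)
    moreover have "r * s powr (p - 1) = r powr p * (r / s) powr (1 - p)"
      using assms s by (simp add: powr_divide powr_diff field_simps)
    ultimately show ?thesis by (simp add: algebra_simps)
  qed
  also have "\<dots> \<le> r powr p * (1 - r / s)" using 1 by (intro mult_left_mono) auto
  also have "\<dots> \<le> s powr p * (1 - r / s)"
    using assms rs by (intro mult_right_mono powr_mono2) auto
  also have "\<dots> \<le> s powr p * (1 - r / s) powr p"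
  proof (rule mult_left_mono)
    have "1 - r / s = (1 - r / s) powr 1" using rs by simp
    also have "\<dots> \<le> (1 - r / s) powr p" using rs assms by (intro powr_mono') auto
    finally show "1 - r / s \<le> (1 - r / s) powr p" .
  qed simp
  also have "\<dots> = (s * (1 - r / s)) powr p" using s rs by (simp add: powr_mult)
  also have "s * (1 - r / s) = s - r" using s by (simp add: field_simps)
  finally show ?thesis .
qed

text \<open>The average of the transport symbol and its image under the exchange of \<xi> and
  -\<xi>-\<eta>; by \<open>crs_third\<close> the cross product changes sign, whence the difference.
  The third frequency is written as in the shears so that substitutions match.\<close>

definition kern :: "real \<Rightarrow> plane \<Rightarrow> plane \<Rightarrow> real" where
  "kern \<beta> \<eta> \<xi> = - (1 / 2) * crs \<xi> \<eta> * (norm \<xi> powr (\<beta> - 2) - norm (- \<xi> - \<eta>) powr (\<beta> - 2))"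

text \<open>The commutator gain: antisymmetrisation moves all \<open>\<beta>\<close> derivatives onto the third factor.\<close>

lemma kern_bound:
  assumes \<beta>: "1 < \<beta>" "\<beta> < 2"
  shows "\<bar>kern \<beta> \<eta> \<xi>\<bar> \<le> 1 / 2 * norm \<eta> powr \<beta>"
proof -
  \<comment> \<open>Here \<zeta> is the shorter of the two frequencies. The cross product is
    estimated through \<zeta> and not through \<xi>: this small factor compensates the singular
    power of the norm of \<zeta>.\<close>
  have main: "\<bar>crs \<xi> \<eta>\<bar> * \<bar>norm \<xi> powr (\<beta> - 2) - norm \<zeta> powr (\<beta> - 2)\<bar> \<le> norm \<eta> powr \<beta>"
    if le: "norm \<zeta> \<le> norm \<xi>" "norm \<xi> \<le> norm \<zeta> + norm \<eta>" and cz: "\<bar>crs \<xi> \<eta>\<bar> \<le> norm \<zeta> * norm \<eta>" for \<xi> \<zeta> :: plane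
  proof (cases "norm \<zeta> = 0")
    case True
    \<comment> \<open>At zero frequency the commutator bound does not apply, but the cross product
      vanishes.\<close>
    hence "crs \<xi> \<eta> = 0" using cz by simp
    thus ?thesis by simp
  next
    case False
    hence pos: "norm \<zeta> > 0" by simp
    have "norm \<xi> powr (\<beta> - 2) \<le> norm \<zeta> powr (\<beta> - 2)"
      using pos le(1) \<beta> by (intro powr_mono2') auto
    hence "\<bar>crs \<xi> \<eta>\<bar> * \<bar>norm \<xi> powr (\<beta> - 2) - norm \<zeta> powr (\<beta> - 2)\<bar>
        \<le> (norm \<zeta> * norm \<eta>) * (norm \<zeta> powr (\<beta> - 2) - norm \<xi> powr (\<beta> - 2))"
      by (intro mult_mono cz) auto
    also have "\<dots> = norm \<eta> * (norm \<zeta> * (norm \<zeta> powr ((\<beta> - 1) - 1) - norm \<xi> powr ((\<beta> - 1) - 1)))"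
      by (simp add: mult_ac)
    also have "\<dots> \<le> norm \<eta> * (norm \<xi> - norm \<zeta>) powr (\<beta> - 1)"
      using pos le \<beta> by (intro mult_left_mono powr_commutator_bound) auto
    also have "\<dots> \<le> norm \<eta> * norm \<eta> powr (\<beta> - 1)"
      using le \<beta> by (intro mult_left_mono powr_mono2) auto
    also have "\<dots> = norm \<eta> powr \<beta>" using powr_mult_base[of "norm \<eta>" "\<beta> - 1"] by simp
    finally show ?thesis .
  qed
  let ?\<zeta> = "- \<xi> - \<eta>"
  have n: "norm \<xi> \<le> norm ?\<zeta> + norm \<eta>" "norm ?\<zeta> \<le> norm \<xi> + norm \<eta>"
    using norm_triangle_ineq4[of "- \<xi>" \<eta>] norm_triangle_ineq[of ?\<zeta> \<eta>] by simp_all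
  have c: "\<bar>crs \<xi> \<eta>\<bar> \<le> norm ?\<zeta> * norm \<eta>" "\<bar>crs ?\<zeta> \<eta>\<bar> \<le> norm \<xi> * norm \<eta>"
    using crs_bound[of ?\<zeta> \<eta>] crs_bound[of \<xi> \<eta>] by (simp_all add: crs_third)
  have "\<bar>crs \<xi> \<eta>\<bar> * \<bar>norm \<xi> powr (\<beta> - 2) - norm ?\<zeta> powr (\<beta> - 2)\<bar> \<le> norm \<eta> powr \<beta>"
  proof (cases "norm ?\<zeta> \<le> norm \<xi>")
    case True thus ?thesis using main n c by blast
  next
    case False
    hence "\<bar>crs ?\<zeta> \<eta>\<bar> * \<bar>norm ?\<zeta> powr (\<beta> - 2) - norm \<xi> powr (\<beta> - 2)\<bar> \<le> norm \<eta> powr \<beta>"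
      using n c by (intro main) auto
    thus ?thesis by (simp add: crs_third abs_minus_commute)
  qed
  thus ?thesis by (simp add: kern_def abs_mult)
qed

lemma kern_measurable [measurable]: "(\<lambda>z. kern \<beta> (fst z) (snd z)) \<in> borel_measurable (borel \<Otimes>\<^sub>M borel)"
  unfolding kern_def by measurable

text \<open>
  \<open>tri \<beta> A B C\<close> is the integral of \<open>((u\<^sub>a \<bullet> \<nabla>) c) b\<close>, symmetrised in \<open>a\<close> and \<open>b\<close>, for functions
  \<open>a\<close>, \<open>b\<close>, \<open>c\<close> with transforms \<open>A\<close>, \<open>B\<close>, \<open>C\<close>.
\<close>

definition tri :: "real \<Rightarrow> (plane \<Rightarrow> complex) \<Rightarrow> (plane \<Rightarrow> complex) \<Rightarrow> (plane \<Rightarrow> complex) \<Rightarrow> complex" where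
  "tri \<beta> A B C = 1 / (2 * complex_of_real pi)^4 *
     (LINT z|LL. complex_of_real (kern \<beta> (fst z) (snd z)) * (C (fst z) * (A (snd z) * B (- snd z - fst z))))"

text \<open>A Wiener-type norm: the integral of the transform with weight of order s. For s =
  \<beta> it is the norm in which the third argument of \<open>tri\<close> is measured.\<close>

definition wint :: "real \<Rightarrow> (plane \<Rightarrow> complex) \<Rightarrow> real" where
  "wint s C = (LINT \<eta>|lborel. norm \<eta> powr s * norm (C \<eta>))"

definition wintegrable :: "real \<Rightarrow> (plane \<Rightarrow> complex) \<Rightarrow> bool" where
  "wintegrable s C \<longleftrightarrow> integrable lborel (\<lambda>\<eta>. of_real (norm \<eta> powr s) * C \<eta>)"

context
  fixes \<beta> :: real
  assumes \<beta>: "1 < \<beta>" "\<beta> < 2"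
begin

lemma
  assumes A: "square_integrable A" and B: "square_integrable B"
    and [measurable]: "C \<in> borel_measurable borel" and C: "wintegrable \<beta> C"
  shows tri_integrable: "integrable LL (\<lambda>z. complex_of_real (kern \<beta> (fst z) (snd z)) * (C (fst z) * (A (snd z) * B (- snd z - fst z))))"
    and tri_bound: "norm (tri \<beta> A B C) \<le> wint \<beta> C * L2_norm A * L2_norm B"
proof -
  note [measurable] = sqi_measurable'[OF A] sqi_measurable'[OF B]
  let ?g = "\<lambda>z. of_real (norm (fst z) powr \<beta>) * C (fst z) * (A (snd z) * B (- snd z - fst z))"
  let ?f = "\<lambda>z. complex_of_real (kern \<beta> (fst z) (snd z)) * (C (fst z) * (A (snd z) * B (- snd z - fst z)))"
  have g: "integrable LL ?g"
    by (rule conv_integrable[OF C[unfolded wintegrable_def] A B])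
  have le: "norm (?f z) \<le> norm (?g z)" for z
  proof -
    have "norm (?f z) \<le> (1 / 2 * norm (fst z) powr \<beta>) * norm (C (fst z) * (A (snd z) * B (- snd z - fst z)))"
      unfolding norm_mult[of "of_real _"] norm_of_real by (intro mult_right_mono kern_bound \<beta>) simp
    also have "\<dots> \<le> (norm (fst z) powr \<beta>) * norm (C (fst z) * (A (snd z) * B (- snd z - fst z)))"
      by (intro mult_right_mono) auto
    also have "\<dots> = norm (?g z)" by (simp add: norm_mult)
    finally show ?thesis .
  qed
  show f: "integrable LL ?f"
    by (rule Bochner_Integration.integrable_bound[OF g]) (use le in auto)
  have "norm (LINT z|LL. ?f z) \<le> (LINT z|LL. norm (?g z))"
    by (rule order_trans[OF integral_norm_bound integral_mono]) (use f g le in auto)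
  also have "\<dots> \<le> wint \<beta> C * L2_norm A * L2_norm B"
    using conv_bound[OF C[unfolded wintegrable_def] A B] by (simp add: wint_def norm_mult)
  finally have 1: "norm (LINT z|LL. ?f z) \<le> wint \<beta> C * L2_norm A * L2_norm B" .
  have "1 \<le> (2 * pi) ^ 4" using pi_gt3 by (intro one_le_power) simp
  hence "norm (1 / (2 * pi) ^ 4 :: complex) \<le> 1"
    by (simp add: norm_divide norm_power norm_mult)
  hence "norm (tri \<beta> A B C) \<le> 1 * norm (LINT z|LL. ?f z)"
    unfolding tri_def norm_mult by (intro mult_right_mono) auto
  with 1 show "norm (tri \<beta> A B C) \<le> wint \<beta> C * L2_norm A * L2_norm B" by simp
qed

lemma tri_add1:
  assumes "square_integrable A" "square_integrable A'" "square_integrable B" "C \<in> borel_measurable borel" "wintegrable \<beta> C"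
  shows "tri \<beta> (\<lambda>x. A x + A' x) B C = tri \<beta> A B C + tri \<beta> A' B C"
  using tri_integrable[of A B C] tri_integrable[of A' B C] assms
  by (simp add: tri_def distrib_left distrib_right)

lemma tri_add2:
  assumes "square_integrable A" "square_integrable B" "square_integrable B'" "C \<in> borel_measurable borel" "wintegrable \<beta> C"
  shows "tri \<beta> A (\<lambda>x. B x + B' x) C = tri \<beta> A B C + tri \<beta> A B' C"
  using tri_integrable[of A B C] tri_integrable[of A B' C] assms
  by (simp add: tri_def distrib_left)

lemma tri_add3:
  assumes "square_integrable A" "square_integrable B" "C \<in> borel_measurable borel" "wintegrable \<beta> C"
    "C' \<in> borel_measurable borel" "wintegrable \<beta> C'"
  shows "tri \<beta> A B (\<lambda>x. C x + C' x) = tri \<beta> A B C + tri \<beta> A B C'"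
  using tri_integrable[of A B C] tri_integrable[of A B C'] assms
  by (simp add: tri_def distrib_left distrib_right)

lemma tri_cmult3: "tri \<beta> A B (\<lambda>x. c * C x) = c * tri \<beta> A B C"
  by (simp add: tri_def mult.left_commute[of _ c] mult.assoc[of c])

lemma kern_shear1: "kern \<beta> \<eta> (- \<xi> - \<eta>) = kern \<beta> \<eta> \<xi>"
  by (simp add: kern_def crs_third algebra_simps)

lemma tri_commute:
  assumes A: "square_integrable A" and B: "square_integrable B"
    and C: "C \<in> borel_measurable borel" "wintegrable \<beta> C"
  shows "tri \<beta> A B C = tri \<beta> B A C"
proof -
  have "(LINT z|LL. complex_of_real (kern \<beta> (fst z) (snd z)) * (C (fst z) * (A (snd z) * B (- snd z - fst z))))
      = (LINT z|LL. complex_of_real (kern \<beta> (fst (shear1 z)) (snd (shear1 z))) * (C (fst (shear1 z)) * (A (snd (shear1 z)) * B (- snd (shear1 z) - fst (shear1 z)))))"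
    by (rule integral_shear1[OF tri_integrable[OF A B C], symmetric])
  also have "\<dots> = (LINT z|LL. complex_of_real (kern \<beta> (fst z) (snd z)) * (C (fst z) * (B (snd z) * A (- snd z - fst z))))"
    by (simp add: kern_shear1 mult_ac)
  finally show ?thesis by (simp add: tri_def)
qed

text \<open>The product of three equal factors is invariant under permutations of the frequencies,
  so the integral is a third of the one whose kernel is summed over three arrangements, and that sum
  vanishes identically. It expresses that a flow transporting itself keeps its norm.\<close>

lemma tri_diagonal:
  assumes G: "square_integrable G" "wintegrable \<beta> G"
  shows "tri \<beta> G G G = 0"
proof -
  define f where "f z = complex_of_real (kern \<beta> (fst z) (snd z)) * (G (fst z) * (G (snd z) * G (- snd z - fst z)))" for z
  have m: "G \<in> borel_measurable borel" using sqi_measurable'[OF G(1)] .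
  have f: "integrable LL f" unfolding f_def by (rule tri_integrable[OF G(1) G(1) m G(2)])
  note f2 = integrable_shear2[OF f]
  note f21 = integrable_shear1[OF f2]
  have "f z + f (shear2 z) + f (shear2 (shear1 z)) = 0" for z
  proof -
    have "kern \<beta> (fst z) (snd z) + kern \<beta> (- snd z - fst z) (snd z) + kern \<beta> (snd z) (- snd z - fst z) = 0"
      by (simp add: kern_def crs_def algebra_simps)
    hence "complex_of_real (kern \<beta> (fst z) (snd z) + kern \<beta> (- snd z - fst z) (snd z) + kern \<beta> (snd z) (- snd z - fst z))
        * (G (fst z) * (G (snd z) * G (- snd z - fst z))) = 0" by (simp only:) simp
    thus ?thesis by (simp add: f_def algebra_simps)
  qed
  hence "0 = (LINT z|LL. f z + f (shear2 z) + f (shear2 (shear1 z)))" by simp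
  also have "\<dots> = (LINT z|LL. f z) + (LINT z|LL. f (shear2 z)) + (LINT z|LL. f (shear2 (shear1 z)))"
    using f f2 f21 by simp
  also have "\<dots> = 3 * (LINT z|LL. f z)"
    by (simp add: integral_shear2[OF f] integral_shear1[OF f2])
  finally show ?thesis by (simp add: tri_def f_def)
qed

text \<open>The substitution \<open>shear1\<close> exchanges the two factors \<open>A\<close>.\<close>

lemma transport_symmetrise:
  assumes int: "integrable LL (\<lambda>z. of_real (- crs (snd z) (fst z) * norm (snd z) powr (\<beta> - 2)) * (C (fst z) * (A (snd z) * A (- snd z - fst z))))"
  shows "1 / (2 * complex_of_real pi)^4 * (LINT z|LL. of_real (- crs (snd z) (fst z) * norm (snd z) powr (\<beta> - 2)) * (C (fst z) * (A (snd z) * A (- snd z - fst z))))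
    = tri \<beta> A A C"
proof -
  define f where "f z = complex_of_real (- crs (snd z) (fst z) * norm (snd z) powr (\<beta> - 2)) * (C (fst z) * (A (snd z) * A (- snd z - fst z)))" for z
  have f: "integrable LL f" unfolding f_def by (rule int)
  have "f z + f (shear1 z) = 2 * (complex_of_real (kern \<beta> (fst z) (snd z)) * (C (fst z) * (A (snd z) * A (- snd z - fst z))))" for z
    by (simp add: f_def kern_def crs_third algebra_simps)
  hence "2 * (LINT z|LL. complex_of_real (kern \<beta> (fst z) (snd z)) * (C (fst z) * (A (snd z) * A (- snd z - fst z)))) = (LINT z|LL. f z + f (shear1 z))"
    by simp
  also have "\<dots> = 2 * (LINT z|LL. f z)"
    using f integrable_shear1[OF f] integral_shear1[OF f] by simp
  finally have "(LINT z|LL. complex_of_real (kern \<beta> (fst z) (snd z)) * (C (fst z) * (A (snd z) * A (- snd z - fst z)))) = (LINT z|LL. f z)" by simp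
  thus ?thesis by (simp add: tri_def f_def)
qed

text \<open>The same integral seen with the velocity carried by the smooth factor.\<close>

lemma transport_symmetrise_smooth:
  assumes A: "square_integrable A" and G: "square_integrable G" and wG: "wintegrable \<beta> G"
    and int: "integrable LL (\<lambda>z. of_real (- crs (snd z) (fst z) * norm (fst z) powr (\<beta> - 2)) * (G (fst z) * (A (snd z) * G (- snd z - fst z))))"
  shows "1 / (2 * complex_of_real pi)^4 * (LINT z|LL. of_real (- crs (snd z) (fst z) * norm (fst z) powr (\<beta> - 2)) * (G (fst z) * (A (snd z) * G (- snd z - fst z))))
    = 2 * tri \<beta> A G G"
proof -
  define f where "f z = complex_of_real (- crs (snd z) (fst z) * norm (fst z) powr (\<beta> - 2)) * (G (fst z) * (A (snd z) * G (- snd z - fst z)))" for z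
  define g where "g z = complex_of_real (kern \<beta> (fst z) (snd z)) * (G (fst z) * (A (snd z) * G (- snd z - fst z)))" for z
  have f: "integrable LL f" unfolding f_def by (rule int)
  have g: "integrable LL g"
    unfolding g_def by (rule tri_integrable[OF A G _ wG]) (rule sqi_measurable'[OF G])
  \<comment> \<open>\<open>shear2\<close> exchanges the two factors \<open>G\<close>. On the right
    the powers of the norm of \<xi> cancel between \<open>g\<close> and its image, leaving those of
    \<eta> and -\<xi>-\<eta> as on the left; this 2 is the one in the conclusion.\<close>
  have "f z + f (shear2 z) = 2 * (g z + g (shear2 z))" for z
    by (simp add: f_def g_def kern_def crs_third algebra_simps)
  hence "(LINT z|LL. f z + f (shear2 z)) = (LINT z|LL. 2 * (g z + g (shear2 z)))"
    by (simp only:)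
  also have "\<dots> = 2 * (LINT z|LL. g z + g (shear2 z))"
    by (rule integral_mult_right_zero)
  finally have "(LINT z|LL. f z + f (shear2 z)) = 2 * (LINT z|LL. g z + g (shear2 z))" .
  hence "2 * (LINT z|LL. f z) = 2 * (2 * (LINT z|LL. g z))"
    using f integrable_shear2[OF f] integral_shear2[OF f] g integrable_shear2[OF g] integral_shear2[OF g] by simp
  thus ?thesis by (simp add: tri_def f_def g_def)
qed

lemma tri_continuous:
  assumes sq: "\<forall>\<^sub>F n in F. square_integrable (As n)" "square_integrable A"
    and C: "C \<in> borel_measurable borel" "wintegrable \<beta> C"
    and lim: "((\<lambda>n. L2_norm (\<lambda>x. As n x - A x)) \<longlongrightarrow> 0) F"
  shows "((\<lambda>n. tri \<beta> (As n) (As n) C) \<longlongrightarrow> tri \<beta> A A C) F"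
proof -
  have "((\<lambda>n. tri \<beta> (As n) (As n) C - tri \<beta> A A C) \<longlongrightarrow> 0) F"
  proof (rule Lim_null_comparison)
    show "\<forall>\<^sub>F n in F. norm (tri \<beta> (As n) (As n) C - tri \<beta> A A C)
        \<le> wint \<beta> C * L2_norm (\<lambda>x. As n x - A x) * (L2_norm (As n) + L2_norm A)"
      using sq(1)
    proof eventually_elim
      case (elim n)
      note d = sqi_diff[OF elim sq(2)]
      have "tri \<beta> (\<lambda>x. A x + (As n x - A x)) (As n) C = tri \<beta> A (As n) C + tri \<beta> (\<lambda>x. As n x - A x) (As n) C"
        by (rule tri_add1[OF sq(2) d elim C])
      moreover have "tri \<beta> A (\<lambda>x. A x + (As n x - A x)) C = tri \<beta> A A C + tri \<beta> A (\<lambda>x. As n x - A x) C"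
        by (rule tri_add2[OF sq(2) sq(2) d C])
      ultimately have "tri \<beta> (As n) (As n) C - tri \<beta> A A C = tri \<beta> A (\<lambda>x. As n x - A x) C + tri \<beta> (\<lambda>x. As n x - A x) (As n) C"
        by simp
      also have "norm \<dots> \<le> wint \<beta> C * L2_norm A * L2_norm (\<lambda>x. As n x - A x) + wint \<beta> C * L2_norm (\<lambda>x. As n x - A x) * L2_norm (As n)"
        by (intro norm_triangle_mono tri_bound d sq elim C)
      finally show ?case by (simp add: algebra_simps)
    qed
    have "((\<lambda>n. wint \<beta> C * L2_norm (\<lambda>x. As n x - A x) * (L2_norm (As n) + L2_norm A)) \<longlongrightarrow> wint \<beta> C * 0 * (L2_norm A + L2_norm A)) F"
      by (intro tendsto_intros lim L2_limit_norm sq)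
    thus "((\<lambda>n. wint \<beta> C * L2_norm (\<lambda>x. As n x - A x) * (L2_norm (As n) + L2_norm A)) \<longlongrightarrow> 0) F" by simp
  qed
  thus ?thesis by (simp add: LIM_zero_iff)
qed

end

section \<open>Velocity and transport\<close>

lemma AE_bounded_of_integrable_FT:
  fixes c C :: "plane \<Rightarrow> complex"
  assumes "has_FT c C" "integrable lborel C"
  shows "AE x in lborel. norm (c x) \<le> (LINT \<eta>|lborel. norm (C \<eta>))"
  using FT_inversion_pointwise[OF assms]
proof eventually_elim
  case (elim x)
  have "1 \<le> (2 * pi)\<^sup>2" using pi_gt3 by (intro one_le_power) simp
  hence "1 * norm (c x) \<le> (2 * pi)\<^sup>2 * norm (c x)" by (intro mult_right_mono) auto
  also have "\<dots> = norm ((2 * pi)\<^sup>2 * c x)" by (simp add: norm_mult norm_power)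
  also have "\<dots> \<le> (LINT \<eta>|lborel. norm (cis (x \<bullet> \<eta>) * C \<eta>))"
    unfolding elim by (rule integral_norm_bound)
  finally show ?case by (simp add: norm_mult)
qed

lemma triple_product_integrable:
  fixes a b c C :: "plane \<Rightarrow> complex"
  assumes a: "square_integrable a" and b: "square_integrable b" and C: "has_FT c C" "integrable lborel C"
  shows "integrable lborel (\<lambda>x. a x * b x * c x)"
proof (rule Bochner_Integration.integrable_bound)
  note [measurable] = sqi_measurable'[OF a] sqi_measurable'[OF b] sqi_measurable'[OF has_FT_sqi(1)[OF C(1)]]
  show "integrable lborel (\<lambda>x. (a x * b x) * of_real (LINT \<eta>|lborel. norm (C \<eta>)))"
    by (intro integrable_mult_left sqi_mult_integrable a b)
  show "(\<lambda>x. a x * b x * c x) \<in> borel_measurable lborel" by measurable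
  show "AE x in lborel. norm (a x * b x * c x) \<le> norm ((a x * b x) * of_real (LINT \<eta>|lborel. norm (C \<eta>)))"
    using AE_bounded_of_integrable_FT[OF C]
    by eventually_elim (simp add: norm_mult mult_left_mono)
qed

lemma symbol_measurable [measurable]:
  "Lambda_symbol \<sigma> \<in> borel_measurable borel" "Bessel_symbol \<sigma> \<in> borel_measurable borel"
  "partial_symbol j \<in> borel_measurable borel"
  unfolding Lambda_symbol_def[abs_def] Bessel_symbol_def[abs_def] partial_symbol_def[abs_def]
  by measurable

lemma symbol_Hermitian:
  "Lambda_symbol \<sigma> (- \<xi>) = cnj (Lambda_symbol \<sigma> \<xi>)"
  "partial_symbol j (- \<xi>) = cnj (partial_symbol j \<xi>)"
  by (simp_all add: Lambda_symbol_def partial_symbol_def)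

lemma component_le_norm_plane: "\<bar>(\<xi>::plane) $ j\<bar> \<le> norm \<xi>"
  by (rule component_le_norm_cart)

definition vsym :: "real \<Rightarrow> 2 \<Rightarrow> plane \<Rightarrow> complex" where
  "vsym \<beta> j = (\<lambda>\<xi>. partial_symbol j \<xi> * Lambda_symbol (\<beta> - 2) \<xi>)"

lemma vsym_measurable [measurable]: "vsym \<beta> j \<in> borel_measurable borel"
  unfolding vsym_def by measurable

text \<open>The order \<beta>-1 is positive, so the singularity of \<beta>-2 at low frequency is
  absorbed by the derivative.\<close>

lemma vsym_bound: "norm (vsym \<beta> j \<xi>) \<le> norm \<xi> powr (\<beta> - 1)"
proof -
  have "norm (vsym \<beta> j \<xi>) = \<bar>\<xi> $ j\<bar> * norm \<xi> powr (\<beta> - 2)"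
    by (simp add: vsym_def partial_symbol_def Lambda_symbol_def norm_mult)
  also have "\<dots> \<le> norm \<xi> * norm \<xi> powr (\<beta> - 2)"
    by (intro mult_right_mono component_le_norm_plane) simp
  also have "\<dots> = norm \<xi> powr (\<beta> - 1)" using powr_mult_base[of "norm \<xi>" "\<beta> - 2"] by simp
  finally show ?thesis .
qed

lemma vsym_in_domain:
  assumes f: "square_integrable f" and "square_integrable (\<lambda>\<xi>. of_real (norm \<xi> powr (\<beta> - 1)) * L2_fourier f \<xi>)"
  shows "in_domain (vsym \<beta> j) f"
proof (rule in_domainI[OF f vsym_measurable])
  note [measurable] = sqi_measurable'[OF sqi_L2_fourier[OF f]]
  show "vsym \<beta> j (- \<xi>) = cnj (vsym \<beta> j \<xi>)" for \<xi>
    by (simp add: vsym_def symbol_Hermitian)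
  show "square_integrable (\<lambda>\<xi>. vsym \<beta> j \<xi> * L2_fourier f \<xi>)"
    by (rule sqi_bound[OF assms(2), where K = 1])
      (auto simp: norm_mult intro!: AE_I2 mult_right_mono vsym_bound)
qed

lemma velocity_FT:
  assumes "in_domain (vsym \<beta> 1) f" "in_domain (vsym \<beta> 2) f"
  shows "has_FT (\<lambda>x. complex_of_real (velocity \<beta> f x $ 1)) (\<lambda>\<xi>. vsym \<beta> 2 \<xi> * L2_fourier f \<xi>)"
    and "has_FT (\<lambda>x. complex_of_real (velocity \<beta> f x $ 2)) (\<lambda>\<xi>. - (vsym \<beta> 1 \<xi> * L2_fourier f \<xi>))"
  using has_FT_multiplier_in_domain[OF assms(2) vsym_measurable]
    has_FT_cmult[OF has_FT_multiplier_in_domain[OF assms(1) vsym_measurable], of "-1"]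
  by (simp_all add: velocity_def vsym_def)

text \<open>\<open>C\<close> plays the transform of a potential whose gradient is \<open>V\<close>.
  The two components of the inner product are triple products with \<open>V\<close> as the factor of
  integrable transform; their symbols add up to the cross product.\<close>

lemma
  fixes f b :: "plane \<Rightarrow> real" and V :: "plane \<Rightarrow> plane"
  assumes dom: "in_domain (vsym \<beta> 1) f" "in_domain (vsym \<beta> 2) f" and b: "square_integrable b"
    and V: "\<And>j. has_FT (\<lambda>x. complex_of_real (V x $ j)) (\<lambda>\<eta>. partial_symbol j \<eta> * C \<eta>)"
    and iV: "\<And>j. integrable lborel (\<lambda>\<eta>. partial_symbol j \<eta> * C \<eta>)"
  shows transport_frequency_integrable: "integrable LL (\<lambda>z. of_real (- crs (snd z) (fst z) * norm (snd z) powr (\<beta> - 2))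
       * (C (fst z) * (L2_fourier f (snd z) * L2_fourier b (- snd z - fst z))))" (is "integrable LL ?k")
    and transport_frequency: "complex_of_real (LINT x|lborel. (velocity \<beta> f x \<bullet> V x) * b x)
    = 1 / (2 * complex_of_real pi)^4 * (LINT z|LL. of_real (- crs (snd z) (fst z) * norm (snd z) powr (\<beta> - 2))
       * (C (fst z) * (L2_fourier f (snd z) * L2_fourier b (- snd z - fst z))))"
proof -
  note u = velocity_FT[OF dom]
  note FB = has_FT_L2_fourier[OF b]
  let ?k1 = "\<lambda>z. (partial_symbol 1 (fst z) * C (fst z)) * ((vsym \<beta> 2 (snd z) * L2_fourier f (snd z)) * L2_fourier b (- snd z - fst z))"
  let ?k2 = "\<lambda>z. (partial_symbol 2 (fst z) * C (fst z)) * (- (vsym \<beta> 1 (snd z) * L2_fourier f (snd z)) * L2_fourier b (- snd z - fst z))"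
  have i1: "integrable LL ?k1" and i2: "integrable LL ?k2"
    using conv_integrable[OF iV has_FT_sqi(2)[OF u(1)] has_FT_sqi(2)[OF FB]]
      conv_integrable[OF iV has_FT_sqi(2)[OF u(2)] has_FT_sqi(2)[OF FB]] by blast+
  have k: "?k1 z + ?k2 z = ?k z" for z
    by (simp add: vsym_def partial_symbol_def Lambda_symbol_def crs_def algebra_simps)
  show "integrable LL ?k"
    using Bochner_Integration.integrable_add[OF i1 i2] unfolding k .
  let ?p1 = "\<lambda>x. complex_of_real (velocity \<beta> f x $ 1) * complex_of_real (b x) * complex_of_real (V x $ 1)"
  let ?p2 = "\<lambda>x. complex_of_real (velocity \<beta> f x $ 2) * complex_of_real (b x) * complex_of_real (V x $ 2)"
  have p1: "integrable lborel ?p1" and p2: "integrable lborel ?p2"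
    by (rule triple_product_integrable[OF has_FT_sqi(1)[OF u(1)] has_FT_sqi(1)[OF FB] V iV]
      triple_product_integrable[OF has_FT_sqi(1)[OF u(2)] has_FT_sqi(1)[OF FB] V iV])+
  have "complex_of_real (LINT x|lborel. (velocity \<beta> f x \<bullet> V x) * b x)
      = (LINT x|lborel. complex_of_real ((velocity \<beta> f x \<bullet> V x) * b x))"
    by (rule integral_complex_of_real[symmetric])
  also have "\<dots> = (LINT x|lborel. ?p1 x + ?p2 x)"
    by (intro Bochner_Integration.integral_cong refl) (simp add: inner_plane algebra_simps)
  also have "\<dots> = (LINT x|lborel. ?p1 x) + (LINT x|lborel. ?p2 x)"
    by (rule Bochner_Integration.integral_add[OF p1 p2])
  also have "\<dots> = 1 / (2 * complex_of_real pi)^4 * ((LINT z|LL. ?k1 z) + (LINT z|LL. ?k2 z))"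
    unfolding triple_product_integral[OF u(1) FB V iV] triple_product_integral[OF u(2) FB V iV]
    by (simp only: distrib_left)
  also have "(LINT z|LL. ?k1 z) + (LINT z|LL. ?k2 z) = (LINT z|LL. ?k1 z + ?k2 z)"
    by (rule Bochner_Integration.integral_add[OF i1 i2, symmetric])
  finally show "complex_of_real (LINT x|lborel. (velocity \<beta> f x \<bullet> V x) * b x) = 1 / (2 * complex_of_real pi)^4 * (LINT z|LL. ?k z)"
    unfolding k .
qed

text \<open>The velocity is the factor given an integrable transform, which is why weights of order
  \<beta>-1 occur; \<theta> and the gradient enter only as square integrable functions. So the rough
  function may stand in the last slot.\<close>

lemma transport_smooth:
  fixes g \<theta> :: "plane \<Rightarrow> real"
  assumes \<beta>: "1 < \<beta>" "\<beta> < 2"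
    and dom: "in_domain (vsym \<beta> 1) g" "in_domain (vsym \<beta> 2) g" and \<theta>: "square_integrable \<theta>"
    and grad: "\<And>j. in_domain (partial_symbol j) g"
    and iG: "wintegrable (\<beta> - 1) (L2_fourier g)" "wintegrable \<beta> (L2_fourier g)"
  shows "complex_of_real (LINT x|lborel. (velocity \<beta> g x \<bullet> L2_gradient g x) * \<theta> x)
    = 2 * tri \<beta> (L2_fourier \<theta>) (L2_fourier g) (L2_fourier g)"
proof -
  define G where "G = L2_fourier g"
  have sg: "square_integrable g" by (rule in_domain_sqi[OF dom(1)])
  have sG: "square_integrable G" unfolding G_def by (rule sqi_L2_fourier[OF sg])
  note [measurable] = sqi_measurable'[OF sG]
  note u = velocity_FT[OF dom]
  note FB = has_FT_L2_fourier[OF \<theta>]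
  have V: "has_FT (\<lambda>x. complex_of_real (L2_gradient g x $ j)) (\<lambda>\<eta>. partial_symbol j \<eta> * G \<eta>)" for j
    using has_FT_multiplier_in_domain[OF grad symbol_measurable(3)] by (simp add: L2_gradient_def G_def)
  have iv: "integrable lborel (\<lambda>\<eta>. vsym \<beta> j \<eta> * G \<eta>)" for j
  proof (rule Bochner_Integration.integrable_bound)
    show "integrable lborel (\<lambda>\<eta>. of_real (norm \<eta> powr (\<beta> - 1)) * G \<eta>)"
      using iG(1) by (simp add: wintegrable_def G_def)
    show "AE \<eta> in lborel. norm (vsym \<beta> j \<eta> * G \<eta>) \<le> norm (of_real (norm \<eta> powr (\<beta> - 1)) * G \<eta>)"
      by (rule AE_I2) (auto simp: norm_mult intro!: mult_right_mono vsym_bound)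
  qed simp
  have iv2: "integrable lborel (\<lambda>\<eta>. - (vsym \<beta> 1 \<eta> * G \<eta>))" using iv by simp
  let ?k = "\<lambda>z. of_real (- crs (snd z) (fst z) * norm (fst z) powr (\<beta> - 2)) * (G (fst z) * (L2_fourier \<theta> (snd z) * G (- snd z - fst z)))"
  let ?k1 = "\<lambda>z. (vsym \<beta> 2 (fst z) * G (fst z)) * (L2_fourier \<theta> (snd z) * (partial_symbol 1 (- snd z - fst z) * G (- snd z - fst z)))"
  let ?k2 = "\<lambda>z. - (vsym \<beta> 1 (fst z) * G (fst z)) * (L2_fourier \<theta> (snd z) * (partial_symbol 2 (- snd z - fst z) * G (- snd z - fst z)))"
  have i1: "integrable LL ?k1" and i2: "integrable LL ?k2"
    using conv_integrable[OF iv has_FT_sqi(2)[OF FB] has_FT_sqi(2)[OF V]]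
      conv_integrable[OF iv2 has_FT_sqi(2)[OF FB] has_FT_sqi(2)[OF V]] by blast+
  have k: "?k1 z + ?k2 z = ?k z" for z
    by (simp add: vsym_def partial_symbol_def Lambda_symbol_def crs_def algebra_simps)
  have ik: "integrable LL ?k"
    using Bochner_Integration.integrable_add[OF i1 i2] unfolding k .
  let ?p1 = "\<lambda>x. complex_of_real (\<theta> x) * complex_of_real (L2_gradient g x $ 1) * complex_of_real (velocity \<beta> g x $ 1)"
  let ?p2 = "\<lambda>x. complex_of_real (\<theta> x) * complex_of_real (L2_gradient g x $ 2) * complex_of_real (velocity \<beta> g x $ 2)"
  note u' = u[folded G_def]
  have p1: "integrable lborel ?p1" and p2: "integrable lborel ?p2"
    by (rule triple_product_integrable[OF has_FT_sqi(1)[OF FB] has_FT_sqi(1)[OF V] u'(1) iv]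
      triple_product_integrable[OF has_FT_sqi(1)[OF FB] has_FT_sqi(1)[OF V] u'(2) iv2])+
  have "complex_of_real (LINT x|lborel. (velocity \<beta> g x \<bullet> L2_gradient g x) * \<theta> x)
      = (LINT x|lborel. complex_of_real ((velocity \<beta> g x \<bullet> L2_gradient g x) * \<theta> x))"
    by (rule integral_complex_of_real[symmetric])
  also have "\<dots> = (LINT x|lborel. ?p1 x + ?p2 x)"
    by (intro Bochner_Integration.integral_cong refl) (simp add: inner_plane algebra_simps)
  also have "\<dots> = (LINT x|lborel. ?p1 x) + (LINT x|lborel. ?p2 x)"
    by (rule Bochner_Integration.integral_add[OF p1 p2])
  also have "\<dots> = 1 / (2 * complex_of_real pi)^4 * ((LINT z|LL. ?k1 z) + (LINT z|LL. ?k2 z))"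
    unfolding triple_product_integral[OF FB V u'(1) iv] triple_product_integral[OF FB V u'(2) iv2]
    by (simp only: distrib_left)
  also have "(LINT z|LL. ?k1 z) + (LINT z|LL. ?k2 z) = (LINT z|LL. ?k1 z + ?k2 z)"
    by (rule Bochner_Integration.integral_add[OF i1 i2, symmetric])
  also have "1 / (2 * complex_of_real pi)^4 * \<dots> = 2 * tri \<beta> (L2_fourier \<theta>) G G"
    unfolding k using iG(2) by (intro transport_symmetrise_smooth[OF \<beta> has_FT_sqi(2)[OF FB] sG _ ik]) (simp add: G_def)
  finally show ?thesis by (simp add: G_def)
qed

lemma low_pass_FT:
  assumes \<theta>: "square_integrable \<theta>"
  shows "has_FT (\<lambda>x. complex_of_real (low_pass R \<theta> x)) (\<lambda>\<xi>. indicator (ball 0 R) \<xi> * L2_fourier \<theta> \<xi>)"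
  unfolding low_pass_def
proof (rule has_FT_multiplier_in_domain[OF in_domainI[OF \<theta>]])
  have "square_integrable (\<lambda>\<xi>. indicator (ball 0 R) \<xi> *\<^sub>R L2_fourier \<theta> \<xi>)"
    by (rule sqi_cut[OF sqi_L2_fourier[OF \<theta>]]) simp
  thus "square_integrable (\<lambda>\<xi>. indicator (ball 0 R) \<xi> * L2_fourier \<theta> \<xi>)"
    by (simp add: scaleR_conv_of_real of_real_indicator)
  show "indicator (ball 0 R) (- \<xi>) = cnj (indicator (ball 0 R) \<xi>)" for \<xi> :: plane
    by (simp add: indicator_def)
qed (rule borel_measurable_indicator, simp)+

lemma sqi_low_pass: "square_integrable \<theta> \<Longrightarrow> square_integrable (low_pass R \<theta>)"
  using has_FT_sqi(1)[OF low_pass_FT] by simp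

text \<open>Obtained from continuity along a constant sequence, which avoids carrying an almost
  everywhere equality through the sheared argument on the product space.\<close>

lemma tri_cong_AE:
  assumes A: "square_integrable A" and A': "square_integrable A'" and eq: "AE \<xi> in lborel. A \<xi> = A' \<xi>"
    and \<beta>: "1 < \<beta>" "\<beta> < 2" and C: "C \<in> borel_measurable borel" "wintegrable \<beta> C"
  shows "tri \<beta> A A C = tri \<beta> A' A' C"
proof -
  have "L2_norm (\<lambda>x. A x - A' x) = L2_norm (\<lambda>_::plane. 0::complex)"
    using eq sqi_measurable'[OF A] sqi_measurable'[OF A'] by (intro L2_norm_cong_AE) auto
  hence "(\<lambda>n::nat. L2_norm (\<lambda>x. A x - A' x)) \<longlonglongrightarrow> 0" by simp
  from tri_continuous[OF \<beta> _ A' C this] A have "(\<lambda>n::nat. tri \<beta> A A C) \<longlonglongrightarrow> tri \<beta> A' A' C" by simp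
  thus ?thesis by (simp add: LIMSEQ_const_iff)
qed

text \<open>Each truncation has a square integrable velocity, so its integral equals the symmetrised
  form. That form is continuous on \<open>L2\<close> and the truncations converge there; hence the
  limit defining \<open>transport_integral\<close> exists, although the velocity of \<theta> need
  not be a function.\<close>

lemma transport_integral_eq:
  fixes V :: "plane \<Rightarrow> plane"
  assumes \<beta>: "1 < \<beta>" "\<beta> < 2" and \<theta>: "square_integrable \<theta>"
    and C: "C \<in> borel_measurable borel" "wintegrable \<beta> C"
    and V: "\<And>j. has_FT (\<lambda>x. complex_of_real (V x $ j)) (\<lambda>\<eta>. partial_symbol j \<eta> * C \<eta>)"
    and iV: "\<And>j. integrable lborel (\<lambda>\<eta>. partial_symbol j \<eta> * C \<eta>)"
  shows "transport_integral \<beta> \<theta> V = Re (tri \<beta> (L2_fourier \<theta>) (L2_fourier \<theta>) C)"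
proof -
  let ?cut = "\<lambda>R \<xi>. indicator (ball 0 R) \<xi> * L2_fourier \<theta> \<xi>"
  note s\<theta> = sqi_L2_fourier[OF \<theta>]
  note [measurable] = sqi_measurable'[OF s\<theta>]
  have scut: "square_integrable (?cut R)" for R by (rule has_FT_sqi(2)[OF low_pass_FT[OF \<theta>]])
  have AEcut: "AE \<xi> in lborel. L2_fourier (low_pass R \<theta>) \<xi> = ?cut R \<xi>" for R
    by (rule L2_fourier_AE[OF low_pass_FT[OF \<theta>]])
  have eq: "complex_of_real (LINT x|lborel. (velocity \<beta> (low_pass R \<theta>) x \<bullet> V x) * low_pass R \<theta> x) = tri \<beta> (?cut R) (?cut R) C" for R
  proof -
    let ?f = "low_pass R \<theta>"
    have sf: "square_integrable ?f" by (rule sqi_low_pass[OF \<theta>])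
    note [measurable] = sqi_measurable'[OF sqi_L2_fourier[OF sf]]
    have "square_integrable (\<lambda>\<xi>. of_real (norm \<xi> powr (\<beta> - 1)) * L2_fourier ?f \<xi>)"
    proof (rule sqi_bound[OF sqi_L2_fourier[OF sf], where K = "\<bar>R\<bar> powr (\<beta> - 1)"])
      show "AE \<xi> in lborel. norm (of_real (norm \<xi> powr (\<beta> - 1)) * L2_fourier ?f \<xi>) \<le> \<bar>R\<bar> powr (\<beta> - 1) * norm (L2_fourier ?f \<xi>)"
        using AEcut[of R]
      proof eventually_elim
        case (elim \<xi>)
        show ?case
        proof (cases "norm \<xi> < R")
          case True
          hence "norm \<xi> powr (\<beta> - 1) \<le> \<bar>R\<bar> powr (\<beta> - 1)" using \<beta> by (intro powr_mono2) auto
          thus ?thesis by (simp add: norm_mult mult_right_mono)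
        next
          case False
          hence "L2_fourier ?f \<xi> = 0" using elim by (simp add: indicator_def)
          thus ?thesis by simp
        qed
      qed
    qed measurable
    hence dom: "in_domain (vsym \<beta> 1) ?f" "in_domain (vsym \<beta> 2) ?f"
      using vsym_in_domain[OF sf] by blast+
    have "complex_of_real (LINT x|lborel. (velocity \<beta> ?f x \<bullet> V x) * ?f x) = tri \<beta> (L2_fourier ?f) (L2_fourier ?f) C"
      unfolding transport_frequency[OF dom sf V iV]
      by (rule transport_symmetrise[OF \<beta> transport_frequency_integrable[OF dom sf V iV]])
    also have "\<dots> = tri \<beta> (?cut R) (?cut R) C"
      by (rule tri_cong_AE[OF sqi_L2_fourier[OF sf] scut AEcut \<beta> C])
    finally show ?thesis .
  qed
  have "((\<lambda>R. tri \<beta> (?cut R) (?cut R) C) \<longlongrightarrow> tri \<beta> (L2_fourier \<theta>) (L2_fourier \<theta>) C) at_top"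
  proof (rule tri_continuous[OF \<beta> _ s\<theta> C])
    show "((\<lambda>R. L2_norm (\<lambda>x. ?cut R x - L2_fourier \<theta> x)) \<longlongrightarrow> 0) at_top"
    proof (rule tendsto_at_topI_sequentially)
      fix X :: "nat \<Rightarrow> real" assume X: "filterlim X at_top sequentially"
      show "(\<lambda>n. L2_norm (\<lambda>x. ?cut (X n) x - L2_fourier \<theta> x)) \<longlonglongrightarrow> 0"
      proof (rule L2_dominated[where w = "\<lambda>x. norm (L2_fourier \<theta> x)"])
        show "AE x in lborel. (\<lambda>n. ?cut (X n) x) \<longlonglongrightarrow> L2_fourier \<theta> x"
        proof (rule AE_I2)
          fix x :: plane
          have "\<forall>\<^sub>F n in sequentially. X n > norm x" using X by (simp add: filterlim_at_top_dense)
          hence "\<forall>\<^sub>F n in sequentially. ?cut (X n) x = L2_fourier \<theta> x"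
            by eventually_elim (simp add: indicator_def)
          thus "(\<lambda>n. ?cut (X n) x) \<longlonglongrightarrow> L2_fourier \<theta> x" by (rule tendsto_eventually)
        qed
        show "square_integrable (\<lambda>x. norm (L2_fourier \<theta> x))" by (rule sqi_norm[OF s\<theta>])
      qed (auto simp: indicator_def intro!: AE_I2)
    qed
  qed (use scut in auto)
  hence "((\<lambda>R. Re (tri \<beta> (?cut R) (?cut R) C)) \<longlongrightarrow> Re (tri \<beta> (L2_fourier \<theta>) (L2_fourier \<theta>) C)) at_top"
    by (rule tendsto_Re)
  hence "((\<lambda>R. LINT x|lborel. (velocity \<beta> (low_pass R \<theta>) x \<bullet> V x) * low_pass R \<theta> x) \<longlongrightarrow> Re (tri \<beta> (L2_fourier \<theta>) (L2_fourier \<theta>) C)) at_top"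
    by (simp only: eq[symmetric] Re_complex_of_real)
  thus ?thesis unfolding transport_integral_def by (intro tendsto_Lim) auto
qed

section \<open>Sobolev weights\<close>

text \<open>Comparison with \<open>(1 + \<bar>x\<bar>) powr (- q)\<close>, which has an explicit
  antiderivative on the half line; reflection supplies the other half. The constant
  \<open>2 powr (q / 2)\<close> comes from (1 + |x|)^2 being at most 2 (1 + x^2).\<close>

lemma integrable_bracket_real:
  assumes q: "q > 1"
  shows "integrable lborel (\<lambda>x::real. (1 + x\<^sup>2) powr (- q / 2))"
proof -
  define h where "h x = (1 + x) powr (- q)" for x :: real
  define H where "H x = - ((1 + x) powr (1 - q) / (q - 1))" for x :: real
  have "(\<integral>\<^sup>+x. ennreal (h x) * indicator {0..} x \<partial>lborel) = ennreal (0 - H 0)"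
  proof (rule nn_integral_FTC_atLeast)
    show "h \<in> borel_measurable borel" unfolding h_def by measurable
    show "(H has_real_derivative h x) (at x)" if "0 \<le> x" for x
    proof -
      have "(H has_real_derivative - ((1 - q) * (1 + x) powr (1 - q - 1) / (q - 1))) (at x)"
        unfolding H_def using that q by (auto intro!: derivative_eq_intros)
      also have "- ((1 - q) * (1 + x) powr (1 - q - 1) / (q - 1)) = h x"
        using q by (simp add: h_def field_simps)
      finally show ?thesis .
    qed
    show "0 \<le> h x" for x by (simp add: h_def)
    have "((\<lambda>x. (1 + x) powr (1 - q)) \<longlongrightarrow> 0) at_top"
      using q by (intro tendsto_neg_powr filterlim_tendsto_add_at_top[OF tendsto_const filterlim_ident]) auto
    from tendsto_minus[OF tendsto_divide[OF this tendsto_const[of "q - 1"]]] q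
    show "(H \<longlongrightarrow> 0) at_top" by (simp add: H_def[abs_def])
  qed
  moreover have "(\<integral>\<^sup>+x. ennreal (norm (indicator {0..} x * h x)) \<partial>lborel) = (\<integral>\<^sup>+x. ennreal (h x) * indicator {0..} x \<partial>lborel)"
    by (intro nn_integral_cong) (auto simp: indicator_def h_def)
  ultimately have h1: "integrable lborel (\<lambda>x. indicator {0..} x * h x)"
    by (intro integrableI_bounded) (auto simp: h_def)
  have h2: "integrable lborel (\<lambda>x. indicator {0..} (- x) * h (- x))"
    using integrable_reflect[OF h1] .
  show ?thesis
  proof (rule Bochner_Integration.integrable_bound)
    show "integrable lborel (\<lambda>x. 2 powr (q / 2) * (indicator {0..} x * h x + indicator {0..} (- x) * h (- x)))"
      using h1 h2 by simp
    show "AE x in lborel. norm ((1 + x\<^sup>2) powr (- q / 2)) \<le> norm (2 powr (q / 2) * (indicator {0..} x * h x + indicator {0..} (- x) * h (- x)))"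
    proof (rule AE_I2)
      fix x :: real
      have "(1 + \<bar>x\<bar>)\<^sup>2 \<le> 2 * (1 + x\<^sup>2)"
        using sum_squares_bound[of 1 "\<bar>x\<bar>"] by (simp add: power2_sum)
      hence "(2 * (1 + x\<^sup>2)) powr (- q / 2) \<le> ((1 + \<bar>x\<bar>)\<^sup>2) powr (- q / 2)"
        using q by (intro powr_mono2') auto
      also have "\<dots> = (1 + \<bar>x\<bar>) powr (- q)"
        by (simp add: powr_powr flip: powr_numeral)
      finally have "(2 * (1 + x\<^sup>2)) powr (- q / 2) \<le> (1 + \<bar>x\<bar>) powr - q" .
      have "2 powr (q / 2) * (2 powr (- q / 2) * (1 + x\<^sup>2) powr (- q / 2)) \<le> 2 powr (q / 2) * (1 + \<bar>x\<bar>) powr (- q)"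
      proof (rule mult_left_mono)
        have "(2 * (1 + x\<^sup>2)) powr (- q / 2) = 2 powr (- q / 2) * (1 + x\<^sup>2) powr (- q / 2)"
          by (subst powr_mult) auto
        thus "2 powr (- q / 2) * (1 + x\<^sup>2) powr (- q / 2) \<le> (1 + \<bar>x\<bar>) powr - q"
          using \<open>(2 * (1 + x\<^sup>2)) powr (- q / 2) \<le> (1 + \<bar>x\<bar>) powr - q\<close> by (simp only:)
      qed simp
      hence "(1 + x\<^sup>2) powr (- q / 2) \<le> 2 powr (q / 2) * h \<bar>x\<bar>"
        by (simp add: powr_minus h_def mult.assoc[symmetric] flip: powr_add)
      also have "\<dots> \<le> 2 powr (q / 2) * (indicator {0..} x * h x + indicator {0..} (- x) * h (- x))"
        by (intro mult_left_mono) (auto simp: indicator_def h_def)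
      finally show "norm ((1 + x\<^sup>2) powr (- q / 2)) \<le> norm (2 powr (q / 2) * (indicator {0..} x * h x + indicator {0..} (- x) * h (- x)))"
        by simp
    qed
  qed measurable
qed

text \<open>The square is a product of two equal powers of the bracket, each bounded by the bracket
  of one coordinate; this reduces to a product of one-dimensional integrals. It is applied with q =
  m-\<beta>, so q > 1 is the assumption m > 1+\<beta>.\<close>

lemma sqi_bracket:
  assumes q: "q > 1"
  shows "square_integrable (\<lambda>\<xi>::plane. (1 + (norm \<xi>)\<^sup>2) powr (- q / 2))"
  unfolding square_integrable_def
proof
  have "integrable lborel (\<lambda>\<xi>::plane. complex_of_real ((1 + (\<xi> $ 1)\<^sup>2) powr (- q / 2)) * complex_of_real ((1 + (\<xi> $ 2)\<^sup>2) powr (- q / 2)))"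
    by (intro integrable_plane_product[of "\<lambda>s. complex_of_real ((1 + s\<^sup>2) powr (- q / 2))" "\<lambda>s. complex_of_real ((1 + s\<^sup>2) powr (- q / 2))"]
      integrable_of_real integrable_bracket_real q)
  thus "integrable lborel (\<lambda>\<xi>::plane. (norm ((1 + (norm \<xi>)\<^sup>2) powr (- q / 2)))\<^sup>2)"
  proof (rule Bochner_Integration.integrable_bound)
    show "AE \<xi> in lborel. norm ((norm ((1 + (norm (\<xi>::plane))\<^sup>2) powr (- q / 2)))\<^sup>2)
       \<le> norm (complex_of_real ((1 + (\<xi> $ 1)\<^sup>2) powr (- q / 2)) * complex_of_real ((1 + (\<xi> $ 2)\<^sup>2) powr (- q / 2)))"
    proof (rule AE_I2)
      fix \<xi> :: plane
      have "(1 + (norm \<xi>)\<^sup>2) powr (- q / 2) \<le> (1 + (\<xi> $ j)\<^sup>2) powr (- q / 2)" for j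
        using q component_le_norm_plane[of \<xi> j]
        by (intro powr_mono2') (auto intro!: add_pos_nonneg abs_le_square_iff[THEN iffD1])
      hence "(1 + (norm \<xi>)\<^sup>2) powr (- q / 2) * (1 + (norm \<xi>)\<^sup>2) powr (- q / 2)
          \<le> (1 + (\<xi> $ 1)\<^sup>2) powr (- q / 2) * (1 + (\<xi> $ 2)\<^sup>2) powr (- q / 2)"
        by (intro mult_mono) auto
      thus "norm ((norm ((1 + (norm \<xi>)\<^sup>2) powr (- q / 2)))\<^sup>2)
       \<le> norm (complex_of_real ((1 + (\<xi> $ 1)\<^sup>2) powr (- q / 2)) * complex_of_real ((1 + (\<xi> $ 2)\<^sup>2) powr (- q / 2)))"
        by (simp add: norm_mult power2_eq_square)
    qed
  qed measurable
qed measurable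

text \<open>The Sobolev norm on the Fourier side. It equals \<open>2 * pi\<close> times
  \<open>H_norm\<close> by \<open>hn_H_norm\<close>, and it is exact on pointwise expressions in
  transforms, where \<open>L2_fourier\<close> is linear only almost everywhere.\<close>

definition hn :: "real \<Rightarrow> (plane \<Rightarrow> complex) \<Rightarrow> real" where
  "hn m F = L2_norm (\<lambda>\<xi>. Bessel_symbol m \<xi> * F \<xi>)"

definition Hm :: "real \<Rightarrow> (plane \<Rightarrow> complex) \<Rightarrow> bool" where
  "Hm m F \<longleftrightarrow> F \<in> borel_measurable borel \<and> square_integrable (\<lambda>\<xi>. Bessel_symbol m \<xi> * F \<xi>)"

lemma norm_powr_le_bracket:
  assumes "0 \<le> s" "s \<le> m"
  shows "norm (\<xi>::plane) powr s \<le> (1 + (norm \<xi>)\<^sup>2) powr (m / 2)"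
proof -
  have "norm \<xi> powr s \<le> ((norm \<xi>)\<^sup>2) powr (s / 2)"
    by (cases "\<xi> = 0") (simp_all add: powr_powr flip: powr_numeral)
  also have "\<dots> \<le> (1 + (norm \<xi>)\<^sup>2) powr (s / 2)" using assms by (intro powr_mono2) auto
  also have "\<dots> \<le> (1 + (norm \<xi>)\<^sup>2) powr (m / 2)" using assms by (intro powr_mono) auto
  finally show ?thesis .
qed

lemma norm_Bessel: "norm (Bessel_symbol m \<xi>) = (1 + (norm \<xi>)\<^sup>2) powr (m / 2)"
  by (simp add: Bessel_symbol_def)

lemma
  assumes F: "Hm m F" and p [measurable]: "p \<in> borel_measurable borel"
    and le: "\<And>\<xi>. norm (p \<xi>) \<le> (1 + (norm \<xi>)\<^sup>2) powr (m / 2)"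
  shows Hm_sqi_symbol: "square_integrable (\<lambda>\<xi>. p \<xi> * F \<xi>)"
    and Hm_norm_symbol: "L2_norm (\<lambda>\<xi>. p \<xi> * F \<xi>) \<le> hn m F"
proof -
  have [measurable]: "F \<in> borel_measurable borel" and sq: "square_integrable (\<lambda>\<xi>. Bessel_symbol m \<xi> * F \<xi>)"
    using F by (auto simp: Hm_def)
  have ae: "norm (p \<xi> * F \<xi>) \<le> norm (Bessel_symbol m \<xi> * F \<xi>)" for \<xi>
    unfolding norm_mult norm_Bessel by (intro mult_right_mono le) simp
  show sq': "square_integrable (\<lambda>\<xi>. p \<xi> * F \<xi>)"
    by (rule sqi_bound[OF sq, where K = 1]) (use ae in auto)
  show "L2_norm (\<lambda>\<xi>. p \<xi> * F \<xi>) \<le> hn m F"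
    unfolding hn_def by (rule L2_norm_mono[OF sq' sq]) (use ae in auto)
qed

lemma
  assumes F: "Hm m F" and m: "m \<ge> 0"
  shows Hm_sqi: "square_integrable F" and Hm_norm: "L2_norm F \<le> hn m F"
proof -
  have "norm (1::complex) \<le> (1 + (norm \<xi>)\<^sup>2) powr (m / 2)" for \<xi> :: plane
    using m by (simp add: ge_one_powr_ge_zero)
  from Hm_sqi_symbol[OF F _ this] Hm_norm_symbol[OF F _ this]
  show "square_integrable F" "L2_norm F \<le> hn m F" by simp_all
qed

definition wK :: "real \<Rightarrow> real" where
  "wK q = L2_norm (\<lambda>\<xi>::plane. (1 + (norm \<xi>)\<^sup>2) powr (- q / 2))"

text \<open>The weight of order s is at most the bracket of order \<beta>, which splits into the
  brackets of orders -(m-\<beta>) and m; Cauchy-Schwarz then gives \<open>wK (m - \<beta>)\<close>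
  as the norm of the first.\<close>

lemma
  assumes F: "Hm m F" and s: "0 \<le> s" "s \<le> \<beta>" and m: "m > 1 + \<beta>"
  shows Hm_wintegrable: "wintegrable s F" and Hm_wint: "wint s F \<le> wK (m - \<beta>) * hn m F"
proof -
  have [measurable]: "F \<in> borel_measurable borel" and sq: "square_integrable (\<lambda>\<xi>. Bessel_symbol m \<xi> * F \<xi>)"
    using F by (auto simp: Hm_def)
  have sb: "square_integrable (\<lambda>\<xi>::plane. (1 + (norm \<xi>)\<^sup>2) powr (- (m - \<beta>) / 2))"
    by (rule sqi_bracket) (use m in simp)
  let ?g = "\<lambda>\<xi>::plane. (1 + (norm \<xi>)\<^sup>2) powr (- (m - \<beta>) / 2) * norm (Bessel_symbol m \<xi> * F \<xi>)"
  have g: "integrable lborel ?g" by (rule sqi_mult_integrable[OF sb sqi_norm[OF sq]])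
  have le: "norm \<xi> powr s * norm (F \<xi>) \<le> ?g \<xi>" for \<xi>
  proof -
    have "norm \<xi> powr s \<le> (1 + (norm \<xi>)\<^sup>2) powr (\<beta> / 2)"
      using s by (rule norm_powr_le_bracket)
    also have "\<dots> = (1 + (norm \<xi>)\<^sup>2) powr (- (m - \<beta>) / 2) * (1 + (norm \<xi>)\<^sup>2) powr (m / 2)"
      by (simp add: field_simps flip: powr_add)
    finally have "norm \<xi> powr s * norm (F \<xi>) \<le> (1 + (norm \<xi>)\<^sup>2) powr (- (m - \<beta>) / 2) * (1 + (norm \<xi>)\<^sup>2) powr (m / 2) * norm (F \<xi>)"
      by (intro mult_right_mono) auto
    thus ?thesis by (simp add: norm_mult norm_Bessel mult.assoc)
  qed
  show w: "wintegrable s F"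
    unfolding wintegrable_def
    by (rule Bochner_Integration.integrable_bound[OF g]) (use le in \<open>auto simp: norm_mult intro!: AE_I2\<close>)
  have "wint s F \<le> (LINT \<xi>|lborel. ?g \<xi>)"
    unfolding wint_def using integrable_norm[OF w[unfolded wintegrable_def]] le
    by (intro integral_mono g) (auto simp: norm_mult)
  also have "\<dots> \<le> wK (m - \<beta>) * hn m F"
    using L2_Cauchy_Schwarz[OF sb sq] by (simp add: wK_def hn_def)
  finally show "wint s F \<le> wK (m - \<beta>) * hn m F" .
qed

section \<open>Smooth functions\<close>

definition smooth :: "('a::real_normed_vector \<Rightarrow> real) \<Rightarrow> bool" where
  "smooth f \<longleftrightarrow> (\<forall>k. C_class k f)"

lemma C_class_Suc_imp: "C_class (Suc k) f \<Longrightarrow> C_class k f"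
proof (induction k arbitrary: f)
  case 0
  hence "\<forall>z. f differentiable (at z)" by simp
  thus ?case
    by (auto simp: continuous_on_eq_continuous_at intro: differentiable_imp_continuous_within)
next
  case (Suc k)
  have "C_class k (\<lambda>z. frechet_derivative f (at z) v)" for v
    by (rule Suc.IH) (use Suc.prems in simp)
  thus ?case using Suc.prems by simp
qed

lemma C_class_SucI:
  assumes "\<And>z. (f has_derivative f' z) (at z)" "\<And>v. C_class k (\<lambda>z. f' z v)"
  shows "C_class (Suc k) f"
proof -
  have "frechet_derivative f (at z) = f' z" for z
    using frechet_derivative_at[OF assms(1)] by simp
  thus ?thesis using assms by (auto simp: differentiable_def)
qed

lemma C_class_has_derivative:
  "C_class (Suc k) f \<Longrightarrow> (f has_derivative frechet_derivative f (at z)) (at z)"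
  by (simp add: frechet_derivative_works[symmetric])

lemma C_class_const: "C_class k (\<lambda>_. c)"
proof (induction k arbitrary: c)
  case (Suc k)
  show ?case by (rule C_class_SucI[where f' = "\<lambda>z v. 0"]) (auto intro: Suc)
qed simp

lemma C_class_add: "C_class k f \<Longrightarrow> C_class k g \<Longrightarrow> C_class k (\<lambda>z. f z + g z)"
proof (induction k arbitrary: f g)
  case 0 thus ?case by (auto intro: continuous_on_add)
next
  case (Suc k)
  show ?case
    by (rule C_class_SucI[OF has_derivative_add[OF C_class_has_derivative[OF Suc.prems(1)] C_class_has_derivative[OF Suc.prems(2)]]])
      (use Suc in simp)
qed

lemma C_class_mult: "C_class k f \<Longrightarrow> C_class k g \<Longrightarrow> C_class k (\<lambda>z. f z * g z)"
proof (induction k arbitrary: f g)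
  case 0 thus ?case by (auto intro: continuous_on_mult)
next
  case (Suc k)
  show ?case
    by (rule C_class_SucI[OF has_derivative_mult[OF C_class_has_derivative[OF Suc.prems(1)] C_class_has_derivative[OF Suc.prems(2)]]])
      (intro C_class_add Suc.IH C_class_Suc_imp[OF Suc.prems(1)] C_class_Suc_imp[OF Suc.prems(2)], use Suc.prems in auto)
qed

lemma C_class_inverse:
  assumes "\<And>z. f z \<noteq> 0"
  shows "C_class k f \<Longrightarrow> C_class k (\<lambda>z. inverse (f z))"
proof (induction k)
  case 0 thus ?case using assms by (auto intro: continuous_on_inverse)
next
  case (Suc k)
  have inv: "C_class k (\<lambda>z. inverse (f z))" by (rule Suc.IH[OF C_class_Suc_imp[OF Suc.prems]])
  show ?case
  proof (rule C_class_SucI[OF Deriv.has_derivative_inverse[OF assms C_class_has_derivative[OF Suc.prems]]])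
    fix v
    have "C_class k (\<lambda>z. (-1) * (inverse (f z) * frechet_derivative f (at z) v * inverse (f z)))"
      by (intro C_class_mult C_class_const inv) (use Suc.prems in simp)
    thus "C_class k (\<lambda>z. - (inverse (f z) * frechet_derivative f (at z) v * inverse (f z)))" by simp
  qed
qed

lemma C_class_compose_affine:
  assumes l: "bounded_linear l"
  shows "C_class k f \<Longrightarrow> C_class k (\<lambda>z. f (l z + c))"
proof (induction k arbitrary: f)
  case 0
  have "continuous_on UNIV (\<lambda>z. l z + c)"
    by (intro continuous_intros linear_continuous_on l)
  from continuous_on_compose2[OF _ this, of UNIV f] 0 show ?case by auto
next
  case (Suc k)
  have aff: "((\<lambda>z. l z + c) has_derivative l) (at z)" for z
    using has_derivative_add[OF bounded_linear_imp_has_derivative[OF l] has_derivative_const] by simp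
  show ?case
  proof (rule C_class_SucI)
    show "((\<lambda>z. f (l z + c)) has_derivative (\<lambda>v. frechet_derivative f (at (l z + c)) (l v))) (at z)" for z
      by (rule has_derivative_compose[OF aff C_class_has_derivative[OF Suc.prems]])
    show "C_class k (\<lambda>z. frechet_derivative f (at (l z + c)) (l v))" for v
      by (rule Suc.IH) (use Suc.prems in simp)
  qed
qed

lemma smooth_add: "smooth f \<Longrightarrow> smooth g \<Longrightarrow> smooth (\<lambda>z. f z + g z)"
  by (simp add: smooth_def C_class_add)

lemma smooth_mult: "smooth f \<Longrightarrow> smooth g \<Longrightarrow> smooth (\<lambda>z. f z * g z)"
  by (simp add: smooth_def C_class_mult)

lemma smooth_const: "smooth (\<lambda>_. c)"
  by (simp add: smooth_def C_class_const)

lemma smooth_diff: "smooth f \<Longrightarrow> smooth g \<Longrightarrow> smooth (\<lambda>z. f z - g z)"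
  using smooth_add[OF _ smooth_mult[OF smooth_const[of "-1"]], of f g] by simp

lemma smooth_compose_affine: "bounded_linear l \<Longrightarrow> smooth f \<Longrightarrow> smooth (\<lambda>z. f (l z + c))"
  by (simp add: smooth_def C_class_compose_affine)

lemma smooth_has_derivative: "smooth f \<Longrightarrow> (f has_derivative frechet_derivative f (at z)) (at z)"
  unfolding smooth_def by (rule C_class_has_derivative) blast

lemma smooth_frechet: "smooth f \<Longrightarrow> smooth (\<lambda>z. frechet_derivative f (at z) v)"
  unfolding smooth_def by (metis C_class.simps(2))

lemma smooth_continuous: "smooth f \<Longrightarrow> continuous_on UNIV f"
  unfolding smooth_def by (metis C_class.simps(1))

lemma smooth_borel: "smooth f \<Longrightarrow> f \<in> borel_measurable borel"
  by (rule borel_measurable_continuous_onI[OF smooth_continuous])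

lemma smooth_deriv:
  fixes f :: "real \<Rightarrow> real"
  assumes "smooth f"
  shows "(f has_real_derivative frechet_derivative f (at x) 1) (at x)"
proof -
  have d: "(f has_derivative frechet_derivative f (at x)) (at x)" by (rule smooth_has_derivative[OF assms])
  define c where "c = frechet_derivative f (at x) 1"
  have eq: "frechet_derivative f (at x) = (\<lambda>v. c * v)"
  proof
    fix v
    show "frechet_derivative f (at x) v = c * v"
      using linear_scale[OF has_derivative_linear[OF d], of v 1] by (simp add: c_def)
  qed
  from d[unfolded eq] show ?thesis unfolding has_field_derivative_def c_def[symmetric] .
qed

lemma frechet_real:
  fixes f :: "real \<Rightarrow> real"
  assumes "(f has_real_derivative f') (at x)"
  shows "frechet_derivative f (at x) 1 = f'"
  using frechet_derivative_at[OF assms[unfolded has_field_derivative_def]] by (metis mult.right_neutral)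

text \<open>A family containing the classical flat function exp(-1/x) and closed under
  differentiation: with y = 1/x, the polynomial p becomes y^2 (p - p'). Smoothness then follows by
  induction over all p at once.\<close>

definition flat :: "real poly \<Rightarrow> real \<Rightarrow> real" where
  "flat p x = (if x > 0 then poly p (1 / x) * exp (- (1 / x)) else 0)"

lemma poly_exp_tendsto_0: "((\<lambda>y. poly p y * exp (- y)) \<longlongrightarrow> 0) at_top" for p :: "real poly"
proof -
  have "((\<lambda>y. \<Sum>i\<le>degree p. coeff p i * (y ^ i / exp y)) \<longlongrightarrow> (\<Sum>i\<le>degree p. coeff p i * 0)) at_top"
    by (intro tendsto_sum tendsto_mult tendsto_const tendsto_power_div_exp_0)
  thus ?thesis by (simp add: poly_altdef sum_distrib_right exp_minus divide_inverse mult.assoc)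
qed

lemma flat_has_derivative: "(flat p has_real_derivative flat ([:0, 0, 1:] * (p - pderiv p)) x) (at x)"
proof -
  let ?q = "[:0, 0, 1:] * (p - pderiv p)"
  consider "x > 0" | "x < 0" | "x = 0" by linarith
  thus ?thesis
  proof cases
    case 1
    have "((\<lambda>x. poly p (1 / x) * exp (- (1 / x))) has_real_derivative flat ?q x) (at x)"
      using 1 by (auto intro!: derivative_eq_intros simp: flat_def power2_eq_square field_simps)
    thus ?thesis
      by (rule has_field_derivative_transform_within_open[of _ _ _ "{0<..}"])
        (use 1 in \<open>auto simp: flat_def\<close>)
  next
    case 2
    have "((\<lambda>x. 0) has_real_derivative 0) (at x)" by simp
    hence "(flat p has_real_derivative 0) (at x)"
      by (rule has_field_derivative_transform_within_open[of _ _ _ "{..<0}"])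
        (use 2 in \<open>auto simp: flat_def\<close>)
    thus ?thesis using 2 by (simp add: flat_def)
  next
    case 3
    have r: "((\<lambda>h. flat p h / h) \<longlongrightarrow> 0) (at_right 0)"
    proof -
      \<comment> \<open>Dividing by h multiplies the polynomial in 1/h by its variable, and the
        exponential still wins.\<close>
      have "((\<lambda>h. poly ([:0, 1:] * p) (inverse h) * exp (- inverse h)) \<longlongrightarrow> 0) (at_right 0)"
        by (rule filterlim_compose[OF poly_exp_tendsto_0 filterlim_inverse_at_top_right])
      moreover have "\<forall>\<^sub>F h in at_right (0::real). poly ([:0, 1:] * p) (inverse h) * exp (- inverse h) = flat p h / h"
        by (rule eventually_at_right_less[THEN eventually_mono]) (simp add: flat_def field_simps)
      ultimately show ?thesis by (rule Lim_transform_eventually)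
    qed
    have l: "((\<lambda>h. flat p h / h) \<longlongrightarrow> 0) (at_left 0)"
    proof (rule tendsto_eventually)
      show "\<forall>\<^sub>F h in at_left (0::real). flat p h / h = 0"
        using eventually_at_left_real[of "-1" 0] by (rule eventually_mono) (auto simp: flat_def)
    qed
    have "((\<lambda>h. (flat p (0 + h) - flat p 0) / h) \<longlongrightarrow> 0) (at 0)"
      using filterlim_split_at[OF l r] by (simp add: flat_def)
    hence "(flat p has_real_derivative 0) (at 0)" by (simp add: DERIV_def)
    thus ?thesis using 3 by (simp add: flat_def)
  qed
qed

lemma smooth_flat: "smooth (flat p)"
  unfolding smooth_def
proof
  fix k
  show "C_class k (flat p)"
  proof (induction k arbitrary: p)
    case 0
    show ?case
      using flat_has_derivative by (auto simp: continuous_on_eq_continuous_at intro: DERIV_isCont)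
  next
    case (Suc k)
    show ?case
    proof (rule C_class_SucI)
      show "(flat p has_derivative (*) (flat ([:0, 0, 1:] * (p - pderiv p)) z)) (at z)" for z
        using flat_has_derivative[of p z] by (simp add: has_field_derivative_def)
      show "C_class k (\<lambda>z. flat ([:0, 0, 1:] * (p - pderiv p)) z * v)" for v
        by (intro C_class_mult C_class_const Suc)
    qed
  qed
qed

text \<open>A smooth step from 0 on the left of -1 to 1 on the right of 1; its derivative is a
  mollifier with integral 1. The denominator is positive since 1+x and 1-x are never both
  nonpositive.\<close>

definition cutoff :: "real \<Rightarrow> real" where
  "cutoff x = flat 1 (1 + x) * inverse (flat 1 (1 + x) + flat 1 (1 - x))"

lemma flat1_nonneg: "flat 1 x \<ge> 0"
  by (simp add: flat_def)

lemma flat1_pos: "x > 0 \<Longrightarrow> flat 1 x > 0"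
  by (simp add: flat_def)

lemma cutoff_denominator: "flat 1 (1 + x) + flat 1 (1 - x) > 0"
proof (cases "1 + x > 0")
  case True thus ?thesis using flat1_pos[of "1 + x"] flat1_nonneg[of "1 - x"] by linarith
next
  case False
  hence "1 - x > 0" by simp
  thus ?thesis using flat1_pos[of "1 - x"] flat1_nonneg[of "1 + x"] by linarith
qed

lemma smooth_cutoff: "smooth cutoff"
proof -
  have a: "smooth (\<lambda>x. flat 1 (x + 1))"
    using smooth_compose_affine[OF bounded_linear_ident smooth_flat] by simp
  have b: "smooth (\<lambda>x. flat 1 (- x + 1))"
    using smooth_compose_affine[OF bounded_linear_minus[OF bounded_linear_ident] smooth_flat] by simp
  have s: "smooth (\<lambda>x. inverse (flat 1 (x + 1) + flat 1 (- x + 1)))"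
    unfolding smooth_def
  proof
    fix k
    show "C_class k (\<lambda>x. inverse (flat 1 (x + 1) + flat 1 (- x + 1)))"
    proof (rule C_class_inverse)
      show "flat 1 (z + 1) + flat 1 (- z + 1) \<noteq> 0" for z
        using cutoff_denominator[of z] by (simp add: add.commute)
      show "C_class k (\<lambda>x. flat 1 (x + 1) + flat 1 (- x + 1))"
        using smooth_add[OF a b] by (simp add: smooth_def)
    qed
  qed
  have "cutoff = (\<lambda>x. flat 1 (x + 1) * inverse (flat 1 (x + 1) + flat 1 (- x + 1)))"
    by (simp add: cutoff_def fun_eq_iff add.commute)
  with smooth_mult[OF a s] show ?thesis by (simp only:)
qed

lemma cutoff_0: "x \<le> -1 \<Longrightarrow> cutoff x = 0"
  by (simp add: cutoff_def flat_def)

lemma cutoff_1: "x \<ge> 1 \<Longrightarrow> cutoff x = 1"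
  using cutoff_denominator[of x] by (simp add: cutoff_def flat_def)

definition cutoff' :: "real \<Rightarrow> real" where
  "cutoff' x = frechet_derivative cutoff (at x) 1"

lemma cutoff_deriv: "(cutoff has_real_derivative cutoff' x) (at x)"
  unfolding cutoff'_def by (rule smooth_deriv[OF smooth_cutoff])

lemma smooth_cutoff': "smooth cutoff'"
  unfolding cutoff'_def[abs_def] by (rule smooth_frechet[OF smooth_cutoff])

lemma cutoff'_0: "\<bar>x\<bar> > 1 \<Longrightarrow> cutoff' x = 0"
proof -
  assume "\<bar>x\<bar> > 1"
  then consider "x < -1" | "x > 1" by linarith
  thus ?thesis
  proof cases
    case 1
    have "((\<lambda>x. 0) has_real_derivative 0) (at x)" by simp
    hence "(cutoff has_real_derivative 0) (at x)"
      by (rule has_field_derivative_transform_within_open[of _ _ _ "{..<-1}"])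
        (use 1 in \<open>auto simp: cutoff_0\<close>)
    thus ?thesis using cutoff_deriv DERIV_unique by blast
  next
    case 2
    have "((\<lambda>x. 1) has_real_derivative 0) (at x)" by simp
    hence "(cutoff has_real_derivative 0) (at x)"
      by (rule has_field_derivative_transform_within_open[of _ _ _ "{1<..}"])
        (use 2 in \<open>auto simp: cutoff_1\<close>)
    thus ?thesis using cutoff_deriv DERIV_unique by blast
  qed
qed

section \<open>Fourier transforms of smooth compactly supported functions on the line\<close>

definition cs :: "(real \<Rightarrow> real) \<Rightarrow> bool" where
  "cs f \<longleftrightarrow> smooth f \<and> (\<exists>R. \<forall>x. \<bar>x\<bar> > R \<longrightarrow> f x = 0)"

lemma cs_smooth: "cs f \<Longrightarrow> smooth f"
  by (simp add: cs_def)

lemma cs_integrable: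
  assumes "cs f" shows "integrable lborel f"
proof -
  obtain R where R: "\<And>x. \<bar>x\<bar> > R \<Longrightarrow> f x = 0" using assms by (auto simp: cs_def)
  have "integrable lborel (\<lambda>x. indicator {-R..R} x *\<^sub>R f x)"
    by (intro borel_integrable_compact) (auto intro: continuous_on_subset[OF smooth_continuous[OF cs_smooth[OF assms]]])
  moreover have "indicator {-R..R} x *\<^sub>R f x = f x" for x
    using R[of x] by (cases "\<bar>x\<bar> > R") (auto simp: indicator_def)
  ultimately show ?thesis by (simp only:)
qed

lemma cs_mult: "cs f \<Longrightarrow> smooth g \<Longrightarrow> cs (\<lambda>x. f x * g x)"
  unfolding cs_def by (metis mult_zero_left smooth_mult)

definition F1 :: "(real \<Rightarrow> real) \<Rightarrow> real \<Rightarrow> complex" where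
  "F1 f t = (LINT x|lborel. cis (- (x * t)) * of_real (f x))"

lemma F1_integrable: "cs f \<Longrightarrow> integrable lborel (\<lambda>x. cis (- (x * t)) * of_real (f x))"
  by (intro integrable_cis_mult integrable_of_real cs_integrable) auto

lemma F1_measurable [measurable]: "cs f \<Longrightarrow> F1 f \<in> borel_measurable borel"
proof -
  assume "cs f"
  note [measurable] = smooth_borel[OF cs_smooth[OF this]]
  have "(\<lambda>t. LINT x|lborel. cis (- (x * t)) * of_real (f x)) \<in> borel_measurable borel"
    by (intro lborel.borel_measurable_lebesgue_integral) measurable
  thus ?thesis by (simp add: F1_def[abs_def])
qed

lemma cs_deriv:
  assumes "cs f" "\<And>x. (f has_real_derivative f' x) (at x)"
  shows "cs f'"
proof -
  have f': "f' = (\<lambda>x. frechet_derivative f (at x) 1)"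
    using frechet_real[OF assms(2)] by auto
  obtain R where R: "\<And>x. \<bar>x\<bar> > R \<Longrightarrow> f x = 0" using assms(1) by (auto simp: cs_def)
  have "f' x = 0" if "\<bar>x\<bar> > R" for x
  proof -
    have op: "open {x::real. \<bar>x\<bar> > R}" by (intro open_Collect_less continuous_intros)
    have "((\<lambda>x. 0) has_real_derivative 0) (at x)" by simp
    hence "(f has_real_derivative 0) (at x)"
      by (rule has_field_derivative_transform_within_open[OF _ op]) (use that R in auto)
    with assms(2) show ?thesis using DERIV_unique by blast
  qed
  moreover have "smooth f'" unfolding f' by (rule smooth_frechet[OF cs_smooth[OF assms(1)]])
  ultimately show ?thesis by (auto simp: cs_def)
qed

text \<open>Integration by parts: the fundamental theorem is applied to phase times \<open>f\<close>
  on an interval whose end points lie outside the support.\<close>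

lemma F1_deriv:
  assumes f: "cs f" and d: "\<And>x. (f has_real_derivative f' x) (at x)"
  shows "F1 f' t = \<i> * of_real t * F1 f t"
proof -
  have f': "cs f'" by (rule cs_deriv[OF f d])
  obtain R where R: "\<And>x. \<bar>x\<bar> > R \<Longrightarrow> f x = 0" using f by (auto simp: cs_def)
  obtain R' where R': "\<And>x. \<bar>x\<bar> > R' \<Longrightarrow> f' x = 0" using f' by (auto simp: cs_def)
  define B where "B = \<bar>R\<bar> + \<bar>R'\<bar> + 1"
  define g where "g x = cis (- (x * t)) * of_real (f' x) - \<i> * of_real t * (cis (- (x * t)) * of_real (f x))" for x
  define G where "G x = cis (- (x * t)) * of_real (f x)" for x
  have cf: "continuous_on UNIV f" "continuous_on UNIV f'"
    using smooth_continuous[OF cs_smooth] f f' by auto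
  have "has_bochner_integral lborel (\<lambda>x. indicator {-B..B} x *\<^sub>R g x) (G B - G (- B))"
  proof (rule has_bochner_integral_FTC_Icc)
    show "- B \<le> B" by (simp add: B_def)
    fix x
    have "((\<lambda>x. cis (- (x * t))) has_vector_derivative (- t) *\<^sub>R (\<i> * cis (- (x * t)))) (at x within {-B..B})"
    proof -
      have "((\<lambda>x. - (x * t)) has_real_derivative - t) (at x within {-B..B})"
        by (auto intro!: derivative_eq_intros)
      from has_derivative_cis[OF this[unfolded has_field_derivative_def]]
      show ?thesis by (simp add: has_vector_derivative_def mult_ac scaleR_conv_of_real)
    qed
    moreover have "((\<lambda>x. complex_of_real (f x)) has_vector_derivative of_real (f' x)) (at x within {-B..B})"
      by (rule has_vector_derivative_of_real[OF has_field_derivative_at_within[OF d]])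
    ultimately have "(G has_vector_derivative cis (- (x * t)) * of_real (f' x) + (- t) *\<^sub>R (\<i> * cis (- (x * t))) * of_real (f x)) (at x within {-B..B})"
      unfolding G_def by (rule has_vector_derivative_mult)
    thus "(G has_vector_derivative g x) (at x within {-B..B})"
      by (simp add: g_def scaleR_conv_of_real mult_ac)
  next
    show "continuous_on {-B..B} g"
      unfolding g_def cis_conv_exp
      by (intro continuous_intros continuous_on_subset[OF cf(1)] continuous_on_subset[OF cf(2)]) auto
  qed
  hence "(LINT x|lborel. indicator {-B..B} x *\<^sub>R g x) = G B - G (- B)"
    by (rule has_bochner_integral_integral_eq)
  also have "\<dots> = 0" using R[of B] R[of "- B"] by (simp add: G_def B_def)
  also have "(\<lambda>x. indicator {-B..B} x *\<^sub>R g x) = g"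
  proof
    fix x
    have "g x = 0" if "x \<notin> {-B..B}"
    proof -
      have "\<bar>x\<bar> > R" "\<bar>x\<bar> > R'" using that by (auto simp: B_def)
      thus ?thesis using R R' by (simp add: g_def)
    qed
    thus "indicator {-B..B} x *\<^sub>R g x = g x" by (auto simp: indicator_def)
  qed
  finally have "(LINT x|lborel. g x) = 0" .
  thus ?thesis using F1_integrable[OF f] F1_integrable[OF f'] by (simp add: g_def F1_def)
qed

lemma cs_diff: "cs f \<Longrightarrow> cs g \<Longrightarrow> cs (\<lambda>x. f x - g x)"
proof -
  assume "cs f" "cs g"
  then obtain R R' where "\<forall>x. \<bar>x\<bar> > R \<longrightarrow> f x = 0" "\<forall>x. \<bar>x\<bar> > R' \<longrightarrow> g x = 0" "smooth f" "smooth g"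
    by (auto simp: cs_def)
  hence "smooth (\<lambda>x. f x - g x) \<and> (\<forall>x. \<bar>x\<bar> > max R R' \<longrightarrow> f x - g x = 0)"
    by (simp add: smooth_diff)
  thus ?thesis unfolding cs_def by blast
qed

lemma F1_diff: "cs f \<Longrightarrow> cs g \<Longrightarrow> F1 (\<lambda>x. f x - g x) t = F1 f t - F1 g t"
  using F1_integrable[of f t] F1_integrable[of g t] by (simp add: F1_def right_diff_distrib)

lemma F1_bounded: "cs f \<Longrightarrow> norm (F1 f t) \<le> (LINT x|lborel. \<bar>f x\<bar>)"
proof -
  have "norm (F1 f t) \<le> (LINT x|lborel. norm (cis (- (x * t)) * of_real (f x)))"
    unfolding F1_def by (rule integral_norm_bound)
  thus ?thesis by (simp add: norm_mult)
qed

text \<open>Induction on n through f - f'': its transform is that of f times 1 + t^2, so each step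
  gains one power.\<close>

lemma F1_decay:
  assumes "cs f"
  obtains K where "\<And>t. (1 + t\<^sup>2) ^ n * norm (F1 f t) \<le> K"
  using assms
proof (induction n arbitrary: f thesis)
  case 0
  show ?case by (rule 0(1)[of "LINT x|lborel. \<bar>f x\<bar>"]) (simp add: F1_bounded 0(2))
next
  case (Suc n)
  define f1 where "f1 x = frechet_derivative f (at x) 1" for x
  have d1: "(f has_real_derivative f1 x) (at x)" for x
    unfolding f1_def by (rule smooth_deriv[OF cs_smooth[OF Suc.prems(2)]])
  have c1: "cs f1" by (rule cs_deriv[OF Suc.prems(2) d1])
  define f2 where "f2 x = frechet_derivative f1 (at x) 1" for x
  have d2: "(f1 has_real_derivative f2 x) (at x)" for x
    unfolding f2_def by (rule smooth_deriv[OF cs_smooth[OF c1]])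
  have c2: "cs f2" by (rule cs_deriv[OF c1 d2])
  have eq: "F1 (\<lambda>x. f x - f2 x) t = of_real (1 + t\<^sup>2) * F1 f t" for t
    by (simp add: F1_diff[OF Suc.prems(2) c2] F1_deriv[OF c1 d2] F1_deriv[OF Suc.prems(2) d1]
        power2_eq_square algebra_simps)
  obtain K where K: "\<And>t. (1 + t\<^sup>2) ^ n * norm (F1 (\<lambda>x. f x - f2 x) t) \<le> K"
    using Suc.IH[OF _ cs_diff[OF Suc.prems(2) c2]] by blast
  show ?case
  proof (rule Suc.prems(1))
    fix t :: real
    have "norm (complex_of_real (1 + t\<^sup>2)) = 1 + t\<^sup>2" unfolding norm_of_real by simp
    hence "norm (F1 (\<lambda>x. f x - f2 x) t) = (1 + t\<^sup>2) * norm (F1 f t)"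
      unfolding eq norm_mult by (simp only:)
    thus "(1 + t\<^sup>2) ^ Suc n * norm (F1 f t) \<le> K" using K[of t] by (simp only: power_Suc2 mult.assoc)
  qed
qed

lemma F1_decay_powr:
  assumes "cs f"
  obtains K where "K \<ge> 0" "\<And>t. (1 + t\<^sup>2) powr s * norm (F1 f t) \<le> K"
proof -
  obtain n :: nat where n: "s \<le> real n" using real_arch_simple by blast
  obtain K where K: "\<And>t. (1 + t\<^sup>2) ^ n * norm (F1 f t) \<le> K" using F1_decay[OF assms] by blast
  have le: "(1 + t\<^sup>2) powr s * norm (F1 f t) \<le> K" for t
  proof -
    have "(1 + t\<^sup>2) powr s \<le> (1 + t\<^sup>2) powr (real n)" using n by (intro powr_mono) auto
    also have "\<dots> = (1 + t\<^sup>2) ^ n" by (rule powr_realpow) (simp add: add_pos_nonneg)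
    finally have "(1 + t\<^sup>2) powr s * norm (F1 f t) \<le> (1 + t\<^sup>2) ^ n * norm (F1 f t)"
      by (intro mult_right_mono) auto
    with K[of t] show ?thesis by simp
  qed
  have "0 \<le> K" by (rule order_trans[OF _ le[of 0]]) simp
  with le show ?thesis by (intro that)
qed

text \<open>Smoothed indicator of \<open>{a<..<b}\<close>: the convolution of the indicator with \<open>cutoff' (\<cdot> / \<epsilon>) / \<epsilon>\<close>.\<close>

definition plateau :: "real \<Rightarrow> real \<Rightarrow> real \<Rightarrow> real \<Rightarrow> real" where
  "plateau \<epsilon> a b x = cutoff ((x - a) / \<epsilon>) - cutoff ((x - b) / \<epsilon>)"

lemma smooth_scaled:
  fixes f :: "real \<Rightarrow> real"
  assumes "smooth f" shows "smooth (\<lambda>x. f ((x - a) / \<epsilon>))"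
proof -
  have "bounded_linear (\<lambda>x::real. x * (1 / \<epsilon>))" by (rule bounded_linear_mult_left)
  from smooth_compose_affine[OF this assms, of "- (a / \<epsilon>)"]
  show ?thesis by (simp add: diff_divide_distrib)
qed

lemma cs_plateau:
  assumes "\<epsilon> > 0" shows "cs (plateau \<epsilon> a b)"
  unfolding cs_def
proof
  show "smooth (plateau \<epsilon> a b)"
    unfolding plateau_def[abs_def] by (intro smooth_diff smooth_scaled smooth_cutoff)
  have "plateau \<epsilon> a b x = 0" if x: "\<bar>x\<bar> > \<bar>a\<bar> + \<bar>b\<bar> + \<epsilon>" for x
  proof (cases "x > 0")
    case True
    hence "(x - a) / \<epsilon> \<ge> 1" "(x - b) / \<epsilon> \<ge> 1" using x assms by (auto simp: pos_le_divide_eq)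
    thus ?thesis by (simp add: plateau_def cutoff_1)
  next
    case False
    hence "(x - a) / \<epsilon> \<le> -1" "(x - b) / \<epsilon> \<le> -1" using x assms by (auto simp: pos_divide_le_eq)
    thus ?thesis by (simp add: plateau_def cutoff_0)
  qed
  thus "\<exists>R. \<forall>x. \<bar>x\<bar> > R \<longrightarrow> plateau \<epsilon> a b x = 0" by blast
qed

definition moll :: "real \<Rightarrow> real \<Rightarrow> real" where
  "moll \<epsilon> x = cutoff' (x / \<epsilon>) / \<epsilon>"

lemma cs_cutoff': "cs cutoff'"
  unfolding cs_def using smooth_cutoff' cutoff'_0 by blast

lemma cs_moll:
  assumes "\<epsilon> > 0" shows "cs (moll \<epsilon>)"
  unfolding cs_def
proof
  show "smooth (moll \<epsilon>)"
    using smooth_mult[OF smooth_scaled[OF smooth_cutoff', of 0 \<epsilon>] smooth_const[of "1 / \<epsilon>"]]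
    by (simp add: moll_def[abs_def])
  have "moll \<epsilon> x = 0" if "\<bar>x\<bar> > \<epsilon>" for x
  proof -
    have "\<bar>x / \<epsilon>\<bar> > 1" using that assms by (simp add: abs_divide)
    thus ?thesis by (simp add: moll_def cutoff'_0)
  qed
  thus "\<exists>R. \<forall>x. \<bar>x\<bar> > R \<longrightarrow> moll \<epsilon> x = 0" by blast
qed

lemma F1_translate:
  assumes "cs f"
  shows "F1 (\<lambda>x. f (x - a)) t = cis (- (a * t)) * F1 f t"
proof -
  have [measurable]: "f \<in> borel_measurable borel" by (rule smooth_borel[OF cs_smooth[OF assms]])
  have "F1 (\<lambda>x. f (x - a)) t = (LINT x|lborel. cis (- ((a + x) * t)) * of_real (f (a + x - a)))"
    unfolding F1_def by (rule integral_translate[symmetric]) measurable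
  also have "\<dots> = (LINT x|lborel. cis (- (a * t)) * (cis (- (x * t)) * of_real (f x)))"
    by (simp add: mult.assoc[symmetric] cis_mult distrib_right)
  finally show ?thesis by (simp add: F1_def)
qed

lemma F1_moll:
  assumes "\<epsilon> > 0"
  shows "F1 (moll \<epsilon>) t = F1 cutoff' (\<epsilon> * t)"
proof -
  have "F1 cutoff' (\<epsilon> * t) = (LINT x|lborel. cis (- (x * (\<epsilon> * t))) * of_real (cutoff' x))"
    by (simp add: F1_def)
  also have "\<dots> = \<bar>1 / \<epsilon>\<bar> *\<^sub>R (LINT x|lborel. cis (- ((0 + 1 / \<epsilon> * x) * (\<epsilon> * t))) * of_real (cutoff' (0 + 1 / \<epsilon> * x)))"
    by (rule lborel_integral_real_affine) (use assms in simp)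
  also have "\<dots> = (LINT x|lborel. \<bar>1 / \<epsilon>\<bar> *\<^sub>R (cis (- ((0 + 1 / \<epsilon> * x) * (\<epsilon> * t))) * of_real (cutoff' (0 + 1 / \<epsilon> * x))))"
    by (rule integral_scaleR_right[symmetric]) 
  also have "\<dots> = F1 (moll \<epsilon>) t"
    unfolding F1_def using assms
    by (intro Bochner_Integration.integral_cong refl) (simp add: moll_def scaleR_conv_of_real)
  finally show ?thesis ..
qed

text \<open>The derivative of the plateau is a difference of two translated mollifiers. Transforming
  it and dividing by the symbol of the derivative, whence t \<noteq> 0, separates the interval from
  the mollifier.\<close>

lemma F1_plateau:
  assumes \<epsilon>: "\<epsilon> > 0" and ab: "a \<le> b" and t: "t \<noteq> 0"
  shows "F1 (plateau \<epsilon> a b) t = e1 a b t * F1 cutoff' (\<epsilon> * t)"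
proof -
  have d: "(plateau \<epsilon> a b has_real_derivative moll \<epsilon> (x - a) - moll \<epsilon> (x - b)) (at x)" for x
  proof -
    have "((\<lambda>x. cutoff ((x - c) / \<epsilon>)) has_real_derivative cutoff' ((x - c) / \<epsilon>) * (1 / \<epsilon>)) (at x)" for c
      by (rule DERIV_chain2[OF cutoff_deriv]) (use \<epsilon> in \<open>auto intro!: derivative_eq_intros\<close>)
    from DERIV_diff[OF this[of a] this[of b]] show ?thesis
      by (simp add: plateau_def[abs_def] moll_def)
  qed
  have tr: "cs (\<lambda>x. moll \<epsilon> (x - c))" for c
  proof -
    obtain R where R: "\<And>x. \<bar>x\<bar> > R \<Longrightarrow> moll \<epsilon> x = 0" using cs_moll[OF \<epsilon>] by (auto simp: cs_def)
    have "smooth (\<lambda>x. moll \<epsilon> (x - c))"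
      using smooth_compose_affine[OF bounded_linear_ident cs_smooth[OF cs_moll[OF \<epsilon>]], of "- c"] by simp
    moreover have "moll \<epsilon> (x - c) = 0" if "\<bar>x\<bar> > R + \<bar>c\<bar>" for x
      by (rule R) (use that in linarith)
    ultimately show ?thesis unfolding cs_def by blast
  qed
  have "\<i> * of_real t * F1 (plateau \<epsilon> a b) t = F1 (\<lambda>x. moll \<epsilon> (x - a) - moll \<epsilon> (x - b)) t"
    by (rule F1_deriv[OF cs_plateau[OF \<epsilon>] d, symmetric])
  also have "\<dots> = (cis (- (a * t)) - cis (- (b * t))) * F1 (moll \<epsilon>) t"
    by (simp add: F1_diff[OF tr tr] F1_translate[OF cs_moll[OF \<epsilon>]] left_diff_distrib)
  also have "cis (- (a * t)) - cis (- (b * t)) = \<i> * of_real t * e1 a b t"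
    using t by (simp add: e1_formula[OF ab t] cis_conv_exp mult.commute)
  finally show ?thesis using t by (simp add: F1_moll[OF \<epsilon>] mult.assoc)
qed

lemma F1_cutoff'_0: "F1 cutoff' 0 = 1"
proof -
  have "has_bochner_integral lborel (\<lambda>x. indicator {-2..2} x *\<^sub>R cutoff' x) (cutoff 2 - cutoff (-2))"
  proof (rule has_bochner_integral_FTC_Icc)
    show "(cutoff has_vector_derivative cutoff' x) (at x within {-2..2})" for x
      using cutoff_deriv[of x] by (simp add: has_real_derivative_iff_has_vector_derivative has_vector_derivative_at_within)
    show "continuous_on {-2..2} cutoff'"
      by (rule continuous_on_subset[OF smooth_continuous[OF smooth_cutoff']]) simp
  qed simp
  hence "(LINT x|lborel. indicator {-2..2} x *\<^sub>R cutoff' x) = 1"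
    by (simp add: has_bochner_integral_integral_eq cutoff_0 cutoff_1)
  moreover have "indicator {-2..2} x *\<^sub>R cutoff' x = cutoff' x" for x
    using cutoff'_0[of x] by (cases "\<bar>x\<bar> > 1") (auto simp: indicator_def)
  ultimately have "(LINT x|lborel. cutoff' x) = 1" by (simp only:)
  thus ?thesis by (simp add: F1_def)
qed

lemma F1_cutoff'_tendsto: "(\<lambda>n. F1 cutoff' (1 / real (Suc n) * t)) \<longlonglongrightarrow> 1"
proof -
  note [measurable] = smooth_borel[OF smooth_cutoff']
  have "(\<lambda>n. LINT x|lborel. cis (- (x * (1 / real (Suc n) * t))) * of_real (cutoff' x)) \<longlonglongrightarrow> (LINT x|lborel. cis (- (x * (0 * t))) * of_real (cutoff' x))"
  proof (rule integral_dominated_convergence[where w = "\<lambda>x. \<bar>cutoff' x\<bar>"])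
    show "AE x in lborel. (\<lambda>n. cis (- (x * (1 / real (Suc n) * t))) * of_real (cutoff' x)) \<longlonglongrightarrow> cis (- (x * (0 * t))) * of_real (cutoff' x)"
    proof (rule AE_I2)
      fix x
      have "(\<lambda>n. - (x * (1 / real (Suc n) * t))) \<longlonglongrightarrow> - (x * (0 * t))"
        by (intro tendsto_intros LIMSEQ_Suc[OF lim_1_over_n])
      from tendsto_cis[OF this]
      show "(\<lambda>n. cis (- (x * (1 / real (Suc n) * t))) * of_real (cutoff' x)) \<longlonglongrightarrow> cis (- (x * (0 * t))) * of_real (cutoff' x)"
        by (intro tendsto_mult tendsto_const)
    qed
    show "integrable lborel (\<lambda>x. \<bar>cutoff' x\<bar>)" using cs_integrable[OF cs_cutoff'] by simp
  qed (auto simp: norm_mult)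
  thus ?thesis using F1_cutoff'_0 by (simp add: F1_def)
qed

section \<open>Density of test functions\<close>

definition good_test :: "(plane \<Rightarrow> real) \<Rightarrow> (plane \<Rightarrow> complex) \<Rightarrow> bool" where
  "good_test \<psi> C \<longleftrightarrow> smooth \<psi> \<and> (\<exists>R. \<forall>x. norm x > R \<longrightarrow> \<psi> x = 0) \<and>
     has_FT (\<lambda>x. complex_of_real (\<psi> x)) C \<and> (\<forall>m. Hm m C) \<and>
     (\<forall>j. has_FT (\<lambda>x. complex_of_real (frechet_derivative \<psi> (at x) (axis j 1))) (\<lambda>\<eta>. partial_symbol j \<eta> * C \<eta>))"

lemma Hm_add: "Hm m F \<Longrightarrow> Hm m G \<Longrightarrow> Hm m (\<lambda>\<xi>. F \<xi> + G \<xi>)"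
  unfolding Hm_def using sqi_add[of "\<lambda>\<xi>. Bessel_symbol m \<xi> * F \<xi>" "\<lambda>\<xi>. Bessel_symbol m \<xi> * G \<xi>"]
  by (auto simp: distrib_left)

lemma Hm_cmult: "Hm m F \<Longrightarrow> Hm m (\<lambda>\<xi>. c * F \<xi>)"
  unfolding Hm_def using sqi_cmult[of "\<lambda>\<xi>. Bessel_symbol m \<xi> * F \<xi>" c]
  by (auto simp: mult.left_commute)

lemma Hm_diff: "Hm m F \<Longrightarrow> Hm m G \<Longrightarrow> Hm m (\<lambda>\<xi>. F \<xi> - G \<xi>)"
  using Hm_add[OF _ Hm_cmult[of _ _ "-1"], of m F G] by simp

lemma hn_add: "Hm m F \<Longrightarrow> Hm m G \<Longrightarrow> hn m (\<lambda>\<xi>. F \<xi> + G \<xi>) \<le> hn m F + hn m G"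
  unfolding Hm_def hn_def
  using L2_norm_triangle[of "\<lambda>\<xi>. Bessel_symbol m \<xi> * F \<xi>" "\<lambda>\<xi>. Bessel_symbol m \<xi> * G \<xi>"]
  by (simp add: distrib_left)

lemma good_test_add:
  assumes "good_test \<phi> C" "good_test \<psi> D"
  shows "good_test (\<lambda>x. \<phi> x + \<psi> x) (\<lambda>\<xi>. C \<xi> + D \<xi>)"
proof -
  have sm: "smooth \<phi>" "smooth \<psi>" using assms by (auto simp: good_test_def)
  have fd: "frechet_derivative (\<lambda>x. \<phi> x + \<psi> x) (at x) v = frechet_derivative \<phi> (at x) v + frechet_derivative \<psi> (at x) v" for x v
    using frechet_derivative_at[OF has_derivative_add[OF smooth_has_derivative[OF sm(1)] smooth_has_derivative[OF sm(2)]], of x]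
    by metis
  obtain R S where "\<forall>x. norm x > R \<longrightarrow> \<phi> x = 0" "\<forall>x. norm x > S \<longrightarrow> \<psi> x = 0"
    using assms by (auto simp: good_test_def)
  hence "\<forall>x. norm x > max R S \<longrightarrow> \<phi> x + \<psi> x = 0" by simp
  hence supp: "\<exists>R. \<forall>x. norm x > R \<longrightarrow> \<phi> x + \<psi> x = 0" by blast
  have "has_FT (\<lambda>x. complex_of_real (frechet_derivative \<phi> (at x) (axis j 1)) + complex_of_real (frechet_derivative \<psi> (at x) (axis j 1)))
      (\<lambda>\<eta>. partial_symbol j \<eta> * C \<eta> + partial_symbol j \<eta> * D \<eta>)" for j
    using assms by (intro has_FT_add) (auto simp: good_test_def)
  moreover have "has_FT (\<lambda>x. complex_of_real (\<phi> x) + complex_of_real (\<psi> x)) (\<lambda>\<xi>. C \<xi> + D \<xi>)"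
    using assms by (intro has_FT_add) (auto simp: good_test_def)
  moreover have "Hm m (\<lambda>\<xi>. C \<xi> + D \<xi>)" for m
    using assms by (intro Hm_add) (auto simp: good_test_def)
  ultimately show ?thesis
    unfolding good_test_def fd
    using supp smooth_add[OF sm] by (simp add: distrib_left)
qed

lemma good_test_scale:
  assumes "good_test \<phi> C"
  shows "good_test (\<lambda>x. c * \<phi> x) (\<lambda>\<xi>. of_real c * C \<xi>)"
proof -
  have sm: "smooth \<phi>" using assms by (auto simp: good_test_def)
  have fd: "frechet_derivative (\<lambda>x. c * \<phi> x) (at x) v = c * frechet_derivative \<phi> (at x) v" for x v
  proof -
    have "((\<lambda>x. c * \<phi> x) has_derivative (\<lambda>v. c * frechet_derivative \<phi> (at x) v)) (at x)"
      by (rule has_derivative_mult_right[OF smooth_has_derivative[OF sm]])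
    from frechet_derivative_at[OF this] show ?thesis by metis
  qed
  have "has_FT (\<lambda>x. of_real c * complex_of_real (frechet_derivative \<phi> (at x) (axis j 1))) (\<lambda>\<eta>. of_real c * (partial_symbol j \<eta> * C \<eta>))" for j
    using assms by (intro has_FT_cmult) (auto simp: good_test_def)
  moreover have "has_FT (\<lambda>x. of_real c * complex_of_real (\<phi> x)) (\<lambda>\<eta>. of_real c * C \<eta>)"
    using assms by (intro has_FT_cmult) (auto simp: good_test_def)
  ultimately show ?thesis
    unfolding good_test_def fd
    using assms by (auto simp: good_test_def mult.left_commute intro!: smooth_mult smooth_const Hm_cmult)
qed

lemma good_test_0: "good_test (\<lambda>_. 0) (\<lambda>_. 0)"
  by (simp add: good_test_def smooth_const has_FT_def Hm_def)

lemma bracket_le_product: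
  fixes \<xi> :: plane
  assumes "0 \<le> s"
  shows "(1 + (norm \<xi>)\<^sup>2) powr s \<le> (1 + (\<xi> $ 1)\<^sup>2) powr s * (1 + (\<xi> $ 2)\<^sup>2) powr s"
proof -
  have "1 + (norm \<xi>)\<^sup>2 \<le> (1 + (\<xi> $ 1)\<^sup>2) * (1 + (\<xi> $ 2)\<^sup>2)"
    by (simp add: norm_plane_sq algebra_simps)
  hence "(1 + (norm \<xi>)\<^sup>2) powr s \<le> ((1 + (\<xi> $ 1)\<^sup>2) * (1 + (\<xi> $ 2)\<^sup>2)) powr s"
    using assms by (intro powr_mono2) auto
  also have "\<dots> = (1 + (\<xi> $ 1)\<^sup>2) powr s * (1 + (\<xi> $ 2)\<^sup>2) powr s"
    by (rule powr_mult) 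
  finally show ?thesis .
qed

definition tens :: "(real \<Rightarrow> real) \<Rightarrow> (real \<Rightarrow> real) \<Rightarrow> plane \<Rightarrow> real" where
  "tens p q x = p (x $ 1) * q (x $ 2)"

definition ftens :: "(real \<Rightarrow> real) \<Rightarrow> (real \<Rightarrow> real) \<Rightarrow> plane \<Rightarrow> complex" where
  "ftens p q \<xi> = F1 p (\<xi> $ 1) * F1 q (\<xi> $ 2)"

lemma ftens_measurable [measurable]: "cs p \<Longrightarrow> cs q \<Longrightarrow> ftens p q \<in> borel_measurable borel"
  unfolding ftens_def[abs_def] by measurable

lemma ftens_bracket_bounded:
  assumes "cs p" "cs q" "s \<ge> 0"
  obtains K where "K \<ge> 0" "\<And>\<xi>. (1 + (norm \<xi>)\<^sup>2) powr s * norm (ftens p q \<xi>) \<le> K"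
proof -
  obtain K where K: "K \<ge> 0" "\<And>t. (1 + t\<^sup>2) powr s * norm (F1 p t) \<le> K" using F1_decay_powr[OF assms(1)] by blast
  obtain L where L: "L \<ge> 0" "\<And>t. (1 + t\<^sup>2) powr s * norm (F1 q t) \<le> L" using F1_decay_powr[OF assms(2)] by blast
  show ?thesis
  proof (rule that)
    fix \<xi> :: plane
    have "(1 + (norm \<xi>)\<^sup>2) powr s * norm (ftens p q \<xi>)
      \<le> ((1 + (\<xi> $ 1)\<^sup>2) powr s * (1 + (\<xi> $ 2)\<^sup>2) powr s) * norm (ftens p q \<xi>)"
      by (intro mult_right_mono bracket_le_product assms) simp
    also have "\<dots> = ((1 + (\<xi> $ 1)\<^sup>2) powr s * norm (F1 p (\<xi> $ 1))) * ((1 + (\<xi> $ 2)\<^sup>2) powr s * norm (F1 q (\<xi> $ 2)))"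
      by (simp add: ftens_def norm_mult mult_ac)
    also have "\<dots> \<le> K * L" by (intro mult_mono K L) auto
    finally show "(1 + (norm \<xi>)\<^sup>2) powr s * norm (ftens p q \<xi>) \<le> K * L" .
  qed (use K L in simp)
qed

lemma Hm_ftens:
  assumes "cs p" "cs q"
  shows "Hm m (ftens p q)"
proof -
  note [measurable] = ftens_measurable[OF assms]
  define s where "s = (\<bar>m\<bar> + 2) / 2"
  obtain K where K: "K \<ge> 0" "\<And>\<xi>. (1 + (norm \<xi>)\<^sup>2) powr s * norm (ftens p q \<xi>) \<le> K"
    using ftens_bracket_bounded[OF assms, of s] by (auto simp: s_def)
  have "square_integrable (\<lambda>\<xi>. Bessel_symbol m \<xi> * ftens p q \<xi>)"
  proof (rule sqi_bound[OF sqi_bracket[of 2], where K = K])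
    show "AE \<xi> in lborel. norm (Bessel_symbol m \<xi> * ftens p q \<xi>) \<le> K * norm ((1 + (norm \<xi>)\<^sup>2) powr (- 2 / 2))"
    proof (rule AE_I2)
      fix \<xi> :: plane
      have "(1 + (norm \<xi>)\<^sup>2) powr (m / 2) \<le> (1 + (norm \<xi>)\<^sup>2) powr (s + (- 2 / 2))"
        by (intro powr_mono) (auto simp: s_def add_divide_distrib)
      hence "norm (Bessel_symbol m \<xi> * ftens p q \<xi>) \<le> (1 + (norm \<xi>)\<^sup>2) powr (s + (- 2 / 2)) * norm (ftens p q \<xi>)"
        unfolding norm_mult norm_Bessel by (intro mult_right_mono) auto
      also have "\<dots> = ((1 + (norm \<xi>)\<^sup>2) powr s * norm (ftens p q \<xi>)) * (1 + (norm \<xi>)\<^sup>2) powr (- 2 / 2)"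
        by (simp only: powr_add mult_ac)
      also have "\<dots> \<le> K * (1 + (norm \<xi>)\<^sup>2) powr (- 2 / 2)"
        by (intro mult_right_mono K) simp
      finally show "norm (Bessel_symbol m \<xi> * ftens p q \<xi>) \<le> K * norm ((1 + (norm \<xi>)\<^sup>2) powr (- 2 / 2))" by simp
    qed
  qed auto
  thus ?thesis by (simp add: Hm_def)
qed

lemma has_FT_tens:
  assumes p: "cs p" and q: "cs q"
  shows "has_FT (\<lambda>x. complex_of_real (tens p q x)) (ftens p q)"
proof -
  have ip: "integrable lborel (\<lambda>s. complex_of_real (p s))" "integrable lborel (\<lambda>s. complex_of_real (q s))"
    using cs_integrable[OF p] cs_integrable[OF q] by auto
  have int: "integrable lborel (\<lambda>x. complex_of_real (tens p q x))"
    using integrable_plane_product[OF ip] by (simp add: tens_def)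
  have ci: "cis (- (x \<bullet> \<xi>)) = cis (- (x $ 1 * \<xi> $ 1)) * cis (- (x $ 2 * \<xi> $ 2))" for x \<xi> :: plane
    by (simp add: inner_plane cis_mult)
  have L: "L1C (\<lambda>x. complex_of_real (tens p q x)) \<xi> = ftens p q \<xi>" for \<xi>
  proof -
    have "L1C (\<lambda>x. complex_of_real (tens p q x)) \<xi> = (LINT x|lborel. (cis (- (x $ 1 * \<xi> $ 1)) * of_real (p (x $ 1)))
        * (cis (- ((x::plane) $ 2 * \<xi> $ 2)) * of_real (q (x $ 2))))"
      unfolding L1C_def by (intro Bochner_Integration.integral_cong refl) (simp add: ci tens_def mult_ac)
    also have "\<dots> = ftens p q \<xi>"
      unfolding ftens_def F1_def by (rule integral_plane_product[OF F1_integrable[OF p] F1_integrable[OF q]])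
    finally show ?thesis .
  qed
  have sq: "square_integrable (\<lambda>x. complex_of_real (tens p q x))"
  proof -
    have "cs (\<lambda>x. p x * p x)" "cs (\<lambda>x. q x * q x)" by (intro cs_mult cs_smooth p q)+
    note pq = integrable_of_real[OF cs_integrable[OF this(1)], where 'a = complex]
      integrable_of_real[OF cs_integrable[OF this(2)], where 'a = complex]
    from integrable_norm[OF integrable_plane_product[OF pq]]
    have "integrable lborel (\<lambda>x. (norm (complex_of_real (tens p q x)))\<^sup>2)"
      by (simp add: tens_def norm_mult power2_eq_square abs_mult mult_ac)
    from conjI[OF borel_measurable_integrable[OF int] this] show ?thesis
      unfolding square_integrable_def .
  qed
  obtain F where F: "has_FT (\<lambda>x. complex_of_real (tens p q x)) F" by (rule has_FT_exists[OF sq])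
  show ?thesis
  proof (rule has_FT_cong[OF F])
    show "(\<lambda>x. complex_of_real (tens p q x)) \<in> borel_measurable borel" using sqi_measurable'[OF sq] .
    show "ftens p q \<in> borel_measurable borel" by (rule ftens_measurable[OF p q])
    show "AE \<xi> in lborel. ftens p q \<xi> = F \<xi>" using has_FT_L1C[OF int F] by (simp add: L eq_commute)
  qed simp
qed

lemma good_test_tens:
  assumes p: "cs p" and q: "cs q"
  shows "good_test (tens p q) (ftens p q)"
proof -
  have bl: "bounded_linear (\<lambda>x::plane. x $ i)" for i by (rule bounded_linear_vec_nth)
  have sm: "smooth (\<lambda>x::plane. p (x $ 1))" "smooth (\<lambda>x::plane. q (x $ 2))"
    using smooth_compose_affine[OF bl cs_smooth[OF p], of 1 0] smooth_compose_affine[OF bl cs_smooth[OF q], of 2 0] by auto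
  have smooth: "smooth (tens p q)" unfolding tens_def[abs_def] by (rule smooth_mult[OF sm])
  obtain R where R: "\<And>x. \<bar>x\<bar> > R \<Longrightarrow> p x = 0" using p by (auto simp: cs_def)
  obtain S where S: "\<And>x. \<bar>x\<bar> > S \<Longrightarrow> q x = 0" using q by (auto simp: cs_def)
  have supp: "tens p q x = 0" if x: "norm x > \<bar>R\<bar> + \<bar>S\<bar>" for x
  proof -
    have "norm x \<le> \<bar>x $ 1\<bar> + \<bar>x $ 2\<bar>" using norm_le_l1_cart[of x] by (simp add: sum_2)
    hence "\<bar>x $ 1\<bar> > R \<or> \<bar>x $ 2\<bar> > S" using x by linarith
    thus ?thesis using R S by (auto simp: tens_def)
  qed
  define p' where "p' x = frechet_derivative p (at x) 1" for x
  have p': "(p has_real_derivative p' x) (at x)" for x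
    unfolding p'_def by (rule smooth_deriv[OF cs_smooth[OF p]])
  define q' where "q' x = frechet_derivative q (at x) 1" for x
  have q': "(q has_real_derivative q' x) (at x)" for x
    unfolding q'_def by (rule smooth_deriv[OF cs_smooth[OF q]])
  have cp': "cs p'" and cq': "cs q'" by (rule cs_deriv[OF p p'] cs_deriv[OF q q'])+
  have der: "(tens p q has_derivative (\<lambda>v. p (x $ 1) * (q' (x $ 2) * v $ 2) + (p' (x $ 1) * v $ 1) * q (x $ 2))) (at x)" for x
    unfolding tens_def[abs_def]
    by (intro has_derivative_mult has_derivative_compose[OF bounded_linear_imp_has_derivative[OF bl]]
      p'[unfolded has_field_derivative_def] q'[unfolded has_field_derivative_def])
  have fd: "frechet_derivative (tens p q) (at x) v = p (x $ 1) * (q' (x $ 2) * v $ 2) + (p' (x $ 1) * v $ 1) * q (x $ 2)" for x v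
    by (rule fun_cong[OF frechet_derivative_at[OF der[of x], symmetric], of v])
  have "has_FT (\<lambda>x. complex_of_real (frechet_derivative (tens p q) (at x) (axis j 1))) (\<lambda>\<eta>. partial_symbol j \<eta> * ftens p q \<eta>)" for j
  proof (cases "j = 1")
    case True
    have "(\<lambda>\<eta>. partial_symbol j \<eta> * ftens p q \<eta>) = ftens p' q"
      by (simp add: True fun_eq_iff ftens_def partial_symbol_def F1_deriv[OF p p'])
    moreover have "(\<lambda>x. frechet_derivative (tens p q) (at x) (axis j 1)) = tens p' q"
      by (simp add: True fun_eq_iff fd tens_def axis_def)
    ultimately show ?thesis using has_FT_tens[OF cp' q] by (simp add: fun_eq_iff)
  next
    case False
    hence j: "j = 2" using exhaust_2[of j] by auto
    have "(\<lambda>\<eta>. partial_symbol j \<eta> * ftens p q \<eta>) = ftens p q'"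
      by (simp add: j fun_eq_iff ftens_def partial_symbol_def F1_deriv[OF q q'])
    moreover have "(\<lambda>x. frechet_derivative (tens p q) (at x) (axis j 1)) = tens p q'"
      by (simp add: j fun_eq_iff fd tens_def axis_def)
    ultimately show ?thesis using has_FT_tens[OF p cq'] by (simp add: fun_eq_iff)
  qed
  with smooth supp has_FT_tens[OF p q] Hm_ftens[OF p q] show ?thesis
    unfolding good_test_def by blast
qed

text \<open>The transform of the two-dimensional mollifier of width \<epsilon>; multiplication by it
  is convolution in space.\<close>

definition rho :: "real \<Rightarrow> plane \<Rightarrow> complex" where
  "rho \<epsilon> = ftens (moll \<epsilon>) (moll \<epsilon>)"

lemma rho_eq: "\<epsilon> > 0 \<Longrightarrow> rho \<epsilon> \<xi> = F1 cutoff' (\<epsilon> * \<xi> $ 1) * F1 cutoff' (\<epsilon> * \<xi> $ 2)"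
  by (simp add: rho_def ftens_def F1_moll)

lemma AE_component_nonzero: "AE \<xi> in lborel. (\<xi>::plane) $ j \<noteq> 0"
proof -
  have "{\<xi>::plane. \<xi> $ j = 0} \<in> null_sets lebesgue"
    using negligible_standard_hyperplane_cart[of j] by (simp add: negligible_iff_null_sets)
  hence "{\<xi>::plane. \<xi> $ j = 0} \<in> null_sets lborel"
  proof (subst null_sets_completion_iff[symmetric])
    have "closed {\<xi>::plane. \<xi> $ j = 0}" by (intro closed_Collect_eq continuous_intros)
    thus "{\<xi>::plane. \<xi> $ j = 0} \<in> sets lborel" by simp
  qed
  from AE_not_in[OF this] show ?thesis by eventually_elim simp
qed

text \<open>Mollifying the indicator of a box gives a tensor product of plateaux, which is smooth
  with compact support. Equality of transforms fails to be covered only on the coordinate axes, a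
  null set; an empty box contributes nothing and is split off because \<open>F1_plateau\<close>
  needs ordered end points.\<close>

lemma good_test_of_box_step:
  assumes \<epsilon>: "\<epsilon> > 0" and "box_step (f :: plane \<Rightarrow> real)"
  shows "\<exists>\<psi> C. good_test \<psi> C \<and> (AE \<xi> in lborel. C \<xi> = L1C (\<lambda>x. complex_of_real (f x)) \<xi> * rho \<epsilon> \<xi>)"
  using assms(2)
proof (induction rule: box_step.induct)
  case zero
  show ?case by (intro exI[of _ "\<lambda>_. 0"] conjI good_test_0) simp
next
  case (add f a b c)
  then obtain \<psi> C where C: "good_test \<psi> C" "AE \<xi> in lborel. C \<xi> = L1C (\<lambda>x. complex_of_real (f x)) \<xi> * rho \<epsilon> \<xi>"
    by blast
  have stf: "box_step (\<lambda>x. complex_of_real (f x))"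
    by (rule box_step_linear[OF _ add.hyps]) (rule bounded_linear.linear[OF bounded_linear_of_real])
  have L: "L1C (\<lambda>x. complex_of_real (f x + indicator (box a b) x *\<^sub>R c)) \<xi> = L1C (\<lambda>x. complex_of_real (f x)) \<xi> + of_real c * bxh a b \<xi>" for \<xi>
    using L1C_step[OF stf, of a b "of_real c" \<xi>] by (simp add: scaleR_conv_of_real)
  show ?case
  proof (cases "a $ 1 \<le> b $ 1 \<and> a $ 2 \<le> b $ 2")
    case True
    let ?p = "plateau \<epsilon> (a $ 1) (b $ 1)" and ?q = "plateau \<epsilon> (a $ 2) (b $ 2)"
    have g: "good_test (\<lambda>x. \<psi> x + c * tens ?p ?q x) (\<lambda>\<xi>. C \<xi> + of_real c * ftens ?p ?q \<xi>)"
      by (intro good_test_add C good_test_scale good_test_tens cs_plateau \<epsilon>)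
    have "AE \<xi> in lborel. C \<xi> + of_real c * ftens ?p ?q \<xi> = L1C (\<lambda>x. complex_of_real (f x + indicator (box a b) x *\<^sub>R c)) \<xi> * rho \<epsilon> \<xi>"
      using C(2) AE_component_nonzero[of 1] AE_component_nonzero[of 2]
    proof eventually_elim
      case (elim \<xi>)
      thus ?case
        unfolding L using True by (simp add: ftens_def F1_plateau[OF \<epsilon>] rho_eq[OF \<epsilon>] bxh_eq algebra_simps)
    qed
    with g show ?thesis by blast
  next
    case False
    hence "bxh a b \<xi> = 0" for \<xi> by (auto simp: bxh_eq e1_empty)
    hence "L1C (\<lambda>x. complex_of_real (f x + indicator (box a b) x *\<^sub>R c)) \<xi> = L1C (\<lambda>x. complex_of_real (f x)) \<xi>" for \<xi>
      by (simp only: L) simp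
    with C show ?thesis by (simp only:) blast
  qed
qed

text \<open>Two approximations in a fixed order. First \<open>rho \<epsilon>\<close> times the
  transform converges in \<open>hn m\<close> by dominated convergence, which fixes \<epsilon>. Then
  multiplication by \<open>rho \<epsilon>\<close> is bounded from \<open>L2\<close> to the Sobolev
  norm, so approximating f by box steps in \<open>L2\<close> alone is enough.\<close>

theorem good_test_dense:
  assumes f: "square_integrable f" and Hf: "Hm m (L2_fourier f)" and m: "m \<ge> 0"
  obtains \<psi> C where "\<And>n. good_test (\<psi> n) (C n)" "(\<lambda>n::nat. hn m (\<lambda>\<xi>. C n \<xi> - L2_fourier f \<xi>)) \<longlonglongrightarrow> 0"
proof -
  define F where "F = L2_fourier f"
  have [measurable]: "F \<in> borel_measurable borel" and sqF: "square_integrable (\<lambda>\<xi>. Bessel_symbol m \<xi> * F \<xi>)"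
    using Hf by (auto simp: Hm_def F_def)
  have [measurable]: "rho (1 / real (Suc n)) \<in> borel_measurable borel" for n
    unfolding rho_def by (intro ftens_measurable cs_moll) auto
  define Q where "Q = (LINT x|lborel. \<bar>cutoff' x\<bar>)"
  have rho_le: "norm (rho (1 / real (Suc n)) \<xi>) \<le> Q * Q" for n \<xi>
  proof -
    have "rho (1 / real (Suc n)) \<xi> = F1 cutoff' (1 / real (Suc n) * \<xi> $ 1) * F1 cutoff' (1 / real (Suc n) * \<xi> $ 2)"
      by (rule rho_eq) simp
    thus ?thesis
      unfolding Q_def
      by (simp only: norm_mult) (intro mult_mono F1_bounded cs_cutoff' norm_ge_zero Bochner_Integration.integral_nonneg, simp)
  qed
  have moll_lim: "(\<lambda>n. L2_norm (\<lambda>\<xi>. rho (1 / real (Suc n)) \<xi> * (Bessel_symbol m \<xi> * F \<xi>) - Bessel_symbol m \<xi> * F \<xi>)) \<longlonglongrightarrow> 0"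
  proof (rule L2_dominated[where w = "\<lambda>\<xi>. (Q * Q + 1) *\<^sub>R norm (Bessel_symbol m \<xi> * F \<xi>)"])
    show "square_integrable (\<lambda>\<xi>. (Q * Q + 1) *\<^sub>R norm (Bessel_symbol m \<xi> * F \<xi>))"
      by (intro sqi_scaleR sqi_norm sqF)
    show "AE \<xi> in lborel. (\<lambda>n. rho (1 / real (Suc n)) \<xi> * (Bessel_symbol m \<xi> * F \<xi>)) \<longlonglongrightarrow> Bessel_symbol m \<xi> * F \<xi>"
    proof (rule AE_I2)
      fix \<xi> :: plane
      have "(\<lambda>n. F1 cutoff' (1 / real (Suc n) * \<xi> $ 1) * F1 cutoff' (1 / real (Suc n) * \<xi> $ 2) * (Bessel_symbol m \<xi> * F \<xi>))
        \<longlonglongrightarrow> 1 * 1 * (Bessel_symbol m \<xi> * F \<xi>)"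
        by (intro tendsto_mult tendsto_const F1_cutoff'_tendsto)
      moreover have "rho (1 / real (Suc n)) \<xi> = F1 cutoff' (1 / real (Suc n) * \<xi> $ 1) * F1 cutoff' (1 / real (Suc n) * \<xi> $ 2)" for n
        by (rule rho_eq) simp
      ultimately show "(\<lambda>n. rho (1 / real (Suc n)) \<xi> * (Bessel_symbol m \<xi> * F \<xi>)) \<longlonglongrightarrow> Bessel_symbol m \<xi> * F \<xi>"
        by (simp only: mult_1)
    qed
    show "AE \<xi> in lborel. norm (rho (1 / real (Suc n)) \<xi> * (Bessel_symbol m \<xi> * F \<xi>) - Bessel_symbol m \<xi> * F \<xi>)
        \<le> (Q * Q + 1) *\<^sub>R norm (Bessel_symbol m \<xi> * F \<xi>)" for n
    proof (rule AE_I2)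
      fix \<xi>
      have "norm (rho (1 / real (Suc n)) \<xi> * (Bessel_symbol m \<xi> * F \<xi>) - Bessel_symbol m \<xi> * F \<xi>)
          \<le> norm (rho (1 / real (Suc n)) \<xi>) * norm (Bessel_symbol m \<xi> * F \<xi>) + norm (Bessel_symbol m \<xi> * F \<xi>)"
        using norm_triangle_ineq4 by (metis norm_mult)
      also have "\<dots> \<le> (Q * Q) * norm (Bessel_symbol m \<xi> * F \<xi>) + norm (Bessel_symbol m \<xi> * F \<xi>)"
        by (intro add_mono mult_right_mono rho_le) auto
      finally show "norm (rho (1 / real (Suc n)) \<xi> * (Bessel_symbol m \<xi> * F \<xi>) - Bessel_symbol m \<xi> * F \<xi>)
        \<le> (Q * Q + 1) *\<^sub>R norm (Bessel_symbol m \<xi> * F \<xi>)" by (simp add: distrib_right)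
    qed
  qed measurable
  have key: "\<exists>\<psi> C. good_test \<psi> C \<and> hn m (\<lambda>\<xi>. C \<xi> - F \<xi>) < d" if d: "d > 0" for d
  proof -
    obtain n where n: "L2_norm (\<lambda>\<xi>. rho (1 / real (Suc n)) \<xi> * (Bessel_symbol m \<xi> * F \<xi>) - Bessel_symbol m \<xi> * F \<xi>) < d / 2"
      using LIMSEQ_D[OF moll_lim, of "d / 2"] d by auto
    define \<epsilon> where "\<epsilon> = 1 / real (Suc n)"
    have \<epsilon>: "\<epsilon> > 0" by (simp add: \<epsilon>_def)
    have [measurable]: "rho \<epsilon> \<in> borel_measurable borel" unfolding \<epsilon>_def by measurable
    obtain K where K: "K \<ge> 0" "\<And>\<xi>. (1 + (norm \<xi>)\<^sup>2) powr (m / 2) * norm (rho \<epsilon> \<xi>) \<le> K"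
      unfolding rho_def using ftens_bracket_bounded[OF cs_moll[OF \<epsilon>] cs_moll[OF \<epsilon>], of "m / 2"] m by auto
    \<comment> \<open>Plancherel contributes \<open>2 * pi\<close> and the smoothing
      \<open>K\<close>, which leaves d/2; \<open>K + 1\<close> guards against
      \<open>K = 0\<close>.\<close>
    have "d / (4 * pi * (K + 1)) > 0" using d K by simp
    then obtain s where s: "box_step s" "L2_norm (\<lambda>x. f x - s x) < d / (4 * pi * (K + 1))"
      using box_step_dense[OF f] unfolding L2_approx_def by blast
    define S where "S = L1C (\<lambda>x. complex_of_real (s x))"
    have sts: "box_step (\<lambda>x. complex_of_real (s x))"
      by (rule box_step_linear[OF _ s(1)]) (rule bounded_linear.linear[OF bounded_linear_of_real])
    have FTs: "has_FT (\<lambda>x. complex_of_real (s x)) S" unfolding S_def by (rule has_FT_step[OF sts])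
    note [measurable] = sqi_measurable'[OF has_FT_sqi(2)[OF FTs]]
    have FTd: "has_FT (\<lambda>x. complex_of_real (s x) - complex_of_real (f x)) (\<lambda>\<xi>. S \<xi> - F \<xi>)"
      unfolding F_def by (rule has_FT_diff[OF FTs has_FT_L2_fourier[OF f]])
    have nSF: "L2_norm (\<lambda>\<xi>. S \<xi> - F \<xi>) = 2 * pi * L2_norm (\<lambda>x. f x - s x)"
      unfolding Plancherel[OF FTd] L2_norm_minus_commute[of f s] using L2_norm_of_real[of "\<lambda>x. s x - f x"] by simp
    obtain \<psi> C where C: "good_test \<psi> C" "AE \<xi> in lborel. C \<xi> = S \<xi> * rho \<epsilon> \<xi>"
      using good_test_of_box_step[OF \<epsilon> s(1)] unfolding S_def by blast
    have [measurable]: "C \<in> borel_measurable borel" using C(1) by (auto simp: good_test_def Hm_def)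
    let ?u = "\<lambda>\<xi>. Bessel_symbol m \<xi> * (rho \<epsilon> \<xi> * (S \<xi> - F \<xi>))"
    let ?v = "\<lambda>\<xi>. rho \<epsilon> \<xi> * (Bessel_symbol m \<xi> * F \<xi>) - Bessel_symbol m \<xi> * F \<xi>"
    have ule: "norm (?u \<xi>) \<le> K * norm (S \<xi> - F \<xi>)" for \<xi>
      unfolding norm_mult norm_Bessel mult.assoc[symmetric] by (intro mult_right_mono K) simp
    have u: "square_integrable ?u"
      by (rule sqi_bound[OF has_FT_sqi(2)[OF FTd], where K = K]) (use ule in auto)
    have v: "square_integrable ?v"
    proof (intro sqi_diff sqF sqi_bound[OF sqF, where K = "Q * Q"])
      show "AE \<xi> in lborel. norm (rho \<epsilon> \<xi> * (Bessel_symbol m \<xi> * F \<xi>)) \<le> Q * Q * norm (Bessel_symbol m \<xi> * F \<xi>)"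
        using rho_le[of n] unfolding norm_mult[of "rho _ _"] by (intro AE_I2 mult_right_mono) (auto simp: \<epsilon>_def)
    qed measurable
    have "hn m (\<lambda>\<xi>. C \<xi> - F \<xi>) = L2_norm (\<lambda>\<xi>. ?u \<xi> + ?v \<xi>)"
      unfolding hn_def
    proof (rule L2_norm_cong_AE)
      show "AE \<xi> in lborel. norm (Bessel_symbol m \<xi> * (C \<xi> - F \<xi>)) = norm (?u \<xi> + ?v \<xi>)"
        using C(2) by eventually_elim (simp add: algebra_simps)
    qed measurable
    also have "\<dots> \<le> L2_norm ?u + L2_norm ?v" by (rule L2_norm_triangle[OF u v])
    also have "L2_norm ?u \<le> K * L2_norm (\<lambda>\<xi>. S \<xi> - F \<xi>)"
    proof -
      have "L2_norm ?u \<le> L2_norm (\<lambda>\<xi>. K *\<^sub>R (S \<xi> - F \<xi>))"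
        using ule K(1) by (intro L2_norm_mono u sqi_scaleR has_FT_sqi(2)[OF FTd]) auto
      thus ?thesis using K(1) by (simp add: L2_norm_scaleR)
    qed
    also have "K * L2_norm (\<lambda>\<xi>. S \<xi> - F \<xi>) \<le> d / 2"
    proof -
      have "K * L2_norm (\<lambda>\<xi>. S \<xi> - F \<xi>) \<le> (K + 1) * (2 * pi * (d / (4 * pi * (K + 1))))"
        unfolding nSF using s(2) K(1) by (intro mult_mono) auto
      also have "\<dots> = d / 2"
      proof -
        define k where "k = K + 1"
        have "k \<noteq> 0" using K(1) by (simp add: k_def)
        thus ?thesis unfolding k_def[symmetric] by simp
      qed
      finally show ?thesis .
    qed
    finally have "hn m (\<lambda>\<xi>. C \<xi> - F \<xi>) < d" using n by (simp add: \<epsilon>_def)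
    with C(1) show ?thesis by blast
  qed
  have "\<forall>n. \<exists>\<psi> C. good_test \<psi> C \<and> hn m (\<lambda>\<xi>. C \<xi> - F \<xi>) < 1 / real (Suc n)"
    by (intro allI key) simp
  then obtain \<psi> C where \<psi>: "\<And>n. good_test (\<psi> n) (C n)" "\<And>n. hn m (\<lambda>\<xi>. C n \<xi> - F \<xi>) < 1 / real (Suc n)"
    by metis
  show ?thesis
  proof (rule that[OF \<psi>(1)])
    show "(\<lambda>n. hn m (\<lambda>\<xi>. C n \<xi> - L2_fourier f \<xi>)) \<longlonglongrightarrow> 0"
    proof (rule Lim_null_comparison)
      show "\<forall>\<^sub>F n in sequentially. norm (hn m (\<lambda>\<xi>. C n \<xi> - L2_fourier f \<xi>)) \<le> 1 / real (Suc n)"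
        using \<psi>(2) by (auto intro!: always_eventually less_imp_le simp: F_def hn_def)
    qed (rule LIMSEQ_Suc[OF lim_1_over_n])
  qed
qed

section \<open>Measurability in time\<close>

text \<open>Completeness of Lebesgue measure, reached by extending both functions by zero to the
  whole line.\<close>

lemma measurable_lebesgue_on_AE:
  fixes f g :: "real \<Rightarrow> real"
  assumes "f \<in> borel_measurable (lebesgue_on S)" and S: "S \<in> sets lebesgue"
    and "AE t in lebesgue_on S. f t = g t"
  shows "g \<in> borel_measurable (lebesgue_on S)"
proof -
  have "(\<lambda>t. if t \<in> S then f t else 0) \<in> borel_measurable lebesgue"
    using assms borel_measurable_if by blast
  moreover have "AE t in lebesgue. (if t \<in> S then f t else 0) = (if t \<in> S then g t else 0)"
    using assms(3) S by (simp add: AE_restrict_space_iff)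
  ultimately have "(\<lambda>t. if t \<in> S then g t else 0) \<in> borel_measurable lebesgue"
    by (rule borel_measurable_AE)
  thus ?thesis using S borel_measurable_if by blast
qed

text \<open>Composition with \<open>\<Phi>\<close> keeps simple functions simple, and continuity
  along sequences passes to the limit, so the topology of \<open>L2\<close> never appears as a
  measurable structure.\<close>

lemma L2_strongly_measurable_compose:
  fixes \<Phi> :: "(plane \<Rightarrow> real) \<Rightarrow> real"
  assumes f: "L2_strongly_measurable I f" and I: "I \<in> sets lebesgue"
    and cont: "\<And>fs g. (\<And>n::nat. square_integrable (fs n)) \<Longrightarrow> square_integrable g \<Longrightarrow>
       (\<lambda>n. L2_norm (\<lambda>x. fs n x - g x)) \<longlonglongrightarrow> 0 \<Longrightarrow> (\<lambda>n. \<Phi> (fs n)) \<longlonglongrightarrow> \<Phi> g"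
  shows "(\<lambda>t. \<Phi> (f t)) \<in> borel_measurable (lebesgue_on I)"
proof -
  from f obtain s :: "nat \<Rightarrow> real \<Rightarrow> plane \<Rightarrow> real"
    where s: "\<And>n. simple_function (lebesgue_on I) (s n)" "\<And>n t. t \<in> I \<Longrightarrow> square_integrable (s n t)"
      and lim: "AE t in lebesgue_on I. square_integrable (f t) \<and> (\<lambda>n. L2_norm (\<lambda>x. f t x - s n t x)) \<longlonglongrightarrow> 0"
    unfolding L2_strongly_measurable_def by blast
  have m: "(\<lambda>t. \<Phi> (s n t)) \<in> borel_measurable (lebesgue_on I)" for n
    using simple_function_compose[OF s(1)[of n], of \<Phi>] by (simp add: borel_measurable_simple_function comp_def)
  have "(\<lambda>t. lim (\<lambda>n. \<Phi> (s n t))) \<in> borel_measurable (lebesgue_on I)"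
    by (intro borel_measurable_lim_metric m)
  moreover have "AE t in lebesgue_on I. lim (\<lambda>n. \<Phi> (s n t)) = \<Phi> (f t)"
    using lim AE_space[of "lebesgue_on I"]
  proof eventually_elim
    case (elim t)
    hence "t \<in> I" by simp
    have "(\<lambda>n. \<Phi> (s n t)) \<longlonglongrightarrow> \<Phi> (f t)"
      using elim s(2)[OF \<open>t \<in> I\<close>] by (intro cont) (auto simp: L2_norm_minus_commute[of _ "f t"])
    thus ?case by (rule limI)
  qed
  ultimately show ?thesis by (rule measurable_lebesgue_on_AE[OF _ I])
qed

lemma L2_norm_fourier_diff:
  assumes "square_integrable f" "square_integrable g"
  shows "L2_norm (\<lambda>\<xi>. L2_fourier f \<xi> - L2_fourier g \<xi>) = 2 * pi * L2_norm (\<lambda>x. f x - g x)"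
proof -
  have "L2_norm (\<lambda>\<xi>. L2_fourier f \<xi> - L2_fourier g \<xi>) = 2 * pi * L2_norm (\<lambda>x. complex_of_real (f x) - complex_of_real (g x))"
    by (rule Plancherel[OF has_FT_diff[OF has_FT_L2_fourier[OF assms(1)] has_FT_L2_fourier[OF assms(2)]]])
  thus ?thesis using L2_norm_of_real[of "\<lambda>x. f x - g x"] by simp
qed

section \<open>The duality pairing on the frequency side\<close>

text \<open>Normalised so that on transforms of real functions it is the integral of their product;
  the real part makes it symmetric for arbitrary complex arguments.\<close>

definition pair :: "(plane \<Rightarrow> complex) \<Rightarrow> (plane \<Rightarrow> complex) \<Rightarrow> real" where
  "pair F G = 1 / (2 * pi)\<^sup>2 * Re (LINT \<xi>|lborel. F \<xi> * cnj (G \<xi>))"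

lemma inverse_2pi_sq_le_1: "1 / (2 * pi)\<^sup>2 \<le> 1"
proof -
  have "1 \<le> (2 * pi)\<^sup>2" using pi_gt3 by (intro one_le_power) simp
  thus ?thesis by simp
qed

lemma pair_add1:
  "square_integrable F \<Longrightarrow> square_integrable F' \<Longrightarrow> square_integrable G \<Longrightarrow>
    pair (\<lambda>\<xi>. F \<xi> + F' \<xi>) G = pair F G + pair F' G"
  by (simp add: pair_def distrib_right distrib_left sqi_mult_integrable sqi_cnj add_divide_distrib)

lemma pair_cmult1: "pair (\<lambda>\<xi>. of_real c * F \<xi>) G = c * pair F G"
  by (simp add: pair_def mult.assoc)

lemma pair_diff1:
  assumes "square_integrable F" "square_integrable F'" "square_integrable G"
  shows "pair (\<lambda>\<xi>. F \<xi> - F' \<xi>) G = pair F G - pair F' G"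
  using pair_add1[OF assms(1) sqi_cmult[OF assms(2), of "of_real (-1)"] assms(3)] pair_cmult1[of "-1" F' G] by simp

lemma pair_commute: "pair F G = pair G F"
proof -
  have "(LINT \<xi>|lborel. F \<xi> * cnj (G \<xi>)) = (LINT \<xi>|lborel. cnj (G \<xi> * cnj (F \<xi>)))"
    by (simp add: mult.commute)
  also have "\<dots> = cnj (LINT \<xi>|lborel. G \<xi> * cnj (F \<xi>))" by (rule Bochner_Integration.integral_cnj)
  finally show ?thesis by (simp add: pair_def)
qed

lemma pair_bound:
  assumes "square_integrable F" "square_integrable G"
  shows "\<bar>pair F G\<bar> \<le> L2_norm F * L2_norm G"
proof -
  have "\<bar>Re (LINT \<xi>|lborel. F \<xi> * cnj (G \<xi>))\<bar> \<le> norm (LINT \<xi>|lborel. F \<xi> * cnj (G \<xi>))" by (rule abs_Re_le_cmod)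
  also have "\<dots> \<le> L2_norm F * L2_norm (\<lambda>\<xi>. cnj (G \<xi>))"
    by (rule L2_Cauchy_Schwarz_norm[OF assms(1) sqi_cnj[OF assms(2)]])
  also have "L2_norm (\<lambda>\<xi>. cnj (G \<xi>)) = L2_norm G" by (simp add: L2_norm_def)
  finally have 1: "\<bar>Re (LINT \<xi>|lborel. F \<xi> * cnj (G \<xi>))\<bar> \<le> L2_norm F * L2_norm G" .
  have "\<bar>pair F G\<bar> = 1 / (2 * pi)\<^sup>2 * \<bar>Re (LINT \<xi>|lborel. F \<xi> * cnj (G \<xi>))\<bar>"
    by (simp add: pair_def abs_mult)
  also have "\<dots> \<le> 1 * \<bar>Re (LINT \<xi>|lborel. F \<xi> * cnj (G \<xi>))\<bar>"
    by (intro mult_right_mono inverse_2pi_sq_le_1) simp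
  finally show ?thesis using 1 by simp
qed

lemma pair_Parseval:
  assumes "has_FT (\<lambda>x. complex_of_real (f x)) F" "has_FT (\<lambda>x. complex_of_real (g x)) G"
  shows "(LINT x|lborel. f x * g x) = pair F G"
proof -
  have "(LINT \<xi>|lborel. F \<xi> * cnj (G \<xi>)) = (2 * pi)\<^sup>2 * (LINT x|lborel. complex_of_real (f x) * cnj (complex_of_real (g x)))"
    by (rule Parseval[OF assms])
  also have "(LINT x|lborel. complex_of_real (f x) * cnj (complex_of_real (g x))) = (LINT x|lborel. complex_of_real (f x * g x))"
    by simp
  also have "\<dots> = complex_of_real (LINT x|lborel. f x * g x)" by (rule integral_complex_of_real)
  finally have "(LINT \<xi>|lborel. F \<xi> * cnj (G \<xi>)) = complex_of_real ((2 * pi)\<^sup>2 * (LINT x|lborel. f x * g x))" by simp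
  thus ?thesis by (simp add: pair_def del: of_real_mult)
qed

lemma pair_self:
  assumes "square_integrable f"
  shows "pair (L2_fourier f) (L2_fourier f) = (L2_norm f)\<^sup>2"
  using pair_Parseval[OF has_FT_L2_fourier[OF assms] has_FT_L2_fourier[OF assms]]
  unfolding L2_norm_sq by (simp add: power2_eq_square)

lemma pair_limit:
  assumes sq: "\<And>n::nat. square_integrable (Gs n)" "square_integrable F" "square_integrable G"
    and lim: "(\<lambda>n. L2_norm (\<lambda>x. Gs n x - G x)) \<longlonglongrightarrow> 0"
  shows "(\<lambda>n. pair F (Gs n)) \<longlonglongrightarrow> pair F G"
proof -
  have c: "L2_norm (\<lambda>x. cnj (Gs n x) - cnj (G x)) = L2_norm (\<lambda>x. Gs n x - G x)" for n
    by (simp add: L2_norm_def flip: complex_cnj_diff)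
  have "(\<lambda>n. LINT \<xi>|lborel. F \<xi> * cnj (Gs n \<xi>)) \<longlonglongrightarrow> (LINT \<xi>|lborel. F \<xi> * cnj (G \<xi>))"
    by (intro L2_limit_mult always_eventually allI sq sqi_cnj) (simp_all add: c lim)
  thus ?thesis unfolding pair_def by (intro tendsto_mult tendsto_const tendsto_Re)
qed

section \<open>The time derivative of a weak solution as a functional on \<open>H\<^sup>m\<close>\<close>

text \<open>
  The integrand in time of the weak formulation, for a solution with transform \<open>A\<close> and a test
  function with transform \<open>C\<close>.
\<close>

definition Nf :: "real \<Rightarrow> real \<Rightarrow> real \<Rightarrow> (plane \<Rightarrow> complex) \<Rightarrow> (plane \<Rightarrow> complex) \<Rightarrow> real" where
  "Nf \<alpha> \<beta> \<nu> A C = Re (tri \<beta> A A C) - \<nu> * pair (\<lambda>\<xi>. Lambda_symbol (2 * \<alpha>) \<xi> * C \<xi>) A"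

lemma good_test_Hm: "good_test \<psi> C \<Longrightarrow> Hm m C"
  by (simp add: good_test_def)

lemma good_test_FT: "good_test \<psi> C \<Longrightarrow> has_FT (\<lambda>x. complex_of_real (\<psi> x)) C"
  by (simp add: good_test_def)

locale sobolev_setting =
  fixes \<alpha> \<beta> m :: real
  assumes \<alpha>: "0 < \<alpha>" "\<alpha> < 1" and \<beta>: "1 < \<beta>" "\<beta> < 2" and m: "m > 1 + \<beta>"
begin

lemma m_pos: "m > 0" "m \<ge> 0" "m \<ge> 2" using m \<beta> by simp_all

lemma HmD:
  assumes "Hm m C"
  shows "C \<in> borel_measurable borel" "square_integrable C" "L2_norm C \<le> hn m C"
    "wintegrable \<beta> C" "wint \<beta> C \<le> wK (m - \<beta>) * hn m C"
    "square_integrable (\<lambda>\<xi>. Lambda_symbol (2 * \<alpha>) \<xi> * C \<xi>)"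
    "L2_norm (\<lambda>\<xi>. Lambda_symbol (2 * \<alpha>) \<xi> * C \<xi>) \<le> hn m C"
proof -
  show "C \<in> borel_measurable borel" using assms by (simp add: Hm_def)
  show "square_integrable C" "L2_norm C \<le> hn m C"
    using Hm_sqi[OF assms] Hm_norm[OF assms] m_pos by auto
  show "wintegrable \<beta> C" "wint \<beta> C \<le> wK (m - \<beta>) * hn m C"
    using Hm_wintegrable[OF assms _ _ m] Hm_wint[OF assms _ _ m] \<beta> by auto
  have "norm (Lambda_symbol (2 * \<alpha>) \<xi>) \<le> (1 + (norm \<xi>)\<^sup>2) powr (m / 2)" for \<xi>
    using norm_powr_le_bracket[of "2 * \<alpha>" m \<xi>] \<alpha> m_pos by (simp add: Lambda_symbol_def)
  from Hm_sqi_symbol[OF assms _ this] Hm_norm_symbol[OF assms _ this]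
  show "square_integrable (\<lambda>\<xi>. Lambda_symbol (2 * \<alpha>) \<xi> * C \<xi>)"
    "L2_norm (\<lambda>\<xi>. Lambda_symbol (2 * \<alpha>) \<xi> * C \<xi>) \<le> hn m C" by simp_all
qed

lemma hn_nonneg: "hn m C \<ge> 0"
  by (simp add: hn_def)

lemma wK_nonneg: "wK q \<ge> 0"
  by (simp add: wK_def)

lemma Nf_add:
  assumes A: "square_integrable A" and C: "Hm m C" "Hm m D"
  shows "Nf \<alpha> \<beta> \<nu> A (\<lambda>\<xi>. C \<xi> + D \<xi>) = Nf \<alpha> \<beta> \<nu> A C + Nf \<alpha> \<beta> \<nu> A D"
  using tri_add3[OF \<beta> A A HmD(1,4)[OF C(1)] HmD(1,4)[OF C(2)]]
    pair_add1[OF HmD(6)[OF C(1)] HmD(6)[OF C(2)] A]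
  by (simp add: Nf_def distrib_left)

lemma Nf_cmult: "Nf \<alpha> \<beta> \<nu> A (\<lambda>\<xi>. of_real c * C \<xi>) = c * Nf \<alpha> \<beta> \<nu> A C"
proof -
  have "pair (\<lambda>\<xi>. Lambda_symbol (2 * \<alpha>) \<xi> * (of_real c * C \<xi>)) A = c * pair (\<lambda>\<xi>. Lambda_symbol (2 * \<alpha>) \<xi> * C \<xi>) A"
    unfolding pair_cmult1[symmetric] by (simp add: mult.left_commute)
  thus ?thesis by (simp add: Nf_def tri_cmult3[OF \<beta>] right_diff_distrib)
qed

lemma Nf_bound:
  assumes A: "square_integrable A" and C: "Hm m C" and \<nu>: "\<nu> \<ge> 0"
  shows "\<bar>Nf \<alpha> \<beta> \<nu> A C\<bar> \<le> (wK (m - \<beta>) * (L2_norm A)\<^sup>2 + \<nu> * L2_norm A) * hn m C"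
proof -
  have "\<bar>Re (tri \<beta> A A C)\<bar> \<le> norm (tri \<beta> A A C)" by (rule abs_Re_le_cmod)
  also have "\<dots> \<le> wint \<beta> C * L2_norm A * L2_norm A" by (rule tri_bound[OF \<beta> A A HmD(1,4)[OF C]])
  also have "\<dots> \<le> (wK (m - \<beta>) * hn m C) * L2_norm A * L2_norm A"
    by (intro mult_right_mono HmD(5)[OF C]) auto
  finally have 1: "\<bar>Re (tri \<beta> A A C)\<bar> \<le> wK (m - \<beta>) * (L2_norm A)\<^sup>2 * hn m C"
    by (simp add: power2_eq_square mult_ac)
  have "\<bar>pair (\<lambda>\<xi>. Lambda_symbol (2 * \<alpha>) \<xi> * C \<xi>) A\<bar> \<le> L2_norm (\<lambda>\<xi>. Lambda_symbol (2 * \<alpha>) \<xi> * C \<xi>) * L2_norm A"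
    by (rule pair_bound[OF HmD(6)[OF C] A])
  also have "\<dots> \<le> hn m C * L2_norm A" by (intro mult_right_mono HmD(7)[OF C]) simp
  finally have "\<nu> * \<bar>pair (\<lambda>\<xi>. Lambda_symbol (2 * \<alpha>) \<xi> * C \<xi>) A\<bar> \<le> \<nu> * (hn m C * L2_norm A)"
    using \<nu> by (rule mult_left_mono)
  hence 2: "\<bar>\<nu> * pair (\<lambda>\<xi>. Lambda_symbol (2 * \<alpha>) \<xi> * C \<xi>) A\<bar> \<le> \<nu> * L2_norm A * hn m C"
    using \<nu> by (simp add: abs_mult mult_ac)
  have "\<bar>Nf \<alpha> \<beta> \<nu> A C\<bar> \<le> \<bar>Re (tri \<beta> A A C)\<bar> + \<bar>\<nu> * pair (\<lambda>\<xi>. Lambda_symbol (2 * \<alpha>) \<xi> * C \<xi>) A\<bar>"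
    unfolding Nf_def by (rule abs_triangle_ineq4)
  with 1 2 show ?thesis by (simp add: distrib_right)
qed

lemma Nf_continuous:
  assumes C: "Hm m C" and sq: "\<And>n::nat. square_integrable (fs n)" "square_integrable g"
    and lim: "(\<lambda>n. L2_norm (\<lambda>x. fs n x - g x)) \<longlonglongrightarrow> 0"
  shows "(\<lambda>n. Nf \<alpha> \<beta> \<nu> (L2_fourier (fs n)) C) \<longlonglongrightarrow> Nf \<alpha> \<beta> \<nu> (L2_fourier g) C"
proof -
  have "(\<lambda>n. 2 * pi * L2_norm (\<lambda>x. fs n x - g x)) \<longlonglongrightarrow> 2 * pi * 0"
    by (intro tendsto_mult tendsto_const lim)
  hence l: "(\<lambda>n. L2_norm (\<lambda>\<xi>. L2_fourier (fs n) \<xi> - L2_fourier g \<xi>)) \<longlonglongrightarrow> 0"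
    by (simp only: L2_norm_fourier_diff[OF sq] mult_zero_right)
  show ?thesis
    unfolding Nf_def
    by (intro tendsto_diff tendsto_mult tendsto_const tendsto_Re tri_continuous[OF \<beta> _ _ HmD(1,4)[OF C] l]
        pair_limit[OF _ HmD(6)[OF C] _ l] always_eventually allI sqi_L2_fourier sq)
qed

end

section \<open>The weak formulation of one viscous solution, extended to Sobolev test
  functions\<close>

locale weak_flow = sobolev_setting +
  fixes \<nu> T :: real and \<theta>0 :: "plane \<Rightarrow> real" and \<theta> :: "real \<Rightarrow> plane \<Rightarrow> real"
  assumes \<nu>: "\<nu> > 0" and T: "T > 0" and \<theta>0: "square_integrable \<theta>0"
    and weak: "global_weak_solution \<alpha> \<beta> \<nu> \<theta>0 \<theta>"
begin

abbreviation hat :: "real \<Rightarrow> plane \<Rightarrow> complex" where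
  "hat s \<equiv> L2_fourier (\<theta> s)"

definition M0 :: real where "M0 = L2_norm \<theta>0"

lemma M0_nonneg: "M0 \<ge> 0" by (simp add: M0_def)

lemma \<theta>_sqi: "t > 0 \<Longrightarrow> square_integrable (\<theta> t)"
  using weak by (auto simp: global_weak_solution_def energy_inequality_def)

lemma \<theta>_norm:
  assumes "t > 0" shows "L2_norm (\<theta> t) \<le> M0"
proof (rule power2_le_imp_le)
  have "(L2_norm (\<theta> t))\<^sup>2 + 2 * \<nu> * (LINT s|lebesgue_on {0<..<t}. (L2_norm (Lambda \<alpha> (\<theta> s)))\<^sup>2) \<le> (L2_norm \<theta>0)\<^sup>2"
    using weak assms by (auto simp: global_weak_solution_def energy_inequality_def)
  moreover have "0 \<le> 2 * \<nu> * (LINT s|lebesgue_on {0<..<t}. (L2_norm (Lambda \<alpha> (\<theta> s)))\<^sup>2)"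
    using \<nu> by (intro mult_nonneg_nonneg Bochner_Integration.integral_nonneg) auto
  ultimately show "(L2_norm (\<theta> t))\<^sup>2 \<le> M0\<^sup>2" unfolding M0_def by linarith
qed (rule M0_nonneg)

lemma hat_sqi: "t > 0 \<Longrightarrow> square_integrable (hat t)"
  by (intro sqi_L2_fourier \<theta>_sqi)

lemma hat_norm: "t > 0 \<Longrightarrow> L2_norm (hat t) \<le> 2 * pi * M0"
  using \<theta>_norm by (simp add: L2_norm_fourier \<theta>_sqi)

text \<open>The norm of the functional \<open>Nf\<close> on the Sobolev space, uniformly in time:
  the transport part is quadratic in the solution, the viscous part linear. It becomes the Lipschitz
  constant of \<open>Lf\<close> in time.\<close>

definition NB :: real where
  "NB = wK (m - \<beta>) * (2 * pi * M0)\<^sup>2 + \<nu> * (2 * pi * M0)"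

lemma NB_nonneg: "NB \<ge> 0"
  using \<nu> M0_nonneg wK_nonneg by (simp add: NB_def)

lemma N_bound:
  assumes "t > 0" "Hm m C"
  shows "\<bar>Nf \<alpha> \<beta> \<nu> (hat t) C\<bar> \<le> NB * hn m C"
proof -
  have "\<bar>Nf \<alpha> \<beta> \<nu> (hat t) C\<bar> \<le> (wK (m - \<beta>) * (L2_norm (hat t))\<^sup>2 + \<nu> * L2_norm (hat t)) * hn m C"
    using \<nu> by (intro Nf_bound hat_sqi assms) simp
  also have "\<dots> \<le> NB * hn m C"
    unfolding NB_def
    using hat_norm[OF assms(1)] \<nu> hn_nonneg wK_nonneg
    by (intro mult_right_mono add_mono mult_left_mono power_mono) auto
  finally show ?thesis .
qed

lemma strongly_measurable: "t > 0 \<Longrightarrow> L2_strongly_measurable {0<..<t} \<theta>"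
  using weak by (auto simp: global_weak_solution_def Linf_L2_def)

lemma N_measurable:
  assumes "Hm m C" "t > 0"
  shows "(\<lambda>s. Nf \<alpha> \<beta> \<nu> (hat s) C) \<in> borel_measurable (lebesgue_on {0<..<t})"
  by (rule L2_strongly_measurable_compose[OF strongly_measurable[OF assms(2)], of "\<lambda>f. Nf \<alpha> \<beta> \<nu> (L2_fourier f) C"])
    (auto intro: Nf_continuous[OF assms(1)])

lemma N_integrable:
  assumes C: "Hm m C"
  shows "integrable (lebesgue_on {0<..<t}) (\<lambda>s. Nf \<alpha> \<beta> \<nu> (hat s) C)"
proof (cases "t > 0")
  case True
  show ?thesis
  proof (rule Bochner_Integration.integrable_bound)
    have "emeasure (lebesgue_on {0<..<t}) (space (lebesgue_on {0<..<t})) < \<infinity>"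
      using emeasure_lborel_Ioo_finite[of 0 t] by (simp add: emeasure_restrict_space)
    hence "finite_measure (lebesgue_on {0<..<t})" by (intro finite_measureI) auto
    thus "integrable (lebesgue_on {0<..<t}) (\<lambda>s. NB * hn m C)"
      by (rule finite_measure.integrable_const)
    show "(\<lambda>s. Nf \<alpha> \<beta> \<nu> (hat s) C) \<in> borel_measurable (lebesgue_on {0<..<t})"
      by (rule N_measurable[OF C True])
    show "AE s in lebesgue_on {0<..<t}. norm (Nf \<alpha> \<beta> \<nu> (hat s) C) \<le> norm (NB * hn m C)"
    proof (rule AE_I2)
      fix s assume "s \<in> space (lebesgue_on {0<..<t})"
      hence "s > 0" by simp
      from N_bound[OF this C] show "norm (Nf \<alpha> \<beta> \<nu> (hat s) C) \<le> norm (NB * hn m C)" by simp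
    qed
  qed
next
  case False
  thus ?thesis by (simp add: integrable_restrict_space)
qed

text \<open>
  The value which the weak formulation prescribes for the pairing of \<open>\<theta> t\<close> with a test function.
  It agrees with the pairing only for almost every \<open>t\<close>, but it is Lipschitz in \<open>t\<close>.
\<close>

definition Lf :: "real \<Rightarrow> (plane \<Rightarrow> complex) \<Rightarrow> real" where
  "Lf t C = pair C (L2_fourier \<theta>0) + (LINT s|lebesgue_on {0<..<t}. Nf \<alpha> \<beta> \<nu> (hat s) C)"

lemma Lf_add:
  assumes "Hm m C" "Hm m D"
  shows "Lf t (\<lambda>\<xi>. C \<xi> + D \<xi>) = Lf t C + Lf t D"
proof -
  have "(LINT s|lebesgue_on {0<..<t}. Nf \<alpha> \<beta> \<nu> (hat s) (\<lambda>\<xi>. C \<xi> + D \<xi>))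
      = (LINT s|lebesgue_on {0<..<t}. Nf \<alpha> \<beta> \<nu> (hat s) C + Nf \<alpha> \<beta> \<nu> (hat s) D)"
    by (intro Bochner_Integration.integral_cong refl) (simp add: Nf_add hat_sqi assms)
  thus ?thesis
    using N_integrable[OF assms(1), of t] N_integrable[OF assms(2), of t]
    by (simp add: Lf_def pair_add1 HmD(2) assms sqi_L2_fourier \<theta>0)
qed

lemma Lf_cmult: "Lf t (\<lambda>\<xi>. of_real c * C \<xi>) = c * Lf t C"
  by (simp add: Lf_def pair_cmult1 Nf_cmult distrib_left)

lemma Lf_diff:
  assumes "Hm m C" "Hm m D"
  shows "Lf t (\<lambda>\<xi>. C \<xi> - D \<xi>) = Lf t C - Lf t D"
  using Lf_add[OF assms(1) Hm_cmult[OF assms(2), of "of_real (-1)"]] Lf_cmult[of t "-1" D] by simp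

lemma Lf_increment:
  assumes C: "Hm m C" and st: "s \<le> t"
  shows "Lf t C - Lf s C = (LINT r|lebesgue. indicator {0<..<t} r * Nf \<alpha> \<beta> \<nu> (hat r) C - indicator {0<..<s} r * Nf \<alpha> \<beta> \<nu> (hat r) C)"
    and "integrable lebesgue (\<lambda>r. indicator {0<..<t} r * Nf \<alpha> \<beta> \<nu> (hat r) C - indicator {0<..<s} r * Nf \<alpha> \<beta> \<nu> (hat r) C)"
proof -
  have i: "integrable lebesgue (\<lambda>r. indicator {0<..<u} r * Nf \<alpha> \<beta> \<nu> (hat r) C)" for u
    using N_integrable[OF C, of u] by (simp add: integrable_restrict_space)
  show "integrable lebesgue (\<lambda>r. indicator {0<..<t} r * Nf \<alpha> \<beta> \<nu> (hat r) C - indicator {0<..<s} r * Nf \<alpha> \<beta> \<nu> (hat r) C)"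
    by (intro Bochner_Integration.integrable_diff i)
  show "Lf t C - Lf s C = (LINT r|lebesgue. indicator {0<..<t} r * Nf \<alpha> \<beta> \<nu> (hat r) C - indicator {0<..<s} r * Nf \<alpha> \<beta> \<nu> (hat r) C)"
    using i by (simp add: Lf_def integral_restrict_space)
qed

text \<open>One-sided, since the growth estimate bounds the integrand only from above, and with an
  almost everywhere hypothesis, since that estimate uses the identity between \<open>pair\<close>
  and \<open>Lf\<close>.\<close>

lemma Lf_increment_upper:
  assumes C: "Hm m C" and st: "0 \<le> s" "s \<le> t"
    and le: "AE r in lebesgue. s < r \<and> r < t \<longrightarrow> Nf \<alpha> \<beta> \<nu> (hat r) C \<le> B"
  shows "Lf t C - Lf s C \<le> B * (t - s)"
proof -
  have "Lf t C - Lf s C \<le> (LINT r|lebesgue. indicator {s<..<t} r * B)"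
    unfolding Lf_increment(1)[OF C st(2)]
  proof (rule integral_mono_AE)
    show "integrable lebesgue (\<lambda>r. indicator {s<..<t} r * B)"
      using emeasure_lborel_Ioo_finite[of s t] by (intro integrable_mult_left integrable_real_indicator) auto
    \<comment> \<open>The open intervals up to s and up to t differ by the open interval between
      them and the single point s.\<close>
    have "AE r in lebesgue. r \<noteq> s" using AE_completion[OF AE_lborel_singleton[of s]] .
    with le show "AE r in lebesgue. indicator {0<..<t} r * Nf \<alpha> \<beta> \<nu> (hat r) C - indicator {0<..<s} r * Nf \<alpha> \<beta> \<nu> (hat r) C
        \<le> indicator {s<..<t} r * B"
    proof eventually_elim
      case (elim r)
      thus ?case using st by (auto simp: indicator_def)
    qed
  qed (rule Lf_increment(2)[OF C st(2)])
  also have "\<dots> = B * (t - s)" using st by simp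
  finally show ?thesis .
qed

lemma Lf_uminus: "Lf t (\<lambda>\<xi>. - C \<xi>) = - Lf t C"
  using Lf_cmult[of t "-1" C] by simp

lemma Nf_uminus: "Nf \<alpha> \<beta> \<nu> A (\<lambda>\<xi>. - C \<xi>) = - Nf \<alpha> \<beta> \<nu> A C"
  using Nf_cmult[of \<nu> A "-1" C] by simp

lemma Hm_uminus: "Hm m C \<Longrightarrow> Hm m (\<lambda>\<xi>. - C \<xi>)"
  using Hm_cmult[of m C "-1"] by simp

lemma Lf_Lipschitz:
  assumes C: "Hm m C" and st: "0 \<le> s" "s \<le> t"
  shows "\<bar>Lf t C - Lf s C\<bar> \<le> NB * hn m C * (t - s)"
proof -
  have "\<bar>Nf \<alpha> \<beta> \<nu> (hat r) C\<bar> \<le> NB * hn m C" if "s < r" for r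
    using that st by (intro N_bound C) simp
  hence 1: "AE r in lebesgue. s < r \<and> r < t \<longrightarrow> Nf \<alpha> \<beta> \<nu> (hat r) C \<le> NB * hn m C"
    and 2: "AE r in lebesgue. s < r \<and> r < t \<longrightarrow> Nf \<alpha> \<beta> \<nu> (hat r) (\<lambda>\<xi>. - C \<xi>) \<le> NB * hn m C"
    by (auto simp: Nf_uminus abs_le_iff intro!: AE_I2)
  have "Lf t C - Lf s C \<le> NB * hn m C * (t - s)"
    by (rule Lf_increment_upper[OF C st 1])
  moreover have "Lf t (\<lambda>\<xi>. - C \<xi>) - Lf s (\<lambda>\<xi>. - C \<xi>) \<le> NB * hn m C * (t - s)"
    by (rule Lf_increment_upper[OF Hm_uminus[OF C] st 2])
  ultimately show ?thesis by (simp add: Lf_uminus abs_le_iff)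
qed

lemma Lf_0: "Lf 0 C = pair C (L2_fourier \<theta>0)"
  by (simp add: Lf_def integral_restrict_space)

text \<open>Continuity of \<open>Lf\<close> on the Sobolev space, uniform up to time T. It carries
  identities through limits of test functions in \<open>weak_Hm\<close> and through limits in the
  time of the smooth solution in \<open>Lf_gh_limit\<close>.\<close>

lemma Lf_bound:
  assumes C: "Hm m C" and t: "0 \<le> t" "t \<le> T"
  shows "\<bar>Lf t C\<bar> \<le> (2 * pi * M0 + NB * T) * hn m C"
proof -
  have "\<bar>Lf 0 C\<bar> \<le> L2_norm C * L2_norm (L2_fourier \<theta>0)"
    unfolding Lf_0 by (intro pair_bound HmD(2)[OF C] sqi_L2_fourier \<theta>0)
  also have "\<dots> \<le> hn m C * (2 * pi * M0)"
    using HmD(3)[OF C] by (simp add: L2_norm_fourier \<theta>0 M0_def mult_right_mono)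
  finally have 1: "\<bar>Lf 0 C\<bar> \<le> hn m C * (2 * pi * M0)" .
  have "\<bar>Lf t C - Lf 0 C\<bar> \<le> NB * hn m C * (t - 0)" by (rule Lf_Lipschitz[OF C _ t(1)]) simp
  also have "\<dots> \<le> NB * hn m C * T" using t NB_nonneg hn_nonneg by (intro mult_left_mono) auto
  finally have "\<bar>Lf t C - Lf 0 C\<bar> \<le> NB * hn m C * T" .
  with 1 show ?thesis by (simp add: algebra_simps)
qed

text \<open>The weak formulation, tested with \<open>\<kappa>(s) \<psi>(x)\<close> where \<open>\<kappa> = 1\<close> on \<open>[0, T]\<close>.\<close>

lemma weak_good_test:
  assumes \<psi>: "good_test \<psi> C"
  shows "AE t in lebesgue. 0 < t \<and> t < T \<longrightarrow> pair C (hat t) = Lf t C"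
proof -
  \<comment> \<open>The shifts 3 and T+4 make both cutoffs equal to 1 for s from -2 to T+3, an open
    neighbourhood of the closed time interval, so that time derivatives vanish there as
    well.\<close>
  define \<kappa> where "\<kappa> s = cutoff (s + 3) * cutoff (- s + (T + 4))" for s
  define \<phi> where "\<phi> z = \<kappa> (fst z) * \<psi> (snd z)" for z :: "real \<times> plane"
  have sm: "smooth \<psi>" using \<psi> by (simp add: good_test_def)
  obtain R where R: "\<And>x. norm x > R \<Longrightarrow> \<psi> x = 0" using \<psi> by (auto simp: good_test_def)
  have \<kappa>1: "\<kappa> s = 1" if "-2 < s" "s < T + 3" for s using that by (simp add: \<kappa>_def cutoff_1)
  have \<kappa>0: "\<kappa> s = 0" if "s < -4 \<or> s > T + 5" for s using that by (auto simp: \<kappa>_def cutoff_0)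
  have "smooth \<phi>"
    unfolding \<phi>_def[abs_def] \<kappa>_def
    using smooth_compose_affine[OF bounded_linear_fst smooth_cutoff, of 3]
      smooth_compose_affine[OF bounded_linear_minus[OF bounded_linear_fst] smooth_cutoff, of "T + 4"]
      smooth_compose_affine[OF bounded_linear_snd sm, of 0]
    by (intro smooth_mult) auto
  moreover have "\<exists>K. compact K \<and> (\<forall>z. z \<notin> K \<longrightarrow> \<phi> z = 0)"
  proof (intro exI conjI allI impI)
    show "compact ({-4..T + 5} \<times> cball (0::plane) R)" by (intro compact_Times) auto
    fix z :: "real \<times> plane" assume "z \<notin> {-4..T + 5} \<times> cball 0 R"
    hence "fst z < -4 \<or> fst z > T + 5 \<or> norm (snd z) > R" by (cases z) auto
    thus "\<phi> z = 0" using R \<kappa>0 by (auto simp: \<phi>_def)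
  qed
  ultimately have "test_function \<phi>" by (simp add: test_function_def smooth_def)
  hence wf: "AE t in lebesgue. 0 < t \<longrightarrow> weak_formulation \<alpha> \<beta> \<nu> \<theta>0 \<theta> \<phi> t"
    using weak by (simp add: global_weak_solution_def)
  have fd: "frechet_derivative \<phi> (at (s, x)) = (\<lambda>v. frechet_derivative \<psi> (at x) (snd v))"
    if s: "0 < s" "s < T" for s x
  proof -
    have "((\<lambda>z. \<psi> (snd z)) has_derivative (\<lambda>v. frechet_derivative \<psi> (at x) (snd v))) (at (s, x))"
      by (rule has_derivative_compose[OF bounded_linear_imp_has_derivative[OF bounded_linear_snd]])
        (simp add: smooth_has_derivative[OF sm])
    hence "(\<phi> has_derivative (\<lambda>v. frechet_derivative \<psi> (at x) (snd v))) (at (s, x))"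
      by (rule has_derivative_transform_within_open[of _ _ _ _ "{-2<..<T + 3} \<times> UNIV"])
        (use s in \<open>auto simp: \<phi>_def \<kappa>1 open_Times\<close>)
    from frechet_derivative_at[OF this] show ?thesis ..
  qed
  have td: "time_derivative \<phi> s x = 0" if "0 < s" "s < T" for s x
  proof -
    have "linear (frechet_derivative \<psi> (at x))" by (rule has_derivative_linear[OF smooth_has_derivative[OF sm]])
    thus ?thesis by (simp add: time_derivative_def fd[OF that] linear_0)
  qed
  define V where "V x = (\<chi> j. frechet_derivative \<psi> (at x) (axis j 1))" for x
  have sg: "space_gradient \<phi> s = V" if "0 < s" "s < T" for s
    by (simp add: fun_eq_iff space_gradient_def V_def fd[OF that])
  have Cm: "Hm k C" for k by (rule good_test_Hm[OF \<psi>])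
  note C = HmD[OF Cm]
  have FT\<psi>: "has_FT (\<lambda>x. complex_of_real (\<psi> x)) C" by (rule good_test_FT[OF \<psi>])
  have s\<psi>: "square_integrable \<psi>" using has_FT_sqi(1)[OF FT\<psi>] by simp
  have V: "has_FT (\<lambda>x. complex_of_real (V x $ j)) (\<lambda>\<eta>. partial_symbol j \<eta> * C \<eta>)" for j
    using \<psi> by (simp add: V_def good_test_def)
  have iV: "integrable lborel (\<lambda>\<eta>. partial_symbol j \<eta> * C \<eta>)" for j
  proof (rule Bochner_Integration.integrable_bound)
    show "integrable lborel (\<lambda>\<eta>. of_real (norm \<eta> powr 1) * C \<eta>)"
      using Hm_wintegrable[OF Cm, of 1 \<beta> m] \<beta> m by (simp add: wintegrable_def)
    show "(\<lambda>\<eta>. partial_symbol j \<eta> * C \<eta>) \<in> borel_measurable lborel" using C(1) by measurable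
    show "AE \<eta> in lborel. norm (partial_symbol j \<eta> * C \<eta>) \<le> norm (of_real (norm \<eta> powr 1) * C \<eta>)"
      by (rule AE_I2)
        (auto simp: norm_mult partial_symbol_def intro!: mult_right_mono component_le_norm_plane)
  qed
  have dom\<psi>: "in_domain (Lambda_symbol \<alpha>) \<psi>" and L\<psi>: "AE \<xi> in lborel. L2_fourier \<psi> \<xi> = C \<xi>"
  proof -
    show ae: "AE \<xi> in lborel. L2_fourier \<psi> \<xi> = C \<xi>" by (rule L2_fourier_AE[OF FT\<psi>])
    show "in_domain (Lambda_symbol \<alpha>) \<psi>"
    proof (rule in_domainI[OF s\<psi>])
      note [measurable] = sqi_measurable'[OF sqi_L2_fourier[OF s\<psi>]]
      have "norm (Lambda_symbol \<alpha> \<xi>) \<le> (1 + (norm \<xi>)\<^sup>2) powr (m / 2)" for \<xi>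
        using norm_powr_le_bracket[of \<alpha> m \<xi>] \<alpha> m_pos by (simp add: Lambda_symbol_def)
      from Hm_sqi_symbol[OF Cm _ this] have sC: "square_integrable (\<lambda>\<xi>. Lambda_symbol \<alpha> \<xi> * C \<xi>)" by simp
      show "square_integrable (\<lambda>\<xi>. Lambda_symbol \<alpha> \<xi> * L2_fourier \<psi> \<xi>)"
      proof (rule sqi_cong_AE[OF sC])
        show "(\<lambda>\<xi>. Lambda_symbol \<alpha> \<xi> * L2_fourier \<psi> \<xi>) \<in> borel_measurable borel" by measurable
        show "AE \<xi> in lborel. Lambda_symbol \<alpha> \<xi> * L2_fourier \<psi> \<xi> = Lambda_symbol \<alpha> \<xi> * C \<xi>"
          using ae by eventually_elim simp
      qed
    qed (auto simp: symbol_Hermitian)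
  qed
  from wf show ?thesis
  proof eventually_elim
    case (elim t)
    show ?case
    proof
      assume t: "0 < t \<and> t < T"
      have \<psi>t: "(\<lambda>y. \<phi> (s, y)) = \<psi>" if "0 \<le> s" "s < T" for s
        using that by (simp add: \<phi>_def \<kappa>1 fun_eq_iff)
      have dom: "AE s in lebesgue_on {0<..<t}. in_domain (Lambda_symbol \<alpha>) (\<theta> s)"
        using weak t by (auto simp: global_weak_solution_def L2_Hdot_def)
      have ae: "AE s in lebesgue_on {0<..<t}. Nf \<alpha> \<beta> \<nu> (hat s) C =
          (LINT x|lborel. time_derivative \<phi> s x * \<theta> s x) + transport_integral \<beta> (\<theta> s) (space_gradient \<phi> s)
          - \<nu> * (LINT x|lborel. Lambda \<alpha> (\<lambda>y. \<phi> (s, y)) x * Lambda \<alpha> (\<theta> s) x)"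
        using dom AE_space[of "lebesgue_on {0<..<t}"]
      proof eventually_elim
        case (elim s)
        hence s: "0 < s" "s < T" using t by auto
        have "(LINT x|lborel. Lambda \<alpha> \<psi> x * Lambda \<alpha> (\<theta> s) x)
            = pair (\<lambda>\<xi>. Lambda_symbol \<alpha> \<xi> * L2_fourier \<psi> \<xi>) (\<lambda>\<xi>. Lambda_symbol \<alpha> \<xi> * hat s \<xi>)"
          by (rule pair_Parseval[OF has_FT_multiplier_in_domain[OF dom\<psi>] has_FT_multiplier_in_domain[OF elim(1)]]) auto
        also have "\<dots> = pair (\<lambda>\<xi>. Lambda_symbol (2 * \<alpha>) \<xi> * C \<xi>) (hat s)"
        proof -
          have "(LINT \<xi>|lborel. Lambda_symbol \<alpha> \<xi> * L2_fourier \<psi> \<xi> * cnj (Lambda_symbol \<alpha> \<xi> * hat s \<xi>))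
              = (LINT \<xi>|lborel. Lambda_symbol (2 * \<alpha>) \<xi> * C \<xi> * cnj (hat s \<xi>))"
          proof (rule integral_cong_AE)
            note [measurable] = sqi_measurable'[OF sqi_L2_fourier[OF s\<psi>]] sqi_measurable'[OF hat_sqi[OF s(1)]] C(1)
            show "(\<lambda>\<xi>. Lambda_symbol \<alpha> \<xi> * L2_fourier \<psi> \<xi> * cnj (Lambda_symbol \<alpha> \<xi> * hat s \<xi>)) \<in> borel_measurable lborel"
              "(\<lambda>\<xi>. Lambda_symbol (2 * \<alpha>) \<xi> * C \<xi> * cnj (hat s \<xi>)) \<in> borel_measurable lborel" by measurable
            \<comment> \<open>The symbol of order \<alpha> is real, so the factor on the solution
              can be moved over to the test function.\<close>
            have LL2: "Lambda_symbol (2 * \<alpha>) \<xi> = Lambda_symbol \<alpha> \<xi> * cnj (Lambda_symbol \<alpha> \<xi>)" for \<xi>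
              by (simp add: Lambda_symbol_def flip: of_real_mult powr_add)
            show "AE \<xi> in lborel. Lambda_symbol \<alpha> \<xi> * L2_fourier \<psi> \<xi> * cnj (Lambda_symbol \<alpha> \<xi> * hat s \<xi>)
                = Lambda_symbol (2 * \<alpha>) \<xi> * C \<xi> * cnj (hat s \<xi>)"
              using L\<psi> by eventually_elim (simp only: LL2, simp add: mult_ac)
          qed
          thus ?thesis by (simp add: pair_def)
        qed
        finally have "(LINT x|lborel. Lambda \<alpha> \<psi> x * Lambda \<alpha> (\<theta> s) x) = pair (\<lambda>\<xi>. Lambda_symbol (2 * \<alpha>) \<xi> * C \<xi>) (hat s)" .
        moreover have "transport_integral \<beta> (\<theta> s) V = Re (tri \<beta> (hat s) (hat s) C)"
          by (rule transport_integral_eq[OF \<beta> \<theta>_sqi[OF s(1)] C(1,4) V iV])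
        ultimately show ?case
          using s by (simp add: Nf_def td sg \<psi>t)
      qed
      have "(LINT x|lborel. \<theta> t x * \<phi> (t, x)) - (LINT x|lborel. \<theta>0 x * \<phi> (0, x)) =
         (LINT s|lebesgue_on {0<..<t}. (LINT x|lborel. time_derivative \<phi> s x * \<theta> s x) + transport_integral \<beta> (\<theta> s) (space_gradient \<phi> s)
          - \<nu> * (LINT x|lborel. Lambda \<alpha> (\<lambda>y. \<phi> (s, y)) x * Lambda \<alpha> (\<theta> s) x))"
        using elim t by (simp add: weak_formulation_def)
      \<comment> \<open>The integrand of the weak formulation inherits measurability from
        \<open>Nf\<close>, with which it agrees almost everywhere.\<close>
      also have "\<dots> = (LINT s|lebesgue_on {0<..<t}. Nf \<alpha> \<beta> \<nu> (hat s) C)"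
        using t ae by (intro integral_cong_AE measurable_lebesgue_on_AE[OF N_measurable[OF Cm]] N_measurable[OF Cm])
          (auto simp: eq_commute)
      finally have "(LINT x|lborel. \<psi> x * \<theta> t x) - (LINT x|lborel. \<psi> x * \<theta>0 x) = (LINT s|lebesgue_on {0<..<t}. Nf \<alpha> \<beta> \<nu> (hat s) C)"
        using t fun_cong[OF \<psi>t[of t]] fun_cong[OF \<psi>t[of 0]] T by (simp add: mult.commute)
      moreover have "(LINT x|lborel. \<psi> x * \<theta> t x) = pair C (hat t)"
        using t by (intro pair_Parseval FT\<psi> has_FT_L2_fourier \<theta>_sqi) simp
      moreover have "(LINT x|lborel. \<psi> x * \<theta>0 x) = pair C (L2_fourier \<theta>0)"
        by (intro pair_Parseval FT\<psi> has_FT_L2_fourier \<theta>0)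
      ultimately show "pair C (hat t) = Lf t C" by (simp add: Lf_def)
    qed
  qed
qed

text \<open>The exceptional null sets of countably many approximating test functions are united; at
  each remaining time both sides are continuous in the Sobolev norm. The null set still depends on
  f.\<close>

lemma weak_Hm:
  assumes f: "square_integrable f" and Hf: "Hm m (L2_fourier f)"
  shows "AE t in lebesgue. 0 < t \<and> t < T \<longrightarrow> pair (L2_fourier f) (hat t) = Lf t (L2_fourier f)"
proof -
  obtain \<psi> C where \<psi>: "\<And>n. good_test (\<psi> n) (C n)" and lim: "(\<lambda>n::nat. hn m (\<lambda>\<xi>. C n \<xi> - L2_fourier f \<xi>)) \<longlonglongrightarrow> 0"
    by (rule good_test_dense[OF f Hf m_pos(2)]) blast
  have CH: "Hm m (C n)" for n by (rule good_test_Hm[OF \<psi>])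
  have D: "Hm m (\<lambda>\<xi>. C n \<xi> - L2_fourier f \<xi>)" for n by (rule Hm_diff[OF CH Hf])
  have "AE t in lebesgue. \<forall>n. 0 < t \<and> t < T \<longrightarrow> pair (C n) (hat t) = Lf t (C n)"
    unfolding AE_all_countable using weak_good_test[OF \<psi>] by blast
  thus ?thesis
  proof eventually_elim
    case (elim t)
    show ?case
    proof
      assume t: "0 < t \<and> t < T"
      have "(\<lambda>n. pair (C n) (hat t) - pair (L2_fourier f) (hat t)) \<longlonglongrightarrow> 0"
      proof (rule Lim_null_comparison)
        show "\<forall>\<^sub>F n in sequentially. norm (pair (C n) (hat t) - pair (L2_fourier f) (hat t)) \<le> hn m (\<lambda>\<xi>. C n \<xi> - L2_fourier f \<xi>) * L2_norm (hat t)"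
        proof (intro always_eventually allI)
          fix n
          have "pair (C n) (hat t) - pair (L2_fourier f) (hat t) = pair (\<lambda>\<xi>. C n \<xi> - L2_fourier f \<xi>) (hat t)"
            using t by (intro pair_diff1[symmetric] HmD(2)[OF CH] HmD(2)[OF Hf] hat_sqi) simp
          also have "norm \<dots> \<le> L2_norm (\<lambda>\<xi>. C n \<xi> - L2_fourier f \<xi>) * L2_norm (hat t)"
            using t unfolding real_norm_def by (intro pair_bound HmD(2)[OF D] hat_sqi) simp
          also have "\<dots> \<le> hn m (\<lambda>\<xi>. C n \<xi> - L2_fourier f \<xi>) * L2_norm (hat t)"
            by (intro mult_right_mono HmD(3)[OF D]) simp
          finally show "norm (pair (C n) (hat t) - pair (L2_fourier f) (hat t)) \<le> hn m (\<lambda>\<xi>. C n \<xi> - L2_fourier f \<xi>) * L2_norm (hat t)" .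
        qed
        show "(\<lambda>n. hn m (\<lambda>\<xi>. C n \<xi> - L2_fourier f \<xi>) * L2_norm (hat t)) \<longlonglongrightarrow> 0"
          using tendsto_mult[OF lim tendsto_const[of "L2_norm (hat t)"]] by simp
      qed
      hence 1: "(\<lambda>n. pair (C n) (hat t)) \<longlonglongrightarrow> pair (L2_fourier f) (hat t)" by (simp add: LIM_zero_iff)
      have "(\<lambda>n. Lf t (C n) - Lf t (L2_fourier f)) \<longlonglongrightarrow> 0"
      proof (rule Lim_null_comparison)
        show "\<forall>\<^sub>F n in sequentially. norm (Lf t (C n) - Lf t (L2_fourier f)) \<le> (2 * pi * M0 + NB * T) * hn m (\<lambda>\<xi>. C n \<xi> - L2_fourier f \<xi>)"
          using t by (intro always_eventually allI) (simp only: Lf_diff[OF CH Hf, symmetric] real_norm_def, intro Lf_bound D, auto)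
        show "(\<lambda>n. (2 * pi * M0 + NB * T) * hn m (\<lambda>\<xi>. C n \<xi> - L2_fourier f \<xi>)) \<longlonglongrightarrow> 0"
          using tendsto_mult[OF tendsto_const[of "2 * pi * M0 + NB * T"] lim] by simp
      qed
      hence 2: "(\<lambda>n. Lf t (C n)) \<longlonglongrightarrow> Lf t (L2_fourier f)" by (simp add: LIM_zero_iff)
      have "Lf t (C n) = pair (C n) (hat t)" for n using elim t by simp
      with 1 2 show "pair (L2_fourier f) (hat t) = Lf t (L2_fourier f)" using LIMSEQ_unique by (simp only:)
    qed
  qed
qed

end

section \<open>A Gronwall inequality for upper right Dini derivatives\<close>

text \<open>Comparison with a supersolution \<open>Y\<close> for the slack e: the last time
  \<open>t0\<close> up to which y stays below \<open>Y\<close> must be b, because the one-sided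
  condition at \<open>t0\<close>, together with the growth of \<open>Y\<close>, extends the
  comparison a little further. Then e tends to 0.\<close>

lemma gronwall_Dini:
  fixes y :: "real \<Rightarrow> real"
  assumes ab: "a \<le> b" and cont: "continuous_on {a..b} y" and K: "K \<ge> 0" and c: "c \<ge> 0"
    and dini: "\<And>t e. a \<le> t \<Longrightarrow> t < b \<Longrightarrow> e > 0 \<Longrightarrow>
      \<exists>\<delta>>0. \<forall>h. 0 < h \<and> h < \<delta> \<longrightarrow> y (t + h) \<le> y t + h * (K * y t + c + e)"
  shows "y b \<le> (\<bar>y a\<bar> + c * (b - a)) * exp (K * (b - a))"
proof -
  have main: "y b \<le> (\<bar>y a\<bar> + (c + e) * (b - a)) * exp (K * (b - a))" if e: "e > 0" for e
  proof -
    \<comment> \<open>The absolute value keeps \<open>Y\<close> nonnegative, which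
      \<open>Ystep\<close> needs: there exp(K h) is bounded below by 1 + K h and multiplied by
      \<open>Y t\<close>.\<close>
    define Y where "Y t = (\<bar>y a\<bar> + (c + e) * (t - a)) * exp (K * (t - a))" for t
    have Ystep: "Y t + h * (K * Y t + c + e) \<le> Y (t + h)" if "a \<le> t" "h \<ge> 0" for t h
    proof -
      define P where "P = \<bar>y a\<bar> + (c + e) * (t - a)"
      have P: "P \<ge> 0" using that c e by (simp add: P_def)
      have Yt: "Y t = P * exp (K * (t - a))" by (simp add: Y_def P_def)
      have "exp (K * h) \<ge> 1 + K * h" by (rule exp_ge_add_one_self)
      hence 1: "Y t * (1 + K * h) \<le> Y t * exp (K * h)"
        using P by (intro mult_left_mono) (auto simp: Yt)
      have "1 \<le> exp (K * (t + h - a))" using that K by simp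
      hence 2: "(c + e) * h * 1 \<le> (c + e) * h * exp (K * (t + h - a))"
        using that c e by (intro mult_left_mono) auto
      have "Y (t + h) = (P + (c + e) * h) * exp (K * (t + h - a))"
        by (simp add: Y_def P_def algebra_simps)
      also have "\<dots> = Y t * exp (K * h) + (c + e) * h * exp (K * (t + h - a))"
      proof -
        have "exp (K * (t + h - a)) = exp (K * (t - a)) * exp (K * h)"
          by (simp add: algebra_simps flip: exp_add)
        thus ?thesis unfolding Yt by (simp only: distrib_right mult.assoc)
      qed
      finally have "Y (t + h) \<ge> Y t * (1 + K * h) + (c + e) * h" using 1 2 by linarith
      thus ?thesis by (simp add: algebra_simps)
    qed
    have Ycont: "continuous_on {a..b} Y" unfolding Y_def by (intro continuous_intros)
    define S where "S = {t \<in> {a..b}. \<forall>s\<in>{a..t}. y s \<le> Y s}"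
    have aS: "a \<in> S" using ab by (auto simp: S_def Y_def)
    have bdd: "bdd_above S" by (rule bdd_aboveI[of _ b]) (auto simp: S_def)
    define t0 where "t0 = Sup S"
    have "a \<le> t0" unfolding t0_def by (rule cSup_upper[OF aS bdd])
    moreover have "t0 \<le> b" unfolding t0_def by (rule cSup_least) (use aS in \<open>auto simp: S_def\<close>)
    ultimately have t0: "a \<le> t0" "t0 \<le> b" by auto
    have below: "y s \<le> Y s" if "a \<le> s" "s < t0" for s
    proof -
      have "s < Sup S" "S \<noteq> {}" using aS that by (auto simp: t0_def)
      then obtain t where "t \<in> S" "s < t" by (rule less_cSupE)
      thus ?thesis using that by (auto simp: S_def)
    qed
    have at0: "y t0 \<le> Y t0"
    proof (cases "t0 = a")
      case True thus ?thesis by (simp add: Y_def)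
    next
      case False
      hence lt: "a < t0" using t0 by simp
      have c1: "continuous (at t0 within {a..b}) y" "continuous (at t0 within {a..b}) Y"
        using cont Ycont t0 by (auto simp: continuous_on_eq_continuous_within)
      have nb: "at t0 within {a..<t0} \<noteq> bot"
        using lt by (simp add: trivial_limit_within islimpt_Ico)
      have l: "(y \<longlongrightarrow> y t0) (at t0 within {a..<t0})" "(Y \<longlongrightarrow> Y t0) (at t0 within {a..<t0})"
        using c1 t0 unfolding continuous_within
        by (auto elim!: tendsto_within_subset)
      show ?thesis
        by (rule tendsto_le[OF nb l(2) l(1)])
          (use below in \<open>auto simp: eventually_at_filter\<close>)
    qed
    have "t0 = b"
    proof (rule ccontr)
      assume "t0 \<noteq> b"
      hence lt: "t0 < b" using t0 by simp
      obtain \<delta> where \<delta>: "\<delta> > 0" "\<And>h. 0 < h \<Longrightarrow> h < \<delta> \<Longrightarrow> y (t0 + h) \<le> y t0 + h * (K * y t0 + c + e)"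
        using dini[OF t0(1) lt e] by blast
      define h where "h = min (\<delta> / 2) (b - t0)"
      have h: "0 < h" "h < \<delta>" "t0 + h \<le> b" using \<delta> lt by (auto simp: h_def min_def)
      have "y (t0 + k) \<le> Y (t0 + k)" if k: "0 < k" "k \<le> h" for k
      proof -
        have "y (t0 + k) \<le> y t0 + k * (K * y t0 + c + e)" using \<delta>(2)[of k] k h by simp
        also have "\<dots> \<le> Y t0 + k * (K * Y t0 + c + e)"
          using at0 K k by (intro add_mono mult_left_mono) auto
        also have "\<dots> \<le> Y (t0 + k)" using k t0 by (intro Ystep) auto
        finally show ?thesis .
      qed
      hence "y s \<le> Y s" if "t0 < s" "s \<le> t0 + h" for s
        using that by (metis add_diff_cancel_left' diff_gt_0_iff_gt add.commute diff_add_cancel diff_le_eq)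
      hence "\<forall>s\<in>{a..t0 + h}. y s \<le> Y s"
        using below at0 by (metis atLeastAtMost_iff linorder_cases)
      hence "t0 + h \<in> S" using h t0 by (simp add: S_def)
      from cSup_upper[OF this bdd] show False using h by (simp add: t0_def)
    qed
    thus ?thesis using at0 by (simp add: Y_def)
  qed
  have "((\<lambda>e. (\<bar>y a\<bar> + (c + e) * (b - a)) * exp (K * (b - a))) \<longlongrightarrow> (\<bar>y a\<bar> + (c + 0) * (b - a)) * exp (K * (b - a))) (at_right 0)"
    by (intro tendsto_intros)
  hence "y b \<le> (\<bar>y a\<bar> + (c + 0) * (b - a)) * exp (K * (b - a))"
    by (rule tendsto_lowerbound) (auto intro!: main eventually_at_rightI[of 0 1])
  thus ?thesis by simp
qed

section \<open>Stability of the smooth solution\<close>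

lemma H_space_iff: "f \<in> H_space m \<longleftrightarrow> square_integrable f \<and> Hm m (L2_fourier f)"
proof
  assume "f \<in> H_space m"
  hence d: "in_domain (Bessel_symbol m) f" by (simp add: H_space_def)
  have f: "square_integrable f" by (rule in_domain_sqi[OF d])
  show "square_integrable f \<and> Hm m (L2_fourier f)"
    using f in_domain_FT_sqi[OF d] sqi_measurable'[OF sqi_L2_fourier[OF f]] by (simp add: Hm_def)
next
  assume "square_integrable f \<and> Hm m (L2_fourier f)"
  thus "f \<in> H_space m"
    unfolding H_space_def by (auto simp: Hm_def Bessel_symbol_def intro!: in_domainI)
qed

lemma hn_H_norm:
  assumes "f \<in> H_space m" shows "hn m (L2_fourier f) = 2 * pi * H_norm m f"
  using L2_norm_multiplier[of "Bessel_symbol m" f] assms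
  by (simp add: hn_def H_norm_def H_space_def)

lemma hn_cong_AE:
  assumes "F \<in> borel_measurable borel" "G \<in> borel_measurable borel" "AE \<xi> in lborel. F \<xi> = G \<xi>"
  shows "hn m F = hn m G"
  unfolding hn_def using assms by (intro L2_norm_cong_AE) (auto elim!: eventually_mono)

lemma Hm_cong_AE:
  assumes "Hm m G" "F \<in> borel_measurable borel" "AE \<xi> in lborel. F \<xi> = G \<xi>"
  shows "Hm m F"
proof -
  have "square_integrable (\<lambda>\<xi>. Bessel_symbol m \<xi> * G \<xi>)" using assms by (simp add: Hm_def)
  hence "square_integrable (\<lambda>\<xi>. Bessel_symbol m \<xi> * F \<xi>)"
    by (rule sqi_cong_AE) (use assms in \<open>auto elim!: eventually_mono\<close>)
  thus ?thesis using assms by (simp add: Hm_def)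
qed

lemma hn_cmult: "hn m (\<lambda>\<xi>. c * F \<xi>) = norm c * hn m F"
  unfolding hn_def L2_norm_cmult[symmetric] by (simp add: mult.left_commute)

section \<open>The relative energy of a weak and a smooth solution\<close>

locale two_flows = weak_flow +
  fixes g0 :: "plane \<Rightarrow> real" and g g' :: "real \<Rightarrow> plane \<Rightarrow> real" and C0 :: real
  assumes g0: "square_integrable g0" and deriv: "has_H_derivative_on m T g g'"
    and inviscid: "\<And>t. t \<in> {0<..<T} \<Longrightarrow> AE x in lborel. g' t x + velocity \<beta> (g t) x \<bullet> L2_gradient (g t) x = 0"
    and bound: "\<And>t. t \<in> {0<..<T} \<Longrightarrow> H_norm m (g t) \<le> C0"
    and init: "((\<lambda>t. L2_norm (\<lambda>x. g t x - g0 x)) \<longlongrightarrow> 0) (at_right 0)"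
begin

abbreviation gh :: "real \<Rightarrow> plane \<Rightarrow> complex" where "gh t \<equiv> L2_fourier (g t)"
abbreviation gh' :: "real \<Rightarrow> plane \<Rightarrow> complex" where "gh' t \<equiv> L2_fourier (g' t)"

lemma g_H: "t \<in> {0<..<T} \<Longrightarrow> g t \<in> H_space m" "t \<in> {0<..<T} \<Longrightarrow> g' t \<in> H_space m"
  using deriv by (auto simp: has_H_derivative_on_def)

lemma g_sqi: "t \<in> {0<..<T} \<Longrightarrow> square_integrable (g t)" "t \<in> {0<..<T} \<Longrightarrow> square_integrable (g' t)"
  using g_H by (auto simp: H_space_iff)

lemma gh_Hm: "t \<in> {0<..<T} \<Longrightarrow> Hm m (gh t)" "t \<in> {0<..<T} \<Longrightarrow> Hm m (gh' t)"
  using g_H by (auto simp: H_space_iff)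

definition Bd :: real where "Bd = 2 * pi * C0"

lemma gh_bound: "t \<in> {0<..<T} \<Longrightarrow> hn m (gh t) \<le> Bd"
  using bound by (simp add: hn_H_norm g_H Bd_def)

lemma Bd_nonneg: "Bd \<ge> 0"
proof -
  have "T / 2 \<in> {0<..<T}" using T by simp
  from gh_bound[OF this] show ?thesis using hn_nonneg order_trans by blast
qed

text \<open>The remainder of the difference quotient in transforms. Defined from the transforms of
  its parts, it makes \<open>gh_increment\<close> an exact pointwise identity, which the transform
  of the remainder itself would satisfy only almost everywhere.\<close>

definition Q :: "real \<Rightarrow> real \<Rightarrow> plane \<Rightarrow> complex" where
  "Q t h = (\<lambda>\<xi>. of_real (1 / h) * (gh (t + h) \<xi> - gh t \<xi>) - gh' t \<xi>)"

lemma Q_Hm: "t \<in> {0<..<T} \<Longrightarrow> t + h \<in> {0<..<T} \<Longrightarrow> Hm m (Q t h)"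
  unfolding Q_def by (intro Hm_diff Hm_cmult gh_Hm)

lemma gh_increment: "h \<noteq> 0 \<Longrightarrow> gh (t + h) \<xi> = gh t \<xi> + of_real h * (gh' t \<xi> + Q t h \<xi>)"
  by (simp add: Q_def field_simps)

lemma Q_tendsto:
  assumes t: "t \<in> {0<..<T}"
  shows "((\<lambda>h. hn m (Q t h)) \<longlongrightarrow> 0) (at 0)"
proof -
  have "((\<lambda>h. H_norm m (\<lambda>x. (g (t + h) x - g t x) / h - g' t x)) \<longlongrightarrow> 0) (at 0)"
    using deriv t by (auto simp: has_H_derivative_on_def)
  from tendsto_mult[OF tendsto_const[of "2 * pi"] this]
  have "((\<lambda>h. 2 * pi * H_norm m (\<lambda>x. (g (t + h) x - g t x) / h - g' t x)) \<longlongrightarrow> 0) (at 0)" by simp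
  moreover have "\<forall>\<^sub>F h in at 0. 2 * pi * H_norm m (\<lambda>x. (g (t + h) x - g t x) / h - g' t x) = hn m (Q t h)"
  proof -
    have "((\<lambda>h. t + h) \<longlongrightarrow> t + 0) (at 0)" by (intro tendsto_intros)
    hence "\<forall>\<^sub>F h in at 0. t + h \<in> {0<..<T}" using t by (intro topological_tendstoD) auto
    thus ?thesis
    proof eventually_elim
      case (elim h)
      let ?f = "\<lambda>x. (g (t + h) x - g t x) / h - g' t x"
      have "has_FT (\<lambda>x. of_real (1 / h) * (complex_of_real (g (t + h) x) - complex_of_real (g t x)) - complex_of_real (g' t x)) (Q t h)"
        unfolding Q_def by (intro has_FT_diff has_FT_cmult has_FT_L2_fourier g_sqi t elim)
      hence FT: "has_FT (\<lambda>x. complex_of_real (?f x)) (Q t h)" by (simp add: divide_inverse mult.commute)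
      have f: "square_integrable ?f" using has_FT_sqi(1)[OF FT] by (simp only: sqi_of_real)
      \<comment> \<open>\<open>H_norm\<close> sees the chosen transform of the quotient,
        \<open>hn\<close> sees \<open>Q\<close>; they agree only up to a null set.\<close>
      have ae: "AE \<xi> in lborel. L2_fourier ?f \<xi> = Q t h \<xi>" by (rule L2_fourier_AE[OF FT])
      have m1: "L2_fourier ?f \<in> borel_measurable borel" by (rule sqi_measurable'[OF sqi_L2_fourier[OF f]])
      have "?f \<in> H_space m"
        unfolding H_space_iff using f Hm_cong_AE[OF Q_Hm[OF t elim] m1 ae] by simp
      from hn_H_norm[OF this] hn_cong_AE[OF m1 HmD(1)[OF Q_Hm[OF t elim]] ae]
      show ?case by simp
    qed
  qed
  ultimately show ?thesis by (rule Lim_transform_eventually)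
qed

lemma g_domains:
  assumes t: "t \<in> {0<..<T}"
  shows "in_domain (vsym \<beta> j) (g t)" "in_domain (partial_symbol j) (g t)"
proof -
  have "norm (complex_of_real (norm \<xi> powr (\<beta> - 1))) \<le> (1 + (norm \<xi>)\<^sup>2) powr (m / 2)" for \<xi> :: plane
    using norm_powr_le_bracket[of "\<beta> - 1" m \<xi>] \<beta> m by simp
  from Hm_sqi_symbol[OF gh_Hm(1)[OF t] _ this]
  show "in_domain (vsym \<beta> j) (g t)" by (intro vsym_in_domain g_sqi t) simp
  have "norm (partial_symbol j \<xi>) \<le> (1 + (norm \<xi>)\<^sup>2) powr (m / 2)" for \<xi>
    using norm_powr_le_bracket[of 1 m \<xi>] component_le_norm_plane[of \<xi> j] m_pos
    by (simp add: partial_symbol_def norm_mult)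
  from Hm_sqi_symbol[OF gh_Hm(1)[OF t] _ this]
  show "in_domain (partial_symbol j) (g t)"
    by (intro in_domainI g_sqi t) (auto simp: symbol_Hermitian)
qed

text \<open>Pairing the inviscid equation with f turns the transport term into
  \<open>2 * tri\<close> by \<open>transport_smooth\<close>. As f is merely square integrable, it
  may be the weak solution at any positive time.\<close>

lemma inviscid_pairing:
  assumes t: "t \<in> {0<..<T}" and f: "square_integrable f"
  shows "pair (gh' t) (L2_fourier f) = - 2 * Re (tri \<beta> (L2_fourier f) (gh t) (gh t))"
proof -
  note dom = g_domains[OF t]
  note [measurable] = sqi_measurable'[OF f] sqi_measurable'[OF g_sqi(2)[OF t]]
  have [measurable]: "(\<lambda>x. velocity \<beta> (g t) x $ 1) \<in> borel_measurable borel" "(\<lambda>x. velocity \<beta> (g t) x $ 2) \<in> borel_measurable borel"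
    using has_FT_sqi(1)[OF velocity_FT(1)[OF dom(1) dom(1)]] has_FT_sqi(1)[OF velocity_FT(2)[OF dom(1) dom(1)]]
    by (simp_all add: sqi_measurable')
  have [measurable]: "(\<lambda>x. L2_gradient (g t) x $ j) \<in> borel_measurable borel" for j
    using sqi_measurable'[OF sqi_multiplier[OF dom(2)[of j]]] by (simp add: L2_gradient_def)
  have "pair (gh' t) (L2_fourier f) = (LINT x|lborel. g' t x * f x)"
    by (rule pair_Parseval[OF has_FT_L2_fourier[OF g_sqi(2)[OF t]] has_FT_L2_fourier[OF f], symmetric])
  also have "\<dots> = (LINT x|lborel. - ((velocity \<beta> (g t) x \<bullet> L2_gradient (g t) x) * f x))"
  proof (rule integral_cong_AE)
    show "AE x in lborel. g' t x * f x = - ((velocity \<beta> (g t) x \<bullet> L2_gradient (g t) x) * f x)"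
      using inviscid[OF t]
    proof eventually_elim
      case (elim x)
      hence "g' t x = - (velocity \<beta> (g t) x \<bullet> L2_gradient (g t) x)" by linarith
      thus ?case by simp
    qed
    show "(\<lambda>x. - ((velocity \<beta> (g t) x \<bullet> L2_gradient (g t) x) * f x)) \<in> borel_measurable lborel"
      unfolding inner_plane by measurable
  qed measurable
  also have "\<dots> = - (LINT x|lborel. (velocity \<beta> (g t) x \<bullet> L2_gradient (g t) x) * f x)" by simp
  also have "(LINT x|lborel. (velocity \<beta> (g t) x \<bullet> L2_gradient (g t) x) * f x) = Re (complex_of_real (LINT x|lborel. (velocity \<beta> (g t) x \<bullet> L2_gradient (g t) x) * f x))"
    by simp
  also have "\<dots> = Re (2 * tri \<beta> (L2_fourier f) (gh t) (gh t))"
    using Hm_wintegrable[OF gh_Hm(1)[OF t] _ _ m, of "\<beta> - 1"] \<beta>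
    by (subst transport_smooth[OF \<beta> dom(1) dom(1) f dom(2) _ HmD(4)[OF gh_Hm(1)[OF t]]]) auto
  finally show ?thesis by simp
qed

lemma pair_gh'_gh:
  assumes t: "t \<in> {0<..<T}" shows "pair (gh' t) (gh t) = 0"
  using inviscid_pairing[OF t g_sqi(1)[OF t]]
    tri_diagonal[OF \<beta> HmD(2)[OF gh_Hm(1)[OF t]] HmD(4)[OF gh_Hm(1)[OF t]]] by simp

text \<open>Write A = G + W with G the transform of g, and expand both slots. Since
  \<open>tri\<close> vanishes on three copies of G, the linear terms in W may be written with A
  instead; they form \<open>2 * tri\<close> with A once, exactly what
  \<open>inviscid_pairing\<close> contributes with opposite sign.\<close>

lemma relative_energy_identity:
  assumes t: "t \<in> {0<..<T}" and A: "square_integrable A"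
  shows "tri \<beta> A A (gh t) = 2 * tri \<beta> A (gh t) (gh t) + tri \<beta> (\<lambda>\<xi>. A \<xi> - gh t \<xi>) (\<lambda>\<xi>. A \<xi> - gh t \<xi>) (gh t)"
proof -
  note G = HmD(2)[OF gh_Hm(1)[OF t]] and C = HmD(1,4)[OF gh_Hm(1)[OF t]]
  let ?W = "\<lambda>\<xi>. A \<xi> - gh t \<xi>"
  have W: "square_integrable ?W" by (rule sqi_diff[OF A G])
  have "tri \<beta> A A (gh t) = tri \<beta> (gh t) A (gh t) + tri \<beta> ?W A (gh t)"
    using tri_add1[OF \<beta> G W A C] by simp
  also have "tri \<beta> (gh t) A (gh t) = tri \<beta> A (gh t) (gh t)" by (rule tri_commute[OF \<beta> G A C])
  also have "tri \<beta> ?W A (gh t) = tri \<beta> ?W (gh t) (gh t) + tri \<beta> ?W ?W (gh t)"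
    using tri_add2[OF \<beta> W G W C] by simp
  also have "tri \<beta> ?W (gh t) (gh t) = tri \<beta> A (gh t) (gh t)"
    using tri_add1[OF \<beta> G W G C] tri_diagonal[OF \<beta> G C(2)] by simp
  finally show ?thesis by simp
qed

text \<open>Origin: the 2 from the cross term in the square of the difference,
  \<open>wK (m - \<beta>) * Bd\<close> bounds the weighted norm of g, and
  \<open>(2 * pi)\<^sup>2\<close> is Plancherel for two factors of the difference. No \<nu> enters
  here; the viscous error \<open>cc\<close> carries it.\<close>

definition KK :: real where "KK = 2 * (wK (m - \<beta>) * Bd * (2 * pi)\<^sup>2)"
definition cc :: real where "cc = 2 * (\<nu> * Bd * (2 * pi * M0))"

lemma KK_nonneg: "KK \<ge> 0" and cc_nonneg: "cc \<ge> 0"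
  using wK_nonneg Bd_nonneg \<nu> M0_nonneg by (simp_all add: KK_def cc_def)

text \<open>The two times are independent: g is taken at t and \<theta> at s. After the linear terms
  cancel, the symmetrised form in the difference gives \<open>KK\<close>, and the viscous term, with
  its whole order 2\<alpha> on g, gives \<open>cc\<close>.\<close>

lemma integrand_bound:
  assumes t: "t \<in> {0<..<T}" and s: "s > 0"
  shows "- 2 * Nf \<alpha> \<beta> \<nu> (hat s) (gh t) - 2 * pair (gh' t) (hat s) \<le> KK * (L2_norm (\<lambda>x. \<theta> s x - g t x))\<^sup>2 + cc"
proof -
  note C = gh_Hm(1)[OF t]
  note A = hat_sqi[OF s]
  let ?W = "\<lambda>\<xi>. hat s \<xi> - gh t \<xi>"
  have W: "square_integrable ?W" by (rule sqi_diff[OF A HmD(2)[OF C]])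
  have nW: "L2_norm ?W = 2 * pi * L2_norm (\<lambda>x. \<theta> s x - g t x)"
    by (rule L2_norm_fourier_diff[OF \<theta>_sqi[OF s] g_sqi(1)[OF t]])
  have "- Re (tri \<beta> ?W ?W (gh t)) \<le> norm (tri \<beta> ?W ?W (gh t))"
    using abs_Re_le_cmod[of "tri \<beta> ?W ?W (gh t)"] by linarith
  also have "\<dots> \<le> wint \<beta> (gh t) * L2_norm ?W * L2_norm ?W" by (rule tri_bound[OF \<beta> W W HmD(1,4)[OF C]])
  also have "\<dots> \<le> (wK (m - \<beta>) * Bd) * L2_norm ?W * L2_norm ?W"
  proof -
    have "wint \<beta> (gh t) \<le> wK (m - \<beta>) * Bd"
      using HmD(5)[OF C] gh_bound[OF t] wK_nonneg[of "m - \<beta>"] by (meson mult_left_mono order_trans)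
    thus ?thesis by (intro mult_right_mono) auto
  qed
  also have "\<dots> = wK (m - \<beta>) * Bd * (2 * pi)\<^sup>2 * (L2_norm (\<lambda>x. \<theta> s x - g t x))\<^sup>2"
    unfolding nW by (simp add: power2_eq_square)
  finally have "2 * (- Re (tri \<beta> ?W ?W (gh t))) \<le> 2 * (wK (m - \<beta>) * Bd * (2 * pi)\<^sup>2 * (L2_norm (\<lambda>x. \<theta> s x - g t x))\<^sup>2)"
    by (rule mult_left_mono) simp
  hence 1: "- 2 * Re (tri \<beta> ?W ?W (gh t)) \<le> KK * (L2_norm (\<lambda>x. \<theta> s x - g t x))\<^sup>2"
    by (simp only: KK_def mult.assoc mult_minus_left mult_minus_right)
  have "pair (\<lambda>\<xi>. Lambda_symbol (2 * \<alpha>) \<xi> * gh t \<xi>) (hat s) \<le> L2_norm (\<lambda>\<xi>. Lambda_symbol (2 * \<alpha>) \<xi> * gh t \<xi>) * L2_norm (hat s)"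
    using pair_bound[OF HmD(6)[OF C] A] by linarith
  also have "\<dots> \<le> Bd * (2 * pi * M0)"
    using HmD(7)[OF C] gh_bound[OF t] hat_norm[OF s] Bd_nonneg by (intro mult_mono) auto
  finally have "\<nu> * pair (\<lambda>\<xi>. Lambda_symbol (2 * \<alpha>) \<xi> * gh t \<xi>) (hat s) \<le> \<nu> * (Bd * (2 * pi * M0))"
    using \<nu> by (intro mult_left_mono) auto
  hence 2: "2 * (\<nu> * pair (\<lambda>\<xi>. Lambda_symbol (2 * \<alpha>) \<xi> * gh t \<xi>) (hat s)) \<le> cc"
    unfolding cc_def by linarith
  have "- 2 * Nf \<alpha> \<beta> \<nu> (hat s) (gh t) - 2 * pair (gh' t) (hat s)
      = - 2 * Re (tri \<beta> ?W ?W (gh t)) + 2 * (\<nu> * pair (\<lambda>\<xi>. Lambda_symbol (2 * \<alpha>) \<xi> * gh t \<xi>) (hat s))"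
    unfolding Nf_def inviscid_pairing[OF t \<theta>_sqi[OF s]] relative_energy_identity[OF t A] by simp
  with 1 2 show ?thesis by linarith
qed

text \<open>\<open>y t\<close> dominates \<open>\<parallel>\<theta> t - g t\<parallel>\<^sup>2\<close> for almost every \<open>t\<close>, and unlike the latter it is continuous.\<close>

definition y :: "real \<Rightarrow> real" where
  "y t = M0\<^sup>2 + (L2_norm (g t))\<^sup>2 - 2 * Lf t (gh t)"

lemma L2_norm_diff_sq:
  assumes f: "square_integrable f" and h: "square_integrable h"
  shows "(L2_norm (\<lambda>x. f x - h x))\<^sup>2 = (L2_norm f)\<^sup>2 + (L2_norm h)\<^sup>2 - 2 * pair (L2_fourier h) (L2_fourier f)"
proof -
  have "(L2_norm (\<lambda>x. f x - h x))\<^sup>2 = (LINT x|lborel. (norm (f x))\<^sup>2 + (norm (h x))\<^sup>2 - 2 * (h x * f x))"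
    unfolding L2_norm_sq by (intro Bochner_Integration.integral_cong) (auto simp: power2_eq_square algebra_simps)
  also have "\<dots> = (L2_norm f)\<^sup>2 + (L2_norm h)\<^sup>2 - 2 * (LINT x|lborel. h x * f x)"
    unfolding L2_norm_sq using sqi_integrable[OF f] sqi_integrable[OF h] sqi_mult_integrable[OF h f] by simp
  also have "(LINT x|lborel. h x * f x) = pair (L2_fourier h) (L2_fourier f)"
    by (rule pair_Parseval[OF has_FT_L2_fourier[OF h] has_FT_L2_fourier[OF f]])
  finally show ?thesis .
qed

text \<open>Fixing t first keeps the null set of \<open>weak_Hm\<close> attached to a single test
  function; only s varies. The energy inequality replaces the norm of \<theta> at s by its initial
  bound.\<close>

lemma frozen_energy:
  assumes t: "t \<in> {0<..<T}"
  shows "AE s in lebesgue. 0 < s \<and> s < T \<longrightarrow>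
    (L2_norm (\<lambda>x. \<theta> s x - g t x))\<^sup>2 \<le> M0\<^sup>2 + (L2_norm (g t))\<^sup>2 - 2 * Lf s (gh t)"
  using weak_Hm[OF g_sqi(1)[OF t] gh_Hm(1)[OF t]]
proof eventually_elim
  case (elim s)
  show ?case
  proof
    assume s: "0 < s \<and> s < T"
    have "(L2_norm (\<theta> s))\<^sup>2 \<le> M0\<^sup>2" using s \<theta>_norm by (intro power_mono) auto
    thus "(L2_norm (\<lambda>x. \<theta> s x - g t x))\<^sup>2 \<le> M0\<^sup>2 + (L2_norm (g t))\<^sup>2 - 2 * Lf s (gh t)"
      using elim s by (simp add: L2_norm_diff_sq[OF \<theta>_sqi g_sqi(1)[OF t]])
  qed
qed

lemma Dini_step:
  assumes t: "t \<in> {0<..<T}" and h: "h > 0" "t + h \<in> {0<..<T}"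
  shows "y (t + h) \<le> y t + h * (KK * y t + cc + ((2 * KK * NB * Bd + 4 * NB * hn m (gh' t)) * h
    + 2 * (2 * pi * M0 + NB * T) * hn m (Q t h) + 2 * Bd * hn m (Q t h) + h * (hn m (gh' t) + hn m (Q t h))\<^sup>2))"
proof -
  define H1 where "H1 = hn m (gh' t)"
  define q where "q = hn m (Q t h)"
  note C = gh_Hm(1)[OF t] and C' = gh_Hm(2)[OF t] and CQ = Q_Hm[OF t h(2)]
  define D where "D \<xi> = of_real h * (gh' t \<xi> + Q t h \<xi>)" for \<xi>
  have CD: "Hm m D" unfolding D_def by (intro Hm_cmult Hm_add C' CQ)
  have ghD: "gh (t + h) = (\<lambda>\<xi>. gh t \<xi> + D \<xi>)"
    using gh_increment[of h t] h by (simp add: fun_eq_iff D_def)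
  have t0: "0 \<le> t" "t \<le> t + h" "0 \<le> t + h" "t + h \<le> T" "t < T" using t h by auto
  have LD: "Lf (t + h) D = h * Lf (t + h) (gh' t) + h * Lf (t + h) (Q t h)"
    unfolding D_def Lf_cmult Lf_add[OF C' CQ] by (rule distrib_left)

  have AE1: "AE s in lebesgue. t < s \<and> s < t + h \<longrightarrow>
      Nf \<alpha> \<beta> \<nu> (hat s) (\<lambda>\<xi>. of_real (- 2) * gh t \<xi>) \<le> KK * (y t + 2 * NB * Bd * h) + cc + 2 * Lf t (gh' t) + 2 * NB * H1 * h"
    using frozen_energy[OF t] weak_Hm[OF g_sqi(2)[OF t] C']
  proof eventually_elim
    case (elim s)
    show ?case
    proof
      assume "t < s \<and> s < t + h"
      hence s: "0 < s" "s < T" "t \<le> s" "s - t \<le> h" using t0 by auto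
      have "\<bar>Lf s (gh t) - Lf t (gh t)\<bar> \<le> NB * hn m (gh t) * (s - t)" by (rule Lf_Lipschitz[OF C t0(1) s(3)])
      also have "\<dots> \<le> NB * Bd * h"
        using s gh_bound[OF t] NB_nonneg Bd_nonneg by (intro mult_mono mult_nonneg_nonneg) (auto simp: hn_nonneg)
      finally have L1: "- 2 * Lf s (gh t) \<le> - 2 * Lf t (gh t) + 2 * NB * Bd * h" by linarith
      have "\<bar>Lf s (gh' t) - Lf t (gh' t)\<bar> \<le> NB * hn m (gh' t) * (s - t)" by (rule Lf_Lipschitz[OF C' t0(1) s(3)])
      also have "\<dots> \<le> NB * H1 * h"
        using s NB_nonneg hn_nonneg by (intro mult_mono mult_nonneg_nonneg) (auto simp: H1_def hn_nonneg)
      finally have L2: "2 * Lf s (gh' t) \<le> 2 * Lf t (gh' t) + 2 * NB * H1 * h" by linarith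
      have "(L2_norm (\<lambda>x. \<theta> s x - g t x))\<^sup>2 \<le> y t + 2 * NB * Bd * h"
        using elim(1) s L1 by (simp add: y_def)
      hence "KK * (L2_norm (\<lambda>x. \<theta> s x - g t x))\<^sup>2 \<le> KK * (y t + 2 * NB * Bd * h)"
        using KK_nonneg by (rule mult_left_mono)
      moreover have "Nf \<alpha> \<beta> \<nu> (hat s) (\<lambda>\<xi>. of_real (- 2) * gh t \<xi>) = - 2 * Nf \<alpha> \<beta> \<nu> (hat s) (gh t)"
        by (rule Nf_cmult)
      moreover have "pair (gh' t) (hat s) = Lf s (gh' t)" using elim(2) s by simp
      ultimately show "Nf \<alpha> \<beta> \<nu> (hat s) (\<lambda>\<xi>. of_real (- 2) * gh t \<xi>)
          \<le> KK * (y t + 2 * NB * Bd * h) + cc + 2 * Lf t (gh' t) + 2 * NB * H1 * h"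
        using integrand_bound[OF t s(1)] L2 by linarith
    qed
  qed
  have "Lf (t + h) (\<lambda>\<xi>. of_real (- 2) * gh t \<xi>) - Lf t (\<lambda>\<xi>. of_real (- 2) * gh t \<xi>)
      \<le> (KK * (y t + 2 * NB * Bd * h) + cc + 2 * Lf t (gh' t) + 2 * NB * H1 * h) * (t + h - t)"
    by (rule Lf_increment_upper[OF Hm_cmult[OF C] t0(1,2) AE1])
  hence I1: "- 2 * Lf (t + h) (gh t) + 2 * Lf t (gh t)
      \<le> h * (KK * (y t + 2 * NB * Bd * h) + cc + 2 * Lf t (gh' t) + 2 * NB * H1 * h)"
    unfolding Lf_cmult by (simp add: mult.commute)

  have "\<bar>Lf (t + h) (gh' t) - Lf t (gh' t)\<bar> \<le> NB * hn m (gh' t) * (t + h - t)" by (rule Lf_Lipschitz[OF C' t0(1,2)])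
  hence "- Lf (t + h) (gh' t) \<le> - Lf t (gh' t) + NB * H1 * h" by (simp add: H1_def abs_le_iff)
  moreover have "- Lf (t + h) (Q t h) \<le> (2 * pi * M0 + NB * T) * q"
    using Lf_bound[OF CQ t0(3,4)] by (simp add: q_def abs_le_iff)
  ultimately have "h * (- Lf (t + h) (gh' t) - Lf (t + h) (Q t h)) \<le> h * (- Lf t (gh' t) + NB * H1 * h + (2 * pi * M0 + NB * T) * q)"
    using h by (intro mult_left_mono) auto
  hence I2: "- 2 * Lf (t + h) D \<le> 2 * (h * (- Lf t (gh' t) + NB * H1 * h + (2 * pi * M0 + NB * T) * q))"
    unfolding LD by (simp add: algebra_simps)

  have sq: "square_integrable (gh t)" "square_integrable D" "square_integrable (gh' t)" "square_integrable (Q t h)"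
    by (rule HmD(2)[OF C] HmD(2)[OF CD] HmD(2)[OF C'] HmD(2)[OF CQ])+
  have "(L2_norm (g (t + h)))\<^sup>2 = pair (gh (t + h)) (gh (t + h))"
    by (rule pair_self[symmetric]) (rule g_sqi(1)[OF h(2)])
  also have "\<dots> = pair (gh t) (gh t) + 2 * pair D (gh t) + pair D D"
  proof -
    have "pair (gh (t + h)) (gh (t + h)) = pair (gh t) (gh (t + h)) + pair D (gh (t + h))"
      unfolding ghD by (intro pair_add1 sq sqi_add)
    also have "pair (gh t) (gh (t + h)) = pair (gh t) (gh t) + pair D (gh t)"
      unfolding pair_commute[of "gh t" "gh (t + h)"] unfolding ghD by (intro pair_add1 sq)
    also have "pair D (gh (t + h)) = pair D (gh t) + pair D D"
      unfolding pair_commute[of D "gh (t + h)"] unfolding ghD pair_commute[of D "gh t"] by (intro pair_add1 sq)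
    finally show ?thesis by simp
  qed
  \<comment> \<open>The part of \<open>D\<close> along the time derivative of g is orthogonal to g,
    by conservation of the norm; only the remainder \<open>Q\<close> is left.\<close>
  also have "pair D (gh t) = h * pair (Q t h) (gh t)"
    unfolding D_def pair_cmult1 by (simp add: pair_add1 sq pair_gh'_gh[OF t])
  also have "pair (gh t) (gh t) = (L2_norm (g t))\<^sup>2" by (rule pair_self[OF g_sqi(1)[OF t]])
  finally have E: "(L2_norm (g (t + h)))\<^sup>2 = (L2_norm (g t))\<^sup>2 + 2 * (h * pair (Q t h) (gh t)) + pair D D" .
  have "pair (Q t h) (gh t) \<le> L2_norm (Q t h) * L2_norm (gh t)"
    using pair_bound[OF sq(4,1)] by linarith
  also have "\<dots> \<le> q * Bd"
    using HmD(3)[OF CQ] HmD(3)[OF C] gh_bound[OF t] hn_nonneg by (intro mult_mono) (auto simp: q_def)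
  finally have E1: "h * pair (Q t h) (gh t) \<le> h * (q * Bd)" using h by (intro mult_left_mono) auto
  have "hn m D \<le> h * (H1 + q)"
    unfolding D_def hn_cmult H1_def q_def using h hn_add[OF C' CQ] by simp
  hence nD: "L2_norm D \<le> h * (H1 + q)" using HmD(3)[OF CD] by linarith
  have "pair D D \<le> L2_norm D * L2_norm D" using pair_bound[OF sq(2,2)] by linarith
  also have "\<dots> \<le> (h * (H1 + q)) * (h * (H1 + q))"
    by (rule mult_mono[OF nD nD order_trans[OF L2_norm_nonneg nD] L2_norm_nonneg])
  finally have E2: "pair D D \<le> h * (h * (H1 + q)\<^sup>2)" by (simp add: power2_eq_square mult_ac)
  have "Lf (t + h) (gh (t + h)) = Lf (t + h) (gh t) + Lf (t + h) D"
    unfolding ghD by (rule Lf_add[OF C CD])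
  hence "y (t + h) = M0\<^sup>2 + ((L2_norm (g t))\<^sup>2 + 2 * (h * pair (Q t h) (gh t)) + pair D D) - 2 * (Lf (t + h) (gh t) + Lf (t + h) D)"
    by (simp only: y_def E)
  \<comment> \<open>The terms \<open>Lf t (gh' t)\<close> come with opposite signs: once from the
    integrand bound, once from moving the test function. They cancel on collecting terms.\<close>
  also have "\<dots> \<le> y t + 2 * (h * (q * Bd)) + h * (h * (H1 + q)\<^sup>2)
      + h * (KK * (y t + 2 * NB * Bd * h) + cc + 2 * Lf t (gh' t) + 2 * NB * H1 * h)
      + 2 * (h * (- Lf t (gh' t) + NB * H1 * h + (2 * pi * M0 + NB * T) * q))"
  proof -
    have lin: "M + (G + 2 * p + d) - 2 * (u + v) \<le> M + G - 2 * u' + 2 * p' + d' + A + B"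
      if "- 2 * u + 2 * u' \<le> A" "- 2 * v \<le> B" "p \<le> p'" "d \<le> d'" for M G p d u v u' p' d' A B :: real
      using that by simp
    show ?thesis unfolding y_def[of t] by (rule lin[OF I1[unfolded y_def] I2 E1 E2])
  qed
  also have "\<dots> = y t + h * (KK * y t + cc + ((2 * KK * NB * Bd + 4 * NB * H1) * h
    + 2 * (2 * pi * M0 + NB * T) * q + 2 * Bd * q + h * (H1 + q)\<^sup>2))"
    by (simp add: algebra_simps)
  finally show ?thesis by (simp add: H1_def q_def)
qed

text \<open>Each term of the remainder in \<open>Dini_step\<close> carries a factor h or the norm of
  \<open>Q t h\<close>, and both tend to 0 from the right.\<close>

lemma Dini:
  assumes t: "t \<in> {0<..<T}" and e: "e > 0"
  shows "\<exists>\<delta>>0. \<forall>h. 0 < h \<and> h < \<delta> \<longrightarrow> y (t + h) \<le> y t + h * (KK * y t + cc + e)"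
proof -
  let ?e = "\<lambda>h. (2 * KK * NB * Bd + 4 * NB * hn m (gh' t)) * h
    + 2 * (2 * pi * M0 + NB * T) * hn m (Q t h) + 2 * Bd * hn m (Q t h) + h * (hn m (gh' t) + hn m (Q t h))\<^sup>2"
  have Q0: "((\<lambda>h. hn m (Q t h)) \<longlongrightarrow> 0) (at_right 0)"
    using Q_tendsto[OF t] by (rule filterlim_mono) (auto intro: at_le)
  have "(?e \<longlongrightarrow> (2 * KK * NB * Bd + 4 * NB * hn m (gh' t)) * 0
    + 2 * (2 * pi * M0 + NB * T) * 0 + 2 * Bd * 0 + 0 * (hn m (gh' t) + 0)\<^sup>2) (at_right 0)"
    by (intro tendsto_intros Q0)
  hence "\<forall>\<^sub>F h in at_right 0. ?e h < e" using e by (intro order_tendstoD(2)) auto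
  then obtain d where d: "d > 0" "\<And>h. 0 < h \<Longrightarrow> h < d \<Longrightarrow> ?e h < e"
    by (auto simp: eventually_at_right_field)
  have "y (t + h) \<le> y t + h * (KK * y t + cc + e)" if h: "0 < h" "h < min d (T - t)" for h
  proof -
    have th: "t + h \<in> {0<..<T}" using t h by auto
    have "y (t + h) \<le> y t + h * (KK * y t + cc + ?e h)" by (rule Dini_step[OF t h(1) th])
    also have "\<dots> \<le> y t + h * (KK * y t + cc + e)"
      using h d(2)[of h] by (intro add_left_mono mult_left_mono) auto
    finally show ?thesis .
  qed
  moreover have "min d (T - t) > 0" using d t by simp
  ultimately show ?thesis by blast
qed

lemma gh_continuous:
  assumes t: "t \<in> {0<..<T}"
  shows "((\<lambda>s. hn m (\<lambda>\<xi>. gh s \<xi> - gh t \<xi>)) \<longlongrightarrow> 0) (at t)"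
proof -
  have ev: "\<forall>\<^sub>F h in at 0. t + h \<in> {0<..<T}"
  proof -
    have "((\<lambda>h. t + h) \<longlongrightarrow> t + 0) (at 0)" by (intro tendsto_intros)
    thus ?thesis using t by (intro topological_tendstoD) auto
  qed
  have "((\<lambda>h. hn m (\<lambda>\<xi>. gh (t + h) \<xi> - gh t \<xi>)) \<longlongrightarrow> 0) (at 0)"
  proof (rule Lim_null_comparison)
    show "\<forall>\<^sub>F h in at 0. norm (hn m (\<lambda>\<xi>. gh (t + h) \<xi> - gh t \<xi>)) \<le> \<bar>h\<bar> * (hn m (gh' t) + hn m (Q t h))"
      using ev eventually_neq_at_within[of 0 0]
    proof eventually_elim
      case (elim h)
      have "(\<lambda>\<xi>. gh (t + h) \<xi> - gh t \<xi>) = (\<lambda>\<xi>. of_real h * (gh' t \<xi> + Q t h \<xi>))"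
        using gh_increment[of h t] elim by simp
      hence "hn m (\<lambda>\<xi>. gh (t + h) \<xi> - gh t \<xi>) = \<bar>h\<bar> * hn m (\<lambda>\<xi>. gh' t \<xi> + Q t h \<xi>)" by (simp add: hn_cmult)
      also have "\<dots> \<le> \<bar>h\<bar> * (hn m (gh' t) + hn m (Q t h))"
        using elim by (intro mult_left_mono hn_add gh_Hm Q_Hm t) auto
      finally show ?case using hn_nonneg by simp
    qed
    have "((\<lambda>h. \<bar>h\<bar> * (hn m (gh' t) + hn m (Q t h))) \<longlongrightarrow> \<bar>0\<bar> * (hn m (gh' t) + 0)) (at 0)"
      by (intro tendsto_intros Q_tendsto t)
    thus "((\<lambda>h. \<bar>h\<bar> * (hn m (gh' t) + hn m (Q t h))) \<longlongrightarrow> 0) (at 0)" by simp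
  qed
  thus ?thesis by (subst at_to_0) (simp add: filterlim_filtermap add.commute)
qed

lemma Lf_gh_limit:
  assumes t: "t \<in> {0<..<T}" and u: "0 \<le> u" "u \<le> T"
  shows "((\<lambda>s. Lf u (gh s)) \<longlongrightarrow> Lf u (gh t)) (at t)"
proof -
  have ev: "\<forall>\<^sub>F s in at t. s \<in> {0<..<T}" using t by (intro eventually_at_in_open') auto
  have "((\<lambda>s. Lf u (gh s) - Lf u (gh t)) \<longlongrightarrow> 0) (at t)"
  proof (rule Lim_null_comparison)
    show "\<forall>\<^sub>F s in at t. norm (Lf u (gh s) - Lf u (gh t)) \<le> (2 * pi * M0 + NB * T) * hn m (\<lambda>\<xi>. gh s \<xi> - gh t \<xi>)"
      using ev
    proof eventually_elim
      case (elim s)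
      show ?case
        unfolding Lf_diff[OF gh_Hm(1)[OF elim] gh_Hm(1)[OF t], symmetric] real_norm_def
        by (intro Lf_bound u Hm_diff gh_Hm elim t)
    qed
    show "((\<lambda>s. (2 * pi * M0 + NB * T) * hn m (\<lambda>\<xi>. gh s \<xi> - gh t \<xi>)) \<longlongrightarrow> 0) (at t)"
      using tendsto_mult[OF tendsto_const[of "2 * pi * M0 + NB * T"] gh_continuous[OF t]] by simp
  qed
  thus ?thesis by (simp add: LIM_zero_iff)
qed

text \<open>Both arguments of \<open>Lf\<close> move. The change in time is controlled uniformly
  over the bounded family of test functions by the Lipschitz constant; the change of test function
  is the limit at fixed time.\<close>

lemma y_continuous: "continuous_on {0<..<T} y"
proof -
  have "(y \<longlongrightarrow> y t) (at t)" if t: "t \<in> {0<..<T}" for t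
  proof -
    have ev: "\<forall>\<^sub>F s in at t. s \<in> {0<..<T}" using t by (intro eventually_at_in_open') auto
    have d0: "((\<lambda>s. L2_norm (\<lambda>\<xi>. gh s \<xi> - gh t \<xi>)) \<longlongrightarrow> 0) (at t)"
      using ev by (intro Lim_null_comparison[OF _ gh_continuous[OF t]])
        (auto elim!: eventually_mono intro!: HmD(3) Hm_diff gh_Hm t)
    have "((\<lambda>s. L2_norm (gh s)) \<longlongrightarrow> L2_norm (gh t)) (at t)"
      by (rule L2_limit_norm[OF _ _ d0]) (use ev in \<open>auto elim!: eventually_mono intro!: sqi_L2_fourier g_sqi t\<close>)
    hence "((\<lambda>s. 1 / (2 * pi) * L2_norm (gh s)) \<longlongrightarrow> 1 / (2 * pi) * L2_norm (gh t)) (at t)"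
      by (intro tendsto_mult tendsto_const)
    moreover have "\<forall>\<^sub>F s in at t. 1 / (2 * pi) * L2_norm (gh s) = L2_norm (g s)"
      using ev by eventually_elim (simp add: L2_norm_fourier g_sqi)
    ultimately have "((\<lambda>s. L2_norm (g s)) \<longlongrightarrow> 1 / (2 * pi) * L2_norm (gh t)) (at t)"
      by (rule Lim_transform_eventually)
    moreover have "1 / (2 * pi) * L2_norm (gh t) = L2_norm (g t)"
      unfolding L2_norm_fourier[OF g_sqi(1)[OF t]] by simp
    ultimately have n: "((\<lambda>s. L2_norm (g s)) \<longlongrightarrow> L2_norm (g t)) (at t)" by (simp only:)
    have "((\<lambda>s. Lf s (gh s) - Lf t (gh s)) \<longlongrightarrow> 0) (at t)"
    proof (rule Lim_null_comparison)
      show "\<forall>\<^sub>F s in at t. norm (Lf s (gh s) - Lf t (gh s)) \<le> NB * Bd * \<bar>s - t\<bar>"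
        using ev
      proof eventually_elim
        case (elim s)
        have le: "NB * hn m (gh s) * \<bar>s - t\<bar> \<le> NB * Bd * \<bar>s - t\<bar>"
          using gh_bound[OF elim] NB_nonneg by (intro mult_right_mono mult_left_mono) auto
        show ?case
        proof (cases "s \<le> t")
          case True
          have "\<bar>Lf t (gh s) - Lf s (gh s)\<bar> \<le> NB * hn m (gh s) * (t - s)"
            using elim True by (intro Lf_Lipschitz gh_Hm) auto
          thus ?thesis using le True by (simp add: abs_minus_commute)
        next
          case False
          have "\<bar>Lf s (gh s) - Lf t (gh s)\<bar> \<le> NB * hn m (gh s) * (s - t)"
            using elim t False by (intro Lf_Lipschitz gh_Hm) auto
          thus ?thesis using le False by simp
        qed
      qed
      have "((\<lambda>s. NB * Bd * \<bar>s - t\<bar>) \<longlongrightarrow> NB * Bd * \<bar>t - t\<bar>) (at t)" by (intro tendsto_intros)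
      thus "((\<lambda>s. NB * Bd * \<bar>s - t\<bar>) \<longlongrightarrow> 0) (at t)" by simp
    qed
    from tendsto_add[OF this Lf_gh_limit[OF t, of t]] t
    have "((\<lambda>s. Lf s (gh s)) \<longlongrightarrow> Lf t (gh t)) (at t)" by simp
    with n show ?thesis unfolding y_def by (intro tendsto_intros)
  qed
  thus ?thesis by (auto simp: continuous_on_eq_continuous_at isCont_def)
qed

text \<open>Near time 0 the smooth solution converges to \<open>g0\<close> only in
  \<open>L2\<close>, where \<open>Lf\<close> is not continuous in general. So \<open>Lf\<close> is
  first moved to time 0 with the uniform Lipschitz bound; there it is the pairing with the initial
  datum, which is \<open>L2\<close>-continuous.\<close>

lemma y_initial: "(y \<longlongrightarrow> (L2_norm (\<lambda>x. \<theta>0 x - g0 x))\<^sup>2) (at_right 0)"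
proof -
  have ev: "\<forall>\<^sub>F s in at_right 0. s \<in> {0<..<T}" by (rule eventually_at_right_real[OF T])
  have "((\<lambda>s. 2 * pi * L2_norm (\<lambda>x. g s x - g0 x)) \<longlongrightarrow> 2 * pi * 0) (at_right 0)"
    by (intro tendsto_mult tendsto_const init)
  moreover have "\<forall>\<^sub>F s in at_right 0. 2 * pi * L2_norm (\<lambda>x. g s x - g0 x) = L2_norm (\<lambda>\<xi>. gh s \<xi> - L2_fourier g0 \<xi>)"
    using ev by eventually_elim (simp add: L2_norm_fourier_diff g_sqi g0)
  ultimately have d: "((\<lambda>s. L2_norm (\<lambda>\<xi>. gh s \<xi> - L2_fourier g0 \<xi>)) \<longlongrightarrow> 0) (at_right 0)"
    using Lim_transform_eventually by fastforce
  have n: "((\<lambda>s. L2_norm (g s)) \<longlongrightarrow> L2_norm g0) (at_right 0)"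
    by (rule L2_limit_norm[OF _ g0 init]) (use ev in \<open>auto elim!: eventually_mono intro: g_sqi\<close>)
  let ?F0 = "L2_fourier \<theta>0"
  have s0: "square_integrable ?F0" "square_integrable (L2_fourier g0)" by (intro sqi_L2_fourier \<theta>0 g0)+
  have "((\<lambda>s. Lf s (gh s) - pair (L2_fourier g0) ?F0) \<longlongrightarrow> 0) (at_right 0)"
  proof (rule Lim_null_comparison)
    show "\<forall>\<^sub>F s in at_right 0. norm (Lf s (gh s) - pair (L2_fourier g0) ?F0)
       \<le> NB * Bd * s + L2_norm (\<lambda>\<xi>. gh s \<xi> - L2_fourier g0 \<xi>) * L2_norm ?F0"
      using ev
    proof eventually_elim
      case (elim s)
      have "\<bar>Lf s (gh s) - Lf 0 (gh s)\<bar> \<le> NB * hn m (gh s) * (s - 0)"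
        using elim by (intro Lf_Lipschitz gh_Hm) auto
      also have "\<dots> \<le> NB * Bd * s"
        using elim gh_bound[OF elim] NB_nonneg by (auto intro!: mult_right_mono mult_left_mono)
      finally have 1: "\<bar>Lf s (gh s) - Lf 0 (gh s)\<bar> \<le> NB * Bd * s" .
      have "Lf 0 (gh s) - pair (L2_fourier g0) ?F0 = pair (\<lambda>\<xi>. gh s \<xi> - L2_fourier g0 \<xi>) ?F0"
        unfolding Lf_0 by (intro pair_diff1[symmetric] sqi_L2_fourier g_sqi elim s0)
      hence 2: "\<bar>Lf 0 (gh s) - pair (L2_fourier g0) ?F0\<bar> \<le> L2_norm (\<lambda>\<xi>. gh s \<xi> - L2_fourier g0 \<xi>) * L2_norm ?F0"
        using pair_bound[OF sqi_diff[OF sqi_L2_fourier[OF g_sqi(1)[OF elim]] s0(2)] s0(1)] by simp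
      from 1 2 show ?case unfolding real_norm_def by linarith
    qed
    have "((\<lambda>s. NB * Bd * s + L2_norm (\<lambda>\<xi>. gh s \<xi> - L2_fourier g0 \<xi>) * L2_norm ?F0) \<longlongrightarrow> NB * Bd * 0 + 0 * L2_norm ?F0) (at_right 0)"
      by (intro tendsto_intros d)
    thus "((\<lambda>s. NB * Bd * s + L2_norm (\<lambda>\<xi>. gh s \<xi> - L2_fourier g0 \<xi>) * L2_norm ?F0) \<longlongrightarrow> 0) (at_right 0)" by simp
  qed
  hence l: "((\<lambda>s. Lf s (gh s)) \<longlongrightarrow> pair (L2_fourier g0) ?F0) (at_right 0)" by (simp add: LIM_zero_iff)
  have "(y \<longlongrightarrow> M0\<^sup>2 + (L2_norm g0)\<^sup>2 - 2 * pair (L2_fourier g0) ?F0) (at_right 0)"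
    unfolding y_def by (intro tendsto_intros n l)
  thus ?thesis by (simp add: L2_norm_diff_sq \<theta>0 g0 M0_def)
qed

definition stab :: real where
  "stab = ((L2_norm (\<lambda>x. \<theta>0 x - g0 x))\<^sup>2 + cc * T) * exp (KK * T)"

text \<open>Gronwall starts at a positive time a, since the continuity of \<open>y\<close> and its
  growth condition are available on the open interval; then a tends to 0 and \<open>y a\<close> to
  its initial limit.\<close>

lemma y_bound:
  assumes t: "t \<in> {0<..<T}"
  shows "y t \<le> stab"
proof -
  let ?w = "(L2_norm (\<lambda>x. \<theta>0 x - g0 x))\<^sup>2"
  have le: "y t \<le> (\<bar>y a\<bar> + cc * (t - a)) * exp (KK * (t - a))" if a: "0 < a" "a < t" for a
  proof (rule gronwall_Dini[OF _ _ KK_nonneg cc_nonneg])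
    show "continuous_on {a..t} y" by (rule continuous_on_subset[OF y_continuous]) (use a t in auto)
    show "\<exists>\<delta>>0. \<forall>h. 0 < h \<and> h < \<delta> \<longrightarrow> y (s + h) \<le> y s + h * (KK * y s + cc + e)"
      if "a \<le> s" "s < t" "e > 0" for s e
      by (rule Dini) (use that a t in auto)
  qed (use a in simp)
  have "((\<lambda>a. (\<bar>y a\<bar> + cc * (t - a)) * exp (KK * (t - a))) \<longlongrightarrow> (\<bar>?w\<bar> + cc * (t - 0)) * exp (KK * (t - 0))) (at_right 0)"
    by (intro tendsto_intros y_initial)
  moreover have "\<forall>\<^sub>F a in at_right 0. y t \<le> (\<bar>y a\<bar> + cc * (t - a)) * exp (KK * (t - a))"
    using t le by (intro eventually_at_rightI[of 0 t]) auto
  ultimately have "y t \<le> (\<bar>?w\<bar> + cc * (t - 0)) * exp (KK * (t - 0))"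
    by (intro tendsto_lowerbound) auto
  also have "\<dots> \<le> stab"
    unfolding stab_def using t cc_nonneg KK_nonneg by (intro mult_mono add_mono) (auto intro!: mult_left_mono)
  finally show ?thesis .
qed

text \<open>Here test function and solution are taken at the same time, so one null set must serve
  all t. It is formed for the countably many rational times r; for a fixed good t both sides are
  continuous in the time of g, and rational times accumulate at t.\<close>

lemma difference_AE:
  "AE t in lebesgue_on {0<..<T}. (L2_norm (\<lambda>x. \<theta> t x - g t x))\<^sup>2 = (L2_norm (\<theta> t))\<^sup>2 - M0\<^sup>2 + y t"
proof -
  have "AE t in lebesgue. \<forall>r\<in>\<rat> \<inter> {0<..<T}. 0 < t \<and> t < T \<longrightarrow> pair (gh r) (hat t) = Lf t (gh r)"
    by (intro AE_ball_countable' weak_Hm g_sqi gh_Hm) (auto intro: countable_subset[OF _ countable_rat])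
  hence "AE t in lebesgue. t \<in> {0<..<T} \<longrightarrow> (L2_norm (\<lambda>x. \<theta> t x - g t x))\<^sup>2 = (L2_norm (\<theta> t))\<^sup>2 - M0\<^sup>2 + y t"
  proof eventually_elim
    case (elim t)
    show ?case
    proof
      assume t: "t \<in> {0<..<T}"
      have "t islimpt (\<rat> \<inter> {0<..<T})"
      proof -
        have "\<exists>q\<in>\<rat> \<inter> {0<..<T}. q \<noteq> t \<and> dist q t < e" if "e > 0" for e
        proof -
          have "t < min (t + e) T" using that t by simp
          then obtain q where "q \<in> \<rat>" "t < q" "q < min (t + e) T"
            using Rats_dense_in_real by blast
          thus ?thesis using t by (intro bexI[of _ q]) (auto simp: dist_real_def)
        qed
        thus ?thesis by (simp add: islimpt_approachable)
      qed
      hence nb: "at t within (\<rat> \<inter> {0<..<T}) \<noteq> bot" by (simp add: trivial_limit_within)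
      have at0: "0 < t" using t by simp
      have 1: "((\<lambda>s. Lf t (gh s)) \<longlongrightarrow> Lf t (gh t)) (at t within (\<rat> \<inter> {0<..<T}))"
        by (rule tendsto_within_subset[OF Lf_gh_limit[OF t]]) (use t in auto)
      have ev: "\<forall>\<^sub>F s in at t within (\<rat> \<inter> {0<..<T}). s \<in> \<rat> \<inter> {0<..<T}" by (simp add: eventually_at_filter)
      have "((\<lambda>s. pair (gh s) (hat t) - pair (gh t) (hat t)) \<longlongrightarrow> 0) (at t within (\<rat> \<inter> {0<..<T}))"
      proof (rule Lim_null_comparison)
        show "\<forall>\<^sub>F s in at t within (\<rat> \<inter> {0<..<T}). norm (pair (gh s) (hat t) - pair (gh t) (hat t)) \<le> hn m (\<lambda>\<xi>. gh s \<xi> - gh t \<xi>) * L2_norm (hat t)"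
          using ev
        proof eventually_elim
          case (elim s)
          hence s: "s \<in> {0<..<T}" by simp
          have D: "Hm m (\<lambda>\<xi>. gh s \<xi> - gh t \<xi>)" by (intro Hm_diff gh_Hm s t)
          have "pair (gh s) (hat t) - pair (gh t) (hat t) = pair (\<lambda>\<xi>. gh s \<xi> - gh t \<xi>) (hat t)"
            by (intro pair_diff1[symmetric] sqi_L2_fourier g_sqi s t \<theta>_sqi at0)
          also have "norm \<dots> \<le> L2_norm (\<lambda>\<xi>. gh s \<xi> - gh t \<xi>) * L2_norm (hat t)"
            unfolding real_norm_def by (intro pair_bound HmD(2)[OF D] hat_sqi at0)
          also have "\<dots> \<le> hn m (\<lambda>\<xi>. gh s \<xi> - gh t \<xi>) * L2_norm (hat t)"
            by (intro mult_right_mono HmD(3)[OF D]) simp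
          finally show ?case .
        qed
        have "((\<lambda>s. hn m (\<lambda>\<xi>. gh s \<xi> - gh t \<xi>) * L2_norm (hat t)) \<longlongrightarrow> 0 * L2_norm (hat t)) (at t within (\<rat> \<inter> {0<..<T}))"
          by (intro tendsto_intros tendsto_within_subset[OF gh_continuous[OF t]]) simp
        thus "((\<lambda>s. hn m (\<lambda>\<xi>. gh s \<xi> - gh t \<xi>) * L2_norm (hat t)) \<longlongrightarrow> 0) (at t within (\<rat> \<inter> {0<..<T}))" by simp
      qed
      hence 2: "((\<lambda>s. pair (gh s) (hat t)) \<longlongrightarrow> pair (gh t) (hat t)) (at t within (\<rat> \<inter> {0<..<T}))"
        by (simp add: LIM_zero_iff)
      have "\<forall>\<^sub>F s in at t within (\<rat> \<inter> {0<..<T}). pair (gh s) (hat t) = Lf t (gh s)"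
        using ev by eventually_elim (use elim t in auto)
      from tendsto_unique[OF nb Lim_transform_eventually[OF 2 this] 1]
      have "pair (gh t) (hat t) = Lf t (gh t)" .
      thus "(L2_norm (\<lambda>x. \<theta> t x - g t x))\<^sup>2 = (L2_norm (\<theta> t))\<^sup>2 - M0\<^sup>2 + y t"
        using L2_norm_diff_sq[OF \<theta>_sqi[OF at0] g_sqi(1)[OF t]] by (simp add: y_def)
    qed
  qed
  thus ?thesis by (simp add: AE_restrict_space_iff)
qed

text \<open>The estimate \<open>esssup_I\<close> asks for measurability of the norm of the
  difference. The identity of \<open>difference_AE\<close> supplies it: the norm of \<theta> is
  measurable by strong measurability, and \<open>y\<close> is continuous.\<close>

lemma difference_measurable:
  "(\<lambda>t. L2_norm (\<lambda>x. \<theta> t x - g t x)) \<in> borel_measurable (lebesgue_on {0<..<T})"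
proof -
  have 1: "(\<lambda>t. L2_norm (\<theta> t)) \<in> borel_measurable (lebesgue_on {0<..<T})"
    by (rule L2_strongly_measurable_compose[OF strongly_measurable[OF T]]) (auto intro!: L2_limit_norm)
  have 2: "y \<in> borel_measurable (lebesgue_on {0<..<T})"
    by (rule continuous_imp_measurable_on_sets_lebesgue[OF y_continuous]) simp
  have f1: "(\<lambda>t. sqrt ((L2_norm (\<theta> t))\<^sup>2 - M0\<^sup>2 + y t)) \<in> borel_measurable (lebesgue_on {0<..<T})"
    using 1 2 by measurable
  have f2: "AE t in lebesgue_on {0<..<T}. sqrt ((L2_norm (\<theta> t))\<^sup>2 - M0\<^sup>2 + y t) = L2_norm (\<lambda>x. \<theta> t x - g t x)"
    using difference_AE by eventually_elim (metis L2_norm_nonneg abs_of_nonneg real_sqrt_abs)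
  show ?thesis by (rule measurable_lebesgue_on_AE[OF f1 _ f2]) simp
qed

lemma Linf_bounds:
  "0 \<le> Linf_L2_norm T (\<lambda>t x. \<theta> t x - g t x)" "Linf_L2_norm T (\<lambda>t x. \<theta> t x - g t x) \<le> ereal (sqrt stab)"
proof -
  have m: "(\<lambda>t. ereal (L2_norm (\<lambda>x. \<theta> t x - g t x))) \<in> borel_measurable (lebesgue_on {0<..<T})"
    using difference_measurable by measurable
  \<comment> \<open>Nonnegativity of the essential supremum uses that the time interval has positive
    measure; it is needed for the squeeze at the end.\<close>
  have "emeasure (lebesgue_on {0<..<T}) (space (lebesgue_on {0<..<T})) \<noteq> 0"
    using T by (simp add: emeasure_restrict_space)
  from esssup_const[OF this, of "0::ereal"]
  have "0 = esssup (lebesgue_on {0<..<T}) (\<lambda>t. 0::ereal)" by simp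
  also have "\<dots> \<le> esssup (lebesgue_on {0<..<T}) (\<lambda>t. ereal (L2_norm (\<lambda>x. \<theta> t x - g t x)))"
    by (rule esssup_mono) auto
  finally show "0 \<le> Linf_L2_norm T (\<lambda>t x. \<theta> t x - g t x)"
    unfolding Linf_L2_norm_def .
  show "Linf_L2_norm T (\<lambda>t x. \<theta> t x - g t x) \<le> ereal (sqrt stab)"
    unfolding Linf_L2_norm_def
  proof (rule esssup_I[OF m])
    show "AE t in lebesgue_on {0<..<T}. ereal (L2_norm (\<lambda>x. \<theta> t x - g t x)) \<le> ereal (sqrt stab)"
      using difference_AE AE_space[of "lebesgue_on {0<..<T}"]
    proof eventually_elim
      case (elim t)
      hence t: "t \<in> {0<..<T}" by simp
      have "(L2_norm (\<theta> t))\<^sup>2 \<le> M0\<^sup>2" using t \<theta>_norm by (intro power_mono) auto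
      hence "(L2_norm (\<lambda>x. \<theta> t x - g t x))\<^sup>2 \<le> stab" using elim(1) y_bound[OF t] by simp
      hence "L2_norm (\<lambda>x. \<theta> t x - g t x) \<le> sqrt stab" by (rule real_le_rsqrt)
      thus ?case by simp
    qed
  qed
qed

end

theorem theorem2p3:
  fixes \<alpha> \<beta> m Tstar :: real
    and \<theta>t0 :: "plane \<Rightarrow> real"
    and \<theta>t :: "real \<Rightarrow> plane \<Rightarrow> real"
    and \<theta>0 :: "real \<Rightarrow> plane \<Rightarrow> real"
    and \<theta> :: "real \<Rightarrow> real \<Rightarrow> plane \<Rightarrow> real"
  assumes "\<alpha> \<in> {0<..<1}" and "\<beta> \<in> {1<..<2}" and "m > 1 + \<beta>"
    and "\<theta>t0 \<in> H_space m"
    and "\<And>\<nu>. \<nu> > 0 \<Longrightarrow> square_integrable (\<theta>0 \<nu>)"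
    and "\<And>\<nu>. \<nu> > 0 \<Longrightarrow> global_weak_solution \<alpha> \<beta> \<nu> (\<theta>0 \<nu>) (\<theta> \<nu>)"
    and "Tstar > 0"
    and "smooth_inviscid_solution \<beta> m Tstar \<theta>t0 \<theta>t"
    and "((\<lambda>\<nu>. L2_norm (\<lambda>x. \<theta>0 \<nu> x - \<theta>t0 x)) \<longlongrightarrow> 0) (at_right 0)"
  shows "((\<lambda>\<nu>. Linf_L2_norm Tstar (\<lambda>t x. \<theta> \<nu> t x - \<theta>t t x)) \<longlongrightarrow> 0) (at_right 0)"
proof -
  obtain \<theta>' C0 where sol: "has_H_derivative_on m Tstar \<theta>t \<theta>'"
    "\<And>t. t \<in> {0<..<Tstar} \<Longrightarrow> AE x in lborel. \<theta>' t x + velocity \<beta> (\<theta>t t) x \<bullet> L2_gradient (\<theta>t t) x = 0"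
    "\<And>t. t \<in> {0<..<Tstar} \<Longrightarrow> H_norm m (\<theta>t t) \<le> C0"
    "((\<lambda>t. L2_norm (\<lambda>x. \<theta>t t x - \<theta>t0 x)) \<longlongrightarrow> 0) (at_right 0)"
    using assms(8) unfolding smooth_inviscid_solution_def by blast
  have sq: "square_integrable \<theta>t0" using assms(4) by (simp add: H_space_iff)
  define B where "B = 2 * pi * C0"
  \<comment> \<open>\<open>E \<nu>\<close> is \<open>stab\<close> written outside the locale, so
    that its dependence on \<nu> is visible: the exponent is free of \<nu>, and the viscous term has
    a factor \<nu>.\<close>
  define E where "E \<nu> = ((L2_norm (\<lambda>x. \<theta>0 \<nu> x - \<theta>t0 x))\<^sup>2 + 2 * (\<nu> * B * (2 * pi * L2_norm (\<theta>0 \<nu>))) * Tstar)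
      * exp (2 * (wK (m - \<beta>) * B * (2 * pi)\<^sup>2) * Tstar)" for \<nu>
  have bounds: "0 \<le> Linf_L2_norm Tstar (\<lambda>t x. \<theta> \<nu> t x - \<theta>t t x)"
    "Linf_L2_norm Tstar (\<lambda>t x. \<theta> \<nu> t x - \<theta>t t x) \<le> ereal (sqrt (E \<nu>))" if \<nu>: "\<nu> > 0" for \<nu>
  proof -
    interpret two_flows \<alpha> \<beta> m \<nu> Tstar "\<theta>0 \<nu>" "\<theta> \<nu>" \<theta>t0 \<theta>t \<theta>' C0
      by unfold_locales (use assms \<nu> sol sq in auto)
    have "stab = E \<nu>" by (simp add: stab_def E_def cc_def KK_def Bd_def M0_def B_def)
    with Linf_bounds show "0 \<le> Linf_L2_norm Tstar (\<lambda>t x. \<theta> \<nu> t x - \<theta>t t x)"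
      "Linf_L2_norm Tstar (\<lambda>t x. \<theta> \<nu> t x - \<theta>t t x) \<le> ereal (sqrt (E \<nu>))" by simp_all
  qed
  have pos: "\<forall>\<^sub>F \<nu> in at_right (0::real). \<nu> > 0" by (simp add: eventually_at_right_less)
  \<comment> \<open>Convergence of the initial data also controls their norms, which occur in the
    viscous error next to the factor \<nu>.\<close>
  have n: "((\<lambda>\<nu>. L2_norm (\<theta>0 \<nu>)) \<longlongrightarrow> L2_norm \<theta>t0) (at_right 0)"
    by (rule L2_limit_norm[OF _ sq assms(9)]) (use pos assms(5) in \<open>auto elim!: eventually_mono\<close>)
  have "(E \<longlongrightarrow> (0\<^sup>2 + 2 * (0 * B * (2 * pi * L2_norm \<theta>t0)) * Tstar) * exp (2 * (wK (m - \<beta>) * B * (2 * pi)\<^sup>2) * Tstar)) (at_right 0)"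
    unfolding E_def by (intro tendsto_intros assms(9) n)
  hence "((\<lambda>\<nu>. sqrt (E \<nu>)) \<longlongrightarrow> 0) (at_right 0)"
    using tendsto_real_sqrt[of E 0] by simp
  hence "((\<lambda>\<nu>. ereal (sqrt (E \<nu>))) \<longlongrightarrow> 0) (at_right 0)"
    by (simp add: zero_ereal_def)
  thus ?thesis
    by (rule tendsto_sandwich[OF _ _ tendsto_const, rotated 2])
      (use pos bounds in \<open>auto elim!: eventually_mono\<close>)
qed

end
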